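(* Let $\mathcal H$ be a separable Hilbert space with scalar product $\langle\cdot,\cdot\rangle$ and norm $|\cdot|$, and let $\phi:\mathcal H\to(-\infty,+\infty]$ be proper and lower semicontinuous. Assume: (COMP) there is $\kappa\ge 0$ such that $v\mapsto \phi(v)+\kappa|v|^2$ has compact sublevels in $\mathcal H$; (CHAIN) for every bounded interval $(a,b)$: if $v\in H^1(a,b;\mathcal H)$, $\xi\in L^2(a,b;\mathcal H)$, $\xi(t)\in\partial_\ell\phi(v(t))$ for a.e. $t\in(a,b)$, and $\phi\circ v$ is bounded, then $\phi\circ v\in AC(a,b)$ and $\frac{d}{dt}\phi(v(t))=\langle \xi(t),v'(t)\rangle$ for a.e. $t\in(a,b)$; and that there exist $K_1,K_2\ge 0$ such that $\phi(u)\ge -K_1|u|-K_2$ for all $u\in\mathcal H$. Let $X:=D(\phi)$ with the metric $d_X(u,v):=|u-v|+|\phi(u)-\phi(v)|$, and let $\mathcal S$ be the set of all functions $u:[0,+\infty)\to\mathcal H$ such that $u \in H^1(0,T;\mathcal H)$ for all $T>0$, $u(0)\in D(\phi)$, and $u'(t)+\partial_s\phi(u(t))\ni 0$ for a.e. $t\in(0,+\infty)$. Then $\mathcal S$ is a generalized semiflow on $(X,d_X)$, its elements are continuous functions from $[0,+\infty)$ to $(X,d_X)$, and $\mathcal S$ satisfies the continuity property (C4).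
   Context: $D(\phi)=\{u\in\mathcal H:\phi(u)<+\infty\}$. The Fréchet subdifferential: $\xi\in\partial\phi(v)$ iff $v\in D(\phi)$ and $\liminf_{w\to v}\frac{\phi(w)-\phi(v)-\langle\xi,w-v\rangle}{|w-v|}\ge 0$. Strong limiting subdifferential: for $v\in D(\phi)$, $\xi\in\partial_s\phi(v)$ iff there are sequences $v_n,\xi_n\in\mathcal H$ with $\xi_n\in\partial\phi(v_n)$, $v_n\to v$, $\xi_n\to\xi$ strongly and $\phi(v_n)\to\phi(v)$. Weak limiting subdifferential: for $v\in D(\phi)$, $\xi\in\partial_\ell\phi(v)$ iff there are sequences $v_n,\xi_n\in\mathcal H$ with $\xi_n\in\partial\phi(v_n)$, $v_n\to v$ strongly, $\xi_n\rightharpoonup\xi$ weakly and $\sup_n\phi(v_n)<+\infty$. Generalized semiflow on a metric space $(X,d_X)$ (not necessarily complete): a family $G$ of maps $g:[0,+\infty)\to X$ such that (H1) for any $g_0\in X$ there is at least one $g\in G$ with $g(0)=g_0$; (H2) for any $g\in G$ and $\tau\ge0$ the translate $g^\tau(t):=g(t+\tau)$, $t\ge 0$, belongs to $G$; (H3) for any $g,h\in G$ and $t\ge 0$ with $h(0)=g(t)$, the map $z$ with $z(\tau)=g(\tau)$ for $0\le\tau\le t$ and $z(\tau)=h(\tau-t)$ for $\tau>t$ belongs to $G$; (H4) if $\{g_n\}\subset G$ and $g_n(0)\to g_0$ in $X$, then there are a subsequence $\{g_{n_k}\}$ and $g\in G$ with $g(0)=g_0$ and $g_{n_k}(t)\to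 g(t)$ in $X$ for all $t\ge0$. (C4): for any $\{g_n\}\subset G$ with $g_n(0)\to g_0$ in $X$ there are a subsequence $\{g_{n_k}\}$ and $g\in G$ with $g(0)=g_0$ and $g_{n_k}\to g$ in $X$ uniformly on compact subsets of $[0,+\infty)$.
   Formalization: The elements of S are additionally required to satisfy u(t) ∈ D(φ) for every t ≥ 0 (so that they map into X); with only u(0) ∈ D(φ) and the inclusion a.e., S can contain functions leaving D(φ) and the claim fails. *)

theory Defs
  imports "HOL-Analysis.Analysis"
begin

section \<open>Subdifferentials of extended-real-valued functionals\<close>

definition effective_domain :: "('h \<Rightarrow> ereal) \<Rightarrow> 'h set" where
  "effective_domain \<phi> = {u. \<phi> u < \<infinity>}"

definition frechet_subdiff :: "('h::real_inner \<Rightarrow> ereal) \<Rightarrow> 'h \<Rightarrow> 'h set" where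
  "frechet_subdiff \<phi> v =
     {\<xi>. v \<in> effective_domain \<phi> \<and>
         0 \<le> Liminf (at v)
               (\<lambda>w. (\<phi> w - \<phi> v - ereal (\<xi> \<bullet> (w - v))) / ereal (norm (w - v)))}"

definition weakly_converges :: "(nat \<Rightarrow> 'h::real_inner) \<Rightarrow> 'h \<Rightarrow> bool" where
  "weakly_converges x l \<longleftrightarrow> (\<forall>h. (\<lambda>n. x n \<bullet> h) \<longlonglongrightarrow> l \<bullet> h)"

definition strong_limiting_subdiff :: "('h::real_inner \<Rightarrow> ereal) \<Rightarrow> 'h \<Rightarrow> 'h set" where
  "strong_limiting_subdiff \<phi> v =
     {\<xi>. v \<in> effective_domain \<phi> \<and>
         (\<exists>vn \<xi>n. (\<forall>n. \<xi>n n \<in> frechet_subdiff \<phi> (vn n)) \<and>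
            vn \<longlonglongrightarrow> v \<and> \<xi>n \<longlonglongrightarrow> \<xi> \<and> (\<lambda>n. \<phi> (vn n)) \<longlonglongrightarrow> \<phi> v)}"

definition weak_limiting_subdiff :: "('h::real_inner \<Rightarrow> ereal) \<Rightarrow> 'h \<Rightarrow> 'h set" where
  "weak_limiting_subdiff \<phi> v =
     {\<xi>. v \<in> effective_domain \<phi> \<and>
         (\<exists>vn \<xi>n. (\<forall>n. \<xi>n n \<in> frechet_subdiff \<phi> (vn n)) \<and>
            vn \<longlonglongrightarrow> v \<and> weakly_converges \<xi>n \<xi> \<and> (SUP n. \<phi> (vn n)) < \<infinity>)}"


section \<open>Lebesgue and Sobolev functions on a bounded interval\<close>

text \<open>In a separable Hilbert space Borel measurability coincides with strong measurability.\<close>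

definition L2_fun ::
  "real \<Rightarrow> real \<Rightarrow> (real \<Rightarrow> 'h::{real_inner,banach,second_countable_topology}) \<Rightarrow> bool" where
  "L2_fun a b f \<longleftrightarrow>
     f \<in> borel_measurable (lebesgue_on {a<..<b}) \<and>
     integrable (lebesgue_on {a<..<b}) (\<lambda>t. (norm (f t))\<^sup>2)"

definition C1_test_function :: "real \<Rightarrow> real \<Rightarrow> (real \<Rightarrow> real) \<Rightarrow> bool" where
  "C1_test_function a b \<psi> \<longleftrightarrow>
     \<psi> C1_differentiable_on UNIV \<and>
     (\<exists>K. compact K \<and> K \<subseteq> {a<..<b} \<and> (\<forall>t. t \<notin> K \<longrightarrow> \<psi> t = 0))"

text \<open>
  \<open>H1_fun a b v v'\<close> says that \<open>v\<close> belongs to the Sobolev space \<open>H^1(a,b;H)\<close> and that \<open>v'\<close> is its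
  weak derivative, which is unique up to null sets.
  An element of \<open>H^1(a,b;H)\<close> is an equivalence class which embeds into \<open>C([a,b];H)\<close>; as
  pointwise values of \<open>v\<close> matter here, \<open>v\<close> is required to be the continuous representative.
\<close>

definition H1_fun ::
  "real \<Rightarrow> real \<Rightarrow> (real \<Rightarrow> 'h::{real_inner,banach,second_countable_topology}) \<Rightarrow>
     (real \<Rightarrow> 'h) \<Rightarrow> bool" where
  "H1_fun a b v v' \<longleftrightarrow>
     continuous_on {a..b} v \<and> L2_fun a b v \<and> L2_fun a b v' \<and>
     (\<forall>\<psi>. C1_test_function a b \<psi> \<longrightarrow>
        (LINT t|lebesgue_on {a<..<b}. deriv \<psi> t *\<^sub>R v t) =
        - (LINT t|lebesgue_on {a<..<b}. \<psi> t *\<^sub>R v' t))"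

definition abs_continuous_on :: "real set \<Rightarrow> (real \<Rightarrow> real) \<Rightarrow> bool" where
  "abs_continuous_on I f \<longleftrightarrow>
     (\<forall>\<epsilon>>0. \<exists>\<delta>>0. \<forall>(n::nat) s t.
        (\<forall>i<n. s i \<le> t i \<and> {s i..t i} \<subseteq> I) \<longrightarrow>
        disjoint_family_on (\<lambda>i. {s i<..<t i}) {..<n} \<longrightarrow>
        (\<Sum>i<n. t i - s i) < \<delta> \<longrightarrow> (\<Sum>i<n. \<bar>f (t i) - f (s i)\<bar>) < \<epsilon>)"


section \<open>Assumptions on the functional\<close>

definition proper_functional :: "('h \<Rightarrow> ereal) \<Rightarrow> bool" where
  "proper_functional \<phi> \<longleftrightarrow> (\<forall>u. \<phi> u \<noteq> -\<infinity>) \<and> effective_domain \<phi> \<noteq> {}"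

definition lower_semicontinuous :: "('h::topological_space \<Rightarrow> ereal) \<Rightarrow> bool" where
  "lower_semicontinuous \<phi> \<longleftrightarrow> (\<forall>u. \<phi> u \<le> Liminf (at u) \<phi>)"

definition comp_condition :: "('h::real_inner \<Rightarrow> ereal) \<Rightarrow> bool" where
  "comp_condition \<phi> \<longleftrightarrow>
     (\<exists>\<kappa>\<ge>0. \<forall>c::real. compact {v. \<phi> v + ereal (\<kappa> * (norm v)\<^sup>2) \<le> ereal c})"

definition chain_condition ::
  "('h::{real_inner,banach,second_countable_topology} \<Rightarrow> ereal) \<Rightarrow> bool" where
  "chain_condition \<phi> \<longleftrightarrow>
     (\<forall>a b v v' \<xi>. a < b \<longrightarrow>
        H1_fun a b v v' \<longrightarrow>
        L2_fun a b \<xi> \<longrightarrow>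
        (AE t in lebesgue_on {a<..<b}. \<xi> t \<in> weak_limiting_subdiff \<phi> (v t)) \<longrightarrow>
        (\<exists>C. \<forall>t\<in>{a<..<b}. \<bar>\<phi> (v t)\<bar> \<le> ereal C) \<longrightarrow>
        abs_continuous_on {a<..<b} (\<lambda>t. real_of_ereal (\<phi> (v t))) \<and>
        (AE t in lebesgue_on {a<..<b}.
           ((\<lambda>t. real_of_ereal (\<phi> (v t))) has_real_derivative \<xi> t \<bullet> v' t) (at t)))"


section \<open>Generalized semiflows\<close>

text \<open>
  A map defined on \<open>[0,\<infinity>)\<close> only is represented by an extensional function on \<open>{0..}\<close>.
\<close>

locale generalized_semiflow = Metric_space X d
  for X :: "'a set" and d :: "'a \<Rightarrow> 'a \<Rightarrow> real" +
  fixes G :: "(real \<Rightarrow> 'a) set"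
  assumes maps: "G \<subseteq> {0..} \<rightarrow>\<^sub>E X"
    and existence: "\<And>g0. g0 \<in> X \<Longrightarrow> \<exists>g\<in>G. g 0 = g0"
    and translate: "\<And>g \<tau>. g \<in> G \<Longrightarrow> 0 \<le> \<tau> \<Longrightarrow> (\<lambda>t\<in>{0..}. g (t + \<tau>)) \<in> G"
    and concatenate: "\<And>g h t. g \<in> G \<Longrightarrow> h \<in> G \<Longrightarrow> 0 \<le> t \<Longrightarrow> h 0 = g t \<Longrightarrow>
          (\<lambda>\<tau>\<in>{0..}. if \<tau> \<le> t then g \<tau> else h (\<tau> - t)) \<in> G"
    and upper_semicontinuity: "\<And>g g0. (\<And>n::nat. g n \<in> G) \<Longrightarrow>
          limitin mtopology (\<lambda>n. g n 0) g0 sequentially \<Longrightarrow>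
          \<exists>r g'. strict_mono r \<and> g' \<in> G \<and> g' 0 = g0 \<and>
            (\<forall>t\<ge>0. limitin mtopology (\<lambda>k. g (r k) t) (g' t) sequentially)"

definition locally_uniform_limit_property ::
  "'a set \<Rightarrow> ('a \<Rightarrow> 'a \<Rightarrow> real) \<Rightarrow> (real \<Rightarrow> 'a) set \<Rightarrow> bool" where
  "locally_uniform_limit_property X d G \<longleftrightarrow>
     (\<forall>g g0. (\<forall>n::nat. g n \<in> G) \<longrightarrow>
        limitin (Metric_space.mtopology X d) (\<lambda>n. g n 0) g0 sequentially \<longrightarrow>
        (\<exists>r g'. strict_mono r \<and> g' \<in> G \<and> g' 0 = g0 \<and>
           (\<forall>K. compact K \<and> K \<subseteq> {0..} \<longrightarrow>
              (\<forall>\<epsilon>>0. \<forall>\<^sub>F k in sequentially. \<forall>t\<in>K. d (g (r k) t) (g' t) < \<epsilon>))))"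


section \<open>Gradient flow solutions\<close>

definition energy_dist :: "('h::real_inner \<Rightarrow> ereal) \<Rightarrow> 'h \<Rightarrow> 'h \<Rightarrow> real" where
  "energy_dist \<phi> u v = norm (u - v) + \<bar>real_of_ereal (\<phi> u) - real_of_ereal (\<phi> v)\<bar>"

definition gradient_flow_solutions ::
  "('h::{real_inner,banach,second_countable_topology} \<Rightarrow> ereal) \<Rightarrow> (real \<Rightarrow> 'h) set" where
  "gradient_flow_solutions \<phi> =
     {u \<in> extensional {0..}. u 0 \<in> effective_domain \<phi> \<and>
        (\<exists>u'. (\<forall>T>0. H1_fun 0 T u u') \<and>
              (AE t in lebesgue_on {0<..}. - u' t \<in> strong_limiting_subdiff \<phi> (u t)))}"

text \<open>
  A generalized semiflow on \<open>X\<close> consists of maps into \<open>X\<close>, so the solutions considered are those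
  with \<open>u t \<in> X = effective_domain \<phi>\<close> for every \<open>t \<ge> 0\<close>. The differential inclusion yields
  this for almost every \<open>t\<close> only, and the exceptional null set need not be empty.
  Example on the real line: let \<open>C \<subseteq> [0,1]\<close> be the Cantor set, and let \<open>c = 0\<close> on
  \<open>(-\<infinity>,0] \<union> [1,\<infinity>)\<close>, \<open>c = n\<close> on the closure of each component of \<open>[0,1] - C\<close> of length \<open>3^(-n)\<close>,
  and \<open>c = \<infinity>\<close> elsewhere. Then \<open>\<phi> x = (x - 2)^2/2 + c x\<close> is lower semicontinuous with compact
  sublevels, and the chain condition holds: each sublevel set is covered by finitely many of the
  pairwise disjoint closed intervals on which \<open>c\<close> is constant, so a continuous curve with bounded
  energy stays in one of them. But \<open>u t = 2 - 2 * exp (-t)\<close> satisfies \<open>u' = - (u - 2)\<close>, hence the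
  inclusion at a.e. \<open>t\<close>, and starts in the domain, while \<open>\<phi> (u t) = \<infinity>\<close> for uncountably many \<open>t\<close>.
\<close>

definition domain_valued_solutions ::
  "('h::{real_inner,banach,second_countable_topology} \<Rightarrow> ereal) \<Rightarrow> (real \<Rightarrow> 'h) set" where
  "domain_valued_solutions \<phi> =
     {u \<in> gradient_flow_solutions \<phi>. \<forall>t\<ge>0. u t \<in> effective_domain \<phi>}"

end

theory Submission
  imports Defs
begin

text \<open>
  Existence comes from minimizing movements. De Giorgi's variational interpolant splits the energy
  dissipated up to a given time into one half controlling the velocity of the discrete solution and
  one half controlling the subgradients \<open>\<zeta>_n\<close> along the interpolant. In the limit
  \<open>\<phi> (u t) + 1/2 \<integral> |u'|^2 + 1/2 \<integral> |\<xi>|^2 \<le> \<phi> (u 0)\<close> with \<open>|\<xi> t| \<le> liminf |\<zeta>_n t|\<close>, where \<open>\<xi> t\<close> is a weak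
  cluster point of \<open>\<zeta>_n t\<close>, chosen measurably in \<open>t\<close>. The chain rule applies to \<open>\<xi>\<close> and turns
  the inequality into \<open>\<integral> |u' + \<xi>|^2 \<le> 0\<close>. Hence \<open>\<xi> = - u'\<close>, the energies and the norms
  \<open>|\<zeta>_n t|\<close> converge along subsequences, and the weak limits are strong ones.

  Sequences of solutions are treated in the same way, starting from the energy identity. The chain rule
  yields that identity only where the energy is bounded, which is not assumed of a solution. Two observations
  close the gap. First, continuing a curve by its own time reversal shows that the chain rule
  extends up to the endpoints of an interval, so the energy oscillates by at most \<open>M = \<integral> |u'|^2\<close> over
  the closure of an interval on which it is locally bounded. Second, if the closed set \<open>F\<close> of times
  near which the energy is unbounded were nonempty, then by Baire's theorem the energy would be bounded on
  \<open>F\<close> near one of its points, and by the bound \<open>M\<close> on the complementary intervals it would be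
  bounded near that point.

  Solutions are Hoelder continuous with a locally uniform constant and their energies are continuous and
  nonincreasing, so that pointwise convergence is locally uniform.
\<close>

section \<open>Square-integrable functions and primitives\<close>

text \<open>The chain condition speaks of curves on open intervals with bounded energy, and it
  supplies an absolutely continuous energy with an a.e. derivative. Everything is therefore phrased
  with integrals over open intervals, and \<open>H1_fun\<close> is replaced by the equivalent
  \<open>L2_primitive\<close>, which can be cut, glued, shifted and reflected. The limit velocity
  does not come from weak compactness in L2: bounds on dyadic sums of squared increments pass to
  pointwise limits, and such bounds make the difference quotients Cauchy in L2. For subgradients
  only the liminf of the norms is controlled; hence weak cluster points are picked at each time
  separately, along subsequences that depend on the time, and measurability of the choice is what
  has to be secured. Discrete and exact solutions enter one convergence lemma: a time error
  \<open>\<delta>\<close> and a factor \<open>\<kappa>\<close> measure the defect of the scheme, and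
  exact solutions are the case \<open>\<delta> = 0\<close>, \<open>\<kappa> = 1\<close>. The Baire
  argument relies on finiteness of the energy at every single time, which is what
  \<open>domain_valued_solutions\<close> provides.\<close>

lemma L2_fun_iff_set:
  "L2_fun a b f \<longleftrightarrow> set_borel_measurable lebesgue {a<..<b} f \<and>
     set_integrable lebesgue {a<..<b} (\<lambda>t. (norm (f t))\<^sup>2)"
  unfolding L2_fun_def set_borel_measurable_def set_integrable_def
  by (subst borel_measurable_restrict_space_iff, simp, subst integrable_restrict_space, simp, simp)

lemma emeasure_lebesgue_Ioo_finite: "emeasure lebesgue {a<..<b::real} < \<infinity>"
  by (cases "a \<le> b") auto

lemma set_integrable_lebesgue_const:
  "set_integrable lebesgue {a<..<b::real} (\<lambda>t. c::'h::{banach,second_countable_topology})"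
  unfolding set_integrable_def
  by (intro integrable_scaleR_left integrable_real_indicator emeasure_lebesgue_Ioo_finite) auto

lemma set_integral_lebesgue_const:
  fixes c :: "'h::{banach,second_countable_topology}"
  assumes "a \<le> b"
  shows "(LINT t:{a<..<b::real}|lebesgue. c) = (b - a) *\<^sub>R c"
  unfolding set_lebesgue_integral_def using assms emeasure_lebesgue_Ioo_finite[of a b]
  by (subst integral_scaleR_left) (auto intro: integrable_real_indicator)

lemma L2_fun_imp_set_integrable:
  assumes "L2_fun a b f" shows "set_integrable lebesgue {a<..<b} f"
proof -
  have "set_integrable lebesgue {a<..<b} (\<lambda>t. 1 + (norm (f t))\<^sup>2)"
    using assms by (intro set_integral_add set_integrable_lebesgue_const) (auto simp: L2_fun_iff_set)
  moreover have "norm x \<le> 1 + (norm x)\<^sup>2" for x :: 'a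
    using sum_squares_bound[of "norm x" 1] norm_ge_zero[of x] unfolding one_power2 by linarith
  ultimately show ?thesis
    using assms unfolding L2_fun_iff_set set_integrable_def set_borel_measurable_def
    by (elim conjE Bochner_Integration.integrable_bound[rotated 1]) (auto simp: indicator_def)
qed

lemma L2_fun_subset:
  assumes "L2_fun a b f" "a \<le> a'" "b' \<le> b" shows "L2_fun a' b' f"
proof -
  have sub: "{a'<..<b'} \<subseteq> {a<..<b}" using assms by auto
  have "set_borel_measurable lebesgue {a'<..<b'} f"
    using assms(1) sub unfolding L2_fun_iff_set by (simp add: set_borel_measurable_subset[OF _ _ sub])
  then show ?thesis
    using assms(1) sub unfolding L2_fun_iff_set by (simp add: set_integrable_subset[OF _ _ sub])
qed

lemma L2_fun_set_integrable_inner: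
  assumes "L2_fun a b f" "L2_fun a b g"
  shows "set_integrable lebesgue {a<..<b} (\<lambda>t. f t \<bullet> g t)"
proof -
  have "set_integrable lebesgue {a<..<b} (\<lambda>t. (norm (f t))\<^sup>2 + (norm (g t))\<^sup>2)"
    using assms by (intro set_integral_add) (auto simp: L2_fun_iff_set)
  moreover have "\<bar>x \<bullet> y\<bar> \<le> (norm x)\<^sup>2 + (norm y)\<^sup>2" for x y :: 'a
  proof -
    have "\<bar>x \<bullet> y\<bar> \<le> norm x * norm y" by (rule Cauchy_Schwarz_ineq2)
    also have "\<dots> \<le> (norm x)\<^sup>2 + (norm y)\<^sup>2"
      using sum_squares_bound[of "norm x" "norm y"] mult_nonneg_nonneg[OF norm_ge_zero[of x]
        norm_ge_zero[of y]] by linarith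
    finally show ?thesis .
  qed
  moreover have "(\<lambda>x. indicat_real {a<..<b} x *\<^sub>R (f x \<bullet> g x)) \<in> borel_measurable lebesgue"
  proof -
    have "(\<lambda>x. (indicat_real {a<..<b} x *\<^sub>R f x) \<bullet> (indicat_real {a<..<b} x *\<^sub>R g x)) \<in> borel_measurable
      lebesgue"
      using assms unfolding L2_fun_iff_set set_borel_measurable_def
      by (intro borel_measurable_inner) auto
    also have "(\<lambda>x. (indicat_real {a<..<b} x *\<^sub>R f x) \<bullet> (indicat_real {a<..<b} x *\<^sub>R g x)) =
        (\<lambda>x. indicat_real {a<..<b} x *\<^sub>R (f x \<bullet> g x))"
      by (auto simp: indicator_def fun_eq_iff)
    finally show ?thesis .
  qed
  ultimately show ?thesis
    unfolding set_integrable_def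
    by (elim Bochner_Integration.integrable_bound[rotated 1]) (auto simp: indicator_def)
qed

lemma L2_fun_add:
  assumes "L2_fun a b f" "L2_fun a b g"
  shows "L2_fun a b (\<lambda>t. f t + g t)"
proof -
  have "set_borel_measurable lebesgue {a<..<b} (\<lambda>t. f t + g t)"
    using assms unfolding L2_fun_iff_set set_borel_measurable_def by (auto simp: scaleR_add_right)
  moreover have "set_integrable lebesgue {a<..<b} (\<lambda>t. (norm (f t))\<^sup>2 + 2 * (f t \<bullet> g t) + (norm (g t))\<^sup>2)"
    using assms L2_fun_set_integrable_inner[OF assms]
    by (intro set_integral_add set_integrable_mult_right) (auto simp: L2_fun_iff_set)
  moreover have "(norm (x + y))\<^sup>2 = (norm x)\<^sup>2 + 2 * (x \<bullet> y) + (norm y)\<^sup>2" for x y :: 'a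
    by (simp add: power2_norm_eq_inner inner_add inner_commute)
  ultimately show ?thesis unfolding L2_fun_iff_set by simp
qed

lemma L2_fun_scale:
  assumes "L2_fun a b f" shows "L2_fun a b (\<lambda>t. c *\<^sub>R f t)"
proof -
  have "set_borel_measurable lebesgue {a<..<b} (\<lambda>t. c *\<^sub>R f t)"
  proof -
    have "(\<lambda>x. c *\<^sub>R (indicat_real {a<..<b} x *\<^sub>R f x)) \<in> borel_measurable lebesgue"
      using assms unfolding L2_fun_iff_set set_borel_measurable_def
      by (intro borel_measurable_scaleR[OF borel_measurable_const]) simp
    then show ?thesis unfolding set_borel_measurable_def by (simp add: mult.commute)
  qed
  then show ?thesis using assms unfolding L2_fun_iff_set
    by (auto simp: power_mult_distrib)
qed

lemma L2_fun_minus: "L2_fun a b f \<Longrightarrow> L2_fun a b (\<lambda>t. - f t)"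
  using L2_fun_scale[of a b f "-1"] by simp

lemma L2_fun_cong:
  assumes "\<And>t. a < t \<Longrightarrow> t < b \<Longrightarrow> f t = g t" "L2_fun a b f" shows "L2_fun a b g"
proof -
  have "(\<lambda>x. indicat_real {a<..<b} x *\<^sub>R f x) = (\<lambda>x. indicat_real {a<..<b} x *\<^sub>R g x)"
    "(\<lambda>x. indicat_real {a<..<b} x *\<^sub>R (norm (f x))\<^sup>2) = (\<lambda>x. indicat_real {a<..<b} x *\<^sub>R (norm (g x))\<^sup>2)"
    using assms(1) by (auto simp: indicator_def fun_eq_iff)
  then show ?thesis using assms(2) unfolding L2_fun_iff_set set_integrable_def set_borel_measurable_def
    by simp
qed

lemma AE_lebesgue_neq: "AE x in lebesgue. x \<noteq> (c::real)"
  by (intro AE_completion AE_lborel_singleton)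

text \<open>The open pieces miss the point \<open>b\<close>, and the last term restores it. The
  identity holds at every point and not merely almost everywhere, so it transfers measurability as
  well as integrability. The last set is empty when \<open>b\<close> is an endpoint.\<close>

lemma indicator_Ioo_concat:
  fixes f :: "real \<Rightarrow> 'b::real_vector"
  assumes "a \<le> b" "b \<le> c"
  shows "indicat_real {a<..<c} x *\<^sub>R f x = indicat_real {a<..<b} x *\<^sub>R f x + indicat_real {b<..<c} x *\<^sub>R f x
      + indicat_real ({b} \<inter> {a<..<c}) x *\<^sub>R f b"
  using assms by (cases x b rule: linorder_cases) (simp_all add: indicator_def)

lemma set_integrable_concat:
  fixes f :: "real \<Rightarrow> 'b::{banach,second_countable_topology}"
  assumes "set_integrable lebesgue {a<..<b} f" "set_integrable lebesgue {b<..<c} f" "a \<le> b" "b \<le> c"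
  shows "set_integrable lebesgue {a<..<c} f"
proof -
  have "emeasure lebesgue ({b} \<inter> {a<..<c}) < \<infinity>"
    by (rule le_less_trans[OF emeasure_mono[of _ "{b}"]]) auto
  then show ?thesis
    using assms(1,2) unfolding set_integrable_def indicator_Ioo_concat[OF assms(3,4)]
    by (intro Bochner_Integration.integrable_add integrable_scaleR_left integrable_real_indicator) auto
qed

lemma L2_fun_concat:
  assumes "L2_fun a b f" "L2_fun b c f" "a \<le> b" "b \<le> c" shows "L2_fun a c f"
proof -
  have "set_borel_measurable lebesgue {a<..<c} f"
    using assms(1,2) unfolding set_borel_measurable_def L2_fun_iff_set indicator_Ioo_concat[OF assms(3,4)]
    by (elim conjE, intro borel_measurable_add borel_measurable_scaleR[of "indicator ({b} \<inter> {a<..<c})"]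
        borel_measurable_indicator) auto
  then show ?thesis
    using assms set_integrable_concat unfolding L2_fun_iff_set by blast
qed

lemma set_integral_concat:
  fixes f :: "real \<Rightarrow> 'b::{banach,second_countable_topology}"
  assumes "set_integrable lebesgue {a<..<c} f" "a \<le> b" "b \<le> c"
  shows "(LINT t:{a<..<c}|lebesgue. f t) = (LINT t:{a<..<b}|lebesgue. f t) + (LINT t:{b<..<c}|lebesgue. f t)"
proof -
  have "set_integrable lebesgue {a<..<b} f" "set_integrable lebesgue {b<..<c} f"
    by (rule set_integrable_subset[OF assms(1)]; use assms in auto)+
  moreover have "(LINT t:{a<..<c}|lebesgue. f t) =
     (\<integral>t. indicat_real {a<..<b} t *\<^sub>R f t + indicat_real {b<..<c} t *\<^sub>R f t \<partial>lebesgue)"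
    unfolding set_lebesgue_integral_def
  proof (rule integral_cong_AE)
    show "AE t in lebesgue. indicat_real {a<..<c} t *\<^sub>R f t =
       indicat_real {a<..<b} t *\<^sub>R f t + indicat_real {b<..<c} t *\<^sub>R f t"
      using AE_lebesgue_neq[of b] proof eventually_elim
        case (elim t) then show ?case using assms(2,3)
          by (cases t b rule: linorder_cases) (simp_all add: indicator_def)
      qed
  qed (use calculation assms(1) in \<open>auto simp: set_integrable_def\<close>)
  ultimately show ?thesis
    unfolding set_integrable_def set_lebesgue_integral_def by simp
qed

lemma set_integral_eq_diff_const:
  fixes p :: "real \<Rightarrow> 'h::{real_inner,banach,second_countable_topology}"
  assumes "L2_fun a b p" "a \<le> b"
  shows "(LINT t:{a<..<b}|lebesgue. (norm (p t - c))\<^sup>2) =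
     (LINT t:{a<..<b}|lebesgue. (norm (p t))\<^sup>2) - 2 * ((LINT t:{a<..<b}|lebesgue. p t) \<bullet> c) + (b - a) * (norm
       c)\<^sup>2"
proof -
  note i = L2_fun_imp_set_integrable[OF assms(1)]
  have i1: "set_integrable lebesgue {a<..<b} (\<lambda>t. (norm (p t))\<^sup>2)" using assms by (simp add: L2_fun_iff_set)
  have i2: "set_integrable lebesgue {a<..<b} (\<lambda>t. p t \<bullet> c)"
    using integrable_inner_left[OF i[unfolded set_integrable_def], of c] by (simp add: set_integrable_def)
  have i3: "set_integrable lebesgue {a<..<b} (\<lambda>t. 2 * (p t \<bullet> c))"
    by (rule set_integrable_mult_right[OF i2])
  have e: "(norm (p t - c))\<^sup>2 = ((norm (p t))\<^sup>2 - 2 * (p t \<bullet> c)) + (norm c)\<^sup>2" for t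
    by (simp add: power2_norm_eq_inner inner_diff inner_commute)
  have "(LINT t:{a<..<b}|lebesgue. p t \<bullet> c) = (LINT t:{a<..<b}|lebesgue. p t) \<bullet> c"
    unfolding set_lebesgue_integral_def
    by (subst integral_inner_left[symmetric]) (use i in \<open>auto simp: set_integrable_def\<close>)
  moreover have "(LINT t:{a<..<b}|lebesgue. (norm (p t - c))\<^sup>2) =
     ((LINT t:{a<..<b}|lebesgue. (norm (p t))\<^sup>2) - (LINT t:{a<..<b}|lebesgue. 2 * (p t \<bullet> c))) + (LINT
       t:{a<..<b}|lebesgue. (norm c)\<^sup>2)"
    unfolding e
    by (simp only: set_integral_add(2)[OF set_integral_diff(1)[OF i1 i3] set_integrable_lebesgue_const]
      set_integral_diff(2)[OF i1 i3])
  ultimately show ?thesis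
    using set_integral_lebesgue_const[OF assms(2), of "(norm c)\<^sup>2"] by simp
qed

text \<open>The Cauchy-Schwarz inequality, obtained from the fact that the integrated square
  distance of \<open>p\<close> from its mean value \<open>c\<close> is nonnegative.\<close>

lemma norm_set_integral_sq_le:
  fixes p :: "real \<Rightarrow> 'h::{real_inner,banach,second_countable_topology}"
  assumes "L2_fun a b p" "a \<le> b"
  shows "(norm (LINT t:{a<..<b}|lebesgue. p t))\<^sup>2 \<le> (b - a) * (LINT t:{a<..<b}|lebesgue. (norm (p t))\<^sup>2)"
proof (cases "a = b")
  case True then show ?thesis by (simp add: set_lebesgue_integral_def)
next
  case False
  define I where "I = (LINT t:{a<..<b}|lebesgue. p t)"
  define c where "c = I /\<^sub>R (b - a)"
  have "0 \<le> (LINT t:{a<..<b}|lebesgue. (norm (p t - c))\<^sup>2)"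
    unfolding set_lebesgue_integral_def by (rule integral_nonneg_AE) auto
  also have "\<dots> = (LINT t:{a<..<b}|lebesgue. (norm (p t))\<^sup>2) - 2 * (I \<bullet> c) + (b - a) * (norm c)\<^sup>2"
    unfolding I_def by (rule set_integral_eq_diff_const[OF assms])
  also have "2 * (I \<bullet> c) = 2 * ((norm I)\<^sup>2 / (b - a))"
    by (simp add: c_def power2_norm_eq_inner divide_inverse)
  also have "(b - a) * (norm c)\<^sup>2 = (norm I)\<^sup>2 / (b - a)"
  proof -
    have "norm c = norm I / (b - a)" using assms(2) by (simp add: c_def divide_inverse_commute)
    then show ?thesis using False by (simp add: power2_eq_square)
  qed
  finally have "(norm I)\<^sup>2 / (b - a) \<le> (LINT t:{a<..<b}|lebesgue. (norm (p t))\<^sup>2)" by simp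
  then show ?thesis using False assms(2) unfolding I_def by (simp add: field_simps)
qed

lemma set_integrable_lebesgue_continuous:
  fixes f :: "real \<Rightarrow> 'b::{banach,second_countable_topology}"
  assumes "continuous_on {a..b} f"
  shows "set_integrable lebesgue {a<..<b} f"
proof -
  have "set_integrable lborel {a..b} f" by (rule borel_integrable_atLeastAtMost'[OF assms])
  then have "set_integrable lebesgue {a..b} f"
    unfolding set_integrable_def using integrable_completion borel_measurable_integrable by blast
  then show ?thesis by (rule set_integrable_subset) auto
qed

lemma set_integral_FTC:
  fixes F :: "real \<Rightarrow> real"
  assumes "a \<le> b" "\<And>x. (F has_real_derivative f x) (at x)" "\<And>x. isCont f x"
  shows "(LINT x:{a<..<b}|lebesgue. f x) = F b - F a"
proof -
  have m: "f \<in> borel_measurable borel" using assms(3)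
    by (intro borel_measurable_continuous_onI) (simp add: continuous_on_eq_continuous_at)
  have "(LINT x:{a<..<b}|lebesgue. f x) = (\<integral>x. f x * indicator {a..b} x \<partial>lebesgue)"
    unfolding set_lebesgue_integral_def
  proof (rule integral_cong_AE)
    show "AE x in lebesgue. indicat_real {a<..<b} x *\<^sub>R f x = f x * indicat_real {a..b} x"
      using AE_lebesgue_neq[of a] AE_lebesgue_neq[of b] by eventually_elim (auto simp: indicator_def)
  qed (use m in \<open>auto intro!: measurable_completion borel_measurable_times\<close>)
  also have "\<dots> = (\<integral>x. f x * indicator {a..b} x \<partial>lborel)"
    by (rule integral_completion) (use m in auto)
  also have "\<dots> = F b - F a"
    using assms by (intro integral_FTC_Icc_real) auto
  finally show ?thesis .
qed

section \<open>Mollification and the lemma of du Bois-Reymond\<close>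

text \<open>The hat function supported in [0,2] with peak value 1 at 1 and area 1, written as a
  second difference of positive parts so that its primitive \<open>smooth_step\<close> is
  explicit.\<close>

definition tent :: "real \<Rightarrow> real" where
  "tent y = max 0 y - 2 * max 0 (y - 1) + max 0 (y - 2)"

text \<open>A C1 transition from 0 to 1 on [0,2]. Squared positive parts are C1, and the second
  difference cancels their growth beyond 2.\<close>

definition smooth_step :: "real \<Rightarrow> real" where
  "smooth_step y = ((max 0 y)\<^sup>2 - 2 * (max 0 (y - 1))\<^sup>2 + (max 0 (y - 2))\<^sup>2) / 2"

lemma has_real_derivative_max_sq: "((\<lambda>x::real. (max 0 x)\<^sup>2) has_real_derivative 2 * max 0 x) (at x)"
proof (cases x "0::real" rule: linorder_cases)
  case less
  have "((\<lambda>x. 0) has_real_derivative 0) (at x)" by simp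
  then have "((\<lambda>x::real. (max 0 x)\<^sup>2) has_real_derivative 0) (at x)"
    by (rule has_field_derivative_transform_within_open[where S="{..<0}"]) (use less in auto)
  then show ?thesis using less by simp
next
  case greater
  have "((\<lambda>x. x\<^sup>2) has_real_derivative 2 * x) (at x)" by (auto intro!: derivative_eq_intros)
  then have "((\<lambda>x::real. (max 0 x)\<^sup>2) has_real_derivative 2 * x) (at x)"
    by (rule has_field_derivative_transform_within_open[where S="{0<..}"]) (use greater in auto)
  then show ?thesis using greater by simp
next
  case equal
  have "((\<lambda>h. ((max 0 h)\<^sup>2) / h) \<longlongrightarrow> 0) (at (0::real))"
  proof (rule Lim_null_comparison)
    show "\<forall>\<^sub>F h in at 0. norm ((max 0 h)\<^sup>2 / h) \<le> \<bar>h::real\<bar>"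
      by (rule always_eventually) (auto simp: max_def power2_eq_square)
    show "((\<lambda>h. \<bar>h::real\<bar>) \<longlongrightarrow> 0) (at 0)" by (rule tendsto_eq_intros | simp)+
  qed
  then show ?thesis using equal by (simp add: DERIV_def)
qed

lemma smooth_step_deriv: "(smooth_step has_real_derivative tent y) (at y)"
proof -
  note d = DERIV_chain2[OF has_real_derivative_max_sq]
  have 1: "((\<lambda>y. (max 0 (y - c))\<^sup>2) has_real_derivative 2 * max 0 (y - c)) (at y)" for c :: real
  proof -
    have "((\<lambda>y. y - c) has_real_derivative 1) (at y)" by (auto intro!: derivative_eq_intros)
    from d[OF this] show ?thesis by simp
  qed
  have "((\<lambda>y. ((max 0 (y - 0))\<^sup>2 - 2 * (max 0 (y - 1))\<^sup>2 + (max 0 (y - 2))\<^sup>2) / 2) has_real_derivative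
     ((2 * max 0 (y - 0) - 2 * (2 * max 0 (y - 1)) + 2 * max 0 (y - 2)) / 2)) (at y)"
    by (intro DERIV_cdivide DERIV_add DERIV_diff DERIV_cmult 1)
  moreover have "(2 * max 0 (y - 0) - 2 * (2 * max 0 (y - 1)) + 2 * max 0 (y - 2)) / 2 = tent y"
    by (simp add: tent_def field_simps)
  ultimately show ?thesis by (simp add: smooth_step_def[abs_def])
qed

lemma tent_nonneg: "0 \<le> tent y" and tent_outside: "y \<le> 0 \<or> 2 \<le> y \<Longrightarrow> tent y = 0"
  unfolding tent_def max_def by auto

lemma smooth_step_outside: "y \<le> 0 \<Longrightarrow> smooth_step y = 0" "2 \<le> y \<Longrightarrow> smooth_step y = 1"
proof -
  show "y \<le> 0 \<Longrightarrow> smooth_step y = 0" by (simp add: smooth_step_def max_def)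
  assume "2 \<le> y"
  then have "smooth_step y = (y\<^sup>2 - 2 * (y - 1)\<^sup>2 + (y - 2)\<^sup>2) / 2" by (simp add: smooth_step_def max_def)
  also have "\<dots> = 1" by (simp add: power2_eq_square algebra_simps)
  finally show "smooth_step y = 1" .
qed

lemma scaled_step:
  assumes "h > (0::real)"
  shows "((\<lambda>x. smooth_step ((x - c) / h)) has_real_derivative tent ((x - c) / h) / h) (at x)"
    and "isCont (\<lambda>x. tent ((x - c) / h) / h) x"
proof -
  have "((\<lambda>x. (x - c) / h) has_real_derivative 1 / h) (at x)"
    using assms by (auto intro!: derivative_eq_intros)
  from DERIV_chain2[OF smooth_step_deriv this] show
    "((\<lambda>x. smooth_step ((x - c) / h)) has_real_derivative tent ((x - c) / h) / h) (at x)"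
    by simp
  show "isCont (\<lambda>x. tent ((x - c) / h) / h) x"
    unfolding tent_def using assms by (intro continuous_intros) auto
qed

text \<open>The scaled hat is a probability density on the interval from \<open>c\<close> to
  \<open>c + 2 * h\<close>. Averaging to the right of \<open>c\<close> only makes the left endpoint
  \<open>c = a\<close> admissible.\<close>

lemma mollifier_estimate:
  fixes w :: "real \<Rightarrow> 'h::{banach,second_countable_topology}"
  assumes w: "continuous_on {a..b} w" and h: "h > 0" "a \<le> c" "c + 2 * h \<le> b"
    and e: "\<And>x. c \<le> x \<Longrightarrow> x \<le> c + 2 * h \<Longrightarrow> norm (w x - w c) \<le> e"
  shows "norm ((LINT x:{a<..<b}|lebesgue. (tent ((x - c) / h) / h) *\<^sub>R w x) - w c) \<le> e"
proof -
  let ?K = "\<lambda>x. tent ((x - c) / h) / h"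
  have K: "continuous_on {a..b} ?K"
    using scaled_step(2)[OF h(1)] by (simp add: continuous_at_imp_continuous_on)
  have one: "(LINT x:{a<..<b}|lebesgue. ?K x) = 1"
  proof -
    have "smooth_step ((b - c) / h) = 1" by (rule smooth_step_outside) (use h in \<open>simp add: field_simps\<close>)
    moreover have "smooth_step ((a - c) / h) = 0" by (rule smooth_step_outside)
      (use h in \<open>simp add: field_simps\<close>)
    ultimately show ?thesis
      using set_integral_FTC[OF _ scaled_step[OF h(1)], of a b c] h by simp
  qed
  have iK: "set_integrable lebesgue {a<..<b} ?K" by (rule set_integrable_lebesgue_continuous[OF K])
  have ic: "set_integrable lebesgue {a<..<b} (\<lambda>x. ?K x *\<^sub>R w c)"
    by (intro set_integrable_lebesgue_continuous continuous_on_scaleR K continuous_on_const)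
  have iw: "set_integrable lebesgue {a<..<b} (\<lambda>x. ?K x *\<^sub>R w x)"
    by (intro set_integrable_lebesgue_continuous continuous_on_scaleR K w)
  have "(LINT x:{a<..<b}|lebesgue. ?K x *\<^sub>R w c) = w c"
  proof -
    have "(LINT x:{a<..<b}|lebesgue. ?K x *\<^sub>R w c) = (\<integral>x. (indicator {a<..<b} x *\<^sub>R ?K x) *\<^sub>R w c \<partial>lebesgue)"
      unfolding set_lebesgue_integral_def by simp
    also have "\<dots> = (LINT x:{a<..<b}|lebesgue. ?K x) *\<^sub>R w c"
      using iK unfolding set_lebesgue_integral_def set_integrable_def by (intro integral_scaleR_left) auto
    finally show ?thesis unfolding one by simp
  qed
  then have eq: "(LINT x:{a<..<b}|lebesgue. ?K x *\<^sub>R w x) - w c = (LINT x:{a<..<b}|lebesgue.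
    ?K x *\<^sub>R w x - ?K x *\<^sub>R w c)"
    using set_integral_diff(2)[OF iw ic] by simp
  have "norm (LINT x:{a<..<b}|lebesgue. ?K x *\<^sub>R w x - ?K x *\<^sub>R w c) \<le> (LINT x:{a<..<b}|lebesgue.
    norm (?K x *\<^sub>R w x - ?K x *\<^sub>R w c))"
    using set_integral_diff(1)[OF iw ic] by (rule set_integral_norm_bound)
  also have "\<dots> \<le> (LINT x:{a<..<b}|lebesgue. ?K x * e)"
  proof (rule set_integral_mono)
    show "set_integrable lebesgue {a<..<b} (\<lambda>x. norm (?K x *\<^sub>R w x - ?K x *\<^sub>R w c))"
      using set_integral_diff(1)[OF iw ic] by (rule set_integrable_norm)
    show "set_integrable lebesgue {a<..<b} (\<lambda>x. ?K x * e)" using iK by (rule set_integrable_mult_left)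
    fix x
    show "norm (?K x *\<^sub>R w x - ?K x *\<^sub>R w c) \<le> ?K x * e"
    proof (cases "c \<le> x \<and> x \<le> c + 2 * h")
      case True
      then have "norm (w x - w c) \<le> e" by (auto intro: e)
      moreover have "0 \<le> ?K x" using h tent_nonneg by simp
      ultimately have "?K x * norm (w x - w c) \<le> ?K x * e" by (rule mult_left_mono)
      then show ?thesis using \<open>0 \<le> ?K x\<close> by (simp only: scaleR_diff_right[symmetric] norm_scaleR
        abs_of_nonneg)
    next
      case False
      then have "tent ((x - c) / h) = 0" using h by (intro tent_outside) (auto simp: field_simps)
      then show ?thesis by simp
    qed
  qed
  also have "\<dots> = e" using one by simp
  finally show ?thesis unfolding eq .
qed

text \<open>The lemma of du Bois-Reymond. Testing with the difference of two smoothed steps shows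
  that averages of \<open>w\<close> just to the right of two interior points agree; shrinking the
  width equates the values of \<open>w\<close>.\<close>

lemma weak_derivative_zero_imp_constant:
  fixes w :: "real \<Rightarrow> 'h::{banach,second_countable_topology}"
  assumes w: "continuous_on {a..b} w" and "a < b"
    and z: "\<And>\<psi>. C1_test_function a b \<psi> \<Longrightarrow> (LINT x:{a<..<b}|lebesgue. deriv \<psi> x *\<^sub>R w x) = 0"
    and t: "t \<in> {a..b}"
  shows "w t = w a"
proof -
  have eq: "w s = w t" if "a < s" "s < t" "t < b" for s t
  proof -
    have "norm (w s - w t) \<le> e" if "e > 0" for e
    proof -
      have c: "isCont w s" "isCont w t"
        using w \<open>a < s\<close> \<open>s < t\<close> \<open>t < b\<close> by (auto intro!: continuous_on_interior
          simp: interior_atLeastAtMost_real)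
      obtain d1 where d1: "d1 > 0" "\<And>x. dist x s < d1 \<Longrightarrow> dist (w x) (w s) < e / 2"
        using c(1) \<open>e > 0\<close> unfolding continuous_at_eps_delta by (metis half_gt_zero)
      obtain d2 where d2: "d2 > 0" "\<And>x. dist x t < d2 \<Longrightarrow> dist (w x) (w t) < e / 2"
        using c(2) \<open>e > 0\<close> unfolding continuous_at_eps_delta by (metis half_gt_zero)
      \<comment> \<open>The quarter keeps the averaging windows, of length \<open>2 * h\<close>,
        within the continuity radii \<open>d1\<close>, \<open>d2\<close> and to the left of
        \<open>b\<close>.\<close>
      define h where "h = min (min d1 d2) (b - t) / 4"
      have h: "h > 0" "2 * h < d1" "2 * h < d2" "t + 2 * h < b"
        using d1 d2 \<open>t < b\<close> by (auto simp: h_def min_def field_simps)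
      let ?K = "\<lambda>c x. tent ((x - c) / h) / h"
      \<comment> \<open>A plateau that rises after \<open>s\<close> and falls after
        \<open>t\<close>. Its derivative is the difference of the two averaging kernels, and its
        support lies in \<open>{s..t + 2 * h}\<close>.\<close>
      define \<psi> where "\<psi> x = smooth_step ((x - s) / h) - smooth_step ((x - t) / h)" for x
      have d: "(\<psi> has_real_derivative ?K s x - ?K t x) (at x)" for x
        unfolding \<psi>_def by (intro DERIV_diff scaled_step h)
      have dpsi: "deriv \<psi> x = ?K s x - ?K t x" for x using d by (rule DERIV_imp_deriv)
      have "C1_test_function a b \<psi>"
        unfolding C1_test_function_def
      proof
        show "\<psi> C1_differentiable_on UNIV"
          unfolding C1_differentiable_on_def
        proof (intro exI conjI ballI)
          show "(\<psi> has_vector_derivative (?K s x - ?K t x)) (at x)" for x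
            using d has_real_derivative_iff_has_vector_derivative by blast
          show "continuous_on UNIV (\<lambda>x. ?K s x - ?K t x)"
            by (intro continuous_on_diff continuous_at_imp_continuous_on ballI scaled_step(2) h)
        qed
        show "\<exists>K. compact K \<and> K \<subseteq> {a<..<b} \<and> (\<forall>x. x \<notin> K \<longrightarrow> \<psi> x = 0)"
        proof (intro exI conjI allI impI)
          show "compact {s..t + 2 * h}" "{s..t + 2 * h} \<subseteq> {a<..<b}" using h \<open>a < s\<close> by auto
          fix x assume "x \<notin> {s..t + 2 * h}"
          then consider "x < s" | "x > t + 2 * h" by fastforce
          then show "\<psi> x = 0"
          proof cases
            case 1
            then have "smooth_step ((x - s) / h) = 0" "smooth_step ((x - t) / h) = 0"
              using h \<open>s < t\<close> by (auto intro!: smooth_step_outside simp: field_simps)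
            then show ?thesis by (simp add: \<psi>_def)
          next
            case 2
            then have "smooth_step ((x - s) / h) = 1" "smooth_step ((x - t) / h) = 1"
              using h \<open>s < t\<close> by (auto intro!: smooth_step_outside simp: field_simps)
            then show ?thesis by (simp add: \<psi>_def)
          qed
        qed
      qed
      then have "(LINT x:{a<..<b}|lebesgue. (?K s x - ?K t x) *\<^sub>R w x) = 0"
        using z[of \<psi>] by (simp only: dpsi)
      moreover have "set_integrable lebesgue {a<..<b} (\<lambda>x. ?K c x *\<^sub>R w x)" for c
        using w scaled_step(2)[OF h(1)]
        by (intro set_integrable_lebesgue_continuous continuous_on_scaleR) (auto
          intro: continuous_at_imp_continuous_on)
      ultimately have "(LINT x:{a<..<b}|lebesgue. ?K s x *\<^sub>R w x) = (LINT x:{a<..<b}|lebesgue.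
        ?K t x *\<^sub>R w x)"
        by (simp only: scaleR_diff_left set_integral_diff) simp
      moreover have "norm ((LINT x:{a<..<b}|lebesgue. ?K s x *\<^sub>R w x) - w s) \<le> e / 2"
        by (rule mollifier_estimate[OF w h(1)]) (use h \<open>a < s\<close> \<open>s < t\<close> d1(2) in
          \<open>auto simp: dist_norm intro!: less_imp_le\<close>)
      moreover have "norm ((LINT x:{a<..<b}|lebesgue. ?K t x *\<^sub>R w x) - w t) \<le> e / 2"
        by (rule mollifier_estimate[OF w h(1)]) (use h \<open>a < s\<close> \<open>s < t\<close> d2(2) in
          \<open>auto simp: dist_norm intro!: less_imp_le\<close>)
      ultimately have "norm (x - w s) \<le> e / 2 \<and> norm (x - w t) \<le> e / 2"
        if "x = (LINT x:{a<..<b}|lebesgue. ?K t x *\<^sub>R w x)" for x using that by simp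
      then obtain x where "norm (x - w s) \<le> e / 2" "norm (x - w t) \<le> e / 2" by blast
      moreover have "w s - w t = (x - w t) - (x - w s)" by simp
      ultimately show ?thesis using norm_triangle_ineq4[of "x - w t" "x - w s"] by simp
    qed
    then have "norm (w s - w t) \<le> 0" by (rule field_le_epsilon) simp
    then show ?thesis by simp
  qed
  \<comment> \<open>Comparison with the midpoint covers the open interval; continuity extends the
    equality to the endpoints.\<close>
  define m where "m = (a + b) / 2"
  have "w x = w m" if "x \<in> {a<..<b}" for x
  proof -
    have "a < m" "m < b" using \<open>a < b\<close> by (auto simp: m_def)
    show ?thesis
    proof (cases x m rule: linorder_cases)
      case less show ?thesis by (rule eq) (use less that \<open>m < b\<close> in simp_all)
    next
      case greater show ?thesis by (rule eq[symmetric]) (use greater that \<open>a < m\<close> in simp_all)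
    qed simp
  qed
  then have "w x = w m" if "x \<in> closure {a<..<b}" for x
    by (rule continuous_constant_on_closure[OF _ _ that, rotated]) (use w \<open>a < b\<close> in simp_all)
  then show ?thesis using t \<open>a < b\<close> by simp
qed

section \<open>Primitives of square-integrable functions and their weak derivatives\<close>

text \<open>The working form of membership in H1: a pointwise identity that can be restricted,
  concatenated and reflected without test functions. By \<open>H1_fun_iff_L2_primitive\<close> it
  agrees with \<open>H1_fun\<close> when \<open>a < b\<close>.\<close>

definition L2_primitive ::
  "real \<Rightarrow> real \<Rightarrow> (real \<Rightarrow> 'h::{real_inner,banach,second_countable_topology}) \<Rightarrow> (real \<Rightarrow> 'h) \<Rightarrow> bool" where
  "L2_primitive a b v p \<longleftrightarrow> L2_fun a b p \<and> (\<forall>t\<in>{a..b}. v t = v a + (LINT s:{a<..<t}|lebesgue. p s))"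

lemma L2_primitive_diff:
  assumes "L2_primitive a b v p" "a \<le> s" "s \<le> t" "t \<le> b"
  shows "v t - v s = (LINT x:{s<..<t}|lebesgue. p x)"
proof -
  have "v t = v a + (LINT x:{a<..<t}|lebesgue. p x)" "v s = v a + (LINT x:{a<..<s}|lebesgue. p x)"
    using assms unfolding L2_primitive_def by (meson atLeastAtMost_iff order_trans)+
  moreover have "set_integrable lebesgue {a<..<t} p"
    using assms(1,4) unfolding L2_primitive_def by (meson L2_fun_imp_set_integrable L2_fun_subset order_refl)
  then have "(LINT x:{a<..<t}|lebesgue. p x) = (LINT x:{a<..<s}|lebesgue. p x) + (LINT x:{s<..<t}|lebesgue.
    p x)"
    by (rule set_integral_concat) (use assms in auto)
  ultimately show ?thesis by simp
qed

lemma set_integral_mono_set_norm: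
  fixes p :: "real \<Rightarrow> 'b::{real_inner,banach,second_countable_topology}"
  assumes "L2_fun a b p" "a \<le> s" "t \<le> b"
  shows "(LINT x:{s<..<t}|lebesgue. (norm (p x))\<^sup>2) \<le> (LINT x:{a<..<b}|lebesgue. (norm (p x))\<^sup>2)"
proof -
  have "L2_fun s t p" using assms by (rule L2_fun_subset)
  then show ?thesis using assms unfolding L2_fun_iff_set set_integrable_def set_lebesgue_integral_def
    by (intro integral_mono) (auto simp: indicator_def)
qed

lemma L2_primitive_holder:
  assumes "L2_primitive a b v p" "a \<le> s" "s \<le> t" "t \<le> b"
  shows "(norm (v t - v s))\<^sup>2 \<le> (t - s) * (LINT x:{s<..<t}|lebesgue. (norm (p x))\<^sup>2)"
    and "(norm (v t - v s))\<^sup>2 \<le> (t - s) * (LINT x:{a<..<b}|lebesgue. (norm (p x))\<^sup>2)"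
proof -
  have L: "L2_fun a b p" using assms by (simp add: L2_primitive_def)
  show 1: "(norm (v t - v s))\<^sup>2 \<le> (t - s) * (LINT x:{s<..<t}|lebesgue. (norm (p x))\<^sup>2)"
    unfolding L2_primitive_diff[OF assms]
    by (rule norm_set_integral_sq_le[OF L2_fun_subset[OF L]]) (use assms in auto)
  have "(t - s) * (LINT x:{s<..<t}|lebesgue. (norm (p x))\<^sup>2) \<le> (t - s) * (LINT x:{a<..<b}|lebesgue.
    (norm (p x))\<^sup>2)"
    using assms by (intro mult_left_mono set_integral_mono_set_norm[OF L]) auto
  with 1 show "(norm (v t - v s))\<^sup>2 \<le> (t - s) * (LINT x:{a<..<b}|lebesgue. (norm (p x))\<^sup>2)" by simp
qed

lemma holder_half_imp_continuous_on:
  fixes v :: "real \<Rightarrow> 'b::real_normed_vector"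
  assumes "\<And>s t. s \<in> S \<Longrightarrow> t \<in> S \<Longrightarrow> s \<le> t \<Longrightarrow> (norm (v t - v s))\<^sup>2 \<le> (t - s) * C"
  shows "continuous_on S v"
  unfolding continuous_on_iff
proof (intro ballI allI impI)
  fix x and e :: real assume "x \<in> S" "e > 0"
  show "\<exists>d>0. \<forall>x'\<in>S. dist x' x < d \<longrightarrow> dist (v x') (v x) < e"
  proof (intro exI[of _ "e\<^sup>2 / (\<bar>C\<bar> + 1)"] conjI ballI impI)
    show "0 < e\<^sup>2 / (\<bar>C\<bar> + 1)" using \<open>e > 0\<close> by simp
    fix y assume "y \<in> S" and d: "dist y x < e\<^sup>2 / (\<bar>C\<bar> + 1)"
    have "(norm (v y - v x))\<^sup>2 \<le> \<bar>y - x\<bar> * C"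
      using assms[OF \<open>x \<in> S\<close> \<open>y \<in> S\<close>] assms[OF \<open>y \<in> S\<close> \<open>x \<in> S\<close>]
      by (cases "x \<le> y") (auto simp: norm_minus_commute)
    also have "\<dots> \<le> \<bar>y - x\<bar> * (\<bar>C\<bar> + 1)" by (intro mult_left_mono) auto
    also have "\<dots> < e\<^sup>2" using d by (simp add: dist_real_def field_simps)
    finally show "dist (v y) (v x) < e" using \<open>e > 0\<close>
      by (simp add: dist_norm power_less_imp_less_base)
  qed
qed

lemma L2_primitive_continuous:
  assumes "L2_primitive a b v p" shows "continuous_on {a..b} v"
  by (rule holder_half_imp_continuous_on[where C="LINT x:{a<..<b}|lebesgue. (norm (p x))\<^sup>2"])
    (use L2_primitive_holder(2)[OF assms] in auto)

lemma L2_primitive_subset: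
  assumes "L2_primitive a b v p" "a \<le> a'" "b' \<le> b" shows "L2_primitive a' b' v p"
  unfolding L2_primitive_def
proof (intro conjI ballI)
  show "L2_fun a' b' p" using assms L2_fun_subset unfolding L2_primitive_def by blast
  show "v t = v a' + (LINT s:{a'<..<t}|lebesgue. p s)" if "t \<in> {a'..b'}" for t
    using L2_primitive_diff[OF assms(1,2), of t] that assms(3) by (simp add: algebra_simps)
qed

text \<open>Fubini's theorem will be applied to \<open>lebesgue\<close> itself, since velocities are
  only Lebesgue measurable.\<close>

lemma sigma_finite_lebesgue: "sigma_finite_measure (lebesgue :: real measure)"
proof
  show "\<exists>A. countable A \<and> A \<subseteq> sets (lebesgue :: real measure) \<and> \<Union> A = space (lebesgue :: real measure) \<and>
    (\<forall>a\<in>A. emeasure lebesgue a \<noteq> \<infinity>)"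
  proof (intro exI[of _ "range (\<lambda>n. {- real n <..< real n})"] conjI)
    show "\<Union> (range (\<lambda>n. {- real n<..<real n})) = space (lebesgue :: real measure)"
    proof -
      have "\<exists>n. - real n < x \<and> x < real n" for x
        using reals_Archimedean2[of "\<bar>x\<bar>"] by (metis abs_less_iff minus_less_iff)
      then show ?thesis by auto
    qed
  qed (use emeasure_lebesgue_Ioo_finite in \<open>auto simp: less_top\<close>)
qed

lemma lebesgue_pair: "pair_sigma_finite (lebesgue :: real measure) (lebesgue :: real measure)"
  by (intro pair_sigma_finite.intro sigma_finite_lebesgue)

text \<open>Fubini's theorem on the triangle \<open>s < t\<close>, with the integral formula for
  \<open>v\<close> inserted. The inner integral of the derivative of \<psi> from \<open>s\<close> to
  \<open>b\<close> is \<open>- \<psi> s\<close> because \<psi> vanishes at \<open>b\<close>; the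
  constant \<open>v a\<close> contributes nothing because \<psi> vanishes at both ends.\<close>

lemma integral_by_parts_test:
  assumes "L2_primitive a b v p" "a < b" "C1_test_function a b \<psi>"
  shows "(LINT t:{a<..<b}|lebesgue. deriv \<psi> t *\<^sub>R v t) = - (LINT t:{a<..<b}|lebesgue. \<psi> t *\<^sub>R p t)"
proof -
  obtain D where D: "\<And>x. (\<psi> has_real_derivative D x) (at x)" "continuous_on UNIV D"
    using assms(3) unfolding C1_test_function_def C1_differentiable_on_def
    by (metis UNIV_I has_real_derivative_iff_has_vector_derivative)
  have cD: "isCont D x" for x using D(2) by (simp add: continuous_on_eq_continuous_at)
  have dD: "deriv \<psi> = D" using D(1) by (auto intro: DERIV_imp_deriv)
  have zero: "\<psi> a = 0" "\<psi> b = 0" using assms(3) unfolding C1_test_function_def by force+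
  define f where "f s = indicator {a<..<b} s *\<^sub>R p s" for s
  define g where "g t = indicator {a<..<b} t *\<^sub>R D t" for t
  have L: "L2_fun a b p" using assms by (simp add: L2_primitive_def)
  have f: "integrable lebesgue f"
    using L2_fun_imp_set_integrable[OF L] unfolding f_def set_integrable_def .
  have g: "integrable lebesgue g"
    using set_integrable_lebesgue_continuous[OF continuous_on_subset[OF D(2)]]
      unfolding g_def set_integrable_def by auto
  define H where "H t s = (g t * indicator {s<..} t) *\<^sub>R f s" for t s
  have mg: "g \<in> borel_measurable lebesgue" and mf: "f \<in> borel_measurable lebesgue"
    using f g by auto
  have mH: "(\<lambda>x. H (fst x) (snd x)) \<in> borel_measurable (lebesgue \<Otimes>\<^sub>M lebesgue)"
  proof -
    have id: "(\<lambda>x. x) \<in> borel_measurable (lebesgue :: real measure)" by (simp add: measurable_completion)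
    have 1: "(\<lambda>x. fst x) \<in> borel_measurable ((lebesgue::real measure) \<Otimes>\<^sub>M (lebesgue::real measure))"
      "(\<lambda>x. snd x) \<in> borel_measurable ((lebesgue::real measure) \<Otimes>\<^sub>M (lebesgue::real measure))"
      using measurable_compose[OF measurable_fst id] measurable_compose[OF measurable_snd id] by auto
    have "(\<lambda>x::real \<times> real. indicator {snd x<..} (fst x) :: real) = (\<lambda>x. if snd x < fst x then 1 else 0)"
      by (auto simp: indicator_def)
    moreover have "(\<lambda>x. if snd x < fst x then 1 else 0::real) \<in> borel_measurable ((lebesgue::real measure) \<Otimes>\<^sub>M
      (lebesgue::real measure))"
      using 1 by measurable
    moreover have "(\<lambda>x. g (fst x)) \<in> borel_measurable (lebesgue \<Otimes>\<^sub>M (lebesgue :: real measure))"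
      "(\<lambda>x. f (snd x)) \<in> borel_measurable ((lebesgue :: real measure) \<Otimes>\<^sub>M lebesgue)"
      using measurable_compose[OF measurable_fst mg] measurable_compose[OF measurable_snd mf] by auto
    ultimately show ?thesis unfolding H_def
      by (intro borel_measurable_scaleR borel_measurable_times) (simp_all only:)
  qed
  have iH: "integrable (lebesgue \<Otimes>\<^sub>M lebesgue) (\<lambda>(t, s). H t s)"
  proof (rule Bochner_Integration.integrable_bound)
    show "integrable (lebesgue \<Otimes>\<^sub>M lebesgue) (\<lambda>(t, s). norm (g t) * norm (f s))"
    proof (rule pair_sigma_finite.Fubini_integrable[OF lebesgue_pair])
      show "(\<lambda>(t, s). norm (g t) * norm (f s)) \<in> borel_measurable (lebesgue \<Otimes>\<^sub>M lebesgue)"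
        using measurable_compose[OF measurable_compose[OF measurable_fst mg] borel_measurable_norm]
          measurable_compose[OF measurable_compose[OF measurable_snd mf] borel_measurable_norm]
        unfolding split_beta' by (intro borel_measurable_times) simp_all
      show "integrable lebesgue (\<lambda>x. LINT y|lebesgue. norm (case (x, y) of (t, s) \<Rightarrow> norm (g t) * norm (f s)))"
        using g by (simp add: abs_mult)
      show "AE x in lebesgue. integrable lebesgue (\<lambda>y. case (x, y) of (t, s) \<Rightarrow> norm (g t) * norm (f s))"
        using f by simp
    qed
    show "(\<lambda>(t, s). H t s) \<in> borel_measurable (lebesgue \<Otimes>\<^sub>M lebesgue)"
      using mH by (simp add: split_beta')
    show "AE x in lebesgue \<Otimes>\<^sub>M lebesgue. norm (case x of (t, s) \<Rightarrow> H t s)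
      \<le> norm (case x of (t, s) \<Rightarrow> norm (g t) * norm (f s))"
      by (rule AE_I2) (auto simp: H_def abs_mult indicator_def)
  qed
  have inner: "(LINT s|lebesgue. H t s) = g t *\<^sub>R (v t - v a)" for t
  proof (cases "t \<in> {a<..<b}")
    case True
    have "(LINT s|lebesgue. H t s) = (LINT s|lebesgue. g t *\<^sub>R (indicator {a<..<t} s *\<^sub>R p s))"
      by (rule Bochner_Integration.integral_cong) (use True in \<open>auto simp: H_def f_def indicator_def\<close>)
    also have "\<dots> = g t *\<^sub>R (LINT s:{a<..<t}|lebesgue. p s)"
      unfolding set_lebesgue_integral_def
      by (rule integral_scaleR_right)
    finally show ?thesis using L2_primitive_diff[OF assms(1), of a t] True by simp
  qed (simp add: H_def g_def)
  have outer: "(LINT t|lebesgue. H t s) = - (\<psi> s *\<^sub>R f s)" for s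
  proof (cases "s \<in> {a<..<b}")
    case True
    have ig: "integrable lebesgue (\<lambda>t. g t * indicator {s<..} t)"
      using integrable_mult_indicator[OF _ g, of "{s<..}"] by (simp add: mult.commute)
    have "(LINT t|lebesgue. H t s) = (LINT t|lebesgue. g t * indicator {s<..} t) *\<^sub>R f s"
      unfolding H_def by (rule integral_scaleR_left) (use ig in simp)
    also have "(LINT t|lebesgue. g t * indicator {s<..} t) = (LINT t:{s<..<b}|lebesgue. D t)"
      unfolding set_lebesgue_integral_def
      by (rule Bochner_Integration.integral_cong) (use True in \<open>auto simp: g_def indicator_def\<close>)
    also have "\<dots> = \<psi> b - \<psi> s" by (rule set_integral_FTC) (use True D cD in auto)
    finally show ?thesis using zero by simp
  qed (simp add: H_def f_def)
  have "(LINT t|lebesgue. LINT s|lebesgue. H t s) = (LINT s|lebesgue. LINT t|lebesgue. H t s)"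
    using pair_sigma_finite.Fubini_integral[OF lebesgue_pair iH] by simp
  then have eq: "(LINT t|lebesgue. g t *\<^sub>R (v t - v a)) = - (LINT s|lebesgue. \<psi> s *\<^sub>R f s)"
    unfolding inner outer by simp
  have iv: "set_integrable lebesgue {a<..<b} (\<lambda>t. D t *\<^sub>R v t)"
    by (intro set_integrable_lebesgue_continuous continuous_on_scaleR continuous_on_subset[OF D(2)]
      L2_primitive_continuous[OF assms(1)]) auto
  have ia: "set_integrable lebesgue {a<..<b} (\<lambda>t. D t *\<^sub>R v a)"
    by (intro set_integrable_lebesgue_continuous continuous_on_scaleR continuous_on_subset[OF D(2)]) auto
  have "(LINT t:{a<..<b}|lebesgue. D t *\<^sub>R v a) = (LINT t:{a<..<b}|lebesgue. D t) *\<^sub>R v a"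
  proof -
    have "(LINT t:{a<..<b}|lebesgue. D t *\<^sub>R v a) = (LINT t|lebesgue. g t *\<^sub>R v a)"
      unfolding set_lebesgue_integral_def g_def by simp
    also have "\<dots> = (LINT t|lebesgue. g t) *\<^sub>R v a" by (rule integral_scaleR_left) (use g in simp)
    finally show ?thesis unfolding set_lebesgue_integral_def g_def .
  qed
  also have "(LINT t:{a<..<b}|lebesgue. D t) = \<psi> b - \<psi> a"
    by (rule set_integral_FTC) (use assms(2) D cD in auto)
  finally have z: "(LINT t:{a<..<b}|lebesgue. D t *\<^sub>R v a) = 0" using zero by simp
  have "(LINT t|lebesgue. g t *\<^sub>R (v t - v a)) = (LINT t:{a<..<b}|lebesgue. D t *\<^sub>R v t - D t *\<^sub>R v a)"
    unfolding set_lebesgue_integral_def g_def by (simp add: scaleR_diff_right)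
  also have "\<dots> = (LINT t:{a<..<b}|lebesgue. D t *\<^sub>R v t)"
    using set_integral_diff(2)[OF iv ia] z by simp
  finally have "(LINT t:{a<..<b}|lebesgue. D t *\<^sub>R v t) = - (LINT s|lebesgue. \<psi> s *\<^sub>R f s)" using eq by simp
  moreover have "(LINT s|lebesgue. \<psi> s *\<^sub>R f s) = (LINT s:{a<..<b}|lebesgue. \<psi> s *\<^sub>R p s)"
    unfolding set_lebesgue_integral_def f_def by (simp add: mult.commute)
  ultimately show ?thesis unfolding dD by simp
qed

text \<open>From right to left this is integration by parts. Conversely, \<open>v\<close> and the
  primitive \<open>F\<close> of \<open>p\<close> have the same weak derivative, so their difference
  is constant by \<open>weak_derivative_zero_imp_constant\<close>. Continuity of \<open>v\<close>,
  which is part of \<open>H1_fun\<close>, makes the formula hold at every time.\<close>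

lemma H1_fun_iff_L2_primitive:
  assumes "a < b"
  shows "H1_fun a b v p \<longleftrightarrow> L2_primitive a b v p"
proof
  assume P: "L2_primitive a b v p"
  have c: "continuous_on {a..b} v" using P by (rule L2_primitive_continuous)
  have "L2_fun a b v" unfolding L2_fun_iff_set
  proof
    show "set_integrable lebesgue {a<..<b} (\<lambda>t. (norm (v t))\<^sup>2)"
      using c by (intro set_integrable_lebesgue_continuous continuous_intros)
    show "set_borel_measurable lebesgue {a<..<b} v"
      using set_integrable_lebesgue_continuous[OF c] unfolding set_integrable_def set_borel_measurable_def
        by auto
  qed
  then show "H1_fun a b v p" unfolding H1_fun_def
    using c P integral_by_parts_test[OF P assms]
    by (auto simp: L2_primitive_def integral_restrict_space set_lebesgue_integral_def)
next
  assume H: "H1_fun a b v p"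
  define F where "F t = (LINT s:{a<..<t}|lebesgue. p s)" for t
  have F: "L2_primitive a b F p"
  proof -
    have "F a = 0" by (simp add: F_def set_lebesgue_integral_def)
    then show ?thesis using H unfolding L2_primitive_def H1_fun_def by (auto simp: F_def)
  qed
  define w where "w t = v t - F t" for t
  have cv: "continuous_on {a..b} v" using H by (simp add: H1_fun_def)
  have cF: "continuous_on {a..b} F" by (rule L2_primitive_continuous[OF F])
  have "w t = w a" if "t \<in> {a..b}" for t
  proof (rule weak_derivative_zero_imp_constant[OF _ assms _ that])
    show "continuous_on {a..b} w" unfolding w_def by (intro continuous_on_diff cv cF)
    fix \<psi> assume \<psi>: "C1_test_function a b \<psi>"
    obtain D where D: "\<And>x. (\<psi> has_real_derivative D x) (at x)" "continuous_on UNIV D"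
      using \<psi> unfolding C1_test_function_def C1_differentiable_on_def
      by (metis UNIV_I has_real_derivative_iff_has_vector_derivative)
    have dD: "deriv \<psi> = D" using D(1) by (auto intro: DERIV_imp_deriv)
    have i: "set_integrable lebesgue {a<..<b} (\<lambda>t. D t *\<^sub>R v t)"
      "set_integrable lebesgue {a<..<b} (\<lambda>t. D t *\<^sub>R F t)"
      by (intro set_integrable_lebesgue_continuous continuous_on_scaleR continuous_on_subset[OF D(2)] cv
        cF; simp)+
    have "(LINT t:{a<..<b}|lebesgue. deriv \<psi> t *\<^sub>R v t) = - (LINT t:{a<..<b}|lebesgue. \<psi> t *\<^sub>R p t)"
      using H \<psi> unfolding H1_fun_def by (auto simp: integral_restrict_space set_lebesgue_integral_def)
    moreover have "(LINT t:{a<..<b}|lebesgue. deriv \<psi> t *\<^sub>R F t) = - (LINT t:{a<..<b}|lebesgue. \<psi> t *\<^sub>R p t)"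
      by (rule integral_by_parts_test[OF F assms \<psi>])
    ultimately show "(LINT t:{a<..<b}|lebesgue. deriv \<psi> t *\<^sub>R w t) = 0"
      unfolding w_def scaleR_diff_right dD using set_integral_diff(2)[OF i] by simp
  qed
  moreover have Ft: "F t = F a + (LINT s:{a<..<t}|lebesgue. p s)" if "t \<in> {a..b}" for t
    using F that unfolding L2_primitive_def by blast
  ultimately have "v t = v a + (LINT s:{a<..<t}|lebesgue. p s)" if "t \<in> {a..b}" for t
  proof -
    have "v t = F t + (v a - F a)" using \<open>\<And>t. t \<in> {a..b} \<Longrightarrow> w t = w a\<close>[OF that] unfolding w_def
      by (simp add: algebra_simps)
    also have "F t = F a + (LINT s:{a<..<t}|lebesgue. p s)" by (rule Ft[OF that])
    finally show ?thesis by simp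
  qed
  then show "L2_primitive a b v p"
    using F unfolding L2_primitive_def by blast
qed

lemma L2_primitive_concat:
  assumes "L2_primitive a b v p" "L2_primitive b c v p" "a \<le> b" "b \<le> c"
  shows "L2_primitive a c v p"
  unfolding L2_primitive_def
proof (intro conjI ballI)
  show L: "L2_fun a c p" using assms L2_fun_concat unfolding L2_primitive_def by blast
  fix t assume t: "t \<in> {a..c}"
  show "v t = v a + (LINT s:{a<..<t}|lebesgue. p s)"
  proof (cases "t \<le> b")
    case True
    then show ?thesis using L2_primitive_diff[OF assms(1), of a t] t by (simp add: algebra_simps)
  next
    case False
    have "set_integrable lebesgue {a<..<t} p"
      using L2_fun_imp_set_integrable[OF L2_fun_subset[OF L, of a t]] t by simp
    then have "(LINT x:{a<..<t}|lebesgue. p x) = (LINT x:{a<..<b}|lebesgue. p x) + (LINT x:{b<..<t}|lebesgue.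
      p x)"
      by (rule set_integral_concat) (use False assms in auto)
    then show ?thesis
      using L2_primitive_diff[OF assms(1), of a b] L2_primitive_diff[OF assms(2), of b t] t False assms(3)
      by (simp add: algebra_simps)
  qed
qed

lemma L2_primitive_cong:
  assumes "L2_primitive a b v p"
    and "\<And>t. a \<le> t \<Longrightarrow> t \<le> b \<Longrightarrow> v' t = v t" "\<And>t. a < t \<Longrightarrow> t < b \<Longrightarrow> p' t = p t"
  shows "L2_primitive a b v' p'"
  unfolding L2_primitive_def
proof (intro conjI ballI)
  show "L2_fun a b p'" using assms(1,3) L2_fun_cong[of a b p p'] unfolding L2_primitive_def by simp
  fix t assume t: "t \<in> {a..b}"
  have "(LINT s:{a<..<t}|lebesgue. p s) = (LINT s:{a<..<t}|lebesgue. p' s)"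
    unfolding set_lebesgue_integral_def
    by (rule Bochner_Integration.integral_cong) (use assms(3) t in \<open>auto simp: indicator_def\<close>)
  then show "v' t = v' a + (LINT s:{a<..<t}|lebesgue. p' s)"
    using L2_primitive_diff[OF assms(1), of a t] t assms(2) by (simp add: algebra_simps)
qed

section \<open>Translations and reflections of the time axis\<close>

text \<open>The factor 1 gives the translations used for translated and concatenated solutions, the
  factor -1 the time reversal that extends the chain rule to endpoints.\<close>

lemma lebesgue_isometry:
  assumes "\<bar>c::real\<bar> = 1"
  shows "(\<lambda>x. t + c * x) \<in> lebesgue \<rightarrow>\<^sub>M lebesgue"
    and "distr lebesgue lebesgue (\<lambda>x. t + c * x) = lebesgue"
proof -
  have c: "c \<noteq> 0" using assms by auto
  show "(\<lambda>x. t + c * x) \<in> lebesgue \<rightarrow>\<^sub>M lebesgue"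
    using lebesgue_affine_measurable[where c= "\<lambda>x::real. c"] c by simp
  show "distr lebesgue lebesgue (\<lambda>x. t + c * x) = lebesgue"
    using lebesgue_real_affine[OF c, of t] assms by (simp add: density_1)
qed

lemma AE_lebesgue_isometry:
  assumes "\<bar>c::real\<bar> = 1" "AE x in lebesgue. P x" shows "AE x in lebesgue. P (t + c * x)"
  using AE_distrD[OF lebesgue_isometry(1)[OF assms(1)], of P t] assms(2)
  unfolding lebesgue_isometry(2)[OF assms(1)] .

lemma
  fixes f :: "real \<Rightarrow> 'b::{banach,second_countable_topology}"
  assumes "\<bar>c::real\<bar> = 1"
  shows borel_measurable_lebesgue_isometry: "f \<in> borel_measurable lebesgue \<Longrightarrow> (\<lambda>x.
    f (t + c * x)) \<in> borel_measurable lebesgue"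
    and integrable_lebesgue_isometry: "integrable lebesgue f \<Longrightarrow> integrable lebesgue (\<lambda>x. f (t + c * x))"
    and integral_lebesgue_isometry: "f \<in> borel_measurable lebesgue \<Longrightarrow> (LINT x|lebesgue.
      f (t + c * x)) = (LINT x|lebesgue. f x)"
proof -
  note T = lebesgue_isometry[OF assms, of t]
  show 1: "(\<lambda>x. f (t + c * x)) \<in> borel_measurable lebesgue" if "f \<in> borel_measurable lebesgue"
    using measurable_compose[OF T(1) that] .
  show "integrable lebesgue (\<lambda>x. f (t + c * x))" if "integrable lebesgue f"
    using integrable_distr[OF T(1), of f] that T(2) by simp
  show "(LINT x|lebesgue. f (t + c * x)) = (LINT x|lebesgue. f x)" if "f \<in> borel_measurable lebesgue"
    using integral_distr[OF T(1) that] T(2) by simp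
qed

lemma L2_fun_isometry:
  assumes "\<bar>c::real\<bar> = 1" "L2_fun a b f" "\<And>x. a' < x \<and> x < b' \<longleftrightarrow> a < t + c * x \<and> t + c * x < b"
  shows "L2_fun a' b' (\<lambda>x. f (t + c * x))"
proof -
  have "indicat_real {a<..<b} (t + c * x) = indicat_real {a'<..<b'} x" for x
    using assms(3) by (simp add: indicator_def)
  then show ?thesis
    using assms(2) borel_measurable_lebesgue_isometry[OF assms(1), of "\<lambda>x. indicat_real {a<..<b} x *\<^sub>R f x" t]
      integrable_lebesgue_isometry[OF assms(1), of "\<lambda>x. indicat_real {a<..<b} x *\<^sub>R (norm (f x))\<^sup>2" t]
    unfolding L2_fun_iff_set set_borel_measurable_def set_integrable_def by simp
qed

lemma set_integral_isometry:
  fixes f :: "real \<Rightarrow> 'b::{banach,second_countable_topology}"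
  assumes "\<bar>c::real\<bar> = 1" "set_integrable lebesgue {a<..<b} f"
    and "\<And>x. a' < x \<and> x < b' \<longleftrightarrow> a < t + c * x \<and> t + c * x < b"
  shows "(LINT x:{a'<..<b'}|lebesgue. f (t + c * x)) = (LINT x:{a<..<b}|lebesgue. f x)"
proof -
  have "indicat_real {a<..<b} (t + c * x) = indicat_real {a'<..<b'} x" for x
    using assms(3) by (simp add: indicator_def)
  then show ?thesis
    using integral_lebesgue_isometry[OF assms(1), of "\<lambda>x. indicat_real {a<..<b} x *\<^sub>R f x" t] assms(2)
    unfolding set_lebesgue_integral_def set_integrable_def by simp
qed

lemma L2_primitive_shift:
  assumes "L2_primitive a b v p"
  shows "L2_primitive (a - c) (b - c) (\<lambda>x. v (x + c)) (\<lambda>x. p (x + c))"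
  unfolding L2_primitive_def
proof (intro conjI ballI)
  have L: "L2_fun a b p" using assms by (simp add: L2_primitive_def)
  show "L2_fun (a - c) (b - c) (\<lambda>x. p (x + c))"
    using L2_fun_isometry[of 1 a b p "a - c" "b - c" c] L by (simp add: add.commute less_diff_eq diff_less_eq)
  fix t assume t: "t \<in> {a - c..b - c}"
  have "set_integrable lebesgue {a<..<t + c} p"
    using L2_fun_imp_set_integrable[OF L2_fun_subset[OF L, of a "t + c"]] t by simp
  then have "(LINT x:{a - c<..<t}|lebesgue. p (x + c)) = (LINT x:{a<..<t + c}|lebesgue. p x)"
    using set_integral_isometry[of 1 a "t + c" p "a - c" t c]
      by (simp add: add.commute less_diff_eq diff_less_eq)
  then show "v (t + c) = v (a - c + c) + (LINT x:{a - c<..<t}|lebesgue. p (x + c))"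
    using L2_primitive_diff[OF assms, of a "t + c"] t by (simp add: algebra_simps)
qed

lemma L2_primitive_reflect:
  assumes "L2_primitive a b v p" "a \<le> b"
  shows "L2_primitive (c - b) (c - a) (\<lambda>x. v (c - x)) (\<lambda>x. - p (c - x))"
  unfolding L2_primitive_def
proof (intro conjI ballI)
  have L: "L2_fun a b p" using assms by (simp add: L2_primitive_def)
  have "L2_fun (c - b) (c - a) (\<lambda>x. p (c - x))"
    using L2_fun_isometry[of "-1" a b p "c - b" "c - a" c] L
      by (simp add: less_diff_eq diff_less_eq add.commute conj_commute)
  then show "L2_fun (c - b) (c - a) (\<lambda>x. - p (c - x))" by (rule L2_fun_minus)
  fix t assume t: "t \<in> {c - b..c - a}"
  have "set_integrable lebesgue {c - t<..<b} p"
    using L2_fun_imp_set_integrable[OF L2_fun_subset[OF L, of "c - t" b]] t by simp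
  then have "(LINT x:{c - b<..<t}|lebesgue. p (c - x)) = (LINT x:{c - t<..<b}|lebesgue. p x)"
    using set_integral_isometry[of "-1" "c - t" b p "c - b" t c]
      by (simp add: less_diff_eq diff_less_eq add.commute conj_commute)
  then have "(LINT x:{c - b<..<t}|lebesgue. - p (c - x)) = - (LINT x:{c - t<..<b}|lebesgue. p x)"
    by (simp add: set_lebesgue_integral_def)
  then show "v (c - t) = v (c - (c - b)) + (LINT x:{c - b<..<t}|lebesgue. - p (c - x))"
    using L2_primitive_diff[OF assms(1), of "c - t" b] t by (simp add: algebra_simps)
qed

section \<open>The fundamental theorem of calculus for absolutely continuous functions\<close>

text \<open>Brings absolute continuity into the form needed for tagged divisions: the members of
  \<open>D\<close> are enumerated, and disjointness of their interiors bounds their total length by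
  the measure of \<open>U\<close>, which is below \<delta>.\<close>

lemma abs_continuous_on_interval_sum:
  assumes ac: "\<And>(n::nat) s t. (\<forall>i<n. s i \<le> t i \<and> {s i..t i} \<subseteq> I) \<Longrightarrow>
        disjoint_family_on (\<lambda>i. {s i<..<t i}) {..<n} \<Longrightarrow>
        (\<Sum>i<n. t i - s i) < \<delta> \<Longrightarrow> (\<Sum>i<n. \<bar>f (t i) - f (s i)\<bar>) < (\<epsilon>::real)"
    and D: "finite D" "\<And>x K. (x, K) \<in> D \<Longrightarrow> \<exists>u v. u \<le> v \<and> K = {u..v} \<and> {u..v} \<subseteq> I \<and> {u<..<v} \<subseteq> U"
      "\<And>x K x' K'. (x, K) \<in> D \<Longrightarrow> (x', K') \<in> D \<Longrightarrow> (x, K) \<noteq> (x', K') \<Longrightarrow> interior K \<inter> interior K' = {}"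
    and U: "U \<in> sets lebesgue" "emeasure lebesgue U < ennreal \<delta>" "\<delta> > 0"
  shows "(\<Sum>(x, K)\<in>D. \<bar>f (Sup K) - f (Inf K :: real)\<bar>) < \<epsilon>"
proof -
  obtain h where h: "bij_betw h {..<card D} D" using ex_bij_betw_nat_finite[OF D(1)]
    by (auto simp: atLeast0LessThan)
  define s where "s i = Inf (snd (h i))" for i
  define t where "t i = Sup (snd (h i))" for i
  have hD: "h i \<in> D" if "i < card D" for i using h that by (auto simp: bij_betw_def)
  have st: "snd (h i) = {s i..t i}" "s i \<le> t i" "{s i..t i} \<subseteq> I" "{s i<..<t i} \<subseteq> U" if "i < card D" for i
  proof -
    have "(fst (h i), snd (h i)) \<in> D" using hD[OF that] by simp
    then obtain u v where uv: "u \<le> v" "snd (h i) = {u..v}" "{u..v} \<subseteq> I" "{u<..<v} \<subseteq> U" using D(2) by blast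
    then have "s i = u" "t i = v" by (auto simp: s_def t_def)
    then show "snd (h i) = {s i..t i}" "s i \<le> t i" "{s i..t i} \<subseteq> I" "{s i<..<t i} \<subseteq> U" using uv by auto
  qed
  have dj: "disjoint_family_on (\<lambda>i. {s i<..<t i}) {..<card D}"
    unfolding disjoint_family_on_def
  proof (intro ballI impI)
    fix i j assume ij: "i \<in> {..<card D}" "j \<in> {..<card D}" "i \<noteq> j"
    then have "h i \<noteq> h j" using h by (auto simp: bij_betw_def inj_on_def)
    then have "interior (snd (h i)) \<inter> interior (snd (h j)) = {}"
      using D(3)[of "fst (h i)" "snd (h i)" "fst (h j)" "snd (h j)"] hD ij by simp
    then show "{s i<..<t i} \<inter> {s j<..<t j} = {}" using st(1) ij by (simp add: interior_atLeastAtMost_real)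
  qed
  have fin: "emeasure lebesgue U < \<infinity>" using U(2) by (rule less_trans) simp
  have "(\<Sum>i<card D. t i - s i) = (\<Sum>i<card D. measure lebesgue {s i<..<t i})"
    using st(2) by (intro sum.cong) auto
  also have "\<dots> = measure lebesgue (\<Union>i<card D. {s i<..<t i})"
    using emeasure_lebesgue_Ioo_finite
    by (intro measure_finite_Union[symmetric] dj) (auto simp: less_top)
  also have "\<dots> \<le> measure lebesgue U"
  proof (rule measure_mono_fmeasurable)
    show "U \<in> fmeasurable lebesgue" using U(1) fin by (simp add: fmeasurable_def)
  qed (use st(4) in auto)
  also have "\<dots> < \<delta>" using U(2,3) fin by (simp add: emeasure_eq_ennreal_measure ennreal_less_iff less_top)
  finally have "(\<Sum>i<card D. \<bar>f (t i) - f (s i)\<bar>) < \<epsilon>" using st by (intro ac dj) auto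
  also have "(\<Sum>i<card D. \<bar>f (t i) - f (s i)\<bar>) = (\<Sum>z\<in>D. \<bar>f (Sup (snd z)) - f (Inf (snd z))\<bar>)"
    unfolding s_def t_def by (rule sum.reindex_bij_betw[OF h])
  finally show ?thesis by (simp add: case_prod_beta')
qed

text \<open>A gauge integral argument. Tags at which the derivative exists satisfy the straddle
  estimate. The other tags lie in a null set, covered by an open set of small measure on which
  absolute continuity controls the increments. The gauge integral so obtained agrees with the
  Lebesgue integral of \<open>f'\<close>.\<close>

lemma abs_continuous_FTC:
  fixes f :: "real \<Rightarrow> real"
  assumes ac: "abs_continuous_on {a<..<b} f"
    and der: "AE x in lebesgue. x \<in> {s<..<t} \<longrightarrow> (f has_real_derivative f' x) (at x)"
    and st: "a < s" "s \<le> t" "t < b" and int: "set_integrable lebesgue {s<..<t} f'"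
  shows "(LINT x:{s<..<t}|lebesgue. f' x) = f t - f s"
proof -
  define N where "N = {x \<in> {s..t}. \<not> (f has_real_derivative f' x) (at x)}"
  have N: "N \<in> null_sets lebesgue"
  proof -
    have "AE x in lebesgue. x \<notin> N" using der AE_lebesgue_neq[of s] AE_lebesgue_neq[of t]
      by eventually_elim (auto simp: N_def)
    then show ?thesis using completion.null_sets_iff_AE[of N lborel] by simp
  qed
  \<comment> \<open>Setting the integrand to 0 on \<open>N\<close> removes the length terms at bad
    tags, so that only increments of \<open>f\<close> remain there.\<close>
  define g where "g x = (if x \<in> N then 0 else f' x)" for x
  have "(g has_integral (f t - f s)) {s..t}"
    unfolding has_integral_real
  proof (intro allI impI)
    fix e :: real assume "e > 0"
    \<comment> \<open>The good tags contribute at most \<open>(t - s) * e1\<close>, which is below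
      \<open>e / 2\<close>; the summand 1 covers \<open>s = t\<close>.\<close>
    define e1 where "e1 = e / (2 * (t - s + 1))"
    have e1: "e1 > 0" using \<open>e > 0\<close> st by (simp add: e1_def)
    obtain \<delta> where \<delta>: "\<delta> > 0" "\<And>(n::nat) s t. (\<forall>i<n. s i \<le> t i \<and> {s i..t i} \<subseteq> {a<..<b}) \<Longrightarrow>
        disjoint_family_on (\<lambda>i. {s i<..<t i}) {..<n} \<Longrightarrow>
        (\<Sum>i<n. t i - s i) < \<delta> \<Longrightarrow> (\<Sum>i<n. \<bar>f (t i) - f (s i)\<bar>) < e / 2"
      using ac[unfolded abs_continuous_on_def, THEN spec, THEN mp, OF half_gt_zero[OF \<open>e > 0\<close>]] by blast
    obtain U where U: "open U" "N \<subseteq> U" "U - N \<in> lmeasurable" "emeasure lebesgue (U - N) < ennreal \<delta>"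
      using sets_lebesgue_outer_open[of N \<delta>] N \<delta>(1) by (auto simp: null_setsD2)
    have U': "U \<in> sets lebesgue" "emeasure lebesgue U < ennreal \<delta>"
      using U emeasure_Diff_null_set[OF N, of U] by auto
    have "\<exists>r>0. (x \<in> N \<longrightarrow> ball x r \<subseteq> U) \<and> (x \<in> {s..t} - N \<longrightarrow> (\<forall>y. \<bar>y - x\<bar> < r \<longrightarrow>
      \<bar>f y - f x - f' x * (y - x)\<bar> \<le> e1 * \<bar>y - x\<bar>))" for x
    proof (cases "x \<in> N")
      case True
      then show ?thesis using U(1,2) open_contains_ball by (metis DiffD2 subsetD)
    next
      case False
      show ?thesis
      proof (cases "x \<in> {s..t}")
        case True
        then have "(f has_derivative (\<lambda>h. f' x * h)) (at x)" using False
          unfolding N_def has_field_derivative_def by simp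
        then have "\<exists>d>0. \<forall>y. \<bar>y - x\<bar> < d \<longrightarrow> \<bar>f y - f x - f' x * (y - x)\<bar> \<le> e1 * \<bar>y - x\<bar>"
          unfolding has_derivative_at_alt real_norm_def using e1 by blast
        then show ?thesis using False by blast
      qed (use False in \<open>auto intro: exI[of _ 1]\<close>)
    qed
    then obtain r where r: "\<And>x. r x > 0" "\<And>x. x \<in> N \<Longrightarrow> ball x (r x) \<subseteq> U"
      "\<And>x y. x \<in> {s..t} - N \<Longrightarrow> \<bar>y - x\<bar> < r x \<Longrightarrow> \<bar>f y - f x - f' x * (y - x)\<bar> \<le> e1 * \<bar>y - x\<bar>"
      by metis
    show "\<exists>\<gamma>. gauge \<gamma> \<and> (\<forall>\<D>. \<D> tagged_division_of {s..t} \<and> \<gamma> fine \<D> \<longrightarrow>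
        norm (sum (\<lambda>(x,k). measure lborel k *\<^sub>R g x) \<D> - (f t - f s)) < e)"
    proof (intro exI[of _ "\<lambda>x. ball x (r x)"] conjI allI impI; (elim conjE)?)
      show "gauge (\<lambda>x. ball x (r x))" using r(1) by (rule gauge_ball_dependent[OF allI])
      fix D assume D: "D tagged_division_of {s..t}" and fine: "(\<lambda>x. ball x (r x)) fine D"
      have finD: "finite D" using D by blast
      have K: "\<exists>u v. u \<le> v \<and> K = {u..v} \<and> x \<in> {u..v} \<and> {u..v} \<subseteq> {s..t} \<and> {u..v} \<subseteq> ball x (r x)"
        if z: "(x, K) \<in> D" for x K
      proof -
        obtain u v where "K = cbox u v" using tagged_division_ofD(4)[OF D z] by blast
        moreover have "x \<in> K" "K \<subseteq> {s..t}" using tagged_division_ofD(2,3)[OF D z] by auto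
        moreover have "K \<subseteq> ball x (r x)" using fine z by (auto simp: fine_def)
        ultimately show ?thesis by (intro exI[of _ u] exI[of _ v]) auto
      qed
      define D1 where "D1 = {z \<in> D. fst z \<in> N}"
      have tel: "f t - f s = (\<Sum>(x, K)\<in>D. f (Sup K) - f (Inf K))"
        using additive_tagged_division_1[OF st(2) D, of f] by simp
      have "norm ((\<Sum>(x,k)\<in>D. measure lborel k *\<^sub>R g x) - (f t - f s)) = norm (\<Sum>(x,k)\<in>D.
        measure lborel k *\<^sub>R g x - (f (Sup k) - f (Inf k)))"
        unfolding tel by (simp add: sum_subtractf case_prod_beta')
      also have "\<dots> \<le> (\<Sum>(x,k)\<in>D. \<bar>measure lborel k *\<^sub>R g x - (f (Sup k) - f (Inf k))\<bar>)"
        using norm_sum[of "\<lambda>(x,k). measure lborel k *\<^sub>R g x - (f (Sup k) - f (Inf k))" D]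
          by (simp add: case_prod_beta')
      also have "\<dots> = (\<Sum>(x,k)\<in>D1. \<bar>measure lborel k *\<^sub>R g x - (f (Sup k) - f (Inf k))\<bar>) + (\<Sum>(x,k)\<in>D - D1.
        \<bar>measure lborel k *\<^sub>R g x - (f (Sup k) - f (Inf k))\<bar>)"
        by (rule sum.subset_diff[OF _ finD, THEN trans[OF _ add.commute]]) (auto simp: D1_def)
      also have "(\<Sum>(x,k)\<in>D1. \<bar>measure lborel k *\<^sub>R g x - (f (Sup k) - f (Inf k))\<bar>) = (\<Sum>(x,k)\<in>D1.
        \<bar>f (Sup k) - f (Inf k)\<bar>)"
        by (rule sum.cong) (auto simp: D1_def g_def)
      also have "\<dots> < e / 2"
      proof (rule abs_continuous_on_interval_sum[OF \<delta>(2), where U=U and I="{a<..<b}"])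
        show "finite D1" using finD by (simp add: D1_def)
        show "\<exists>u v. u \<le> v \<and> K = {u..v} \<and> {u..v} \<subseteq> {a<..<b} \<and> {u<..<v} \<subseteq> U" if z: "(x, K) \<in> D1" for x K
        proof -
          have "(x, K) \<in> D" "x \<in> N" using z by (auto simp: D1_def)
          then obtain u v where "u \<le> v" "K = {u..v}" "{u..v} \<subseteq> {s..t}" "{u..v} \<subseteq> ball x (r x)" using K
            by blast
          moreover have "ball x (r x) \<subseteq> U" using r(2) \<open>x \<in> N\<close> by blast
          moreover have "{s..t} \<subseteq> {a<..<b}" using st by auto
          moreover have "{u<..<v} \<subseteq> {u..v}" by auto
          ultimately show ?thesis by blast
        qed
        show "interior K \<inter> interior K' = {}" if "(x, K) \<in> D1" "(x', K') \<in> D1" "(x, K) \<noteq> (x', K')"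
          for x K x' K'
          using tagged_division_ofD(5)[OF D] that unfolding D1_def by blast
      qed (use U' \<delta> in auto)
      also have "(\<Sum>(x,k)\<in>D - D1. \<bar>measure lborel k *\<^sub>R g x - (f (Sup k) - f (Inf k))\<bar>) \<le> (\<Sum>(x,k)\<in>D.
        measure lborel k * e1)"
      proof -
        have "(\<Sum>(x,k)\<in>D - D1. \<bar>measure lborel k *\<^sub>R g x - (f (Sup k) - f (Inf k))\<bar>) \<le> (\<Sum>(x,k)\<in>D - D1.
          measure lborel k * e1)"
        proof (rule sum_mono, clarify)
          fix x k assume z: "(x, k) \<in> D" "(x, k) \<notin> D1"
          then obtain u v where uv: "u \<le> v" "k = {u..v}" "x \<in> {u..v}" "{u..v} \<subseteq> {s..t}"
            "{u..v} \<subseteq> ball x (r x)" using K by blast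
          have "u \<in> {u..v}" "v \<in> {u..v}" using uv(1) by auto
          then have "u \<in> ball x (r x)" "v \<in> ball x (r x)" using uv(5) by blast+
          then have dx: "\<bar>u - x\<bar> < r x" "\<bar>v - x\<bar> < r x" by (simp_all add: dist_real_def abs_minus_commute)
          have "x \<in> {s..t} - N" using z uv by (auto simp: D1_def)
          then have "\<bar>f u - f x - f' x * (u - x)\<bar> \<le> e1 * \<bar>u - x\<bar>"
            "\<bar>f v - f x - f' x * (v - x)\<bar> \<le> e1 * \<bar>v - x\<bar>"
            using r(3) dx by blast+
          \<comment> \<open>The straddle estimate: as the tag lies between \<open>u\<close> and
            \<open>v\<close>, the two errors add up to \<open>e1\<close> times the length.\<close>
          then have "\<bar>(v - u) * f' x - (f v - f u)\<bar> \<le> (v - u) * e1"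
          proof -
            have "(v - u) * f' x - (f v - f u) = (f u - f x - f' x * (u - x)) - (f v - f x - f' x * (v - x))"
              by (simp add: algebra_simps)
            then have "\<bar>(v - u) * f' x - (f v - f u)\<bar>
              \<le> \<bar>f u - f x - f' x * (u - x)\<bar> + \<bar>f v - f x - f' x * (v - x)\<bar>"
              by (simp only: abs_triangle_ineq4)
            also have "\<dots> \<le> e1 * \<bar>u - x\<bar> + e1 * \<bar>v - x\<bar>"
              by (intro add_mono) fact+
            also have "\<dots> = (v - u) * e1" using uv(3) by (simp add: algebra_simps)
            finally show ?thesis .
          qed
          then show "\<bar>measure lborel k *\<^sub>R g x - (f (Sup k) - f (Inf k))\<bar> \<le> measure lborel k * e1"
            using z uv by (simp add: g_def D1_def)
        qed
        also have "\<dots> \<le> (\<Sum>(x,k)\<in>D. measure lborel k * e1)"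
          by (rule sum_mono2[OF finD]) (use e1 in \<open>auto simp: \<close>)
        finally show ?thesis .
      qed
      also have "(\<Sum>(x,k)\<in>D. measure lborel k * e1) = (t - s) * e1"
        using additive_content_tagged_division[of D s t] D st(2)
          by (simp add: sum_distrib_right[symmetric] case_prod_beta')
      also have "\<dots> < e / 2"
        using \<open>e > 0\<close> st by (simp add: e1_def field_simps)
      finally show "norm ((\<Sum>(x,k)\<in>D. measure lborel k *\<^sub>R g x) - (f t - f s)) < e" by simp
    qed
  qed
  moreover have "(f' has_integral (LINT x:{s<..<t}|lebesgue. f' x)) {s..t}"
    using has_integral_set_lebesgue[OF int] has_integral_Icc_iff_Ioo by blast
  then have "(g has_integral (LINT x:{s<..<t}|lebesgue. f' x)) {s..t}"
    by (rule has_integral_spike[of N, rotated 2]) (use N in \<open>auto simp: g_def negligible_iff_null_sets\<close>)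
  ultimately show ?thesis by (rule has_integral_unique[symmetric])
qed

section \<open>Weak compactness and measurable selection\<close>

text \<open>The representing vector minimises \<open>J\<close>. The parallelogram identity turns a
  minimising sequence into a Cauchy sequence, and stationarity at the minimiser is the
  representation.\<close>

lemma Riesz_representation:
  fixes l :: "'h::{real_inner,banach} \<Rightarrow> real"
  assumes "bounded_linear l"
  shows "\<exists>x. \<forall>h. l h = x \<bullet> h"
proof -
  interpret l: bounded_linear l by fact
  obtain K where K: "\<And>h. norm (l h) \<le> norm h * K" using l.bounded by blast
  define J where "J h = (norm h)\<^sup>2 / 2 - l h" for h
  have lower: "- (K\<^sup>2 / 2) \<le> J h" for h
  proof -
    have "l h \<le> norm h * K" using K[of h] by simp
    moreover have "0 \<le> (norm h - K)\<^sup>2" by simp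
    ultimately show ?thesis by (simp add: J_def power2_eq_square algebra_simps)
  qed
  define m where "m = (INF h. J h)"
  have bdd: "bdd_below (range J)" using lower by (intro bdd_belowI[of _ "- (K\<^sup>2 / 2)"]) auto
  have m: "m \<le> J h" for h unfolding m_def by (rule cINF_lower[OF bdd]) simp
  have "\<exists>h. J h < m + 1 / real (Suc n)" for n
  proof -
    have "(INF h. J h) < m + 1 / real (Suc n)" by (simp add: m_def)
    then show ?thesis using bdd by (simp add: cINF_less_iff)
  qed
  then obtain x where x: "\<And>n. J (x n) < m + 1 / real (Suc n)" by metis
  have par: "(norm (u - v))\<^sup>2 / 4 = J u + J v - 2 * J ((1/2) *\<^sub>R (u + v))" for u v
    by (simp add: J_def l.add l.scaleR power_mult_distrib power2_norm_eq_inner inner_add inner_diff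
      inner_commute field_simps)
  have close: "(norm (x i - x j))\<^sup>2 \<le> 4 * (1 / real (Suc i) + 1 / real (Suc j))" for i j
  proof -
    have "A \<le> 4 * (p + q)" if "A / 4 = a + b - 2 * c" "m \<le> c" "a < m + p" "b < m + q" for A a b c p q :: real
      using that by argo
    from this[OF par m x x] show ?thesis .
  qed
  have "Cauchy x"
  proof (rule metric_CauchyI)
    fix e :: real assume "e > 0"
    obtain N where N: "8 / e\<^sup>2 < real N" using reals_Archimedean2 by blast
    show "\<exists>M. \<forall>i\<ge>M. \<forall>j\<ge>M. dist (x i) (x j) < e"
    proof (intro exI[of _ N] allI impI)
      fix i j assume ij: "N \<le> i" "N \<le> j"
      have "8 / e\<^sup>2 > 0" using \<open>e > 0\<close> by simp
      then have "real N > 0" using N by linarith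
      have b: "1 / real (Suc k) < e\<^sup>2 / 8" if "N \<le> k" for k
      proof -
        have "8 / e\<^sup>2 < real (Suc k)" using N that by linarith
        then show ?thesis using \<open>e > 0\<close> by (simp add: field_simps)
      qed
      have "(norm (x i - x j))\<^sup>2 < e\<^sup>2" using close[of i j] b[OF ij(1)] b[OF ij(2)] by argo
      then show "dist (x i) (x j) < e" using \<open>e > 0\<close> by (simp add: dist_norm power_less_imp_less_base)
    qed
  qed
  then obtain y where y: "x \<longlonglongrightarrow> y" using Cauchy_convergent convergent_def by blast
  have "(\<lambda>n. J (x n)) \<longlonglongrightarrow> J y" unfolding J_def by (intro tendsto_intros y l.tendsto) simp
  moreover have "(\<lambda>n. m + 1 / real (Suc n)) \<longlonglongrightarrow> m + 0"
    by (intro tendsto_add tendsto_const LIMSEQ_Suc lim_1_over_n)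
  ultimately have "J y \<le> m + 0" by (rule LIMSEQ_le) (use x in \<open>auto intro: less_imp_le\<close>)
  then have min: "J y \<le> J h" for h using m[of h] by simp
  have "l h = y \<bullet> h" for h
  proof (cases "h = 0")
    case True then show ?thesis by (simp add: l.zero)
  next
    case False
    define d where "d = l h - y \<bullet> h"
    \<comment> \<open>The step length that minimises \<open>J\<close> along the line through
      \<open>y\<close> in direction \<open>h\<close>; a gap \<open>d\<close> would lower
      \<open>J\<close> by d^2 / (2 |h|^2).\<close>
    define t where "t = d / (norm h)\<^sup>2"
    have "J (y + t *\<^sub>R h) = J y + (t\<^sup>2 * (norm h)\<^sup>2 / 2 - t * d)"
    proof -
      have "(norm (y + t *\<^sub>R h))\<^sup>2 = (norm y)\<^sup>2 + 2 * t * (y \<bullet> h) + t\<^sup>2 * (norm h)\<^sup>2"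
        unfolding power2_norm_eq_inner by (simp add: inner_add inner_commute power2_eq_square algebra_simps)
      then show ?thesis by (simp add: J_def d_def l.add l.scaleR algebra_simps add_divide_distrib)
    qed
    moreover have "t\<^sup>2 * (norm h)\<^sup>2 / 2 - t * d = - (d\<^sup>2 / (norm h)\<^sup>2 / 2)"
      using False by (simp add: t_def power2_eq_square field_simps)
    ultimately have "d\<^sup>2 / (norm h)\<^sup>2 \<le> 0" using min[of "y + t *\<^sub>R h"] by simp
    then have "d = 0" using False by (simp add: divide_le_0_iff)
    then show ?thesis by (simp add: d_def)
  qed
  then show ?thesis by blast
qed

text \<open>The norm bound extends convergence of the pairings from \<open>E\<close> to all test
  vectors. The limit is a bounded functional, hence given by a vector through
  \<open>Riesz_representation\<close>.\<close>

lemma bounded_weakly_convergent: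
  fixes b :: "nat \<Rightarrow> 'h::{real_inner,banach}"
  assumes bd: "\<And>k. norm (b k) \<le> R" and E: "closure E = UNIV"
    and conv: "\<And>e. e \<in> E \<Longrightarrow> convergent (\<lambda>k. b k \<bullet> e)"
  shows "\<exists>x. weakly_converges b x"
proof -
  have "R \<ge> 0" using bd[of 0] norm_ge_zero order_trans by blast
  have C: "convergent (\<lambda>k. b k \<bullet> h)" for h
  proof -
    have "Cauchy (\<lambda>k. b k \<bullet> h)"
    proof (rule metric_CauchyI)
      fix e :: real assume "e > 0"
      define d where "d = e / 3 / (R + 1)"
      have "d > 0" using \<open>e > 0\<close> \<open>R \<ge> 0\<close> by (simp add: d_def)
      then obtain g where g: "g \<in> E" "dist g h < d" using E closure_approachable[of h E] by auto
      have near: "\<bar>b k \<bullet> h - b k \<bullet> g\<bar> \<le> e / 3" for k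
      proof -
        have "\<bar>b k \<bullet> (h - g)\<bar> \<le> norm (b k) * norm (h - g)" by (rule Cauchy_Schwarz_ineq2)
        also have "\<dots> \<le> (R + 1) * d" using bd[of k] g(2) \<open>R \<ge> 0\<close>
          by (intro mult_mono) (auto simp: dist_norm norm_minus_commute)
        also have "\<dots> = e / 3" unfolding d_def using \<open>R \<ge> 0\<close>
          by (subst times_divide_eq_right, intro nonzero_mult_div_cancel_left) simp
        finally show ?thesis by (simp add: inner_diff_right)
      qed
      have "Cauchy (\<lambda>k. b k \<bullet> g)" using conv[OF g(1)] by (rule convergent_Cauchy)
      then obtain M where M: "\<And>i j. i \<ge> M \<Longrightarrow> j \<ge> M \<Longrightarrow> dist (b i \<bullet> g) (b j \<bullet> g) < e / 3"
        using \<open>e > 0\<close> unfolding Cauchy_def by (meson divide_pos_pos zero_less_numeral)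
      show "\<exists>M. \<forall>i\<ge>M. \<forall>j\<ge>M. dist (b i \<bullet> h) (b j \<bullet> h) < e"
      proof (intro exI[of _ M] allI impI)
        fix i j assume "M \<le> i" "M \<le> j"
        from M[OF this] near[of i] near[of j] show "dist (b i \<bullet> h) (b j \<bullet> h) < e"
          unfolding dist_real_def by linarith
      qed
    qed
    then show ?thesis by (rule Cauchy_convergent)
  qed
  define l where "l h = lim (\<lambda>k. b k \<bullet> h)" for h
  have lim: "(\<lambda>k. b k \<bullet> h) \<longlonglongrightarrow> l h" for h using C convergent_LIMSEQ_iff unfolding l_def by blast
  have "bounded_linear l"
  proof (rule bounded_linear_intro[where K=R])
    show "l (x + y) = l x + l y" for x y
      by (rule LIMSEQ_unique[OF lim]) (simp add: inner_add_right tendsto_add lim)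
    show "l (r *\<^sub>R x) = r *\<^sub>R l x" for r x
      by (rule LIMSEQ_unique[OF lim]) (simp add: tendsto_mult_left lim)
    show "norm (l x) \<le> norm x * R" for x
    proof (rule Lim_norm_ubound[OF _ lim])
      have "norm (b k \<bullet> x) \<le> norm x * R" for k
        using Cauchy_Schwarz_ineq2[of "b k" x] mult_right_mono[OF bd[of k] norm_ge_zero[of x]]
          by (simp add: mult.commute)
      then show "\<forall>\<^sub>F k in sequentially. norm (b k \<bullet> x) \<le> norm x * R" by simp
    qed simp
  qed
  from Riesz_representation[OF this] obtain x where "\<And>h. l h = x \<bullet> h" by blast
  then show ?thesis unfolding weakly_converges_def using lim by metis
qed

text \<open>Weak lower semicontinuity of the norm, from pairing with \<open>x\<close> itself. The
  second assumption says that the liminf of the norms is at most \<open>L\<close> without using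
  extended reals.\<close>

lemma weakly_converges_norm_le:
  fixes x :: "'h::real_inner"
  assumes "weakly_converges b x" "\<And>c. L < c \<Longrightarrow> \<exists>\<^sub>F k in sequentially. norm (b k) \<le> c"
  shows "norm x \<le> L"
proof (rule dense_ge)
  fix c assume "L < c"
  show "norm x \<le> c"
  proof (rule ccontr)
    assume "\<not> norm x \<le> c"
    then have "x \<noteq> 0 \<and> c * norm x < x \<bullet> x \<or> c < 0"
    proof (cases "c < 0")
      case False
      with \<open>\<not> norm x \<le> c\<close> have "c * norm x < norm x * norm x" by (intro mult_strict_right_mono) auto
      then show ?thesis by (auto simp: power2_norm_eq_inner[symmetric] power2_eq_square)
    qed simp
    then show False
    proof
      assume a: "x \<noteq> 0 \<and> c * norm x < x \<bullet> x"
      have "(\<lambda>k. b k \<bullet> x) \<longlonglongrightarrow> x \<bullet> x" using assms(1) by (simp add: weakly_converges_def)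
      then have "\<forall>\<^sub>F k in sequentially. c * norm x < b k \<bullet> x" using a order_tendstoD(1) by blast
      with assms(2)[OF \<open>L < c\<close>] have "\<exists>\<^sub>F k in sequentially. norm (b k) \<le> c \<and> c * norm x < b k \<bullet> x"
        by (rule frequently_eventually_frequently)
      then obtain k where k: "norm (b k) \<le> c" "c * norm x < b k \<bullet> x" using frequently_ex by blast
      have "b k \<bullet> x \<le> norm (b k) * norm x" by (rule norm_cauchy_schwarz)
      also have "\<dots> \<le> c * norm x" using k(1) by (rule mult_right_mono) simp
      finally show False using k(2) by simp
    next
      assume "c < 0"
      from frequently_ex[OF assms(2)[OF \<open>L < c\<close>]] obtain k where "norm (b k) \<le> c" by blast
      with \<open>c < 0\<close> norm_ge_zero[of "b k"] show False by linarith
    qed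
  qed
qed

section \<open>Measurability of Hilbert space valued maps\<close>

text \<open>For countable \<open>E\<close> this describes a ball by countably many scalar
  inequalities, which is what makes preimages of balls measurable in
  \<open>Pettis_measurability\<close>.\<close>

lemma norm_le_iff_inner_dense:
  fixes x :: "'h::real_inner"
  assumes E: "closure E = UNIV"
  shows "norm x \<le> r \<longleftrightarrow> 0 \<le> r \<and> (\<forall>e\<in>E. x \<bullet> e \<le> r * norm e)"
proof
  assume r: "norm x \<le> r"
  then have "0 \<le> r" using norm_ge_zero order_trans by blast
  moreover have "x \<bullet> e \<le> r * norm e" for e
    using norm_cauchy_schwarz[of x e] mult_right_mono[OF r norm_ge_zero[of e]] by linarith
  ultimately show "0 \<le> r \<and> (\<forall>e\<in>E. x \<bullet> e \<le> r * norm e)" by blast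
next
  assume a: "0 \<le> r \<and> (\<forall>e\<in>E. x \<bullet> e \<le> r * norm e)"
  have "closed {e. x \<bullet> e \<le> r * norm e}" by (intro closed_Collect_le continuous_intros)
  then have "closure E \<subseteq> {e. x \<bullet> e \<le> r * norm e}" by (rule closure_minimal[rotated]) (use a in auto)
  then have "x \<bullet> x \<le> r * norm x" using E by auto
  then have "norm x * norm x \<le> r * norm x" by (simp add: power2_norm_eq_inner[symmetric] power2_eq_square)
  then show "norm x \<le> r" using a by (cases "x = 0") auto
qed

text \<open>Preimages of closed balls are countable intersections of scalar conditions, and an open
  set is a countable union of closed balls with centers in \<open>E\<close> and radii 1 / (n +
  1).\<close>

lemma Pettis_measurability:
  fixes f :: "'x \<Rightarrow> 'h::{real_inner,second_countable_topology}"
  assumes E: "closure E = UNIV" "countable E"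
    and m: "\<And>e. e \<in> E \<Longrightarrow> (\<lambda>x. f x \<bullet> e) \<in> borel_measurable M"
  shows "f \<in> borel_measurable M"
proof (rule borel_measurableI)
  have ball: "{x \<in> space M. dist c (f x) \<le> r} \<in> sets M" for c r
  proof -
    have "{x \<in> space M. dist c (f x) \<le> r} = {x \<in> space M. 0 \<le> r \<and> (\<forall>e\<in>E. (f x - c) \<bullet> e \<le> r * norm e)}"
      unfolding dist_norm norm_minus_commute[of c] by (subst norm_le_iff_inner_dense[OF E(1)]) simp
    also have "\<dots> \<in> sets M"
    proof -
      have "{x \<in> space M. r * norm e < f x \<bullet> e - c \<bullet> e} \<in> sets M" if "e \<in> E" for e
        using m[OF that] by simp
      then have "space M - (\<Union>e\<in>E. {x \<in> space M. r * norm e < f x \<bullet> e - c \<bullet> e}) \<in> sets M"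
        by (intro sets.Diff sets.top sets.countable_UN'[OF E(2)]) auto
      also have "space M - (\<Union>e\<in>E. {x \<in> space M. r * norm e < f x \<bullet> e - c \<bullet> e}) =
          {x \<in> space M. \<forall>e\<in>E. (f x - c) \<bullet> e \<le> r * norm e}"
        by (auto simp: inner_diff_left not_less)
      finally have "{x \<in> space M. \<forall>e\<in>E. (f x - c) \<bullet> e \<le> r * norm e} \<in> sets M" .
      then show ?thesis by (cases "0 \<le> r") auto
    qed
    finally show ?thesis .
  qed
  fix S :: "'h set" assume S: "open S"
  define I where "I = {(c, n::nat). c \<in> E \<and> cball c (1 / real (Suc n)) \<subseteq> S}"
  have "countable I" by (rule countable_subset[of _ "E \<times> UNIV"]) (use E(2) in \<open>auto simp: I_def\<close>)
  have Seq: "S = (\<Union>z\<in>I. cball (fst z) (1 / real (Suc (snd z))))"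
  proof
    show "(\<Union>z\<in>I. cball (fst z) (1 / real (Suc (snd z)))) \<subseteq> S" by (auto simp: I_def)
    show "S \<subseteq> (\<Union>z\<in>I. cball (fst z) (1 / real (Suc (snd z))))"
    proof
      fix x assume "x \<in> S"
      then obtain r where r: "r > 0" "ball x r \<subseteq> S" using S open_contains_ball by blast
      obtain n where n: "2 / r < real n" using reals_Archimedean2 by blast
      have n1: "1 / real (Suc n) < r / 2"
      proof -
        have "2 / r < real (Suc n)" using n by simp
        then show ?thesis using r(1) by (simp add: field_simps)
      qed
      obtain c where c: "c \<in> E" "dist c x < 1 / real (Suc n)"
      proof -
        have "0 < 1 / real (Suc n)" by simp
        moreover have "x \<in> closure E" using E(1) by simp
        ultimately have "\<exists>c\<in>E. dist c x < 1 / real (Suc n)" using closure_approachable by metis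
        then show ?thesis using that by blast
      qed
      have "cball c (1 / real (Suc n)) \<subseteq> ball x r"
      proof
        fix y assume "y \<in> cball c (1 / real (Suc n))"
        then have "dist c y \<le> 1 / real (Suc n)" by simp
        then have "dist x y < r" using c(2) n1 dist_triangle[of x y c] by (simp add: dist_commute)
        then show "y \<in> ball x r" by simp
      qed
      then have "(c, n) \<in> I" using c r by (auto simp: I_def)
      moreover have "x \<in> cball (fst (c, n)) (1 / real (Suc (snd (c, n))))" using c by simp
      ultimately show "x \<in> (\<Union>z\<in>I. cball (fst z) (1 / real (Suc (snd z))))" by blast
    qed
  qed
  have "f -` S \<inter> space M = (\<Union>z\<in>I. {x \<in> space M. dist (fst z) (f x) \<le> 1 / real (Suc (snd z))})"
    by (subst Seq) (simp only: set_eq_iff vimage_eq Int_iff UN_iff mem_cball mem_Collect_eq, blast)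
  also have "\<dots> \<in> sets M" using ball \<open>countable I\<close> by (intro sets.countable_UN') auto
  finally show "f -` S \<inter> space M \<in> sets M" .
qed

section \<open>Measurable selection of cluster points\<close>

text \<open>A Bolzano-Weierstrass construction run at all points \<open>x\<close> at once. The step
  from \<open>k\<close> to \<open>Suc k\<close> keeps the indices whose values lie within 1 / (k +
  1) of one center, namely the member of least index in the dense sequence \<open>y\<close> that
  leaves infinitely many indices. Taking the least index instead of an arbitrary one keeps every
  stage measurable in \<open>x\<close>.\<close>

primrec nested_cluster :: "(nat \<Rightarrow> 'y::metric_space) \<Rightarrow> (nat \<Rightarrow> 'x \<Rightarrow> 'y) \<Rightarrow> nat \<Rightarrow> 'x \<Rightarrow> nat set" where
  "nested_cluster y a 0 x = UNIV"
| "nested_cluster y a (Suc k) x =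
     {n \<in> nested_cluster y a k x.
        dist (a n x) (y (LEAST i. infinite {n \<in> nested_cluster y a k x. dist (a n x) (y i) < 1 / real (Suc
          k)})) < 1 / real (Suc k)}"

definition cluster_center :: "(nat \<Rightarrow> 'y::metric_space) \<Rightarrow> (nat \<Rightarrow> 'x \<Rightarrow> 'y) \<Rightarrow> nat \<Rightarrow> 'x \<Rightarrow> 'y" where
  "cluster_center y a k x = y (LEAST i. infinite {n \<in> nested_cluster y a k x.
    dist (a n x) (y i) < 1 / real (Suc k)})"

lemma nested_cluster_Suc:
  "nested_cluster y a (Suc k) x = {n \<in> nested_cluster y a k x.
    dist (a n x) (cluster_center y a k x) < 1 / real (Suc k)}"
  by (simp add: cluster_center_def)

text \<open>Finitely many balls around members of \<open>y\<close> cover \<open>C\<close> and split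
  the infinite index set of the previous stage, so one of them keeps infinitely many indices and the
  \<open>LEAST\<close> is attained.\<close>

lemma infinite_nested_cluster:
  assumes y: "closure (range y) = UNIV" and C: "compact C" "\<And>n. a n x \<in> C"
  shows "infinite (nested_cluster y a k x)"
proof (induction k)
  case (Suc k)
  let ?A = "nested_cluster y a k x"
  have "C \<subseteq> (\<Union>i. ball (y i) (1 / real (Suc k)))"
  proof
    fix z assume "z \<in> C"
    obtain i where "dist (y i) z < 1 / real (Suc k)"
      using y closure_approachable[of z "range y"]
        by (metis UNIV_I image_iff of_nat_0_less_iff zero_less_Suc zero_less_divide_1_iff)
    then show "z \<in> (\<Union>i. ball (y i) (1 / real (Suc k)))" by auto
  qed
  then obtain I where I: "finite I" "C \<subseteq> (\<Union>i\<in>I. ball (y i) (1 / real (Suc k)))"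
    using compactE_image[OF C(1), of UNIV "\<lambda>i. ball (y i) (1 / real (Suc k))"] by auto
  have "?A = (\<Union>i\<in>I. {n \<in> ?A. dist (a n x) (y i) < 1 / real (Suc k)})"
    using I(2) C(2) by (fastforce simp: dist_commute)
  then have "\<exists>i\<in>I. infinite {n \<in> ?A. dist (a n x) (y i) < 1 / real (Suc k)}"
    using Suc I(1) by (metis (no_types, lifting) finite_UN)
  then have "\<exists>i. infinite {n \<in> ?A. dist (a n x) (y i) < 1 / real (Suc k)}" by blast
  from LeastI_ex[OF this] show ?case by simp
qed simp

text \<open>The two claims feed each other: the center of a stage is measurable once membership in
  its index set is, and membership in the next stage is measurable once the center is. Infinity of a
  set of naturals is a countable condition.\<close>

lemma measurable_nested_cluster:
  fixes y :: "nat \<Rightarrow> 'y::{metric_space,second_countable_topology}"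
  assumes a: "\<And>n. a n \<in> borel_measurable M"
  shows "Measurable.pred M (\<lambda>x. n \<in> nested_cluster y a k x)"
    and "cluster_center y a k \<in> borel_measurable M"
proof -
  have step: "cluster_center y a k \<in> borel_measurable M"
    if P: "\<And>n. Measurable.pred M (\<lambda>x. n \<in> nested_cluster y a k x)" for k
  proof -
    have "Measurable.pred M (\<lambda>x. infinite {n \<in> nested_cluster y a k x.
      dist (a n x) (y i) < 1 / real (Suc k)})" for i
    proof -
      note P [measurable] a [measurable]
      have "Measurable.pred M (\<lambda>x. \<forall>m. \<exists>n. m < n \<and> n \<in> nested_cluster y a k x \<and>
        dist (a n x) (y i) < 1 / real (Suc k))"
        by measurable
      then show ?thesis by (simp add: infinite_nat_iff_unbounded)
    qed
    then have "(\<lambda>x. LEAST i. infinite {n \<in> nested_cluster y a k x.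
      dist (a n x) (y i) < 1 / real (Suc k)}) \<in> M \<rightarrow>\<^sub>M count_space UNIV"
      by (rule measurable_Least)
    then show ?thesis unfolding cluster_center_def[abs_def] by (rule measurable_compose) simp
  qed
  have P: "Measurable.pred M (\<lambda>x. n \<in> nested_cluster y a k x)" for n k
  proof (induction k arbitrary: n)
    case (Suc k)
    note Suc [measurable] a [measurable] step[OF Suc, measurable]
    show ?case unfolding nested_cluster_Suc mem_Collect_eq by measurable
  qed simp
  show "Measurable.pred M (\<lambda>x. n \<in> nested_cluster y a k x)" by (rule P)
  show "cluster_center y a k \<in> borel_measurable M" by (rule step[OF P])
qed

text \<open>Two centers are both close to the value at any index that survives to a later stage, so
  the centers form a Cauchy sequence, and their limit is measurable. The subsequence depends on
  \<open>x\<close>; measurability is claimed for its limit only.\<close>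

lemma measurable_cluster_selection:
  fixes a :: "nat \<Rightarrow> 'x \<Rightarrow> 'y::{complete_space,second_countable_topology}"
  assumes a: "\<And>n. a n \<in> borel_measurable M"
    and C: "\<And>x. x \<in> space M \<Longrightarrow> \<exists>C. compact C \<and> (\<forall>n. a n x \<in> C)"
  shows "\<exists>\<xi>. \<xi> \<in> borel_measurable M \<and> (\<forall>x\<in>space M. \<exists>r. strict_mono r \<and> (\<lambda>k. a (r k) x) \<longlonglongrightarrow> \<xi> x)"
proof -
  obtain D :: "'y set" where D: "countable D" "closure D = UNIV"
  proof -
    obtain D :: "'y set" where "countable D" "\<And>X. open X \<Longrightarrow> X \<noteq> {} \<Longrightarrow> \<exists>d\<in>D. d \<in> X"
      using countable_dense_setE by blast
    moreover from this(2) have "x \<in> closure D" for x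
      unfolding closure_approachable
    proof (intro allI impI)
      fix e :: real assume "0 < e"
      then obtain d where "d \<in> D" "d \<in> ball x e" using \<open>\<And>X. open X \<Longrightarrow> X \<noteq> {} \<Longrightarrow> \<exists>d\<in>D. d \<in> X\<close>[of "ball x e"]
        by auto
      then show "\<exists>y\<in>D. dist y x < e" by (auto simp: dist_commute)
    qed
    ultimately show ?thesis using that by blast
  qed
  have "D \<noteq> {}" using D(2) by auto
  define y where "y = from_nat_into D"
  have y: "closure (range y) = UNIV" using D \<open>D \<noteq> {}\<close> by (simp add: y_def range_from_nat_into)
  define \<xi> where "\<xi> x = lim (\<lambda>k. cluster_center y a k x)" for x
  have dec: "nested_cluster y a (k + j) x \<subseteq> nested_cluster y a k x" for k j x
    by (induction j) auto
  have near: "dist (a n x) (cluster_center y a k x) < 1 / real (Suc k)"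
    if "n \<in> nested_cluster y a m x" "k < m" for n k m x
  proof -
    have "n \<in> nested_cluster y a (Suc k) x" using that dec[of "Suc k" "m - Suc k" x] by auto
    then show ?thesis by (simp only: nested_cluster_Suc mem_Collect_eq)
  qed
  have sm: "\<exists>N. \<forall>k\<ge>N. 1 / real (Suc k) < e" if "e > 0" for e :: real
  proof -
    obtain N where N: "1 / e < real N" using reals_Archimedean2 by blast
    have "1 / real (Suc k) < e" if "N \<le> k" for k
    proof -
      have "1 / e < real (Suc k)" using N that by simp
      then show ?thesis using \<open>e > 0\<close> by (simp add: field_simps)
    qed
    then show ?thesis by blast
  qed
  have conv: "(\<lambda>k. cluster_center y a k x) \<longlonglongrightarrow> \<xi> x" if x: "x \<in> space M" for x
  proof -
    obtain C where CC: "compact C" "\<And>n. a n x \<in> C" using C[OF x] by blast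
    have inf: "infinite (nested_cluster y a k x)" for k by (rule infinite_nested_cluster[where a=a, OF y CC])
    have "Cauchy (\<lambda>k. cluster_center y a k x)"
    proof (rule metric_CauchyI)
      fix e :: real assume "e > 0"
      then obtain N where N: "\<And>k. k \<ge> N \<Longrightarrow> 1 / real (Suc k) < e / 2" using sm[of "e/2"] by auto
      show "\<exists>M. \<forall>i\<ge>M. \<forall>j\<ge>M. dist (cluster_center y a i x) (cluster_center y a j x) < e"
      proof (intro exI[of _ N] allI impI)
        fix i j assume ij: "N \<le> i" "N \<le> j"
        obtain n where n: "n \<in> nested_cluster y a (Suc (max i j)) x"
          using inf[of "Suc (max i j)"] by (metis ex_in_conv finite.emptyI)
        have "dist (a n x) (cluster_center y a i x) < e / 2" "dist (a n x) (cluster_center y a j x) < e / 2"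
          using near[OF n, of i] near[OF n, of j] N[OF ij(1)] N[OF ij(2)] by (auto simp: less_Suc_eq_le)
        then show "dist (cluster_center y a i x) (cluster_center y a j x) < e"
          using dist_triangle_half_r by blast
      qed
    qed
    then show ?thesis unfolding \<xi>_def using Cauchy_convergent convergent_LIMSEQ_iff by blast
  qed
  have "\<xi> \<in> borel_measurable M"
    by (rule borel_measurable_LIMSEQ_metric[OF measurable_nested_cluster(2)[OF a] conv])
  moreover have "\<exists>r. strict_mono r \<and> (\<lambda>k. a (r k) x) \<longlonglongrightarrow> \<xi> x" if x: "x \<in> space M" for x
  proof -
    obtain C where CC: "compact C" "\<And>n. a n x \<in> C" using C[OF x] by blast
    have inf: "infinite (nested_cluster y a k x)" for k by (rule infinite_nested_cluster[where a=a, OF y CC])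
    have "\<exists>r. \<forall>k. r k \<in> nested_cluster y a (Suc k) x \<and> r k < r (Suc k)"
    proof (rule dependent_nat_choice)
      show "\<exists>n. n \<in> nested_cluster y a (Suc 0) x" using inf by (metis ex_in_conv finite.emptyI)
      show "\<exists>m. m \<in> nested_cluster y a (Suc (Suc k)) x \<and> n < m" for n k
        using inf[of "Suc (Suc k)"] unfolding infinite_nat_iff_unbounded by blast
    qed
    then obtain r where r: "\<And>k. r k \<in> nested_cluster y a (Suc k) x" "\<And>k. r k < r (Suc k)" by blast
    have "(\<lambda>k. dist (a (r k) x) (cluster_center y a k x)) \<longlonglongrightarrow> 0"
      by (rule tendsto_sandwich[OF _ _ tendsto_const LIMSEQ_Suc[OF lim_1_over_n]])
        (use near[OF r(1)] in \<open>auto intro!: always_eventually less_imp_le\<close>)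
    then have "(\<lambda>k. dist (a (r k) x) (cluster_center y a k x) + dist (cluster_center y a k x) (\<xi> x)) \<longlonglongrightarrow> 0 + 0"
      using conv[OF x] by (intro tendsto_add) (simp_all add: tendsto_dist_iff[symmetric])
    then have "(\<lambda>k. dist (a (r k) x) (\<xi> x)) \<longlonglongrightarrow> 0"
      unfolding add_0_right by (rule Lim_null_comparison[rotated]) (simp add: dist_triangle)
    then have "(\<lambda>k. a (r k) x) \<longlonglongrightarrow> \<xi> x" by (simp add: tendsto_dist_iff[symmetric])
    then show ?thesis using r(2) by (auto intro: exI[of _ r] simp: strict_mono_Suc_iff)
  qed
  ultimately show ?thesis by blast
qed

section \<open>Step functions on uniform grids and completeness of L2\<close>

lemma set_integral_step:
  fixes F :: "nat \<Rightarrow> 'b::{banach,second_countable_topology}"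
  assumes h: "h > (0::real)"
  shows "set_integrable lebesgue {a<..<a + real N * h} (\<lambda>x. F (nat \<lfloor>(x - a) / h\<rfloor>))"
    and "(LINT x:{a<..<a + real N * h}|lebesgue. F (nat \<lfloor>(x - a) / h\<rfloor>)) = (\<Sum>i<N. h *\<^sub>R F i)"
proof -
  have piece: "set_integrable lebesgue {a + real N * h<..<c} (\<lambda>x. F (nat \<lfloor>(x - a) / h\<rfloor>)) \<and>
      (LINT x:{a + real N * h<..<c}|lebesgue. F (nat \<lfloor>(x - a) / h\<rfloor>)) = (c - (a + real N * h)) *\<^sub>R F N"
    if c: "a + real N * h \<le> c" "c \<le> a + real (Suc N) * h" for N c
  proof -
    have "nat \<lfloor>(x - a) / h\<rfloor> = N" if "x \<in> {a + real N * h<..<c}" for x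
    proof -
      have "real N \<le> (x - a) / h" "(x - a) / h < real N + 1" using that c h by (auto simp: field_simps)
      then have "\<lfloor>(x - a) / h\<rfloor> = int N" by (simp add: floor_unique)
      then show ?thesis by simp
    qed
    then have eq: "indicat_real {a + real N * h<..<c} x *\<^sub>R F (nat \<lfloor>(x - a) / h\<rfloor>)
      = indicat_real {a + real N * h<..<c} x *\<^sub>R F N" for x
      by (cases "x \<in> {a + real N * h<..<c}") auto
    show ?thesis
      using set_integrable_lebesgue_const[of "a + real N * h" c
        "F N"] set_integral_lebesgue_const[OF c(1), of "F N"]
      unfolding set_integrable_def set_lebesgue_integral_def eq by simp
  qed
  have "set_integrable lebesgue {a<..<a + real N * h} (\<lambda>x. F (nat \<lfloor>(x - a) / h\<rfloor>)) \<and>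
    (LINT x:{a<..<a + real N * h}|lebesgue. F (nat \<lfloor>(x - a) / h\<rfloor>)) = (\<Sum>i<N. h *\<^sub>R F i)"
  proof (induction N)
    case 0
    show ?case by (simp add: set_integrable_def set_lebesgue_integral_def)
  next
    case (Suc N)
    have le: "a \<le> a + real N * h" "a + real N * h \<le> a + real (Suc N) * h" using h
      by (auto simp: algebra_simps)
    note p = piece[of N "a + real (Suc N) * h"]
    have i: "set_integrable lebesgue {a<..<a + real (Suc N) * h} (\<lambda>x. F (nat \<lfloor>(x - a) / h\<rfloor>))"
      using set_integrable_concat[OF conjunct1[OF Suc] _ le] p le by blast
    have "a + real (Suc N) * h - (a + real N * h) = h" by (simp add: algebra_simps)
    then show ?case using i set_integral_concat[OF i le] Suc p le by simp
  qed
  then show "set_integrable lebesgue {a<..<a + real N * h} (\<lambda>x. F (nat \<lfloor>(x - a) / h\<rfloor>))"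
    and "(LINT x:{a<..<a + real N * h}|lebesgue. F (nat \<lfloor>(x - a) / h\<rfloor>)) = (\<Sum>i<N. h *\<^sub>R F i)" by auto
qed

lemma set_integral_step_partial:
  fixes F :: "nat \<Rightarrow> 'b::{banach,second_countable_topology}"
  assumes h: "h > (0::real)" and c: "a + real N * h \<le> c" "c \<le> a + real (Suc N) * h"
  shows "(LINT x:{a<..<c}|lebesgue. F (nat \<lfloor>(x - a) / h\<rfloor>)) = (\<Sum>i<N.
    h *\<^sub>R F i) + (c - (a + real N * h)) *\<^sub>R F N"
proof -
  have "nat \<lfloor>(x - a) / h\<rfloor> = N" if "x \<in> {a + real N * h<..<c}" for x
  proof -
    have "real N \<le> (x - a) / h" "(x - a) / h < real N + 1" using that c h by (auto simp: field_simps)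
    then have "\<lfloor>(x - a) / h\<rfloor> = int N" by (simp add: floor_unique)
    then show ?thesis by simp
  qed
  then have eq: "indicat_real {a + real N * h<..<c} x *\<^sub>R F (nat \<lfloor>(x - a) / h\<rfloor>)
    = indicat_real {a + real N * h<..<c} x *\<^sub>R F N" for x
    by (cases "x \<in> {a + real N * h<..<c}") auto
  have "set_integrable lebesgue {a<..<a + real (Suc N) * h} (\<lambda>x. F (nat \<lfloor>(x - a) / h\<rfloor>))"
    by (rule set_integral_step(1)[OF h])
  then have i: "set_integrable lebesgue {a<..<c} (\<lambda>x. F (nat \<lfloor>(x - a) / h\<rfloor>))"
    by (rule set_integrable_subset) (use c in auto)
  have "a \<le> a + real N * h" using h by simp
  then have "(LINT x:{a<..<c}|lebesgue. F (nat \<lfloor>(x - a) / h\<rfloor>)) =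
      (LINT x:{a<..<a + real N * h}|lebesgue. F (nat \<lfloor>(x - a) / h\<rfloor>)) + (LINT x:{a + real N * h<..<c}|lebesgue.
        F (nat \<lfloor>(x - a) / h\<rfloor>))"
    by (rule set_integral_concat[OF i _ c(1)])
  also have "(LINT x:{a + real N * h<..<c}|lebesgue. F (nat \<lfloor>(x - a) / h\<rfloor>)) = (c - (a + real N * h)) *\<^sub>R F N"
    using set_integral_lebesgue_const[OF c(1), of "F N"] unfolding set_lebesgue_integral_def eq .
  finally show ?thesis using set_integral_step(2)[OF h] by metis
qed

lemma L2_fun_step:
  fixes F :: "nat \<Rightarrow> 'b::{real_inner,banach,second_countable_topology}"
  assumes h: "h > (0::real)"
  shows "L2_fun a (a + real N * h) (\<lambda>x. F (nat \<lfloor>(x - a) / h\<rfloor>))"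
  using set_integral_step(1)[OF h, of a N F] set_integral_step(1)[OF h, of a N "\<lambda>i. (norm (F i))\<^sup>2"]
  unfolding L2_fun_iff_set set_integrable_def set_borel_measurable_def
    by (auto dest: borel_measurable_integrable)

text \<open>Pythagoras on each block of \<open>k\<close> cells: with \<open>Y\<close> as increments,
  the coarse difference quotient is the mean of the fine ones, hence the squared distance is the
  difference of the squared norms.\<close>

lemma sum_norm_sq_refine:
  fixes Y :: "nat \<Rightarrow> 'h::real_inner"
  assumes h: "h > 0" and k: "k > 0"
  shows "(\<Sum>j<n * k. h * (norm (Y j /\<^sub>R h - (\<Sum>l\<in>{j div k * k..<j div k * k + k}. Y l) /\<^sub>R (real k * h)))\<^sup>2)
     = (\<Sum>j<n * k. (norm (Y j))\<^sup>2 / h) - (\<Sum>i<n. (norm (\<Sum>l\<in>{i * k..<i * k + k}. Y l))\<^sup>2 / (real k * h))"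
proof -
  define X where "X i = (\<Sum>l\<in>{i * k..<i * k + k}. Y l)" for i
  have block: "(\<Sum>j\<in>{i * k..<i * k + k}. h * (norm (Y j /\<^sub>R h - X (j div k) /\<^sub>R (real k * h)))\<^sup>2)
     = (\<Sum>j\<in>{i * k..<i * k + k}. (norm (Y j))\<^sup>2 / h) - (norm (X i))\<^sup>2 / (real k * h)" for i
  proof -
    define c where "c = X i /\<^sub>R (real k * h)"
    have "j div k = i" if "j \<in> {i * k..<i * k + k}" for j
      using that by (auto intro!: div_nat_eqI simp: mult.commute)
    then have "(\<Sum>j\<in>{i * k..<i * k + k}. h * (norm (Y j /\<^sub>R h - X (j div k) /\<^sub>R (real k * h)))\<^sup>2)
       = (\<Sum>j\<in>{i * k..<i * k + k}. h * (norm (Y j /\<^sub>R h - c))\<^sup>2)" by (simp add: c_def)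
    also have "\<dots> = (\<Sum>j\<in>{i * k..<i * k + k}. (norm (Y j))\<^sup>2 / h - 2 * (Y j \<bullet> c) + h * (norm c)\<^sup>2)"
    proof (rule sum.cong[OF refl])
      fix j
      have "(norm (Y j /\<^sub>R h - c))\<^sup>2 = (norm (Y j))\<^sup>2 / h\<^sup>2 - 2 * (Y j \<bullet> c) / h + (norm c)\<^sup>2"
        using h unfolding power2_norm_eq_inner
        by (simp add: inner_diff inner_commute power2_eq_square divide_inverse algebra_simps)
      then show "h * (norm (Y j /\<^sub>R h - c))\<^sup>2 = (norm (Y j))\<^sup>2 / h - 2 * (Y j \<bullet> c) + h * (norm c)\<^sup>2"
        using h by (simp add: field_simps power2_eq_square)
    qed
    also have "\<dots> = (\<Sum>j\<in>{i * k..<i * k + k}. (norm (Y j))\<^sup>2 / h) - 2 * (X i \<bullet> c) + real k * h * (norm c)\<^sup>2"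
      by (simp add: sum.distrib sum_subtractf X_def inner_sum_left sum_distrib_left)
    also have "2 * (X i \<bullet> c) = 2 * ((norm (X i))\<^sup>2 / (real k * h))"
      by (simp add: c_def power2_norm_eq_inner divide_inverse)
    also have "real k * h * (norm c)\<^sup>2 = (norm (X i))\<^sup>2 / (real k * h)"
    proof -
      have "norm c = norm (X i) / (real k * h)" using h by (simp add: c_def divide_inverse_commute)
      then show ?thesis using h k by (simp add: power2_eq_square)
    qed
    finally show ?thesis by simp
  qed
  have "(\<Sum>j<n * k. h * (norm (Y j /\<^sub>R h - X (j div k) /\<^sub>R (real k * h)))\<^sup>2)
      = (\<Sum>i<n. \<Sum>j\<in>{i * k..<i * k + k}. h * (norm (Y j /\<^sub>R h - X (j div k) /\<^sub>R (real k * h)))\<^sup>2)"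
    by (rule sum.nat_group[symmetric])
  also have "\<dots> = (\<Sum>i<n. \<Sum>j\<in>{i * k..<i * k + k}. (norm (Y j))\<^sup>2 / h) - (\<Sum>i<n. (norm (X i))\<^sup>2 / (real k * h))"
    unfolding block by (rule sum_subtractf)
  also have "(\<Sum>i<n. \<Sum>j\<in>{i * k..<i * k + k}. (norm (Y j))\<^sup>2 / h) = (\<Sum>j<n * k. (norm (Y j))\<^sup>2 / h)"
    by (rule sum.nat_group)
  finally show ?thesis by (simp only: X_def)
qed

text \<open>The Riesz-Fischer argument: on a bounded interval a Cauchy sequence in L2 is Cauchy in
  L1, a subsequence converges almost everywhere, and Fatou's lemma transfers the bounds to its
  limit.\<close>

lemma L2_Cauchy_imp_convergent:
  fixes D :: "nat \<Rightarrow> real \<Rightarrow> 'h::{real_inner,banach,second_countable_topology}"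
  assumes "a \<le> b" and D: "\<And>n. L2_fun a b (D n)"
    and C: "\<And>e. e > 0 \<Longrightarrow> \<exists>N. \<forall>m\<ge>N. \<forall>n\<ge>N. (LINT x:{a<..<b}|lebesgue. (norm (D m x - D n x))\<^sup>2) < e"
    and B: "\<And>n. (LINT x:{a<..<b}|lebesgue. (norm (D n x))\<^sup>2) \<le> B"
  shows "\<exists>p. L2_fun a b p \<and> (LINT x:{a<..<b}|lebesgue. (norm (p x))\<^sup>2) \<le> B \<and>
     (\<forall>e>0. \<forall>\<^sub>F n in sequentially. (LINT x:{a<..<b}|lebesgue. (norm (p x - D n x))\<^sup>2) \<le> e)"
proof -
  define s where "s n x = indicat_real {a<..<b} x *\<^sub>R D n x" for n x
  have Dmn: "L2_fun a b (\<lambda>x. D m x - D n x)" for m n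
    using L2_fun_add[OF D L2_fun_minus[OF D], of m n] by simp
  have sD: "norm (s m x - s n x) = indicat_real {a<..<b} x *\<^sub>R norm (D m x - D n x)" for m n x
    by (simp add: s_def indicator_def)
  have ms: "s n \<in> borel_measurable lebesgue" for n
    using D unfolding L2_fun_iff_set set_borel_measurable_def s_def by blast
  have si: "integrable lebesgue (s n)" for n
    using L2_fun_imp_set_integrable[OF D] unfolding set_integrable_def s_def by blast
  have L1: "(LINT x|lebesgue. norm (s m x - s n x))\<^sup>2 \<le> (b - a) * (LINT x:{a<..<b}|lebesgue.
    (norm (D m x - D n x))\<^sup>2)" for m n
  proof -
    have "L2_fun a b (\<lambda>x. norm (D m x - D n x))"
      using Dmn[of m n] measurable_compose[OF _ borel_measurable_norm, of "\<lambda>x.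
        indicat_real {a<..<b} x *\<^sub>R (D m x - D n x)" lebesgue]
      unfolding L2_fun_iff_set set_borel_measurable_def by simp
    from norm_set_integral_sq_le[OF this assms(1)] show ?thesis
      unfolding set_lebesgue_integral_def sD by simp
  qed
  obtain r where r: "strict_mono r" "AE x in lebesgue. Cauchy (\<lambda>i. s (r i) x)"
  proof (rule cauchy_L1_AE_cauchy_subseq[of lebesgue s])
    fix e :: real assume "e > 0"
    have "0 < e\<^sup>2 / (b - a + 1)" using \<open>e > 0\<close> assms(1) by simp
    from C[OF this] obtain N where N: "\<And>m n. m \<ge> N \<Longrightarrow> n \<ge> N \<Longrightarrow> (LINT x:{a<..<b}|lebesgue.
      (norm (D m x - D n x))\<^sup>2) < e\<^sup>2 / (b - a + 1)" by blast
    show "\<exists>N. \<forall>i\<ge>N. \<forall>j\<ge>N. LINT x|lebesgue. norm (s i x - s j x) < e"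
    proof (intro exI[of _ N] allI impI)
      fix i j assume ij: "N \<le> i" "N \<le> j"
      have "0 \<le> (LINT x:{a<..<b}|lebesgue. (norm (D i x - D j x))\<^sup>2)"
        unfolding set_lebesgue_integral_def by (rule integral_nonneg_AE) auto
      then have "(b - a) * (LINT x:{a<..<b}|lebesgue.
        (norm (D i x - D j x))\<^sup>2) \<le> (b - a + 1) * (LINT x:{a<..<b}|lebesgue. (norm (D i x - D j x))\<^sup>2)"
        by (intro mult_right_mono) auto
      also have "\<dots> < e\<^sup>2" using N[OF ij] assms(1) by (simp add: field_simps)
      finally have "(LINT x|lebesgue. norm (s i x - s j x))\<^sup>2 < e\<^sup>2" using L1[of i j] by linarith
      then show "(LINT x|lebesgue. norm (s i x - s j x)) < e"
        using \<open>e > 0\<close> by (simp add: power_less_imp_less_base)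
    qed
  qed (use si in auto)
  define p where "p x = lim (\<lambda>i. s (r i) x)" for x
  have mp: "p \<in> borel_measurable lebesgue" unfolding p_def[abs_def]
    by (rule borel_measurable_lim_metric) (rule ms)
  have conv: "AE x in lebesgue. (\<lambda>i. s (r i) x) \<longlonglongrightarrow> p x"
    using r(2) unfolding p_def by eventually_elim (simp add: Cauchy_convergent_iff convergent_LIMSEQ_iff)
  have p0: "p x = 0" if "x \<notin> {a<..<b}" for x using that by (simp add: p_def s_def)
  \<comment> \<open>Used twice: with \<open>g\<close> zero for the bound \<open>B\<close>, and with
    \<open>g = s n\<close> for the distance of the limit from \<open>D n\<close>.\<close>
  have Fatou: "integrable lebesgue (\<lambda>x. (norm (p x - g x))\<^sup>2) \<and> (LINT x|lebesgue. (norm (p x - g x))\<^sup>2) \<le> K"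
    if g: "g \<in> borel_measurable lebesgue"
      and gi: "\<And>i. integrable lebesgue (\<lambda>x. (norm (s (r i) x - g x))\<^sup>2)"
      and K: "\<forall>\<^sub>F i in sequentially. (LINT x|lebesgue. (norm (s (r i) x - g x))\<^sup>2) \<le> K" for g K
  proof -
    have "(\<integral>\<^sup>+x. ennreal ((norm (p x - g x))\<^sup>2) \<partial>lebesgue) \<le> (\<integral>\<^sup>+x. liminf (\<lambda>i.
      ennreal ((norm (s (r i) x - g x))\<^sup>2)) \<partial>lebesgue)"
    proof (rule nn_integral_mono_AE)
      show "AE x in lebesgue. ennreal ((norm (p x - g x))\<^sup>2) \<le> liminf (\<lambda>i.
        ennreal ((norm (s (r i) x - g x))\<^sup>2))"
        using conv
      proof eventually_elim
        case (elim x)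
        then have "(\<lambda>i. ennreal ((norm (s (r i) x - g x))\<^sup>2)) \<longlonglongrightarrow> ennreal ((norm (p x - g x))\<^sup>2)"
          by (intro tendsto_ennrealI tendsto_intros)
        then show ?case by (subst lim_imp_Liminf[rotated]) auto
      qed
    qed
    also have "\<dots> \<le> liminf (\<lambda>i. \<integral>\<^sup>+x. ennreal ((norm (s (r i) x - g x))\<^sup>2) \<partial>lebesgue)"
      by (rule nn_integral_liminf) (use ms g in \<open>auto intro!: measurable_compose[OF _ measurable_ennreal]\<close>)
    also have "\<dots> \<le> ennreal K"
    proof -
      have "\<forall>\<^sub>F i in sequentially. (\<integral>\<^sup>+x. ennreal ((norm (s (r i) x - g x))\<^sup>2) \<partial>lebesgue) \<le> ennreal K"
        using K by eventually_elim (simp add: nn_integral_eq_integral[OF gi] ennreal_leI)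
      then show ?thesis by (intro Liminf_le) auto
    qed
    finally have nn: "(\<integral>\<^sup>+x. ennreal ((norm (p x - g x))\<^sup>2) \<partial>lebesgue) \<le> ennreal K" .
    have i: "integrable lebesgue (\<lambda>x. (norm (p x - g x))\<^sup>2)"
      by (rule integrableI_nonneg) (use mp g nn in \<open>auto simp: le_less_trans\<close>)
    have "0 \<le> K"
    proof -
      obtain i where "(LINT x|lebesgue. (norm (s (r i) x - g x))\<^sup>2) \<le> K" using K
        by (auto simp: eventually_sequentially)
      moreover have "0 \<le> (LINT x|lebesgue. (norm (s (r i) x - g x))\<^sup>2)" by (rule integral_nonneg_AE) auto
      ultimately show ?thesis by linarith
    qed
    then show ?thesis using i nn by (simp add: nn_integral_eq_integral)
  qed
  have sq: "(norm (s n x))\<^sup>2 = indicat_real {a<..<b} x *\<^sub>R (norm (D n x))\<^sup>2"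
    "(norm (s m x - s n x))\<^sup>2 = indicat_real {a<..<b} x *\<^sub>R (norm (D m x - D n x))\<^sup>2" for m n x
    by (auto simp: s_def indicator_def)
  have i1: "integrable lebesgue (\<lambda>x. (norm (s n x - 0))\<^sup>2)" for n
    using D[of n] unfolding L2_fun_iff_set set_integrable_def sq diff_0_right by blast
  have i2: "integrable lebesgue (\<lambda>x. (norm (s m x - s n x))\<^sup>2)" for m n
    using Dmn[of m n] unfolding L2_fun_iff_set set_integrable_def sq by blast
  have F1: "integrable lebesgue (\<lambda>x. (norm (p x - 0))\<^sup>2) \<and> (LINT x|lebesgue. (norm (p x - 0))\<^sup>2) \<le> B"
    by (rule Fatou[OF _ i1]) (use B in \<open>auto simp: sq set_lebesgue_integral_def\<close>)
  have pind: "indicat_real {a<..<b} x *\<^sub>R p x = p x"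
    "indicat_real {a<..<b} x *\<^sub>R (norm (p x))\<^sup>2 = (norm (p x))\<^sup>2"
    "indicat_real {a<..<b} x *\<^sub>R (norm (p x - D n x))\<^sup>2 = (norm (p x - s n x))\<^sup>2" for x n
    using p0[of x] by (auto simp: indicator_def s_def)
  have "L2_fun a b p" using F1 mp unfolding L2_fun_iff_set set_borel_measurable_def set_integrable_def pind
    by simp
  moreover have "(LINT x:{a<..<b}|lebesgue. (norm (p x))\<^sup>2) \<le> B" using F1
    unfolding set_lebesgue_integral_def pind by simp
  moreover have "\<forall>\<^sub>F n in sequentially. (LINT x:{a<..<b}|lebesgue. (norm (p x - D n x))\<^sup>2) \<le> e" if e: "e > 0"
    for e
  proof -
    obtain N where N: "\<And>m n. m \<ge> N \<Longrightarrow> n \<ge> N \<Longrightarrow> (LINT x:{a<..<b}|lebesgue. (norm (D m x - D n x))\<^sup>2) < e"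
      using C[OF e] by blast
    have "(LINT x:{a<..<b}|lebesgue. (norm (p x - D n x))\<^sup>2) \<le> e" if "N \<le> n" for n
    proof -
      have "\<forall>\<^sub>F i in sequentially. (LINT x|lebesgue. (norm (s (r i) x - s n x))\<^sup>2) \<le> e"
        unfolding sq set_lebesgue_integral_def[symmetric]
        using eventually_ge_at_top[of N]
      proof eventually_elim
        case (elim i)
        then have "N \<le> r i" using seq_suble[OF r(1), of i] by linarith
        then show ?case using N[OF _ that] by (simp add: less_imp_le)
      qed
      from Fatou[OF ms i2 this] show ?thesis unfolding set_lebesgue_integral_def pind by blast
    qed
    then show ?thesis by (auto simp: eventually_sequentially)
  qed
  ultimately show ?thesis by blast
qed

section \<open>Dyadic bounds and primitives\<close>

text \<open>The dyadic difference quotients form a martingale: by \<open>sum_norm_sq_refine\<close>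
  the squared L2 distance of two levels is the difference of their squared norms \<open>S\<close>.
  As \<open>S\<close> is monotone and bounded by \<open>C\<close>, the quotients converge in L2, and
  their integrals telescope to increments of \<open>u\<close>.\<close>

lemma dyadic_bound_imp_L2_primitive:
  fixes u :: "real \<Rightarrow> 'h::{real_inner,banach,second_countable_topology}"
  assumes "a < b" and u: "continuous_on {a..b} u"
    and bound: "\<And>n. (\<Sum>i<2 ^ n. (norm (u (a + real (Suc i) * ((b - a) / 2 ^ n)) - u (a + real i * ((b - a) / 2
      ^ n))))\<^sup>2 / ((b - a) / 2 ^ n)) \<le> C"
  shows "\<exists>p. L2_primitive a b u p \<and> (LINT x:{a<..<b}|lebesgue. (norm (p x))\<^sup>2) \<le> C"
proof -
  define h where "h n = (b - a) / 2 ^ n" for n :: nat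
  define X where "X n i = u (a + real (Suc i) * h n) - u (a + real i * h n)" for n i
  define S where "S n = (\<Sum>i<2 ^ n. (norm (X n i))\<^sup>2 / h n)" for n
  define D where "D n x = X n (nat \<lfloor>(x - a) / h n\<rfloor>) /\<^sub>R h n" for n x
  have h: "h n > 0" for n using assms(1) by (simp add: h_def)
  have hb: "a + real (2 ^ n) * h n = b" for n by (simp add: h_def)
  have SC: "S n \<le> C" for n using bound[of n] by (simp add: S_def X_def h_def)
  have LD: "L2_fun a b (D n)" for n
    using L2_fun_step[OF h, of a "2 ^ n" n "\<lambda>i. X n i /\<^sub>R h n"] unfolding hb D_def .
  have ID: "(LINT x:{a<..<b}|lebesgue. (norm (D n x))\<^sup>2) = S n" for n
  proof -
    have "(LINT x:{a<..<b}|lebesgue. (norm (D n x))\<^sup>2) = (\<Sum>i<2 ^ n. h n *\<^sub>R (norm (X n i /\<^sub>R h n))\<^sup>2)"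
      using set_integral_step(2)[OF h, of a "2 ^ n" n "\<lambda>i. (norm (X n i /\<^sub>R h n))\<^sup>2"] unfolding hb D_def .
    also have "\<dots> = S n" unfolding S_def
    proof (rule sum.cong[OF refl])
      fix i
      have "norm (X n i /\<^sub>R h n) = norm (X n i) / h n" using h[of n] by (simp add: divide_inverse_commute)
      then show "h n *\<^sub>R (norm (X n i /\<^sub>R h n))\<^sup>2 = (norm (X n i))\<^sup>2 / h n"
        using h[of n] by (simp add: power2_eq_square)
    qed
    finally show ?thesis .
  qed
  have hmn: "h n = real (2 ^ k) * h (n + k)" for n k by (simp add: h_def power_add)
  have X_refine: "(\<Sum>l\<in>{i * 2 ^ k..<i * 2 ^ k + 2 ^ k}. X (n + k) l) = X n i" for n k i
  proof -
    define g where "g l = u (a + real l * h (n + k))" for l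
    have "(\<Sum>l\<in>{i * 2 ^ k..<i * 2 ^ k + 2 ^ k}. X (n + k) l) = (\<Sum>l\<in>{i * 2 ^ k..<i * 2 ^ k + 2 ^ k}.
      g (Suc l) - g l)"
      by (simp add: X_def g_def)
    also have "\<dots> = g (i * 2 ^ k + 2 ^ k) - g (i * 2 ^ k)" by (rule sum_Suc_diff') simp
    also have "g (i * 2 ^ k) = u (a + real i * h n)" by (simp add: g_def hmn[of n k] mult.assoc)
    also have "g (i * 2 ^ k + 2 ^ k) = u (a + real (Suc i) * h n)"
    proof -
      have "real (i * 2 ^ k + 2 ^ k) * h (n + k) = real (Suc i) * h n"
        by (simp add: hmn[of n k] algebra_simps)
      then show ?thesis by (simp only: g_def)
    qed
    finally show ?thesis by (simp add: X_def)
  qed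
  have IDD: "(LINT x:{a<..<b}|lebesgue. (norm (D (n + k) x - D n x))\<^sup>2) = S (n + k) - S n" for n k
  proof -
    \<comment> \<open>A cell of width \<open>h n\<close> consists of \<open>2 ^ k\<close> cells of
      level \<open>n + k\<close>, so its index is a quotient by \<open>2 ^ k\<close>.\<close>
    have idx: "nat \<lfloor>(x - a) / h n\<rfloor> = nat \<lfloor>(x - a) / h (n + k)\<rfloor> div 2 ^ k" if "x > a" for x
    proof -
      have "(x - a) / h n = (x - a) / h (n + k) / real_of_int (2 ^ k)"
        by (simp add: hmn[of n k])
      then have "\<lfloor>(x - a) / h n\<rfloor> = \<lfloor>(x - a) / h (n + k) / real_of_int (2 ^ k)\<rfloor>" by (rule arg_cong)
      also have "\<dots> = \<lfloor>(x - a) / h (n + k)\<rfloor> div 2 ^ k" by (rule floor_divide_real_eq_div) simp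
      finally have "\<lfloor>(x - a) / h n\<rfloor> = \<lfloor>(x - a) / h (n + k)\<rfloor> div 2 ^ k" .
      moreover have "0 \<le> \<lfloor>(x - a) / h (n + k)\<rfloor>" using h[of "n + k"] that by simp
      ultimately show ?thesis by (simp add: nat_div_distrib nat_power_eq)
    qed
    define F where "F j = (norm (X (n + k) j /\<^sub>R h (n + k) - X n (j div 2 ^ k) /\<^sub>R h n))\<^sup>2" for j
    have "(LINT x:{a<..<b}|lebesgue. (norm (D (n + k) x - D n x))\<^sup>2) = (LINT x:{a<..<b}|lebesgue.
      F (nat \<lfloor>(x - a) / h (n + k)\<rfloor>))"
      unfolding set_lebesgue_integral_def
      by (rule Bochner_Integration.integral_cong) (auto simp: indicator_def D_def F_def idx)
    also have "\<dots> = (\<Sum>j<2 ^ (n + k). h (n + k) *\<^sub>R F j)"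
      using set_integral_step(2)[OF h, of a "2 ^ (n + k)" "n + k" F] unfolding hb .
    also have "\<dots> = (\<Sum>j<2 ^ n * 2 ^ k. h (n + k) * (norm (X (n + k) j /\<^sub>R h (n + k) -
        (\<Sum>l\<in>{j div 2 ^ k * 2 ^ k..<j div 2 ^ k * 2 ^ k + 2 ^ k}. X (n + k) l) /\<^sub>R (real (2 ^ k) * h (n +
          k))))\<^sup>2)"
      unfolding X_refine F_def hmn[of n k, symmetric] by (simp add: power_add)
    also have "\<dots> = (\<Sum>j<2 ^ n * 2 ^ k. (norm (X (n + k) j))\<^sup>2 / h (n + k)) - (\<Sum>i<2 ^ n.
      (norm (X n i))\<^sup>2 / h n)"
      by (subst sum_norm_sq_refine[OF h]) (simp_all only: X_refine hmn[of n k, symmetric], simp)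
    finally show ?thesis by (simp add: S_def power_add)
  qed
  have "incseq S"
  proof (rule incseq_SucI)
    fix n
    have "0 \<le> (LINT x:{a<..<b}|lebesgue. (norm (D (n + 1) x - D n x))\<^sup>2)"
      unfolding set_lebesgue_integral_def by (rule integral_nonneg_AE) auto
    then show "S n \<le> S (Suc n)" using IDD[of n 1] by simp
  qed
  then have "convergent S" using SC by (metis Bseq_mono_convergent BseqI' incseq_def incseq_convergent
    convergent_def)
  then have "Cauchy S" by (rule convergent_Cauchy)
  have IDD': "(LINT x:{a<..<b}|lebesgue. (norm (D m x - D n x))\<^sup>2) \<le> \<bar>S m - S n\<bar>" for m n
  proof (cases "n \<le> m")
    case True
    then show ?thesis using IDD[of n "m - n"] by simp
  next
    case False
    then show ?thesis using IDD[of m "n - m"] by (simp add: norm_minus_commute)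
  qed
  have Cau: "\<exists>N. \<forall>m\<ge>N. \<forall>n\<ge>N. (LINT x:{a<..<b}|lebesgue. (norm (D m x - D n x))\<^sup>2) < e" if e: "e > 0" for e
  proof -
    obtain N where "\<And>m n. m \<ge> N \<Longrightarrow> n \<ge> N \<Longrightarrow> dist (S m) (S n) < e"
      using \<open>Cauchy S\<close> e unfolding Cauchy_def by blast
    then show ?thesis using IDD' unfolding dist_real_def by (meson le_less_trans)
  qed
  obtain p where p: "L2_fun a b p" "(LINT x:{a<..<b}|lebesgue. (norm (p x))\<^sup>2) \<le> C"
    "\<And>e. e > 0 \<Longrightarrow> \<forall>\<^sub>F n in sequentially. (LINT x:{a<..<b}|lebesgue. (norm (p x - D n x))\<^sup>2) \<le> e"
    using L2_Cauchy_imp_convergent[OF less_imp_le[OF assms(1)] LD Cau, of C] ID SC by auto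
  have "u t = u a + (LINT x:{a<..<t}|lebesgue. p x)" if t: "t \<in> {a..b}" for t
  proof -
    have sub: "L2_fun a t f" if "L2_fun a b f" for f :: "real \<Rightarrow> 'h" using L2_fun_subset[OF that] t by simp
    have pD: "L2_fun a b (\<lambda>x. p x - D n x)" for n using L2_fun_add[OF p(1) L2_fun_minus[OF LD], of n] by simp
    have lim1: "(\<lambda>n. LINT x:{a<..<t}|lebesgue. D n x) \<longlonglongrightarrow> (LINT x:{a<..<t}|lebesgue. p x)"
    proof (rule tendstoI)
      fix e :: real assume "e > 0"
      have "0 < e\<^sup>2 / 2 / (b - a)" using \<open>e > 0\<close> assms(1) by simp
      from p(3)[OF this] show "\<forall>\<^sub>F n in sequentially. dist (LINT x:{a<..<t}|lebesgue.
        D n x) (LINT x:{a<..<t}|lebesgue. p x) < e"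
      proof eventually_elim
        case (elim n)
        have eqd: "dist (LINT x:{a<..<t}|lebesgue. D n x) (LINT x:{a<..<t}|lebesgue.
          p x) = norm (LINT x:{a<..<t}|lebesgue. p x - D n x)"
          using set_integral_diff(2)[OF L2_fun_imp_set_integrable[OF sub[OF p(1)]]
            L2_fun_imp_set_integrable[OF sub[OF LD]], of n]
          by (simp add: dist_norm norm_minus_commute)
        have "(norm (LINT x:{a<..<t}|lebesgue. p x - D n x))\<^sup>2 \<le> (t - a) * (LINT x:{a<..<t}|lebesgue.
          (norm (p x - D n x))\<^sup>2)"
          by (rule norm_set_integral_sq_le[OF sub[OF pD]]) (use t in simp)
        moreover have "(t - a) * (LINT x:{a<..<t}|lebesgue.
          (norm (p x - D n x))\<^sup>2) \<le> (b - a) * (e\<^sup>2 / 2 / (b - a))"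
        proof (rule mult_mono)
          have "(LINT x:{a<..<t}|lebesgue. (norm (p x - D n x))\<^sup>2) \<le> (LINT x:{a<..<b}|lebesgue.
            (norm (p x - D n x))\<^sup>2)"
            by (rule set_integral_mono_set_norm[OF pD]) (use t in auto)
          with elim show "(LINT x:{a<..<t}|lebesgue. (norm (p x - D n x))\<^sup>2) \<le> e\<^sup>2 / 2 / (b - a)" by linarith
          show "0 \<le> (LINT x:{a<..<t}|lebesgue. (norm (p x - D n x))\<^sup>2)"
            unfolding set_lebesgue_integral_def by (rule integral_nonneg_AE) auto
        qed (use t in auto)
        moreover have "(b - a) * (e\<^sup>2 / 2 / (b - a)) = e\<^sup>2 / 2"
          by (subst times_divide_eq_right, intro nonzero_mult_div_cancel_left) (use assms(1) in simp)
        moreover have "e\<^sup>2 / 2 < e\<^sup>2" using \<open>e > 0\<close> by simp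
        ultimately have "(norm (LINT x:{a<..<t}|lebesgue. p x - D n x))\<^sup>2 < e\<^sup>2" by linarith
        then show ?case unfolding eqd using \<open>e > 0\<close> by (simp add: power_less_imp_less_base)
      qed
    qed
    \<comment> \<open>The integral telescopes up to the last node before \<open>t\<close>. Uniform
      continuity of \<open>u\<close> controls both the distance from this node to \<open>t\<close>
      and the increment over the remaining cell.\<close>
    have lim2: "(\<lambda>n. LINT x:{a<..<t}|lebesgue. D n x) \<longlonglongrightarrow> u t - u a"
    proof (rule tendstoI)
      fix e :: real assume "e > 0"
      have "uniformly_continuous_on {a..b} u" using u by (simp add: compact_uniformly_continuous)
      then obtain \<delta> where \<delta>: "\<delta> > 0" "\<And>x y. x \<in> {a..b} \<Longrightarrow> y \<in> {a..b} \<Longrightarrow> dist y x < \<delta> \<Longrightarrow> dist (u y) (u x) < e / 2"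
        using \<open>e > 0\<close> unfolding uniformly_continuous_on_def by (meson half_gt_zero)
      have "h \<longlonglongrightarrow> 0" unfolding h_def by (intro LIMSEQ_divide_realpow_zero) simp
      then have "\<forall>\<^sub>F n in sequentially. h n < \<delta>" using \<delta>(1) by (rule order_tendstoD(2))
      then show "\<forall>\<^sub>F n in sequentially. dist (LINT x:{a<..<t}|lebesgue. D n x) (u t - u a) < e"
      proof eventually_elim
        case (elim n)
        define k where "k = nat \<lfloor>(t - a) / h n\<rfloor>"
        have "real k = real_of_int \<lfloor>(t - a) / h n\<rfloor>" using t h[of n] by (simp add: k_def)
        then have "real k \<le> (t - a) / h n" "(t - a) / h n < real k + 1" by linarith+
        then have k: "a + real k * h n \<le> t" "t < a + real (Suc k) * h n" using h[of n]
          by (auto simp: field_simps)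
        have "(LINT x:{a<..<t}|lebesgue. D n x) = (\<Sum>i<k.
          h n *\<^sub>R (X n i /\<^sub>R h n)) + (t - (a + real k * h n)) *\<^sub>R (X n k /\<^sub>R h n)"
          unfolding D_def by (rule set_integral_step_partial[OF h k(1)]) (use k in simp)
        also have "(\<Sum>i<k. h n *\<^sub>R (X n i /\<^sub>R h n)) = (\<Sum>i<k.
          u (a + real (Suc i) * h n) - u (a + real i * h n))"
          using h[of n] by (simp add: X_def)
        also have "\<dots> = u (a + real k * h n) - u a"
          using sum_lessThan_telescope[of "\<lambda>i. u (a + real i * h n)" k] by simp
        finally have eq: "(LINT x:{a<..<t}|lebesgue.
          D n x) - (u t - u a) = (u (a + real k * h n) - u t) + (t - (a + real k * h n)) *\<^sub>R (X n k /\<^sub>R h n)"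
          by simp
        have "a + real k * h n \<in> {a..b}" using k t h[of n] by auto
        moreover have "dist (a + real k * h n) t < \<delta>" using k elim by (simp add: dist_real_def algebra_simps)
        ultimately have n1: "norm (u (a + real k * h n) - u t) < e / 2" using \<delta>(2) t unfolding dist_norm
          by blast
        have n2: "norm ((t - (a + real k * h n)) *\<^sub>R (X n k /\<^sub>R h n)) \<le> e / 2"
        proof (cases "t = b")
          \<comment> \<open>At \<open>t = b\<close> the cell of index \<open>k\<close> would reach
            beyond \<open>b\<close>, where \<open>u\<close> is not controlled; its contribution
            vanishes because the node is \<open>t\<close> itself.\<close>
          case True
          have "(t - a) / h n = 2 ^ n" using True h[of n] assms(1) by (simp add: h_def)
          then have "k = 2 ^ n" by (simp add: k_def nat_power_eq)
          then have "a + real k * h n = t" using True hb by metis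
          then show ?thesis using \<open>e > 0\<close> by simp
        next
          case False
          have "k < 2 ^ n"
          proof (rule ccontr)
            assume "\<not> k < 2 ^ n"
            then have "real (2 ^ n) \<le> real k" by (simp del: of_nat_power)
            then have "real (2 ^ n) * h n \<le> real k * h n" using h[of n] by (intro mult_right_mono) auto
            then show False using hb[of n] k(1) t False by auto
          qed
          then have "real (Suc k) \<le> real (2 ^ n)" by (simp del: of_nat_power of_nat_Suc)
          then have "real (Suc k) * h n \<le> real (2 ^ n) * h n" using h[of n] by (intro mult_right_mono) auto
          then have "a + real (Suc k) * h n \<in> {a..b}" "a + real k * h n \<in> {a..b}" using hb[of n] k t h[of n]
            by auto
          moreover have "dist (a + real (Suc k) * h n) (a + real k * h n) < \<delta>"
            using elim h[of n] by (simp add: dist_real_def algebra_simps)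
          ultimately have "norm (X n k) < e / 2" unfolding X_def dist_norm[symmetric] by (intro \<delta>(2))
          moreover have "norm ((t - (a + real k * h n)) *\<^sub>R (X n k /\<^sub>R h n))
            = (t - (a + real k * h n)) / h n * norm (X n k)"
            using k h[of n] by (simp add: divide_inverse)
          moreover have "(t - (a + real k * h n)) / h n * norm (X n k) \<le> 1 * norm (X n k)"
            by (rule mult_right_mono) (use k h[of n] in \<open>auto simp: field_simps\<close>)
          ultimately show ?thesis by linarith
        qed
        show ?case unfolding dist_norm eq using norm_triangle_ineq[of "u (a + real k * h n) - u t"
          "(t - (a + real k * h n)) *\<^sub>R (X n k /\<^sub>R h n)"] n1 n2
          by linarith
      qed
    qed
    show ?thesis using LIMSEQ_unique[OF lim1 lim2] by simp
  qed
  then show ?thesis using p unfolding L2_primitive_def by blast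
qed

text \<open>The velocities found on different intervals are glued without comparing them: between
  \<open>n\<close> and \<open>n + 1\<close> the one found on \<open>[0, n + 1]\<close> is
  used.\<close>

lemma L2_primitive_extend:
  fixes u :: "real \<Rightarrow> 'h::{real_inner,banach,second_countable_topology}"
  assumes "\<And>n::nat. \<exists>p. L2_primitive 0 (real (Suc n)) u p \<and> (AE t in lebesgue. 0 < t \<and> t < real (Suc n) \<longrightarrow>
    R t (p t))"
  shows "\<exists>p. (\<forall>T>0. L2_primitive 0 T u p) \<and> (AE t in lebesgue. 0 < t \<longrightarrow> R t (p t))"
proof -
  obtain P where P: "\<And>n. L2_primitive 0 (real (Suc n)) u (P n)"
    "\<And>n. AE t in lebesgue. 0 < t \<and> t < real (Suc n) \<longrightarrow> R t (P n t)" using assms by metis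
  define p where "p x = P (nat \<lfloor>x\<rfloor>) x" for x
  have piece: "L2_primitive (real n) (real (Suc n)) u p" for n
  proof (rule L2_primitive_cong[of _ _ u "P n"])
    show "L2_primitive (real n) (real (Suc n)) u (P n)"
      by (rule L2_primitive_subset[OF P(1)]) auto
    fix t assume "real n < t" "t < real (Suc n)"
    then have "\<lfloor>t\<rfloor> = int n" by (simp add: floor_unique)
    then show "p t = P n t" by (simp add: p_def)
  qed simp
  have "L2_primitive 0 (real n) u p" for n
  proof (induction n)
    case 0 show ?case by (rule L2_primitive_cong[OF L2_primitive_subset[OF P(1)[of 0], of 0 "real 0"]]) auto
  next
    case (Suc n)
    show ?case by (rule L2_primitive_concat[OF Suc piece]) auto
  qed
  moreover have "\<exists>n. T \<le> real n" for T by (rule real_arch_simple)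
  ultimately have "L2_primitive 0 T u p" for T using L2_primitive_subset by (metis order_refl)
  moreover have "AE t in lebesgue. \<forall>n. 0 < t \<and> t < real (Suc n) \<longrightarrow> R t (P n t)"
    using P(2) by (simp add: AE_all_countable)
  then have "AE t in lebesgue. 0 < t \<longrightarrow> R t (p t)"
  proof eventually_elim
    case (elim t)
    have "t < real (Suc (nat \<lfloor>t\<rfloor>))" by linarith
    then show ?case using elim unfolding p_def by blast
  qed
  ultimately show ?thesis by blast
qed

section \<open>Subgradient curves and the energy identity\<close>

text \<open>Where \<phi> is infinite this is the default value 0, so it represents \<phi> only on
  \<open>effective_domain\<close>.\<close>

abbreviation energy :: "('h \<Rightarrow> ereal) \<Rightarrow> 'h \<Rightarrow> real" where
  "energy \<phi> u \<equiv> real_of_ereal (\<phi> u)"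

lemma effective_domain_eq:
  assumes "proper_functional \<phi>" "u \<in> effective_domain \<phi>" shows "\<phi> u = ereal (energy \<phi> u)"
  using assms by (cases "\<phi> u") (auto simp: proper_functional_def effective_domain_def)

text \<open>The definition concerns punctured neighbourhoods, whereas \<open>x\<close> may take the
  value \<open>u\<close>; at \<open>u\<close> itself the lower bound \<open>y < \<phi> u\<close> is
  the assumption.\<close>

lemma lower_semicontinuous_sequentially:
  assumes "lower_semicontinuous \<phi>" "(x \<longlongrightarrow> u) F"
  shows "\<phi> u \<le> Liminf F (\<lambda>n. \<phi> (x n))"
  unfolding le_Liminf_iff
proof (intro allI impI)
  fix y assume y: "y < \<phi> u"
  have "\<phi> u \<le> Liminf (at u) \<phi>" using assms(1) by (simp add: lower_semicontinuous_def)
  then have "\<forall>\<^sub>F w in at u. y < \<phi> w" using y unfolding le_Liminf_iff by blast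
  then have "\<forall>\<^sub>F w in nhds u. y < \<phi> w" using y by (auto simp: eventually_at_filter elim: eventually_mono)
  then show "\<forall>\<^sub>F n in F. y < \<phi> (x n)" by (rule eventually_compose_filterlim[OF _ assms(2)])
qed

lemma lower_semicontinuous_le:
  assumes "lower_semicontinuous \<phi>" "(x \<longlongrightarrow> u) F" "F \<noteq> bot" "\<forall>\<^sub>F n in F. \<phi> (x n) \<le> C"
  shows "\<phi> u \<le> C"
  using lower_semicontinuous_sequentially[OF assms(1,2)] Liminf_le[OF assms(3,4)] by order

section \<open>Subdifferentials and their limits\<close>

lemma frechet_subdiff_domain: "\<xi> \<in> frechet_subdiff \<phi> v \<Longrightarrow> v \<in> effective_domain \<phi>"
  by (simp add: frechet_subdiff_def)

text \<open>Expanding the square around \<open>v\<close>, minimality leaves the subgradient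
  inequality with an error |w - v|^2 / (2 r). This is of second order, hence below any multiple of
  |w - v| near \<open>v\<close>.\<close>

lemma minimizer_frechet_subdiff:
  fixes \<phi> :: "'h::real_inner \<Rightarrow> ereal"
  assumes p: "proper_functional \<phi>" and v: "v \<in> effective_domain \<phi>" and r: "r > 0"
    and min: "\<And>w. w \<in> effective_domain \<phi> \<Longrightarrow> energy \<phi> v + (norm (v - u))\<^sup>2 / (2 * r)
      \<le> energy \<phi> w + (norm (w - u))\<^sup>2 / (2 * r)"
  shows "- ((v - u) /\<^sub>R r) \<in> frechet_subdiff \<phi> v"
proof -
  let ?\<xi> = "- ((v - u) /\<^sub>R r)"
  have "0 \<le> Liminf (at v) (\<lambda>w. (\<phi> w - \<phi> v - ereal (?\<xi> \<bullet> (w - v))) / ereal (norm (w - v)))"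
    unfolding le_Liminf_iff
  proof (intro allI impI)
    fix y :: ereal assume "y < 0"
    then obtain y' where y': "y' < 0" "y \<le> ereal y'"
      by (cases y) (auto intro: that[of "-1"])
    have "\<forall>\<^sub>F w in at v. dist w v < 2 * r * (- y')" 
      using y'(1) r unfolding eventually_at by (intro exI[of _ "2 * r * (- y')"]) (auto simp: mult_pos_neg)
    moreover have "\<forall>\<^sub>F w in at v. w \<noteq> v" by (simp add: eventually_at_filter)
    ultimately show "\<forall>\<^sub>F w in at v. y < (\<phi> w - \<phi> v - ereal (?\<xi> \<bullet> (w - v))) / ereal (norm (w - v))"
    proof eventually_elim
      case (elim w)
      have n: "norm (w - v) > 0" using elim by simp
      show ?case
      proof (cases "w \<in> effective_domain \<phi>")
        case False
        then have "\<phi> w = \<infinity>" by (simp add: effective_domain_def)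
        then have "(\<phi> w - \<phi> v - ereal (?\<xi> \<bullet> (w - v))) / ereal (norm (w - v)) = \<infinity>"
          using n by (subst effective_domain_eq[OF p v]) (simp add: divide_ereal_def)
        then show ?thesis using \<open>y < 0\<close> by (cases y) auto
      next
        case True
        have "(norm (w - u))\<^sup>2 = (norm (w - v))\<^sup>2 + 2 * ((v - u) \<bullet> (w - v)) + (norm (v - u))\<^sup>2"
          unfolding power2_norm_eq_inner by (simp add: inner_diff inner_commute algebra_simps)
        then have "(norm (w - u))\<^sup>2 / (2 * r) = (norm (w - v))\<^sup>2 / (2 * r) + ((v - u) \<bullet> (w - v)) / r + (norm
          (v - u))\<^sup>2 / (2 * r)"
          using r by (simp add: field_simps)
        moreover have "?\<xi> \<bullet> (w - v) = - (((v - u) \<bullet> (w - v)) / r)" by (simp add: divide_inverse mult.commute)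
        ultimately have "- ((norm (w - v))\<^sup>2 / (2 * r)) \<le> energy \<phi> w - energy \<phi> v - ?\<xi> \<bullet> (w - v)"
          using min[OF True] by linarith
        moreover have "y' * norm (w - v) < - ((norm (w - v))\<^sup>2 / (2 * r))"
        proof -
          have "norm (w - v) < 2 * r * (- y')" using elim by (simp add: dist_norm)
          then have "norm (w - v) / (2 * r) < - y'" using r by (simp add: pos_divide_less_eq mult.commute)
          then have "norm (w - v) * (norm (w - v) / (2 * r)) < norm (w - v) * (- y')" using n
            by (rule mult_strict_left_mono)
          then show ?thesis by (simp add: power2_eq_square mult.commute)
        qed
        ultimately have "y' * norm (w - v) < energy \<phi> w - energy \<phi> v - ?\<xi> \<bullet> (w - v)" by linarith
        then have "y' < (energy \<phi> w - energy \<phi> v - ?\<xi> \<bullet> (w - v)) / norm (w - v)" using n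
          by (simp add: pos_less_divide_eq)
        then have "ereal y' < (\<phi> w - \<phi> v - ereal (?\<xi> \<bullet> (w - v))) / ereal (norm (w - v))"
          using n by (subst effective_domain_eq[OF p v], subst effective_domain_eq[OF p True]) simp
        then show ?thesis using y'(2) by (rule le_less_trans[rotated])
      qed
    qed
  qed
  then show ?thesis using v by (simp add: frechet_subdiff_def)
qed

text \<open>A single Frechet pair within a prescribed error is what the diagonal arguments over
  sequences of limiting subgradients use.\<close>

lemma strong_limiting_subdiff_approx:
  fixes \<phi> :: "'h::real_inner \<Rightarrow> ereal"
  assumes p: "proper_functional \<phi>" and \<zeta>: "\<zeta> \<in> strong_limiting_subdiff \<phi> w" and "e > 0"
  shows "\<exists>v \<eta>. \<eta> \<in> frechet_subdiff \<phi> v \<and> dist v w < e \<and> dist \<eta> \<zeta> < e \<and> \<bar>energy \<phi> v - energy \<phi> w\<bar> < e"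
proof -
  obtain vn \<xi>n where s: "\<And>n. \<xi>n n \<in> frechet_subdiff \<phi> (vn n)" "vn \<longlonglongrightarrow> w" "\<xi>n \<longlonglongrightarrow> \<zeta>" "(\<lambda>n. \<phi> (vn n)) \<longlonglongrightarrow> \<phi> w"
    and w: "w \<in> effective_domain \<phi>"
    using \<zeta> unfolding strong_limiting_subdiff_def by blast
  have "(\<lambda>n. energy \<phi> (vn n)) \<longlonglongrightarrow> energy \<phi> w"
    by (rule lim_real_of_ereal) (metis s(4) effective_domain_eq[OF p w])
  then have "\<forall>\<^sub>F n in sequentially. dist (energy \<phi> (vn n)) (energy \<phi> w) < e" using \<open>e > 0\<close> by (rule tendstoD)
  moreover have "\<forall>\<^sub>F n in sequentially. dist (vn n) w < e" using s(2) \<open>e > 0\<close> by (rule tendstoD)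
  moreover have "\<forall>\<^sub>F n in sequentially. dist (\<xi>n n) \<zeta> < e" using s(3) \<open>e > 0\<close> by (rule tendstoD)
  ultimately have "\<forall>\<^sub>F n in sequentially. dist (vn n) w < e \<and> dist (\<xi>n n) \<zeta> < e \<and>
    \<bar>energy \<phi> (vn n) - energy \<phi> w\<bar> < e"
    by eventually_elim (simp add: dist_real_def)
  then obtain n where "dist (vn n) w < e \<and> dist (\<xi>n n) \<zeta> < e \<and> \<bar>energy \<phi> (vn n) - energy \<phi> w\<bar> < e"
    by (auto simp: eventually_sequentially)
  then show ?thesis using s(1) by blast
qed

lemma strong_limiting_subdiff_approx_sequence:
  fixes \<phi> :: "'h::real_inner \<Rightarrow> ereal"
  assumes p: "proper_functional \<phi>" and \<zeta>: "\<And>n::nat. \<zeta> n \<in> strong_limiting_subdiff \<phi> (w n)"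
  shows "\<exists>v \<eta>. (\<forall>n. \<eta> n \<in> frechet_subdiff \<phi> (v n)) \<and> (\<lambda>n. v n - w n) \<longlonglongrightarrow> 0 \<and> (\<lambda>n. \<eta> n - \<zeta> n) \<longlonglongrightarrow> 0 \<and>
     (\<lambda>n. energy \<phi> (v n) - energy \<phi> (w n)) \<longlonglongrightarrow> 0 \<and> (\<forall>n. \<bar>energy \<phi> (v n) - energy \<phi> (w n)\<bar> < 1)"
proof -
  have "\<exists>v \<eta>. \<eta> \<in> frechet_subdiff \<phi> v \<and> dist v (w n) < 1 / real (Suc n) \<and> dist \<eta> (\<zeta> n) < 1 / real (Suc n) \<and>
    \<bar>energy \<phi> v - energy \<phi> (w n)\<bar> < 1 / real (Suc n)" for n
    by (rule strong_limiting_subdiff_approx[OF p \<zeta>]) simp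
  then obtain v \<eta> where v: "\<And>n. \<eta> n \<in> frechet_subdiff \<phi> (v n)" "\<And>n. dist (v n) (w n) < 1 / real (Suc n)"
    "\<And>n. dist (\<eta> n) (\<zeta> n) < 1 / real (Suc n)" "\<And>n. \<bar>energy \<phi> (v n) - energy \<phi> (w n)\<bar> < 1 / real (Suc n)"
      by metis
  note z = LIMSEQ_Suc[OF lim_1_over_n]
  show ?thesis
  proof (intro exI conjI allI)
    show "\<eta> n \<in> frechet_subdiff \<phi> (v n)" for n by (rule v)
    show "(\<lambda>n. v n - w n) \<longlonglongrightarrow> 0" "(\<lambda>n. \<eta> n - \<zeta> n) \<longlonglongrightarrow> 0" "(\<lambda>n. energy \<phi> (v n) - energy \<phi> (w n)) \<longlonglongrightarrow> 0"
      by (rule Lim_null_comparison[OF always_eventually z]; use v in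
        \<open>auto simp: dist_norm intro: less_imp_le\<close>)+
    show "\<bar>energy \<phi> (v n) - energy \<phi> (w n)\<bar> < 1" for n
    proof -
      have "1 / real (Suc n) \<le> 1" by simp
      then show ?thesis using v(4)[of n] by linarith
    qed
  qed
qed

text \<open>Replacing each limiting subgradient by a nearby Frechet subgradient costs errors that
  tend to 0, so the weak limit persists; the energies change by less than 1 and stay
  bounded.\<close>

lemma strong_limiting_subdiff_weak_closure:
  fixes \<phi> :: "'h::real_inner \<Rightarrow> ereal"
  assumes p: "proper_functional \<phi>" and l: "lower_semicontinuous \<phi>"
    and \<zeta>: "\<And>n::nat. \<zeta> n \<in> strong_limiting_subdiff \<phi> (w n)"
    and w: "w \<longlonglongrightarrow> v" and \<xi>: "weakly_converges \<zeta> \<xi>" and C: "\<And>n. \<phi> (w n) \<le> ereal C"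
  shows "\<xi> \<in> weak_limiting_subdiff \<phi> v"
proof -
  obtain v' \<eta> where s: "\<And>n. \<eta> n \<in> frechet_subdiff \<phi> (v' n)" "(\<lambda>n. v' n - w n) \<longlonglongrightarrow> 0" "(\<lambda>n. \<eta> n - \<zeta> n) \<longlonglongrightarrow> 0"
    "\<And>n. \<bar>energy \<phi> (v' n) - energy \<phi> (w n)\<bar> < 1"
    using strong_limiting_subdiff_approx_sequence[where \<zeta>=\<zeta> and w=w, OF p \<zeta>] by blast
  have "\<phi> v \<le> ereal C" by (rule lower_semicontinuous_le[OF l w]) (use C in auto)
  then have "v \<in> effective_domain \<phi>" by (auto simp: effective_domain_def)
  moreover have "v' \<longlonglongrightarrow> v" using tendsto_add[OF s(2) w] by simp
  moreover have "weakly_converges \<eta> \<xi>"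
    unfolding weakly_converges_def
  proof
    fix h
    have "(\<lambda>n. (\<eta> n - \<zeta> n) \<bullet> h) \<longlonglongrightarrow> 0 \<bullet> h" by (intro tendsto_inner s(3) tendsto_const)
    moreover have "(\<lambda>n. \<zeta> n \<bullet> h) \<longlonglongrightarrow> \<xi> \<bullet> h" using \<xi> by (simp add: weakly_converges_def)
    ultimately have "(\<lambda>n. (\<eta> n - \<zeta> n) \<bullet> h + \<zeta> n \<bullet> h) \<longlonglongrightarrow> 0 \<bullet> h + \<xi> \<bullet> h"
      by (rule tendsto_add)
    then show "(\<lambda>n. \<eta> n \<bullet> h) \<longlonglongrightarrow> \<xi> \<bullet> h" by (simp add: inner_diff_left)
  qed
  moreover have "(SUP n. \<phi> (v' n)) < \<infinity>"
  proof -
    have "\<phi> (v' n) \<le> ereal (C + 1)" for n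
    proof -
      have "w n \<in> effective_domain \<phi>" using C[of n] by (auto simp: effective_domain_def)
      then have "energy \<phi> (w n) \<le> C" using C[of n] effective_domain_eq[OF p] by (metis ereal_less_eq(3))
      then have "energy \<phi> (v' n) \<le> C + 1" using s(4)[of n] by linarith
      then show ?thesis using effective_domain_eq[OF p frechet_subdiff_domain[OF s(1)]]
        by (metis ereal_less_eq(3))
    qed
    then have "(SUP n. \<phi> (v' n)) \<le> ereal (C + 1)" by (intro SUP_least)
    then show ?thesis by (auto simp: le_less_trans)
  qed
  ultimately show ?thesis unfolding weak_limiting_subdiff_def using s(1) by blast
qed

lemma strong_limiting_subdiff_subset_weak:
  fixes \<phi> :: "'h::real_inner \<Rightarrow> ereal"
  assumes p: "proper_functional \<phi>" and l: "lower_semicontinuous \<phi>" and "\<xi> \<in> strong_limiting_subdiff \<phi> v"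
  shows "\<xi> \<in> weak_limiting_subdiff \<phi> v"
proof (rule strong_limiting_subdiff_weak_closure[OF p l, of "\<lambda>_. \<xi>" "\<lambda>_. v" v \<xi> "energy \<phi> v"])
  have "v \<in> effective_domain \<phi>" using assms(3) by (simp add: strong_limiting_subdiff_def)
  then show "\<phi> v \<le> ereal (energy \<phi> v)" using effective_domain_eq[OF p] by simp
qed (use assms(3) in \<open>auto simp: weakly_converges_def\<close>)

text \<open>The same diagonal argument, now with strong convergence. Convergence of the energies is
  part of the strong limiting subdifferential, which is why the limit passage has to establish it
  besides convergence of the curves.\<close>

lemma strong_limiting_subdiff_closed:
  fixes \<phi> :: "'h::real_inner \<Rightarrow> ereal"
  assumes p: "proper_functional \<phi>" and \<zeta>: "\<And>n::nat. \<zeta> n \<in> strong_limiting_subdiff \<phi> (w n)"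
    and w: "w \<longlonglongrightarrow> v" and \<xi>: "\<zeta> \<longlonglongrightarrow> \<xi>" and v: "v \<in> effective_domain \<phi>" and E: "(\<lambda>n. energy \<phi> (w n)) \<longlonglongrightarrow> energy \<phi> v"
  shows "\<xi> \<in> strong_limiting_subdiff \<phi> v"
proof -
  obtain v' \<eta> where s: "\<And>n. \<eta> n \<in> frechet_subdiff \<phi> (v' n)" "(\<lambda>n. v' n - w n) \<longlonglongrightarrow> 0" "(\<lambda>n. \<eta> n - \<zeta> n) \<longlonglongrightarrow> 0"
    "(\<lambda>n. energy \<phi> (v' n) - energy \<phi> (w n)) \<longlonglongrightarrow> 0"
    using strong_limiting_subdiff_approx_sequence[where \<zeta>=\<zeta> and w=w, OF p \<zeta>] by blast
  have "(\<lambda>n. ereal (energy \<phi> (v' n))) \<longlonglongrightarrow> ereal (energy \<phi> v)" using tendsto_add[OF s(4) E] by simp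
  then have "(\<lambda>n. \<phi> (v' n)) \<longlonglongrightarrow> \<phi> v"
    using effective_domain_eq[OF p frechet_subdiff_domain[OF s(1)]] effective_domain_eq[OF p v] by simp
  moreover have "v' \<longlonglongrightarrow> v" using tendsto_add[OF s(2) w] by simp
  moreover have "\<eta> \<longlonglongrightarrow> \<xi>" using tendsto_add[OF s(3) \<xi>] by simp
  ultimately show ?thesis using v s(1) unfolding strong_limiting_subdiff_def by blast
qed

section \<open>The chain rule up to the endpoints\<close>

text \<open>Collects what the chain condition asks of a curve apart from the energy bound, which is
  kept separate because it has to be proved for solutions.\<close>

definition subgradient_curve ::
  "('h::{real_inner,banach,second_countable_topology} \<Rightarrow> ereal) \<Rightarrow> real \<Rightarrow> real \<Rightarrow> (real \<Rightarrow> 'h) \<Rightarrow> (real \<Rightarrow> 'h) \<Rightarrow>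
    (real \<Rightarrow> 'h) \<Rightarrow> bool" where
  "subgradient_curve \<phi> a b v p \<xi> \<longleftrightarrow> L2_primitive a b v p \<and> L2_fun a b \<xi> \<and>
     (AE t in lebesgue. a < t \<and> t < b \<longrightarrow> \<xi> t \<in> weak_limiting_subdiff \<phi> (v t))"

text \<open>The chain condition makes the energy absolutely continuous on the open interval, and
  \<open>abs_continuous_FTC\<close> integrates its derivative between interior points.\<close>

lemma subgradient_curve_chain_open:
  assumes chain: "chain_condition \<phi>" and c: "subgradient_curve \<phi> a b v p \<xi>"
    and bd: "\<And>t. a < t \<Longrightarrow> t < b \<Longrightarrow> \<bar>\<phi> (v t)\<bar> \<le> ereal C"
    and st: "a < s" "s \<le> t" "t < b"
  shows "energy \<phi> (v t) - energy \<phi> (v s) = (LINT x:{s<..<t}|lebesgue. \<xi> x \<bullet> p x)"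
proof -
  have ab: "a < b" using st by linarith
  have L: "L2_primitive a b v p" "L2_fun a b \<xi>" using c by (auto simp: subgradient_curve_def)
  have AEi: "(AE t in lebesgue_on {a<..<b}. P t) \<longleftrightarrow> (AE t in lebesgue. a < t \<and> t < b \<longrightarrow> P t)" for P
    by (subst AE_restrict_space_iff) auto
  have "abs_continuous_on {a<..<b} (\<lambda>t. energy \<phi> (v t)) \<and>
        (AE t in lebesgue_on {a<..<b}. ((\<lambda>t. energy \<phi> (v t)) has_real_derivative \<xi> t \<bullet> p t) (at t))"
  proof (rule chain[unfolded chain_condition_def, rule_format, OF ab])
    show "H1_fun a b v p" using H1_fun_iff_L2_primitive[OF ab] L by blast
    show "AE t in lebesgue_on {a<..<b}. \<xi> t \<in> weak_limiting_subdiff \<phi> (v t)" using c AEi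
      unfolding subgradient_curve_def by blast
    show "\<exists>C. \<forall>t\<in>{a<..<b}. \<bar>\<phi> (v t)\<bar> \<le> ereal C" using bd greaterThanLessThan_iff by blast
  qed (rule L)
  then have ac: "abs_continuous_on {a<..<b} (\<lambda>t. energy \<phi> (v t))"
    and d: "AE t in lebesgue. a < t \<and> t < b \<longrightarrow> ((\<lambda>t. energy \<phi> (v t)) has_real_derivative \<xi> t \<bullet> p t) (at t)"
    using AEi by auto
  have "(LINT x:{s<..<t}|lebesgue. \<xi> x \<bullet> p x) = energy \<phi> (v t) - energy \<phi> (v s)"
  proof (rule abs_continuous_FTC[OF ac _ st])
    show "AE x in lebesgue. x \<in> {s<..<t} \<longrightarrow> ((\<lambda>t. energy \<phi> (v t)) has_real_derivative \<xi> x \<bullet> p x) (at x)"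
      using d by eventually_elim (use st in auto)
    have "L2_fun s t \<xi>" "L2_fun s t p" using L st L2_fun_subset[of a b _ s t] unfolding L2_primitive_def
      by auto
    then show "set_integrable lebesgue {s<..<t} (\<lambda>x. \<xi> x \<bullet> p x)" by (rule L2_fun_set_integrable_inner)
  qed
  then show ?thesis by simp
qed

lemma subgradient_curve_reflect:
  assumes "subgradient_curve \<phi> a b v p \<xi>" "a \<le> b"
  shows "subgradient_curve \<phi> (c - b) (c - a) (\<lambda>t. v (c - t)) (\<lambda>t. - p (c - t)) (\<lambda>t. \<xi> (c - t))"
  unfolding subgradient_curve_def
proof (intro conjI)
  show "L2_primitive (c - b) (c - a) (\<lambda>t. v (c - t)) (\<lambda>t. - p (c - t))"
    using assms L2_primitive_reflect by (auto simp: subgradient_curve_def)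
  show "L2_fun (c - b) (c - a) (\<lambda>t. \<xi> (c - t))"
    using assms L2_fun_isometry[of "-1" a b \<xi> "c - b" "c - a" c]
    by (simp add: subgradient_curve_def less_diff_eq diff_less_eq add.commute conj_commute)
  have "AE t in lebesgue. a < t \<and> t < b \<longrightarrow> \<xi> t \<in> weak_limiting_subdiff \<phi> (v t)" using assms
    by (simp add: subgradient_curve_def)
  from AE_lebesgue_isometry[OF _ this, of "-1" c]
  have "AE t in lebesgue. a < c - t \<and> c - t < b \<longrightarrow> \<xi> (c - t) \<in> weak_limiting_subdiff \<phi> (v (c - t))" by simp
  then show "AE t in lebesgue. c - b < t \<and> t < c - a \<longrightarrow> \<xi> (c - t) \<in> weak_limiting_subdiff \<phi> (v (c - t))"
    by eventually_elim auto
qed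

text \<open>Continuing the curve to the left of \<open>a\<close> by its reflection makes
  \<open>a\<close> an interior point, so that the open version applies there.\<close>

lemma subgradient_curve_chain_left:
  assumes chain: "chain_condition \<phi>" and c: "subgradient_curve \<phi> a b v p \<xi>"
    and bd: "\<And>t. a \<le> t \<Longrightarrow> t < b \<Longrightarrow> \<bar>\<phi> (v t)\<bar> \<le> ereal C"
    and st: "a \<le> s" "s \<le> t" "t < b"
  shows "energy \<phi> (v t) - energy \<phi> (v s) = (LINT x:{s<..<t}|lebesgue. \<xi> x \<bullet> p x)"
proof -
  have ab: "a < b" using st by linarith
  define v' where "v' t = (if t < a then v (2 * a - t) else v t)" for t
  \<comment> \<open>Reflection reverses the velocity but not the subgradient, since the inclusion
    depends on the position only.\<close>
  define p' where "p' t = (if t < a then - p (2 * a - t) else p t)" for t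
  define \<xi>' where "\<xi>' t = (if t < a then \<xi> (2 * a - t) else \<xi> t)" for t
  have r: "subgradient_curve \<phi> (2 * a - b) a (\<lambda>t. v (2 * a - t)) (\<lambda>t. - p (2 * a - t)) (\<lambda>t. \<xi> (2 * a - t))"
    using subgradient_curve_reflect[OF c, of "2 * a"] ab by simp
  have c': "subgradient_curve \<phi> (2 * a - b) b v' p' \<xi>'"
    unfolding subgradient_curve_def
  proof (intro conjI)
    show "L2_primitive (2 * a - b) b v' p'"
    proof (rule L2_primitive_concat)
      show "L2_primitive (2 * a - b) a v' p'"
        by (rule L2_primitive_cong[of _ _ "\<lambda>t. v (2 * a - t)" "\<lambda>t. - p (2 * a - t)"])
          (use r in \<open>auto simp: subgradient_curve_def v'_def p'_def\<close>)
      show "L2_primitive a b v' p'"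
        by (rule L2_primitive_cong[of _ _ v p]) (use c in \<open>auto simp: subgradient_curve_def v'_def p'_def\<close>)
    qed (use ab in auto)
    show "L2_fun (2 * a - b) b \<xi>'"
    proof (rule L2_fun_concat)
      show "L2_fun (2 * a - b) a \<xi>'"
        by (rule L2_fun_cong[of _ _ "\<lambda>t. \<xi> (2 * a - t)"]) (use r in \<open>auto simp: subgradient_curve_def \<xi>'_def\<close>)
      show "L2_fun a b \<xi>'"
        by (rule L2_fun_cong[of _ _ \<xi>]) (use c in \<open>auto simp: subgradient_curve_def \<xi>'_def\<close>)
    qed (use ab in auto)
    have "AE t in lebesgue. a < t \<and> t < b \<longrightarrow> \<xi> t \<in> weak_limiting_subdiff \<phi> (v t)"
      "AE t in lebesgue. 2 * a - b < t \<and> t < a \<longrightarrow> \<xi> (2 * a - t) \<in> weak_limiting_subdiff \<phi> (v (2 * a - t))"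
      using c r by (auto simp: subgradient_curve_def)
    then show "AE t in lebesgue. 2 * a - b < t \<and> t < b \<longrightarrow> \<xi>' t \<in> weak_limiting_subdiff \<phi> (v' t)"
      using AE_lebesgue_neq[of a] by eventually_elim (auto simp: \<xi>'_def v'_def)
  qed
  have "energy \<phi> (v' t) - energy \<phi> (v' s) = (LINT x:{s<..<t}|lebesgue. \<xi>' x \<bullet> p' x)"
  proof (rule subgradient_curve_chain_open[OF chain c'])
    show "\<bar>\<phi> (v' x)\<bar> \<le> ereal C" if "2 * a - b < x" "x < b" for x
      using bd[of x] bd[of "2 * a - x"] that by (auto simp: v'_def)
  qed (use st ab in auto)
  moreover have "(LINT x:{s<..<t}|lebesgue. \<xi>' x \<bullet> p' x) = (LINT x:{s<..<t}|lebesgue. \<xi> x \<bullet> p x)"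
    unfolding set_lebesgue_integral_def
    by (rule Bochner_Integration.integral_cong) (use st in \<open>auto simp: indicator_def \<xi>'_def p'_def\<close>)
  ultimately show ?thesis using st by (simp add: v'_def)
qed

text \<open>A further time reversal exchanges the two ends. Splitting at an interior point
  \<open>m\<close> treats the left part directly and the right part in reversed time.\<close>

lemma subgradient_curve_chain_closed:
  assumes chain: "chain_condition \<phi>" and c: "subgradient_curve \<phi> a b v p \<xi>"
    and bd: "\<And>t. a \<le> t \<Longrightarrow> t \<le> b \<Longrightarrow> \<bar>\<phi> (v t)\<bar> \<le> ereal C"
    and st: "a \<le> s" "s \<le> t" "t \<le> b"
  shows "energy \<phi> (v t) - energy \<phi> (v s) = (LINT x:{s<..<t}|lebesgue. \<xi> x \<bullet> p x)"
proof (cases "t < b \<or> s = t")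
  case True
  then show ?thesis
  proof
    assume "t < b" then show ?thesis by (intro subgradient_curve_chain_left[OF chain c bd]) (use st in auto)
  qed (simp add: set_lebesgue_integral_def)
next
  case False
  then have t: "t = b" "s < b" using st by auto
  define m where "m = (s + b) / 2"
  have m: "s < m" "m < b" using t by (auto simp: m_def)
  have L: "L2_fun a b \<xi>" "L2_fun a b p" using c by (auto simp: subgradient_curve_def L2_primitive_def)
  have i: "set_integrable lebesgue {a<..<b} (\<lambda>x. \<xi> x \<bullet> p x)" by (rule L2_fun_set_integrable_inner[OF L])
  have ab: "a \<le> b" using st by simp
  have "energy \<phi> (v (a + b - (a + b - m))) - energy \<phi> (v (a + b - a)) = (LINT x:{a<..<a + b - m}|lebesgue.
    \<xi> (a + b - x) \<bullet> - p (a + b - x))"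
    by (rule subgradient_curve_chain_left[OF chain subgradient_curve_reflect[OF c ab, of "a + b", simplified],
      of C])
      (use bd m st in auto)
  also have "\<dots> = - (LINT x:{a<..<a + b - m}|lebesgue. \<xi> (a + b - x) \<bullet> p (a + b - x))"
    unfolding set_lebesgue_integral_def by simp
  also have "(LINT x:{a<..<a + b - m}|lebesgue. \<xi> (a + b - x) \<bullet> p (a + b - x)) = (LINT x:{m<..<b}|lebesgue.
    \<xi> x \<bullet> p x)"
  proof -
    have i2: "set_integrable lebesgue {m<..<b} (\<lambda>x. \<xi> x \<bullet> p x)" by (rule set_integrable_subset[OF i])
      (use m st in auto)
    have "(LINT x:{a<..<a + b - m}|lebesgue. (\<lambda>x. \<xi> x \<bullet> p x) (a + b + -1 * x)) = (LINT x:{m<..<b}|lebesgue.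
      \<xi> x \<bullet> p x)"
      by (rule set_integral_isometry[OF _ i2]) auto
    then show ?thesis by simp
  qed
  finally have 1: "energy \<phi> (v b) - energy \<phi> (v m) = (LINT x:{m<..<b}|lebesgue. \<xi> x \<bullet> p x)" by simp
  have 2: "energy \<phi> (v m) - energy \<phi> (v s) = (LINT x:{s<..<m}|lebesgue. \<xi> x \<bullet> p x)"
    by (rule subgradient_curve_chain_left[OF chain c bd]) (use m st in auto)
  have "set_integrable lebesgue {s<..<b} (\<lambda>x. \<xi> x \<bullet> p x)" by (rule set_integrable_subset[OF i])
    (use m st in auto)
  from set_integral_concat[OF this, of m] 1 2 m t show ?thesis by simp
qed

section \<open>Boundedness of the energy along solutions\<close>

lemma locally_bounded_imp_bounded:
  fixes E :: "real \<Rightarrow> real"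
  assumes "\<And>t. t \<in> {a..b} \<Longrightarrow> \<exists>\<epsilon>>0. \<exists>C. \<forall>x\<in>{a..b}. \<bar>x - t\<bar> < \<epsilon> \<longrightarrow> \<bar>E x\<bar> \<le> C"
  shows "\<exists>C. \<forall>x\<in>{a..b}. \<bar>E x\<bar> \<le> C"
proof -
  obtain \<epsilon> C where e: "\<And>t. t \<in> {a..b} \<Longrightarrow> \<epsilon> t > 0"
    "\<And>t x. t \<in> {a..b} \<Longrightarrow> x \<in> {a..b} \<Longrightarrow> \<bar>x - t\<bar> < \<epsilon> t \<Longrightarrow> \<bar>E x\<bar> \<le> C t"
    using assms by metis
  have "{a..b} \<subseteq> (\<Union>t\<in>{a..b}. ball t (\<epsilon> t))" using e(1) by auto
  then obtain I where I: "I \<subseteq> {a..b}" "finite I" "{a..b} \<subseteq> (\<Union>t\<in>I. ball t (\<epsilon> t))"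
    using compactE_image[of "{a..b}" "{a..b}" "\<lambda>t. ball t (\<epsilon> t)"] by auto
  have "\<bar>E x\<bar> \<le> (\<Sum>t\<in>I. \<bar>C t\<bar>)" if x: "x \<in> {a..b}" for x
  proof -
    obtain t where t: "t \<in> I" "dist t x < \<epsilon> t" using I(3) x by auto
    then have "\<bar>E x\<bar> \<le> C t" using e(2)[of t x] I(1) x by (auto simp: dist_real_def abs_minus_commute)
    also have "\<dots> \<le> \<bar>C t\<bar>" by simp
    also have "\<dots> \<le> (\<Sum>t\<in>I. \<bar>C t\<bar>)" using member_le_sum[OF t(1), of "\<lambda>t. \<bar>C t\<bar>"] I(2) by simp
    finally show ?thesis .
  qed
  then show ?thesis by blast
qed

text \<open>The supremum of the part of \<open>F\<close> between \<open>c\<close> and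
  \<open>t\<close> is the left end of the gap that contains \<open>t\<close>.\<close>

lemma closed_nearest_right:
  fixes F :: "real set"
  assumes "closed F" "c \<in> F" "c \<le> t" "t \<notin> F"
  shows "\<exists>f\<in>F. c \<le> f \<and> f < t \<and> {f<..t} \<inter> F = {}"
proof -
  let ?S = "F \<inter> {c..t}"
  have ne: "?S \<noteq> {}" and bdd: "bdd_above ?S" and cl: "closed ?S" using assms
    by (auto intro: bdd_aboveI[of _ t])
  have f: "Sup ?S \<in> ?S" by (rule closed_contains_Sup[OF ne bdd cl])
  have "x \<le> Sup ?S" if "x \<in> ?S" for x using cSup_upper[OF that bdd] .
  then have "{Sup ?S<..t} \<inter> F = {}" using f by (force simp: not_le[symmetric])
  moreover have "Sup ?S \<noteq> t" using f assms(4) by auto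
  ultimately show ?thesis using f by (intro bexI[of _ "Sup ?S"]) auto
qed

lemma closed_nearest_left:
  fixes F :: "real set"
  assumes "closed F" "c \<in> F" "t \<le> c" "t \<notin> F"
  shows "\<exists>f\<in>F. f \<le> c \<and> t < f \<and> {t..<f} \<inter> F = {}"
proof -
  have "closed (uminus ` F)" using closed_negations[OF assms(1)] .
  then obtain f where f0: "f \<in> uminus ` F" and f: "- c \<le> f" "f < - t" "{f<..- t} \<inter> uminus ` F = {}"
  proof -
    have "- c \<in> uminus ` F" "- t \<notin> uminus ` F" using assms by auto
    then show ?thesis using closed_nearest_right[of "uminus ` F" "- c"
      "- t"] assms(3) \<open>closed (uminus ` F)\<close> that by (metis neg_le_iff_le)
  qed
  have fF: "- f \<in> F" using f0 by auto
  have "{t..<- f} \<inter> F = {}"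
  proof (rule ccontr)
    assume "{t..<- f} \<inter> F \<noteq> {}"
    then obtain x where "x \<in> F" "t \<le> x" "x < - f" by auto
    then have "- x \<in> {f<..- t} \<inter> uminus ` F" by auto
    then show False using f(3) by blast
  qed
  then show ?thesis using f fF by (intro bexI[of _ "- f"]) auto
qed

text \<open>Otherwise every \<open>F - A n\<close> is relatively open and dense in \<open>F\<close>,
  and by Baire's theorem their intersection, which is empty, would be dense in
  \<open>F\<close>.\<close>

lemma closed_UN_has_interior_point:
  fixes F :: "'a::{real_normed_vector,heine_borel} set"
  assumes "closed F" "F \<noteq> {}" and F: "F = (\<Union>n::nat. A n)" and A: "\<And>n. closed (A n)"
  shows "\<exists>n. \<exists>c\<in>F. \<exists>\<epsilon>>0. \<forall>x\<in>F. dist x c < \<epsilon> \<longrightarrow> x \<in> A n"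
proof (rule ccontr)
  assume no: "\<not> ?thesis"
  have "F \<subseteq> closure (\<Inter>(range (\<lambda>n. F - A n)))"
  proof (rule Baire[OF assms(1)])
    fix T assume "T \<in> range (\<lambda>n. F - A n)"
    then obtain n where T: "T = F - A n" by auto
    have "openin (top_of_set F) (F \<inter> (- A n))" using A[of n] by (intro openin_open_Int) auto
    moreover have "x \<in> closure T" if "x \<in> F" for x
      unfolding closure_approachable T using no that by (metis DiffI)
    ultimately show "openin (top_of_set F) T \<and> F \<subseteq> closure T" by (auto simp: T Diff_eq)
  qed auto
  moreover have "\<Inter>(range (\<lambda>n. F - A n)) = {}" using F by auto
  ultimately have "F \<subseteq> closure {}" by (simp only:)
  then show False using assms(2) by simp
qed

text \<open>Times along which the energy tends to minus infinity would accumulate at a time where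
  lower semicontinuity forces \<phi> below every bound.\<close>

lemma energy_bounded_below:
  assumes p: "proper_functional \<phi>" and l: "lower_semicontinuous \<phi>" and cu: "continuous_on {a..b::real} u"
    and dom: "\<And>t. a \<le> t \<Longrightarrow> u t \<in> effective_domain \<phi>"
  shows "\<exists>m. \<forall>t\<in>{a..b}. m \<le> energy \<phi> (u t)"
proof (rule ccontr)
  assume "\<not> ?thesis"
  then have "\<forall>k::nat. \<exists>t\<in>{a..b}. energy \<phi> (u t) < - real k" by (metis not_le)
  then obtain x where x: "\<And>k. x k \<in> {a..b}" "\<And>k. energy \<phi> (u (x k)) < - real k" by metis
  obtain t r where t: "t \<in> {a..b}" "strict_mono r" "(x \<circ> r) \<longlonglongrightarrow> t"
    using compact_Icc[of a b] x(1) unfolding compact_def by (metis (no_types, lifting))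
  have "\<phi> (u t) \<le> ereal (- real k)" for k
  proof (rule lower_semicontinuous_le[OF l])
    show "(\<lambda>j. u ((x \<circ> r) j)) \<longlonglongrightarrow> u t"
      by (rule continuous_on_tendsto_compose[OF cu t(3,1)]) (use x in auto)
    show "\<forall>\<^sub>F j in sequentially. \<phi> (u ((x \<circ> r) j)) \<le> ereal (- real k)"
      using eventually_ge_at_top[of k]
    proof eventually_elim
      case (elim j)
      then have "k \<le> r j" using seq_suble[OF t(2), of j] by linarith
      then have "energy \<phi> (u ((x \<circ> r) j)) \<le> - real k" using x(2)[of "r j"] by simp
      then show ?case using effective_domain_eq[OF p dom, of "(x \<circ> r) j"] x(1)[of "r j"]
        by (metis atLeastAtMost_iff comp_apply ereal_less_eq(3))
    qed
  qed simp
  then have le: "energy \<phi> (u t) \<le> - real k" for k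
    using effective_domain_eq[OF p dom, of t] t(1) by (metis atLeastAtMost_iff ereal_less_eq(3))
  obtain k where k: "- energy \<phi> (u t) < real k" using reals_Archimedean2 by blast
  show False using le[of k] k by linarith
qed

lemma strong_subgradient_curve:
  fixes u :: "real \<Rightarrow> 'h::{real_inner,banach,second_countable_topology}"
  assumes p: "proper_functional \<phi>" and l: "lower_semicontinuous \<phi>"
    and prim: "L2_primitive 0 T u q"
    and ae: "AE t in lebesgue. 0 < t \<longrightarrow> - q t \<in> strong_limiting_subdiff \<phi> (u t)"
    and ab: "0 \<le> a" "b \<le> T"
  shows "subgradient_curve \<phi> a b u q (\<lambda>t. - q t)"
  unfolding subgradient_curve_def
proof (intro conjI)
  show P: "L2_primitive a b u q" using L2_primitive_subset[OF prim ab] .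
  show "L2_fun a b (\<lambda>t. - q t)" using P by (intro L2_fun_minus) (simp add: L2_primitive_def)
  show "AE t in lebesgue. a < t \<and> t < b \<longrightarrow> - q t \<in> weak_limiting_subdiff \<phi> (u t)"
    using ae by eventually_elim (use ab strong_limiting_subdiff_subset_weak[OF p l] in auto)
qed

text \<open>The oscillation bound \<open>M\<close> does not depend on the bound \<open>C\<close>
  under which the chain rule is applied; this is what turns finite but uncontrolled values into a
  uniform estimate.\<close>

lemma solution_energy_bounded:
  fixes u :: "real \<Rightarrow> 'h::{real_inner,banach,second_countable_topology}"
  assumes p: "proper_functional \<phi>" and l: "lower_semicontinuous \<phi>" and chain: "chain_condition \<phi>"
    and prim: "L2_primitive 0 T u q"
    and ae: "AE t in lebesgue. 0 < t \<longrightarrow> - q t \<in> strong_limiting_subdiff \<phi> (u t)"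
    and dom: "\<And>t. 0 \<le> t \<Longrightarrow> u t \<in> effective_domain \<phi>"
  shows "\<exists>C. \<forall>t\<in>{0..T}. \<bar>energy \<phi> (u t)\<bar> \<le> C"
proof -
  define E where "E t = energy \<phi> (u t)" for t
  define M where "M = (LINT x:{0<..<T}|lebesgue. (norm (q x))\<^sup>2)"
  have Lq: "L2_fun 0 T q" using prim by (simp add: L2_primitive_def)
  have diff: "\<bar>E t - E s\<bar> \<le> M" if st: "0 \<le> a" "a \<le> s" "s \<le> t" "t \<le> b" "b \<le> T"
    and bd: "\<And>x. a \<le> x \<Longrightarrow> x \<le> b \<Longrightarrow> \<bar>E x\<bar> \<le> C" for a b s t C
  proof -
    have "E t - E s = (LINT x:{s<..<t}|lebesgue. - q x \<bullet> q x)"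
      unfolding E_def
    proof (rule subgradient_curve_chain_closed[OF chain strong_subgradient_curve[OF p l prim ae]])
      show "\<bar>\<phi> (u x)\<bar> \<le> ereal C" if "a \<le> x" "x \<le> b" for x
        using bd[OF that] effective_domain_eq[OF p dom, of x] st that unfolding E_def
        by (metis abs_ereal.simps(1) ereal_less_eq(3) order_trans)
    qed (use st in auto)
    also have "\<dots> = - (LINT x:{s<..<t}|lebesgue. (norm (q x))\<^sup>2)"
      unfolding set_lebesgue_integral_def by (simp add: power2_norm_eq_inner)
    finally have "E t - E s = - (LINT x:{s<..<t}|lebesgue. (norm (q x))\<^sup>2)" .
    moreover have "(LINT x:{s<..<t}|lebesgue. (norm (q x))\<^sup>2) \<le> M"
      unfolding M_def by (rule set_integral_mono_set_norm[OF Lq]) (use st in auto)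
    moreover have "0 \<le> (LINT x:{s<..<t}|lebesgue. (norm (q x))\<^sup>2)"
      unfolding set_lebesgue_integral_def by (rule integral_nonneg_AE) auto
    ultimately show ?thesis by linarith
  qed
  define good where "good t \<longleftrightarrow> (\<exists>\<epsilon>>0. \<exists>C. \<forall>x\<in>{0..T}. \<bar>x - t\<bar> < \<epsilon> \<longrightarrow> \<bar>E x\<bar> \<le> C)" for t
  define F where "F = {t \<in> {0..T}. \<not> good t}"
  have "F = {}"
  proof (rule ccontr)
    assume "F \<noteq> {}"
    have "open {t. good t}"
      unfolding open_dist
    proof (intro ballI)
      fix t assume "t \<in> {t. good t}"
      then obtain \<epsilon> C where e: "\<epsilon> > 0" "\<And>x. x \<in> {0..T} \<Longrightarrow> \<bar>x - t\<bar> < \<epsilon> \<Longrightarrow> \<bar>E x\<bar> \<le> C" unfolding good_def by blast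
      show "\<exists>e>0. \<forall>y. dist y t < e \<longrightarrow> y \<in> {t. good t}"
      proof (intro exI[of _ "\<epsilon> / 2"] conjI allI impI)
        fix y assume y: "dist y t < \<epsilon> / 2"
        have "\<bar>E x\<bar> \<le> C" if x: "x \<in> {0..T}" "\<bar>x - y\<bar> < \<epsilon> / 2" for x
        proof -
          have "\<bar>x - t\<bar> < \<epsilon>" using y x(2) unfolding dist_real_def by linarith
          then show ?thesis using e(2) x(1) by blast
        qed
        moreover have "0 < \<epsilon> / 2" using e by simp
        ultimately show "y \<in> {t. good t}" unfolding good_def by blast
      qed (use e in simp)
    qed
    moreover have "F = {0..T} - {t. good t}" by (auto simp: F_def)
    ultimately have clF: "closed F" by (auto intro: closed_Diff)
    have cu: "continuous_on {0..T} u" by (rule L2_primitive_continuous[OF prim])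
    have near: "\<bar>E t - E s\<bar> \<le> M" if st: "0 \<le> s" "s < t" "t \<le> T" and g: "\<And>x. s < x \<Longrightarrow> x < t \<Longrightarrow> good x" for s t
    proof -
      define m where "m = (s + t) / 2"
      have m: "s < m" "m < t" using st by (auto simp: m_def)
      have c: "\<bar>E y - E x\<bar> \<le> M" if xy: "s < x" "x \<le> y" "y < t" for x y
      proof -
        have "\<exists>C. \<forall>z\<in>{x..y}. \<bar>E z\<bar> \<le> C"
        proof (rule locally_bounded_imp_bounded)
          fix z assume "z \<in> {x..y}"
          then have "good z" using g xy by auto
          then obtain \<epsilon> C where "\<epsilon> > 0" "\<forall>x\<in>{0..T}. \<bar>x - z\<bar> < \<epsilon> \<longrightarrow> \<bar>E x\<bar> \<le> C" unfolding good_def by blast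
          moreover have "{x..y} \<subseteq> {0..T}" using xy st by auto
          ultimately show "\<exists>\<epsilon>>0. \<exists>C. \<forall>x\<in>{x..y}. \<bar>x - z\<bar> < \<epsilon> \<longrightarrow> \<bar>E x\<bar> \<le> C" by blast
        qed
        then obtain C where "\<And>z. x \<le> z \<Longrightarrow> z \<le> y \<Longrightarrow> \<bar>E z\<bar> \<le> C" by (metis atLeastAtMost_iff)
        then show ?thesis by (intro diff[of x x y y C]) (use xy st in auto)
      qed
      \<comment> \<open>The endpoints may be bad times, but their energies are finite numbers and
        may enter \<open>C\<close>; the conclusion of \<open>diff\<close> no longer refers to
        \<open>C\<close>.\<close>
      define C where "C = max (\<bar>E m\<bar> + M) (max \<bar>E s\<bar> \<bar>E t\<bar>)"
      have "\<bar>E x\<bar> \<le> C" if "s \<le> x" "x \<le> t" for x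
      proof (cases "x = s \<or> x = t")
        case False
        then have "\<bar>E x - E m\<bar> \<le> M" using c[of x m] c[of m x] that m by (cases "x \<le> m") auto
        then show ?thesis by (auto simp: C_def)
      qed (auto simp: C_def)
      then show ?thesis by (intro diff[of s s t t C]) (use st in auto)
    qed
    \<comment> \<open>Closed by lower semicontinuity of \<phi> and continuity of \<open>u\<close>;
      these sets exhaust \<open>F\<close> since each time has a finite energy.\<close>
    define A where "A n = {t \<in> F. E t \<le> real n}" for n :: nat
    have closedA: "closed (A n)" for n
      unfolding closed_sequential_limits
    proof (intro allI impI, elim conjE)
      fix x t assume x: "\<forall>k. x k \<in> A n" and lim: "x \<longlonglongrightarrow> t"
      have "t \<in> F" using clF x lim unfolding closed_sequential_limits A_def by blast
      moreover have "\<phi> (u t) \<le> ereal (real n)"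
      proof (rule lower_semicontinuous_le[OF l])
        show "(\<lambda>k. u (x k)) \<longlonglongrightarrow> u t"
          by (rule continuous_on_tendsto_compose[OF cu lim]) (use x \<open>t \<in> F\<close> in \<open>auto simp: A_def F_def\<close>)
        have "\<phi> (u (x k)) \<le> ereal (real n)" for k
        proof -
          have "x k \<in> A n" using x by blast
          then have "E (x k) \<le> real n" "0 \<le> x k" by (auto simp: A_def F_def)
          then show ?thesis using effective_domain_eq[OF p dom, of "x k"] unfolding E_def
            by (metis ereal_less_eq(3))
        qed
        then show "\<forall>\<^sub>F k in sequentially. \<phi> (u (x k)) \<le> ereal (real n)" by simp
      qed simp
      moreover have "0 \<le> t" using \<open>t \<in> F\<close> by (simp add: F_def)
      ultimately show "t \<in> A n"
        using effective_domain_eq[OF p dom, of t] unfolding A_def E_def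
          by (metis (mono_tags, lifting) ereal_less_eq(3) mem_Collect_eq)
    qed
    have "F = (\<Union>n. A n)"
      using real_arch_simple by (auto simp: A_def)
    from closed_UN_has_interior_point[OF clF \<open>F \<noteq> {}\<close> this closedA]
    obtain n c \<epsilon> where c: "c \<in> F" "\<epsilon> > 0" "\<And>x. x \<in> F \<Longrightarrow> dist x c < \<epsilon> \<Longrightarrow> x \<in> A n" by blast
    obtain Lb where Lb: "\<And>t. t \<in> {0..T} \<Longrightarrow> - Lb \<le> E t"
      using energy_bounded_below[OF p l cu dom] unfolding E_def by (metis atLeastAtMost_iff minus_minus)
    have "\<bar>E x\<bar> \<le> real n + \<bar>Lb\<bar> + M" if x: "x \<in> {0..T}" and xc: "\<bar>x - c\<bar> < \<epsilon>" for x
    proof -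
      have M0: "0 \<le> M" unfolding M_def set_lebesgue_integral_def by (rule integral_nonneg_AE) auto
      have onF: "\<bar>E f\<bar> \<le> real n + \<bar>Lb\<bar>" if "f \<in> F" "\<bar>f - c\<bar> < \<epsilon>" for f
        using c(3)[of f] that Lb[of f] by (auto simp: A_def F_def dist_real_def)
      have cT: "c \<in> {0..T}" using c(1) by (simp add: F_def)
      show ?thesis
      proof (cases "x \<in> F")
        case True
        then show ?thesis using onF[OF True xc] M0 by linarith
      next
        case False
        show ?thesis
        proof (cases "c \<le> x")
          case True
          \<comment> \<open>The point of \<open>F\<close> next to \<open>x\<close> on the way to
            \<open>c\<close> is still within \<epsilon> of \<open>c\<close>, and all times strictly
            between it and \<open>x\<close> are good.\<close>
          obtain f where f: "f \<in> F" "c \<le> f" "f < x" "{f<..x} \<inter> F = {}"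
            using closed_nearest_right[OF clF c(1) True False] by blast
          have "\<bar>E x - E f\<bar> \<le> M"
          proof (rule near)
            show "good y" if "f < y" "y < x" for y
            proof -
              have "y \<in> {f<..x}" using that by simp
              then have "y \<notin> F" using f(4) by blast
              then show ?thesis using that f x by (auto simp: F_def)
            qed
          qed (use f x in \<open>auto simp: F_def\<close>)
          moreover have "\<bar>f - c\<bar> < \<epsilon>" using f xc by auto
          ultimately show ?thesis using onF[OF f(1)] by linarith
        next
          case g: False
          then obtain f where f: "f \<in> F" "f \<le> c" "x < f" "{x..<f} \<inter> F = {}"
            using closed_nearest_left[OF clF c(1) _ False] by auto
          have "\<bar>E f - E x\<bar> \<le> M"
          proof (rule near)
            show "good y" if "x < y" "y < f" for y
            proof -
              have "y \<in> {x..<f}" using that by simp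
              then have "y \<notin> F" using f(4) by blast
              then show ?thesis using that f x by (auto simp: F_def)
            qed
          qed (use f x in \<open>auto simp: F_def\<close>)
          moreover have "\<bar>f - c\<bar> < \<epsilon>" using f xc by auto
          ultimately show ?thesis using onF[OF f(1)] by linarith
        qed
      qed
    qed
    then have "good c" unfolding good_def using c(2) by blast
    then show False using c(1) by (simp add: F_def)
  qed
  then have "\<exists>\<epsilon>>0. \<exists>C. \<forall>x\<in>{0..T}. \<bar>x - t\<bar> < \<epsilon> \<longrightarrow> \<bar>E x\<bar> \<le> C" if "t \<in> {0..T}" for t
    using that unfolding F_def good_def by blast
  then show ?thesis using locally_bounded_imp_bounded[of 0 T E] unfolding E_def by blast
qed

lemma solution_energy_identity:
  fixes u :: "real \<Rightarrow> 'h::{real_inner,banach,second_countable_topology}"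
  assumes p: "proper_functional \<phi>" and l: "lower_semicontinuous \<phi>" and chain: "chain_condition \<phi>"
    and prim: "L2_primitive 0 T u q"
    and ae: "AE t in lebesgue. 0 < t \<longrightarrow> - q t \<in> strong_limiting_subdiff \<phi> (u t)"
    and dom: "\<And>t. 0 \<le> t \<Longrightarrow> u t \<in> effective_domain \<phi>" and st: "0 \<le> s" "s \<le> t" "t \<le> T"
  shows "energy \<phi> (u t) = energy \<phi> (u s) - (LINT x:{s<..<t}|lebesgue. (norm (q x))\<^sup>2)"
proof -
  obtain C where C: "\<And>t. t \<in> {0..T} \<Longrightarrow> \<bar>energy \<phi> (u t)\<bar> \<le> C"
    using solution_energy_bounded[OF p l chain prim ae dom] by blast
  have "energy \<phi> (u t) - energy \<phi> (u s) = (LINT x:{s<..<t}|lebesgue. - q x \<bullet> q x)"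
  proof (rule subgradient_curve_chain_closed[OF chain strong_subgradient_curve[OF p l prim ae order_refl
    order_refl]])
    show "\<bar>\<phi> (u x)\<bar> \<le> ereal C" if "0 \<le> x" "x \<le> T" for x
      using C[of x] effective_domain_eq[OF p dom, of x] that
      by (metis abs_ereal.simps(1) atLeastAtMost_iff ereal_less_eq(3))
  qed (use st in auto)
  then show ?thesis
    unfolding set_lebesgue_integral_def by (simp add: power2_norm_eq_inner)
qed

section \<open>Limits of approximate solutions\<close>

lemma weakly_converges_unique_dense:
  fixes x y :: "'h::real_inner"
  assumes "closure E = UNIV" "\<And>e. e \<in> E \<Longrightarrow> x \<bullet> e = y \<bullet> e"
  shows "x = y"
proof -
  have "norm (x - y) \<le> 0" using assms by (subst norm_le_iff_inner_dense[OF assms(1)]) (simp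
    add: inner_diff_left)
  then show ?thesis by simp
qed

text \<open>An instance of Tychonoff's theorem, transferred from product topologies to the function
  type.\<close>

lemma compact_coordinatewise:
  fixes K :: "nat \<Rightarrow> 'a::topological_space set"
  assumes "\<And>j. compact (K j)"
  shows "compact {f :: nat \<Rightarrow> 'a. \<forall>j. f j \<in> K j}"
proof -
  have "compactin (product_topology (\<lambda>i. euclidean) UNIV) (PiE UNIV K)"
    unfolding compactin_PiE by (simp add: compactin_euclidean_iff assms)
  also have "PiE UNIV K = {f. \<forall>j. f j \<in> K j}"
    by (auto simp: PiE_def)
  finally show ?thesis by (simp add: euclidean_product_topology compactin_euclidean_iff)
qed

text \<open>Pairing with a dense sequence \<open>e\<close> maps bounded sets of vectors into compact
  boxes of real sequences, to which \<open>measurable_cluster_selection\<close> applies. A limit of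
  the coordinates comes from a weak limit by \<open>bounded_weakly_convergent\<close>, and the
  vector so determined is measurable by \<open>Pettis_measurability\<close>.\<close>

lemma weak_cluster_selection:
  fixes b :: "nat \<Rightarrow> 'x \<Rightarrow> 'h::{real_inner,banach,second_countable_topology}"
  assumes b: "\<And>n. b n \<in> borel_measurable M" and bd: "\<And>n x. x \<in> space M \<Longrightarrow> norm (b n x) \<le> R x"
  shows "\<exists>\<xi>. \<xi> \<in> borel_measurable M \<and> (\<forall>x\<in>space M. \<exists>r. strict_mono r \<and> weakly_converges (\<lambda>k.
    b (r k) x) (\<xi> x))"
proof -
  obtain D :: "'h set" where D: "countable D" "\<And>X. open X \<Longrightarrow> X \<noteq> {} \<Longrightarrow> \<exists>d\<in>D. d \<in> X"
    using countable_dense_setE by blast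
  have clD: "closure D = UNIV"
  proof -
    have "x \<in> closure D" for x
      unfolding closure_approachable
    proof (intro allI impI)
      fix e :: real assume "0 < e"
      then obtain d where "d \<in> D" "d \<in> ball x e" using D(2)[of "ball x e"] by auto
      then show "\<exists>y\<in>D. dist y x < e" by (auto simp: dist_commute)
    qed
    then show ?thesis by blast
  qed
  then have "D \<noteq> {}" by auto
  define e where "e = from_nat_into D"
  have re: "range e = D" using D(1) \<open>D \<noteq> {}\<close> by (simp add: e_def range_from_nat_into)
  define a where "a n x = (\<lambda>j. b n x \<bullet> e j)" for n x
  have ma: "a n \<in> borel_measurable M" for n
    unfolding a_def[abs_def] using b[of n]
    by (intro measurable_coordinatewise_then_product borel_measurable_inner) auto
  have "\<exists>C. compact C \<and> (\<forall>n. a n x \<in> C)" if "x \<in> space M" for x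
  proof (intro exI conjI allI)
    show "compact {f :: nat \<Rightarrow> real. \<forall>j. f j \<in> {- (R x * norm (e j))..R x * norm (e j)}}"
      by (rule compact_coordinatewise) simp
    have "\<bar>b n x \<bullet> e j\<bar> \<le> R x * norm (e j)" for n j
      using Cauchy_Schwarz_ineq2[of "b n x" "e j"] mult_right_mono[OF bd[OF that, of n]
        norm_ge_zero[of "e j"]] by linarith
    then show "a n x \<in> {f. \<forall>j. f j \<in> {- (R x * norm (e j))..R x * norm (e j)}}" for n
      by (auto simp: a_def abs_le_iff minus_le_iff)
  qed
  from measurable_cluster_selection[of a M, OF ma this] obtain x' where x': "x' \<in> borel_measurable M"
    "\<And>x. x \<in> space M \<Longrightarrow> \<exists>r. strict_mono r \<and> (\<lambda>k. a (r k) x) \<longlonglongrightarrow> x' x" by blast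
  have lim: "\<exists>r z. strict_mono r \<and> weakly_converges (\<lambda>k. b (r k) x) z \<and> (\<forall>j. z \<bullet> e j = x' x j)"
    if x: "x \<in> space M" for x
  proof -
    obtain r where r: "strict_mono r" "(\<lambda>k. a (r k) x) \<longlonglongrightarrow> x' x" using x'(2)[OF x] by blast
    have c: "(\<lambda>k. b (r k) x \<bullet> e j) \<longlonglongrightarrow> x' x j" for j
    proof -
      have "continuous_on UNIV (\<lambda>f :: nat \<Rightarrow> real. f j)" by simp
      then have "(\<lambda>k. a (r k) x j) \<longlonglongrightarrow> x' x j"
        by (rule continuous_on_tendsto_compose[OF _ r(2)]) auto
      then show ?thesis by (simp add: a_def)
    qed
    have "\<exists>z. weakly_converges (\<lambda>k. b (r k) x) z"
    proof (rule bounded_weakly_convergent[OF bd[OF x] clD])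
      fix d assume "d \<in> D"
      then obtain j where "d = e j" using re by auto
      then show "convergent (\<lambda>k. b (r k) x \<bullet> d)" using c convergent_def by blast
    qed
    then obtain z where z: "weakly_converges (\<lambda>k. b (r k) x) z" by blast
    have "z \<bullet> e j = x' x j" for j
      using z c LIMSEQ_unique unfolding weakly_converges_def by blast
    then show ?thesis using r(1) z by blast
  qed
  \<comment> \<open>On the space of \<open>M\<close> such a vector exists, and density of the
    \<open>e j\<close> makes it unique, so the choice is harmless.\<close>
  define \<xi> where "\<xi> x = (SOME z. \<forall>j. z \<bullet> e j = x' x j)" for x
  have \<xi>: "\<xi> x \<bullet> e j = x' x j" if "x \<in> space M" for x j
  proof -
    have "\<exists>z. \<forall>j. z \<bullet> e j = x' x j" using lim[OF that] by blast
    from someI_ex[OF this] show ?thesis unfolding \<xi>_def by blast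
  qed
  have "\<xi> \<in> borel_measurable M"
  proof (rule Pettis_measurability[OF clD D(1)])
    fix d assume "d \<in> D"
    then obtain j where j: "d = e j" using re by auto
    have "(\<lambda>x. x' x j) \<in> borel_measurable M" using x'(1) by (rule measurable_product_then_coordinatewise)
    then show "(\<lambda>x. \<xi> x \<bullet> d) \<in> borel_measurable M"
      using \<xi> unfolding j by (simp cong: measurable_cong)
  qed
  moreover have "\<exists>r. strict_mono r \<and> weakly_converges (\<lambda>k. b (r k) x) (\<xi> x)" if x: "x \<in> space M" for x
  proof -
    obtain r z where rz: "strict_mono r" "weakly_converges (\<lambda>k. b (r k) x) z" "\<And>j. z \<bullet> e j = x' x j"
      using lim[OF x] by blast
    have "z = \<xi> x" by (rule weakly_converges_unique_dense[OF clD]) (use rz(3) \<xi>[OF x] re in force)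
    then show ?thesis using rz by blast
  qed
  ultimately show ?thesis by blast
qed

text \<open>The cluster point is selected along indices at which the norm nearly attains its liminf,
  so that the norms along the final subsequence converge to that liminf. An arbitrary weak cluster
  point would not come with this information.\<close>

lemma weak_limit_selection:
  fixes \<zeta> :: "nat \<Rightarrow> 'x \<Rightarrow> 'h::{real_inner,banach,second_countable_topology}"
  assumes \<zeta>: "\<And>n. \<zeta> n \<in> borel_measurable M"
  defines "L \<equiv> \<lambda>x. liminf (\<lambda>n. ennreal (norm (\<zeta> n x)))"
  shows "\<exists>\<xi>. \<xi> \<in> borel_measurable M \<and> (\<forall>x\<in>space M. L x < \<infinity> \<longrightarrow> norm (\<xi> x) \<le> enn2real (L x) \<and>
     (\<exists>r. filterlim r at_top sequentially \<and> weakly_converges (\<lambda>k. \<zeta> (r k) x) (\<xi> x) \<and> (\<lambda>k. norm (\<zeta> (r k) x)) \<longlonglongrightarrow>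
       enn2real (L x)))"
proof -
  note \<zeta>[measurable]
  have mL[measurable]: "L \<in> borel_measurable M" unfolding L_def by measurable
  define l where "l x = enn2real (L x)" for x
  have ml[measurable]: "l \<in> borel_measurable M" unfolding l_def by measurable
  \<comment> \<open>An index from \<open>k\<close> on at which the norm is at most the liminf plus 1
    / (k + 1); taking the least one keeps the choice measurable.\<close>
  define s where "s k x = (LEAST n. k \<le> n \<and> norm (\<zeta> n x) \<le> l x + 1 / real (Suc k))" for k x
  have ms[measurable]: "s k \<in> M \<rightarrow>\<^sub>M count_space UNIV" for k unfolding s_def by measurable
  \<comment> \<open>Where the liminf is infinite the sequence is replaced by 0, which keeps it
    bounded at every point.\<close>
  define b where "b k x = (if L x < \<infinity> then \<zeta> (s k x) x else 0)" for k x
  have mb: "b k \<in> borel_measurable M" for k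
  proof -
    have "(\<lambda>x. \<zeta> (s k x) x) \<in> borel_measurable M" by (rule measurable_compose_countable[OF \<zeta> ms])
    then show ?thesis unfolding b_def[abs_def] by measurable
  qed
  have s: "k \<le> s k x \<and> norm (\<zeta> (s k x) x) \<le> l x + 1 / real (Suc k)" if "L x < \<infinity>" for k x
  proof -
    have "\<exists>n\<ge>k. ennreal (norm (\<zeta> n x)) < ennreal (l x + 1 / real (Suc k))"
    proof (rule ccontr)
      assume "\<not> ?thesis"
      then have "\<forall>\<^sub>F n in sequentially. ennreal (l x + 1 / real (Suc k)) \<le> ennreal (norm (\<zeta> n x))"
        by (auto simp: eventually_sequentially not_less)
      then have "ennreal (l x + 1 / real (Suc k)) \<le> L x" unfolding L_def by (rule Liminf_bounded)
      moreover have "L x = ennreal (l x)" using that by (simp add: l_def)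
      moreover have "0 \<le> l x" by (simp add: l_def)
      ultimately show False by (simp add: ennreal_le_iff2)
    qed
    then have "\<exists>n. k \<le> n \<and> norm (\<zeta> n x) \<le> l x + 1 / real (Suc k)"
      by (metis ennreal_less_iff less_imp_le norm_ge_zero)
    from LeastI_ex[OF this] show ?thesis unfolding s_def .
  qed
  have "norm (b k x) \<le> l x + 1" for k x
  proof (cases "L x < \<infinity>")
    case True
    have "1 / real (Suc k) \<le> 1" by simp
    then have "norm (\<zeta> (s k x) x) \<le> l x + 1" using s[OF True, of k] by linarith
    then show ?thesis using True by (simp add: b_def)
  qed (simp add: b_def l_def)
  from weak_cluster_selection[of b M, OF mb this] obtain \<xi> where \<xi>: "\<xi> \<in> borel_measurable M"
    "\<And>x. x \<in> space M \<Longrightarrow> \<exists>r. strict_mono r \<and> weakly_converges (\<lambda>k. b (r k) x) (\<xi> x)" by blast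
  have "norm (\<xi> x) \<le> l x \<and>
     (\<exists>r. filterlim r at_top sequentially \<and> weakly_converges (\<lambda>k. \<zeta> (r k) x) (\<xi> x) \<and> (\<lambda>k. norm (\<zeta> (r k) x)) \<longlonglongrightarrow>
       l x)"
    if x: "x \<in> space M" and fin: "L x < \<infinity>" for x
  proof -
    obtain r where r: "strict_mono r" "weakly_converges (\<lambda>k. b (r k) x) (\<xi> x)" using \<xi>(2)[OF x] by blast
    define r' where "r' k = s (r k) x" for k
    have ge: "k \<le> r' k" for k using s[OF fin, of "r k"] seq_suble[OF r(1), of k] unfolding r'_def by linarith
    have inf: "filterlim r' at_top sequentially"
      by (rule filterlim_at_top_mono[OF filterlim_ident]) (use ge in simp)
    have w: "weakly_converges (\<lambda>k. \<zeta> (r' k) x) (\<xi> x)" using r(2) fin by (simp add: b_def r'_def)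
    have up: "norm (\<zeta> (r' k) x) \<le> l x + 1 / real (Suc k)" for k
    proof -
      have "1 / real (Suc (r k)) \<le> 1 / real (Suc k)" using seq_suble[OF r(1), of k] by (simp add: frac_le)
      then show ?thesis using s[OF fin, of "r k"] unfolding r'_def by linarith
    qed
    have lim: "(\<lambda>k. norm (\<zeta> (r' k) x)) \<longlonglongrightarrow> l x"
    proof (rule order_tendstoI)
      fix y assume "y < l x"
      show "\<forall>\<^sub>F k in sequentially. y < norm (\<zeta> (r' k) x)"
      proof (cases "y < 0")
        case False
        have "L x = ennreal (l x)" using fin by (simp add: l_def)
        moreover have "ennreal y < ennreal (l x)" using \<open>y < l x\<close> False by (simp add: ennreal_less_iff)
        ultimately have "ennreal y < L x" by (simp only:)
        then have "\<forall>\<^sub>F n in sequentially. ennreal y < ennreal (norm (\<zeta> n x))" unfolding L_def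
          by (rule less_LiminfD)
        then have "\<forall>\<^sub>F k in sequentially. ennreal y < ennreal (norm (\<zeta> (r' k) x))"
          by (rule eventually_compose_filterlim[OF _ inf])
        then show ?thesis using False by (simp add: ennreal_less_iff)
      qed (simp add: less_le_trans)
    next
      fix y assume "l x < y"
      have "(\<lambda>k. l x + 1 / real (Suc k)) \<longlonglongrightarrow> l x + 0"
        by (intro tendsto_add tendsto_const LIMSEQ_Suc[OF lim_1_over_n])
      then have "\<forall>\<^sub>F k in sequentially. l x + 1 / real (Suc k) < y" by (rule order_tendstoD)
        (use \<open>l x < y\<close> in simp)
      then show "\<forall>\<^sub>F k in sequentially. norm (\<zeta> (r' k) x) < y"
        by eventually_elim (use up in \<open>auto intro: le_less_trans\<close>)
    qed
    have "norm (\<xi> x) \<le> l x"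
    proof (rule weakly_converges_norm_le[OF w])
      fix c assume "l x < c"
      then have "\<forall>\<^sub>F k in sequentially. norm (\<zeta> (r' k) x) < c" using lim by (rule order_tendstoD(2)[rotated])
      then have "\<forall>\<^sub>F k in sequentially. norm (\<zeta> (r' k) x) \<le> c" by eventually_elim simp
      then show "\<exists>\<^sub>F k in sequentially. norm (\<zeta> (r' k) x) \<le> c" by (rule eventually_frequently[rotated]) simp
    qed
    then show ?thesis using inf w lim by blast
  qed
  then show ?thesis using \<xi>(1) unfolding l_def by blast
qed

text \<open>In the expanded squared distance the mixed term converges by weak convergence and the
  square of the norm by assumption.\<close>

lemma weakly_converges_norm_imp_tendsto:
  fixes x :: "nat \<Rightarrow> 'h::real_inner"
  assumes "weakly_converges x y" "(\<lambda>k. norm (x k)) \<longlonglongrightarrow> norm y"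
  shows "x \<longlonglongrightarrow> y"
proof -
  have "(\<lambda>k. (norm (x k))\<^sup>2 - 2 * (x k \<bullet> y) + (norm y)\<^sup>2) \<longlonglongrightarrow> (norm y)\<^sup>2 - 2 * (y \<bullet> y) + (norm y)\<^sup>2"
    using assms(1) unfolding weakly_converges_def by (intro tendsto_add tendsto_diff tendsto_power assms(2)
      tendsto_mult tendsto_const) blast
  moreover have "(norm (x k))\<^sup>2 - 2 * (x k \<bullet> y) + (norm y)\<^sup>2 = (norm (x k - y))\<^sup>2" for k
    unfolding power2_norm_eq_inner by (simp add: inner_diff inner_commute)
  ultimately have "(\<lambda>k. (norm (x k - y))\<^sup>2) \<longlonglongrightarrow> 0" by (simp add: power2_norm_eq_inner)
  then have "(\<lambda>k. sqrt ((norm (x k - y))\<^sup>2)) \<longlonglongrightarrow> sqrt 0" by (rule tendsto_real_sqrt)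
  then show ?thesis by (simp add: tendsto_norm_zero_iff LIM_zero_iff)
qed

section \<open>Identification of the limit\<close>

text \<open>The energy inequality in the limit, combined with the chain rule for the selected weak
  limit \<open>\<xi>\<close>, gives a nonpositive integral of the nonnegative function
  \<open>f\<close>. Hence \<open>\<xi> = - q\<close>, its norm is the liminf \<open>g\<close>, and
  the inequality is an equality, which yields convergence of the energy at time \<open>T\<close>.
  The second conclusion assumes convergence at intermediate times because the first concerns the
  final time; it will be applied with every time as final time.\<close>

lemma limit_is_solution:
  fixes u :: "real \<Rightarrow> 'h::{real_inner,banach,second_countable_topology}"
  assumes p: "proper_functional \<phi>" and l: "lower_semicontinuous \<phi>" and chain: "chain_condition \<phi>"
    and prim: "L2_primitive 0 T u q" and T: "T > 0"
    and \<zeta>: "\<And>n. \<zeta> n \<in> borel_measurable lebesgue"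
    and sub: "AE t in lebesgue. 0 < t \<longrightarrow> (\<forall>n. \<zeta> n t \<in> strong_limiting_subdiff \<phi> (w n t))"
    and w: "\<And>t. 0 \<le> t \<Longrightarrow> t \<le> T \<Longrightarrow> (\<lambda>n. w n t) \<longlonglongrightarrow> u t"
    and dom: "\<And>n t. 0 \<le> t \<Longrightarrow> w n t \<in> effective_domain \<phi>"
    and u0: "u 0 \<in> effective_domain \<phi>"
    and bd: "\<And>n t. 0 \<le> t \<Longrightarrow> energy \<phi> (w n t) \<le> B"
    and G: "(\<integral>\<^sup>+x\<in>{0<..<T}. (liminf (\<lambda>n. ennreal (norm (\<zeta> n x))))\<^sup>2 \<partial>lebesgue) \<le> ennreal G" "0 \<le> G"
    and E: "\<And>c. energy \<phi> (u 0) - (LINT x:{0<..<T}|lebesgue. (norm (q x))\<^sup>2) / 2 - G / 2 < c \<Longrightarrow>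
        \<forall>\<^sub>F n in sequentially. energy \<phi> (w n T) \<le> c"
  shows "(\<lambda>n. energy \<phi> (w n T)) \<longlonglongrightarrow> energy \<phi> (u T)"
    and "AE t in lebesgue. 0 < t \<and> t < T \<longrightarrow> (\<lambda>n. energy \<phi> (w n t)) \<longlonglongrightarrow> energy \<phi> (u t) \<longrightarrow>
       - q t \<in> strong_limiting_subdiff \<phi> (u t)"
proof -
  define L where "L x = liminf (\<lambda>n. ennreal (norm (\<zeta> n x)))" for x
  define g where "g x = enn2real (L x)" for x
  define Q where "Q = (LINT x:{0<..<T}|lebesgue. (norm (q x))\<^sup>2)"
  have T': "0 \<le> T" "T \<le> T" using T by auto
  note \<zeta>[measurable]
  have mL[measurable]: "L \<in> borel_measurable lebesgue" unfolding L_def[abs_def] by measurable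
  have mg[measurable]: "g \<in> borel_measurable lebesgue" unfolding g_def[abs_def] by measurable
  have en: "\<phi> (w n t) = ereal (energy \<phi> (w n t))" if "0 \<le> t" for n t
    using effective_domain_eq[OF p dom[OF that]] .
  have le: "\<phi> (u t) \<le> ereal c" if "0 \<le> t" "t \<le> T" "\<forall>\<^sub>F n in sequentially. energy \<phi> (w n t) \<le> c" for t c
  proof (rule lower_semicontinuous_le[OF l w[OF that(1,2)]])
    show "\<forall>\<^sub>F n in sequentially. \<phi> (w n t) \<le> ereal c"
      using that(3) by eventually_elim (metis en[OF that(1)] ereal_less_eq(3))
  qed simp
  have uB: "\<phi> (u t) \<le> ereal B" if "0 \<le> t" "t \<le> T" for t by (rule le[OF that]) (use bd that in simp)
  have udom: "u t \<in> effective_domain \<phi>" if "0 \<le> t" "t \<le> T" for t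
    using uB[OF that] by (auto simp: effective_domain_def)
  have eu: "\<phi> (u t) = ereal (energy \<phi> (u t))" if "0 \<le> t" "t \<le> T" for t
    using effective_domain_eq[OF p udom[OF that]] .
  have upper: "energy \<phi> (u T) \<le> energy \<phi> (u 0) - Q / 2 - G / 2"
  proof (rule field_le_epsilon)
    fix e :: real assume "0 < e"
    then have "\<forall>\<^sub>F n in sequentially. energy \<phi> (w n T) \<le> energy \<phi> (u 0) - Q / 2 - G / 2 + e"
      unfolding Q_def by (intro E) simp
    from le[OF T' this] eu[OF T'] show "energy \<phi> (u T) \<le> energy \<phi> (u 0) - Q / 2 - G / 2 + e"
      by (metis ereal_less_eq(3))
  qed
  obtain \<xi> where m\<xi>[measurable]: "\<xi> \<in> borel_measurable lebesgue"
    and \<xi>0: "\<forall>x\<in>space lebesgue. L x < \<infinity> \<longrightarrow> norm (\<xi> x) \<le> enn2real (L x) \<and>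
      (\<exists>r. filterlim r at_top sequentially \<and> weakly_converges (\<lambda>k. \<zeta> (r k) x) (\<xi> x) \<and> (\<lambda>k. norm (\<zeta> (r k) x)) \<longlonglongrightarrow>
        enn2real (L x))"
    using weak_limit_selection[of \<zeta> lebesgue, OF \<zeta>] unfolding L_def by blast
  have \<xi>: "norm (\<xi> x) \<le> g x" "\<exists>r. filterlim r at_top sequentially \<and> weakly_converges (\<lambda>k. \<zeta> (r k) x) (\<xi> x) \<and>
    (\<lambda>k. norm (\<zeta> (r k) x)) \<longlonglongrightarrow> g x"
    if "L x < \<infinity>" for x using \<xi>0 that unfolding g_def by auto
  have fin: "AE x in lebesgue. 0 < x \<and> x < T \<longrightarrow> L x < \<infinity>"
  proof -
    have "(\<integral>\<^sup>+x. (L x)\<^sup>2 * indicator {0<..<T} x \<partial>lebesgue) \<noteq> \<infinity>"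
      using G(1) unfolding L_def by (auto simp: top_unique)
    then have "AE x in lebesgue. (L x)\<^sup>2 * indicator {0<..<T} x \<noteq> \<infinity>"
      by (intro nn_integral_noteq_infinite borel_measurable_times_ennreal borel_measurable_power_ennreal
        borel_measurable_indicator mL) auto
    then show ?thesis by eventually_elim (auto simp: less_top power2_eq_square ennreal_mult_eq_top_iff)
  qed
  have Lg: "L x = ennreal (g x)" if "L x < \<infinity>" for x using that by (simp add: g_def)
  have ig: "set_integrable lebesgue {0<..<T} (\<lambda>x. (g x)\<^sup>2)" "(LINT x:{0<..<T}|lebesgue. (g x)\<^sup>2) \<le> G"
  proof -
    have "(\<integral>\<^sup>+x. ennreal (indicat_real {0<..<T} x *\<^sub>R (g x)\<^sup>2) \<partial>lebesgue) = (\<integral>\<^sup>+x\<in>{0<..<T}.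
      (L x)\<^sup>2 \<partial>lebesgue)"
    proof (rule nn_integral_cong_AE)
      show "AE x in lebesgue. ennreal (indicat_real {0<..<T} x *\<^sub>R (g x)\<^sup>2) = (L x)\<^sup>2 * indicator {0<..<T} x"
        using fin
      proof eventually_elim
        case (elim x)
        show ?case
        proof (cases "x \<in> {0<..<T}")
          case True
          then have "L x = ennreal (g x)" using elim by (intro Lg) auto
          moreover have "0 \<le> g x" by (simp add: g_def)
          ultimately have "(L x)\<^sup>2 = ennreal ((g x)\<^sup>2)" by (simp only: ennreal_power)
          then show ?thesis using True by simp
        qed simp
      qed
    qed
    also have "\<dots> \<le> ennreal G" using G(1) unfolding L_def .
    finally have nn: "(\<integral>\<^sup>+x. ennreal (indicat_real {0<..<T} x *\<^sub>R (g x)\<^sup>2) \<partial>lebesgue) \<le> ennreal G" .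
    have i: "integrable lebesgue (\<lambda>x. indicat_real {0<..<T} x *\<^sub>R (g x)\<^sup>2)"
    proof (rule integrableI_nonneg)
      show "(\<lambda>x. indicat_real {0<..<T} x *\<^sub>R (g x)\<^sup>2) \<in> borel_measurable lebesgue"
        by (intro borel_measurable_scaleR borel_measurable_power borel_measurable_indicator mg) simp
      show "(\<integral>\<^sup>+x. ennreal (indicat_real {0<..<T} x *\<^sub>R (g x)\<^sup>2) \<partial>lebesgue) < \<infinity>"
        using nn by (rule le_less_trans) simp
    qed simp
    show "set_integrable lebesgue {0<..<T} (\<lambda>x. (g x)\<^sup>2)" using i unfolding set_integrable_def .
    show "(LINT x:{0<..<T}|lebesgue. (g x)\<^sup>2) \<le> G" using i nn G(2) unfolding set_lebesgue_integral_def
      by (subst (asm) nn_integral_eq_integral) auto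
  qed
  have Lq: "L2_fun 0 T q" using prim by (simp add: L2_primitive_def)
  have L\<xi>: "L2_fun 0 T \<xi>"
    unfolding L2_fun_iff_set
  proof
    show "set_borel_measurable lebesgue {0<..<T} \<xi>" unfolding set_borel_measurable_def
      by (intro borel_measurable_scaleR[OF _ m\<xi>] borel_measurable_indicator) simp
    show "set_integrable lebesgue {0<..<T} (\<lambda>t. (norm (\<xi> t))\<^sup>2)"
    proof (rule set_integrable_bound)
      show "set_integrable lebesgue {0<..<T} (\<lambda>x. (g x)\<^sup>2)" by (rule ig)
      show "set_borel_measurable lebesgue {0<..<T} (\<lambda>t. (norm (\<xi> t))\<^sup>2)" unfolding set_borel_measurable_def
        by (intro borel_measurable_scaleR borel_measurable_power measurable_compose[OF m\<xi>
          borel_measurable_norm] borel_measurable_indicator) simp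
      show "AE x\<in>{0<..<T} in lebesgue. norm ((norm (\<xi> x))\<^sup>2) \<le> norm ((g x)\<^sup>2)"
        using fin by eventually_elim (use \<xi>(1) in \<open>auto intro: power_mono\<close>)
    qed
  qed
  have weak: "AE t in lebesgue. 0 < t \<and> t < T \<longrightarrow> \<xi> t \<in> weak_limiting_subdiff \<phi> (u t)"
    using sub fin
  proof eventually_elim
    case (elim t)
    show ?case
    proof
    assume tt: "0 < t \<and> t < T"
    then have t: "0 \<le> t" "t \<le> T" "0 < t" "L t < \<infinity>" using elim by auto
    obtain r where r: "filterlim r at_top sequentially" "weakly_converges (\<lambda>k. \<zeta> (r k) t) (\<xi> t)"
      using \<xi>(2)[OF t(4)] by blast
    show "\<xi> t \<in> weak_limiting_subdiff \<phi> (u t)"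
    proof (rule strong_limiting_subdiff_weak_closure[OF p l, of "\<lambda>k. \<zeta> (r k) t" "\<lambda>k. w (r k) t"])
      show "(\<lambda>k. w (r k) t) \<longlonglongrightarrow> u t" by (rule filterlim_compose[OF w[OF t(1,2)] r(1)])
      show "\<phi> (w (r n) t) \<le> ereal B" for n using bd[OF t(1)] en[OF t(1)] by (metis ereal_less_eq(3))
    qed (use elim t r in auto)
    qed
  qed
  have curve: "subgradient_curve \<phi> 0 T u q \<xi>" unfolding subgradient_curve_def using prim L\<xi> weak by blast
  have cu: "continuous_on {0..T} u" by (rule L2_primitive_continuous[OF prim])
  \<comment> \<open>The curve is stopped at \<open>T\<close>, since
    \<open>energy_bounded_below\<close> refers to all later times.\<close>
  define u' where "u' t = u (min t T)" for t
  have "\<exists>m. \<forall>t\<in>{0..T}. m \<le> energy \<phi> (u' t)"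
  proof (rule energy_bounded_below[OF p l])
    show "continuous_on {0..T} u'" using cu by (rule continuous_on_eq) (auto simp: u'_def)
    show "u' t \<in> effective_domain \<phi>" if "0 \<le> t" for t unfolding u'_def using udom[of "min t T"] that T by simp
  qed
  then obtain m where "\<forall>t\<in>{0..T}. m \<le> energy \<phi> (u' t)" by blast
  then have m: "m \<le> energy \<phi> (u t)" if "0 \<le> t" "t \<le> T" for t using that unfolding u'_def
    by (metis atLeastAtMost_iff min.absorb1)
  define C where "C = \<bar>m\<bar> + \<bar>B\<bar>"
  have ubd: "\<bar>\<phi> (u t)\<bar> \<le> ereal C" if t: "0 \<le> t" "t \<le> T" for t
  proof -
    have "energy \<phi> (u t) \<le> B" using uB[OF t] eu[OF t] by (metis ereal_less_eq(3))
    then have "\<bar>energy \<phi> (u t)\<bar> \<le> C" using m[OF t] unfolding C_def by linarith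
    then show ?thesis using eu[OF t] by (metis abs_ereal.simps(1) ereal_less_eq(3))
  qed
  have id: "energy \<phi> (u T) - energy \<phi> (u 0) = (LINT x:{0<..<T}|lebesgue. \<xi> x \<bullet> q x)"
    by (rule subgradient_curve_chain_closed[OF chain curve ubd]) (use T in auto)
  \<comment> \<open>Equal to |q + \<xi>|^2 plus g^2 - |\<xi>|^2, two terms that are nonnegative
    almost everywhere on the interval; its integral measures the defect in the energy
    balance.\<close>
  define f where "f x = (norm (q x))\<^sup>2 + (g x)\<^sup>2 + 2 * (\<xi> x \<bullet> q x)" for x
  have i1: "set_integrable lebesgue {0<..<T} (\<lambda>x. (norm (q x))\<^sup>2)" using Lq by (simp add: L2_fun_iff_set)
  have i3: "set_integrable lebesgue {0<..<T} (\<lambda>x. 2 * (\<xi> x \<bullet> q x))"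
    by (intro set_integrable_mult_right L2_fun_set_integrable_inner Lq L\<xi>)
  have fi: "set_integrable lebesgue {0<..<T} f"
    unfolding f_def by (intro set_integral_add i1 ig i3)
  have fI: "(LINT x:{0<..<T}|lebesgue. f x) = Q + (LINT x:{0<..<T}|lebesgue.
    (g x)\<^sup>2) + 2 * (energy \<phi> (u T) - energy \<phi> (u 0))"
    unfolding f_def id Q_def
    using set_integral_add(2)[OF set_integral_add(1)[OF i1 ig(1)] i3] set_integral_add(2)[OF i1 ig(1)] by simp
  have f_ge: "AE x in lebesgue. 0 < x \<and> x < T \<longrightarrow> (norm (q x + \<xi> x))\<^sup>2 + ((g x)\<^sup>2 - (norm (\<xi> x))\<^sup>2) = f x \<and>
    (norm (\<xi> x))\<^sup>2 \<le> (g x)\<^sup>2"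
    using fin
  proof eventually_elim
    case (elim x)
    have "(norm (\<xi> x))\<^sup>2 \<le> (g x)\<^sup>2" if "0 < x \<and> x < T" by (rule power_mono) (use \<xi>(1) elim that in auto)
    moreover have "(norm (q x + \<xi> x))\<^sup>2 + ((g x)\<^sup>2 - (norm (\<xi> x))\<^sup>2) = f x"
      unfolding f_def power2_norm_eq_inner by (simp add: inner_add inner_commute)
    ultimately show ?case by blast
  qed
  have f_nonneg: "AE x in lebesgue. 0 \<le> indicat_real {0<..<T} x *\<^sub>R f x"
    using f_ge
  proof eventually_elim
    case (elim x)
    show ?case
    proof (cases "x \<in> {0<..<T}")
      case True
      then have "f x = (norm (q x + \<xi> x))\<^sup>2 + ((g x)\<^sup>2 - (norm (\<xi> x))\<^sup>2)" "0 \<le> (g x)\<^sup>2 - (norm (\<xi> x))\<^sup>2"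
        using elim by auto
      then show ?thesis using True by simp
    qed simp
  qed
  have f_le: "(LINT x:{0<..<T}|lebesgue. f x) \<le> 0" using fI ig(2) upper by argo
  have f0: "AE x in lebesgue. indicat_real {0<..<T} x *\<^sub>R f x = 0"
  proof -
    have i: "integrable lebesgue (\<lambda>x. indicat_real {0<..<T} x *\<^sub>R f x)" using fi
      by (simp add: set_integrable_def)
    have "(LINT x|lebesgue. indicat_real {0<..<T} x *\<^sub>R f x) = 0"
      using integral_nonneg_AE[OF f_nonneg] f_le unfolding set_lebesgue_integral_def by linarith
    then show ?thesis using integral_nonneg_eq_0_iff_AE[OF i f_nonneg] by blast
  qed
  have eq: "AE x in lebesgue. 0 < x \<and> x < T \<longrightarrow> \<xi> x = - q x \<and> g x = norm (\<xi> x)"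
    using f0 f_ge
  proof eventually_elim
    case (elim x)
    show ?case
    proof
    assume "0 < x \<and> x < T"
    with elim have "f x = 0" "(norm (q x + \<xi> x))\<^sup>2 + ((g x)\<^sup>2 - (norm (\<xi> x))\<^sup>2) = f x"
      "0 \<le> (g x)\<^sup>2 - (norm (\<xi> x))\<^sup>2" by auto
    then have "(norm (q x + \<xi> x))\<^sup>2 = 0" "(g x)\<^sup>2 = (norm (\<xi> x))\<^sup>2"
      using zero_le_power2[of "norm (q x + \<xi> x)"] by linarith+
    moreover have "0 \<le> g x" by (simp add: g_def)
    ultimately show "\<xi> x = - q x \<and> g x = norm (\<xi> x)"
      by (simp add: eq_neg_iff_add_eq_0 add.commute power2_eq_iff_nonneg)
    qed
  qed
  \<comment> \<open>The reverse of \<open>upper\<close>: the upper bound supplied by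
    \<open>E\<close> is the energy of the limit, and lower semicontinuity gives the other half of
    the convergence.\<close>
  have low: "energy \<phi> (u 0) - Q / 2 - G / 2 \<le> energy \<phi> (u T)"
    using fI ig(2) integral_nonneg_AE[OF f_nonneg] unfolding set_lebesgue_integral_def by argo
  show "(\<lambda>n. energy \<phi> (w n T)) \<longlonglongrightarrow> energy \<phi> (u T)"
    proof (rule order_tendstoI)
      fix a assume "a < energy \<phi> (u T)"
      then have "ereal a < \<phi> (u T)" using eu[OF T'] by (metis ereal_less(1) less_ereal.simps(1))
      also have "\<phi> (u T) \<le> liminf (\<lambda>n. \<phi> (w n T))" by (rule lower_semicontinuous_sequentially[OF l w[OF T']])
      finally have "\<forall>\<^sub>F n in sequentially. ereal a < \<phi> (w n T)" by (rule less_LiminfD)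
      then show "\<forall>\<^sub>F n in sequentially. a < energy \<phi> (w n T)"
        by eventually_elim (metis en[OF T'(1)] less_ereal.simps(1))
    next
      fix a assume a: "energy \<phi> (u T) < a"
      define c where "c = (energy \<phi> (u T) + a) / 2"
      have c: "energy \<phi> (u T) < c" "c < a" using a by (auto simp: c_def)
      have "\<forall>\<^sub>F n in sequentially. energy \<phi> (w n T) \<le> c"
        by (rule E) (use low c in \<open>simp add: Q_def\<close>)
      then show "\<forall>\<^sub>F n in sequentially. energy \<phi> (w n T) < a" by eventually_elim (use c in simp)
    qed
  show "AE t in lebesgue. 0 < t \<and> t < T \<longrightarrow> (\<lambda>n. energy \<phi> (w n t)) \<longlonglongrightarrow> energy \<phi> (u t) \<longrightarrow>
       - q t \<in> strong_limiting_subdiff \<phi> (u t)"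
    using sub fin eq
  proof eventually_elim
    case (elim t)
    show ?case
    proof (intro impI)
    assume "0 < t \<and> t < T" and econv: "(\<lambda>n. energy \<phi> (w n t)) \<longlonglongrightarrow> energy \<phi> (u t)"
    with elim have t: "0 \<le> t" "t \<le> T" "0 < t" "L t < \<infinity>" "\<xi> t = - q t" "g t = norm (\<xi> t)" by auto
    obtain r where r: "filterlim r at_top sequentially" "weakly_converges (\<lambda>k. \<zeta> (r k) t) (\<xi> t)"
      "(\<lambda>k. norm (\<zeta> (r k) t)) \<longlonglongrightarrow> g t" using \<xi>(2)[OF t(4)] by blast
    have "\<xi> t \<in> strong_limiting_subdiff \<phi> (u t)"
    proof (rule strong_limiting_subdiff_closed[OF p, of "\<lambda>k. \<zeta> (r k) t" "\<lambda>k. w (r k) t"])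
      show "(\<lambda>k. w (r k) t) \<longlonglongrightarrow> u t" by (rule filterlim_compose[OF w[OF t(1,2)] r(1)])
      show "(\<lambda>k. energy \<phi> (w (r k) t)) \<longlonglongrightarrow> energy \<phi> (u t)" by (rule filterlim_compose[OF econv r(1)])
      show "(\<lambda>k. \<zeta> (r k) t) \<longlonglongrightarrow> \<xi> t"
        by (rule weakly_converges_norm_imp_tendsto[OF r(2)]) (use r(3) t(6) in simp)
      show "u t \<in> effective_domain \<phi>" by (rule udom[OF t(1,2)])
      show "\<zeta> (r n) t \<in> strong_limiting_subdiff \<phi> (w (r n) t)" for n using elim t by blast
    qed
    then show "- q t \<in> strong_limiting_subdiff \<phi> (u t)" using t(5) by simp
    qed
  qed
qed

section \<open>A priori bounds and compactness of approximate solutions\<close>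

text \<open>Compactness of a countable product takes the place of a diagonal argument.\<close>

lemma pointwise_convergent_subsequence:
  fixes f :: "nat \<Rightarrow> nat \<Rightarrow> 'a::metric_space"
  assumes K: "\<And>j. compact (K j)" and f: "\<And>n j. f n j \<in> K j"
  shows "\<exists>r. strict_mono r \<and> (\<forall>j. convergent (\<lambda>n. f (r n) j))"
proof -
  have "seq_compact {g :: nat \<Rightarrow> 'a. \<forall>j. g j \<in> K j}"
    by (intro compact_imp_seq_compact compact_coordinatewise K)
  moreover have "\<forall>n. f n \<in> {g. \<forall>j. g j \<in> K j}" using f by simp
  ultimately obtain l r where r: "strict_mono r" "(f \<circ> r) \<longlonglongrightarrow> l" by (rule seq_compactE)
  have "(\<lambda>n. f (r n) j) \<longlonglongrightarrow> l j" for j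
  proof -
    have "continuous_on UNIV (\<lambda>g :: nat \<Rightarrow> 'a. g j)" by simp
    from continuous_on_tendsto_compose[OF this r(2)] show ?thesis by simp
  qed
  then show ?thesis using r(1) unfolding convergent_def by blast
qed

text \<open>On a ball the quadratic term of the compactness condition is bounded, so a bounded
  sublevel of \<phi> is a closed part of a compact set.\<close>

lemma bounded_sublevel_compact:
  fixes \<phi> :: "'h::real_inner \<Rightarrow> ereal"
  assumes l: "lower_semicontinuous \<phi>" and comp: "comp_condition \<phi>"
  shows "compact {v. \<phi> v \<le> ereal C \<and> norm v \<le> R}"
proof -
  obtain \<kappa> where \<kappa>: "\<kappa> \<ge> 0" "\<And>c::real. compact {v. \<phi> v + ereal (\<kappa> * (norm v)\<^sup>2) \<le> ereal c}"
    using comp unfolding comp_condition_def by blast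
  have "closed {v. \<phi> v \<le> ereal C}"
    unfolding closed_sequential_limits
  proof (intro allI impI, elim conjE)
    fix x v assume "\<forall>n. x n \<in> {v. \<phi> v \<le> ereal C}" "x \<longlonglongrightarrow> v"
    then show "v \<in> {v. \<phi> v \<le> ereal C}" using lower_semicontinuous_le[OF l, of x v sequentially] by simp
  qed
  moreover have "closed {v::'h. norm v \<le> R}" by (intro closed_Collect_le continuous_intros)
  ultimately have cl: "closed ({v. \<phi> v \<le> ereal C} \<inter> {v. norm v \<le> R})" by (rule closed_Int)
  have eq: "{v. \<phi> v \<le> ereal C \<and> norm v \<le> R} = ({v. \<phi> v \<le> ereal C} \<inter> {v. norm v \<le> R}) \<inter> {v.
    \<phi> v + ereal (\<kappa> * (norm v)\<^sup>2) \<le> ereal (C + \<kappa> * R\<^sup>2)}"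
  proof -
    have "\<phi> v + ereal (\<kappa> * (norm v)\<^sup>2) \<le> ereal (C + \<kappa> * R\<^sup>2)" if "\<phi> v \<le> ereal C" "norm v \<le> R" for v
    proof -
      have "\<kappa> * (norm v)\<^sup>2 \<le> \<kappa> * R\<^sup>2" using that(2) \<kappa>(1) by (intro mult_left_mono power_mono) auto
      then have "\<phi> v + ereal (\<kappa> * (norm v)\<^sup>2) \<le> ereal C + ereal (\<kappa> * R\<^sup>2)" using that(1)
        by (intro add_mono) auto
      then show ?thesis by simp
    qed
    then show ?thesis by auto
  qed
  show ?thesis unfolding eq by (rule closed_Int_compact[OF cl \<kappa>(2)])
qed

lemma norm_add_sq_le:
  fixes a b :: "'h::real_inner"
  shows "(norm (a + b))\<^sup>2 \<le> 2 * (norm a)\<^sup>2 + 2 * (norm b)\<^sup>2"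
proof -
  have "0 \<le> (norm (a - b))\<^sup>2" by simp
  then show ?thesis unfolding power2_norm_eq_inner by (simp add: inner_add inner_diff inner_commute)
qed

text \<open>Absorbs a linear term into a square. This is how the linear lower bound on \<phi> is
  exploited: an energy estimate that itself depends on the distance travelled becomes a bound on
  this distance.\<close>

lemma quadratic_bound:
  fixes x :: real
  assumes "x\<^sup>2 \<le> c * (b + k * x)" "0 \<le> c" "0 \<le> b" "0 \<le> k"
  shows "x \<le> c * k + c * b + 1"
proof (rule ccontr)
  assume n: "\<not> ?thesis"
  have cb: "0 \<le> c * k" "0 \<le> c * b" using assms by auto
  then have x1: "1 < x" using n by linarith
  have "(c * k + c * b + 1) * x < x * x" using n x1 by (intro mult_strict_right_mono) auto
  moreover have "c * b * 1 \<le> c * b * x" using cb x1 by (intro mult_left_mono) auto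
  ultimately show False using assms(1) x1 by (simp add: power2_eq_square algebra_simps)
qed

text \<open>The two halves of a finite liminf. The half with \<open>\<exists>\<^sub>F\<close> serves
  the bounds on velocity and subgradients, the half with \<open>\<forall>\<^sub>F\<close> the energy
  inequality.\<close>

lemma real_liminf:
  fixes a :: "nat \<Rightarrow> real"
  assumes "\<And>n. 0 \<le> a n" "\<And>n. a n \<le> R"
  shows "\<exists>l\<ge>0. (\<forall>c>l. \<exists>\<^sub>F n in sequentially. a n \<le> c) \<and> (\<forall>c<l. \<forall>\<^sub>F n in sequentially. c < a n)"
proof -
  define L where "L = liminf (\<lambda>n. ereal (a n))"
  have "0 \<le> L" unfolding L_def by (rule Liminf_bounded) (use assms in simp)
  moreover have "L \<le> ereal R" unfolding L_def by (rule Liminf_le) (use assms in auto)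
  ultimately obtain l where l: "L = ereal l" "0 \<le> l" by (cases L) auto
  have "\<exists>\<^sub>F n in sequentially. a n \<le> c" if "l < c" for c
  proof (rule ccontr)
    assume "\<not> ?thesis"
    then have "\<forall>\<^sub>F n in sequentially. ereal c \<le> ereal (a n)" unfolding not_frequently by eventually_elim simp
    then have "ereal c \<le> L" unfolding L_def by (rule Liminf_bounded)
    then show False using that l by simp
  qed
  moreover have "\<forall>\<^sub>F n in sequentially. c < a n" if "c < l" for c
  proof -
    have "ereal c < L" using that l by simp
    then have "\<forall>\<^sub>F n in sequentially. ereal c < ereal (a n)" unfolding L_def by (rule less_LiminfD)
    then show ?thesis by simp
  qed
  ultimately show ?thesis using l(2) by blast
qed

lemma liminf_norm_power2_le:
  fixes z :: "nat \<Rightarrow> 'h::real_normed_vector"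
  shows "(liminf (\<lambda>n. ennreal (norm (z n))))\<^sup>2 \<le> liminf (\<lambda>n. (ennreal (norm (z n)))\<^sup>2)"
  unfolding le_Liminf_iff
proof (intro allI impI)
  fix y assume y: "y < (liminf (\<lambda>n. ennreal (norm (z n))))\<^sup>2"
  then obtain y' where y': "y = ennreal y'" "0 \<le> y'" by (cases y) (auto simp: top.not_eq_extremum)
  have "ennreal (sqrt y') < liminf (\<lambda>n. ennreal (norm (z n)))"
  proof (rule ccontr)
    assume "\<not> ?thesis"
    then have "(liminf (\<lambda>n. ennreal (norm (z n))))\<^sup>2 \<le> (ennreal (sqrt y'))\<^sup>2"
      by (intro power_mono) (auto simp: not_less)
    also have "\<dots> = y" using y' by (simp add: ennreal_power)
    finally show False using y by simp
  qed
  then have "\<forall>\<^sub>F n in sequentially. ennreal (sqrt y') < ennreal (norm (z n))" by (rule less_LiminfD)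
  then show "\<forall>\<^sub>F n in sequentially. y < (ennreal (norm (z n)))\<^sup>2"
  proof eventually_elim
    case (elim n)
    then have "sqrt y' < norm (z n)" using y' by (simp add: ennreal_less_iff)
    then have "(sqrt y')\<^sup>2 < (norm (z n))\<^sup>2" using y' by (intro power_strict_mono) auto
    then show ?case using y' by (simp add: ennreal_power ennreal_less_iff)
  qed
qed

text \<open>Fatou's lemma: the windows \<open>{0<..<T - \<delta> n}\<close> exhaust the interval,
  and the factors \<open>\<kappa> n\<close> disappear in the limit.\<close>

lemma subgradient_liminf_bound:
  fixes \<zeta> :: "nat \<Rightarrow> real \<Rightarrow> 'h::{real_inner,banach,second_countable_topology}"
  assumes \<zeta>: "\<And>n. \<zeta> n \<in> borel_measurable lebesgue"
    and \<delta>: "\<delta> \<longlonglongrightarrow> 0" and \<kappa>: "\<kappa> \<longlonglongrightarrow> 1"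
    and b: "0 \<le> b" "\<And>c. b < c \<Longrightarrow> \<exists>\<^sub>F n in sequentially. \<beta> n \<le> c"
    and le: "\<And>n. ennreal (\<kappa> n) * (\<integral>\<^sup>+x\<in>{0<..<T - \<delta> n}. (ennreal (norm (\<zeta> n x)))\<^sup>2 \<partial>lebesgue) \<le> ennreal (\<beta> n)"
  shows "(\<integral>\<^sup>+x\<in>{0<..<T}. (liminf (\<lambda>n. ennreal (norm (\<zeta> n x))))\<^sup>2 \<partial>lebesgue) \<le> ennreal b"
proof -
  define I where "I n = (\<integral>\<^sup>+x\<in>{0<..<T - \<delta> n}. (ennreal (norm (\<zeta> n x)))\<^sup>2 \<partial>lebesgue)" for n
  have "(\<integral>\<^sup>+x\<in>{0<..<T}. (liminf (\<lambda>n. ennreal (norm (\<zeta> n x))))\<^sup>2 \<partial>lebesgue)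
      \<le> (\<integral>\<^sup>+x. liminf (\<lambda>n. (ennreal (norm (\<zeta> n x)))\<^sup>2 * indicator {0<..<T - \<delta> n} x) \<partial>lebesgue)"
  proof (rule nn_integral_mono)
    fix x :: real
    show "(liminf (\<lambda>n. ennreal (norm (\<zeta> n x))))\<^sup>2 * indicator {0<..<T} x \<le> liminf (\<lambda>n.
      (ennreal (norm (\<zeta> n x)))\<^sup>2 * indicator {0<..<T - \<delta> n} x)"
    proof (cases "x \<in> {0<..<T}")
      case True
      then have "\<forall>\<^sub>F n in sequentially. \<delta> n < T - x" using \<delta> by (intro order_tendstoD(2)) auto
      then have "\<forall>\<^sub>F n in sequentially. (ennreal (norm (\<zeta> n x)))\<^sup>2 * indicator {0<..<T - \<delta> n} x
        = (ennreal (norm (\<zeta> n x)))\<^sup>2"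
        by eventually_elim (use True in auto)
      from Liminf_eq[OF this] show ?thesis using liminf_norm_power2_le[of "\<lambda>n. \<zeta> n x"] True by simp
    qed simp
  qed
  also have "\<dots> \<le> liminf I" unfolding I_def
  proof (rule nn_integral_liminf)
    show "(\<lambda>x. (ennreal (norm (\<zeta> n x)))\<^sup>2 * indicator {0<..<T - \<delta> n} x) \<in> borel_measurable lebesgue" for n
      by (intro borel_measurable_times_ennreal borel_measurable_power_ennreal borel_measurable_indicator
          measurable_compose[OF measurable_compose[OF \<zeta> borel_measurable_norm] measurable_ennreal]) simp
  qed
  also have "\<dots> \<le> ennreal b"
  proof (rule ccontr)
    assume "\<not> liminf I \<le> ennreal b"
    then obtain c' where c': "ennreal b < c'" "c' < liminf I" using dense by (auto simp: not_le)
    then obtain c where c: "c' = ennreal c" "0 \<le> c" by (cases c') (auto simp: top.not_eq_extremum)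
    have bc: "b < c" using c' b(1) unfolding c by (simp add: ennreal_less_iff)
    \<comment> \<open>Strictly between \<open>b\<close> and \<open>c\<close>, so that
      \<open>C / c\<close> is below 1 and is eventually exceeded by
      \<open>\<kappa> n\<close>.\<close>
    define C where "C = (b + c) / 2"
    have C: "b < C" "C < c" "0 < c" using bc b(1) by (auto simp: C_def)
    have "\<forall>\<^sub>F n in sequentially. c' < I n" using c'(2) by (rule less_LiminfD)
    moreover have "\<forall>\<^sub>F n in sequentially. C / c < \<kappa> n" using \<kappa> C by (intro order_tendstoD(1)) auto
    ultimately have "\<forall>\<^sub>F n in sequentially. \<not> \<beta> n \<le> C"
    proof eventually_elim
      case (elim n)
      have "0 \<le> C / c" using C b(1) by simp
      then have k: "0 \<le> \<kappa> n" using elim(2) by linarith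
      have "ennreal C < ennreal (\<kappa> n * c)" using elim(2) C b(1)
        by (intro ennreal_lessI) (auto simp: field_simps intro: le_less_trans)
      also have "\<dots> = ennreal (\<kappa> n) * c'" using k c by (simp add: ennreal_mult)
      also have "\<dots> \<le> ennreal (\<kappa> n) * I n" using elim(1) by (intro mult_left_mono) auto
      also have "\<dots> \<le> ennreal (\<beta> n)" unfolding I_def by (rule le)
      finally show ?case using C b(1) by (auto simp: not_le ennreal_less_iff)
    qed
    then show False using b(2)[OF C(1)] by (simp add: frequently_def)
  qed
  finally show ?thesis .
qed

text \<open>For a fixed mesh \<open>h\<close> the Hoelder estimate is summed over the cells, where
  the increments of \<open>A\<close> telescope. The time error only produces the factor
  \<open>(h + \<delta> n) / h\<close>, which tends to 1 for this \<open>h\<close>, so the limit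
  bound does not depend on the mesh. The approximants \<open>U n\<close> are allowed to
  jump.\<close>

lemma limit_dyadic_bound:
  fixes U :: "nat \<Rightarrow> real \<Rightarrow> 'h::{real_inner,banach,second_countable_topology}"
  assumes T: "T > 0" and u: "continuous_on {0..T} u" "\<And>t. 0 \<le> t \<Longrightarrow> t \<le> T \<Longrightarrow> (\<lambda>n. U n t) \<longlonglongrightarrow> u t"
    and \<delta>: "\<delta> \<longlonglongrightarrow> 0" "\<And>n. 0 \<le> \<delta> n"
    and A: "\<And>n s t. 0 \<le> s \<Longrightarrow> s \<le> t \<Longrightarrow> A n s \<le> A n t" "\<And>n. A n 0 = 0"
    and hold: "\<And>n s t. 0 \<le> s \<Longrightarrow> s \<le> t \<Longrightarrow> (norm (U n t - U n s))\<^sup>2 \<le> (t - s + \<delta> n) * (A n t - A n s)"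
    and a: "0 \<le> a" "\<And>c. a < c \<Longrightarrow> \<exists>\<^sub>F n in sequentially. A n T \<le> c"
  shows "\<exists>p. L2_primitive 0 T u p \<and> (LINT x:{0<..<T}|lebesgue. (norm (p x))\<^sup>2) \<le> a"
proof (rule dyadic_bound_imp_L2_primitive[OF T u(1)])
  fix m :: nat
  define h where "h = T / 2 ^ m"
  have h: "h > 0" using T by (simp add: h_def)
  have hT: "real i * h \<le> T" if "i \<le> 2 ^ m" for i
  proof -
    have "real i \<le> 2 ^ m" using that by (metis of_nat_le_iff of_nat_numeral of_nat_power)
    then have "real i * h \<le> 2 ^ m * h" using h by (intro mult_right_mono) auto
    then show ?thesis by (simp add: h_def)
  qed
  define S where "S v = (\<Sum>i<2 ^ m. (norm (v (real (Suc i) * h) - v (real i * h)))\<^sup>2 / h)" for v :: "real \<Rightarrow> 'h"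
  have lim: "(\<lambda>n. S (U n)) \<longlonglongrightarrow> S u"
    unfolding S_def
  proof (intro tendsto_sum tendsto_divide tendsto_power tendsto_norm tendsto_diff tendsto_const)
    fix i assume "i \<in> {..<2 ^ m :: nat}"
    then have "real (Suc i) * h \<le> T" "real i * h \<le> T" by (auto intro!: hT simp del: of_nat_Suc)
    then show "(\<lambda>n. U n (real (Suc i) * h)) \<longlonglongrightarrow> u (real (Suc i) * h)" "(\<lambda>n. U n (real i * h)) \<longlonglongrightarrow> u (real i * h)"
      using h by (auto intro!: u(2) simp del: of_nat_Suc)
  qed (use h in simp)
  have SU: "S (U n) \<le> (h + \<delta> n) / h * A n T" for n
  proof -
    have "S (U n) \<le> (\<Sum>i<2 ^ m. (h + \<delta> n) / h * (A n (real (Suc i) * h) - A n (real i * h)))"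
      unfolding S_def
    proof (rule sum_mono)
      fix i
      have "(norm (U n (real (Suc i) * h) - U n (real i * h)))\<^sup>2
        \<le> (real (Suc i) * h - real i * h + \<delta> n) * (A n (real (Suc i) * h) - A n (real i * h))"
        by (rule hold) (use h in auto)
      also have "real (Suc i) * h - real i * h = h" by (simp add: algebra_simps)
      finally show "(norm (U n (real (Suc i) * h) - U n (real i * h)))\<^sup>2 / h
        \<le> (h + \<delta> n) / h * (A n (real (Suc i) * h) - A n (real i * h))"
        using h by (simp add: field_simps)
    qed
    also have "\<dots> = (h + \<delta> n) / h * (\<Sum>i<2 ^ m. A n (real (Suc i) * h) - A n (real i * h))"
      by (rule sum_distrib_left[symmetric])
    also have "(\<Sum>i<2 ^ m. A n (real (Suc i) * h) - A n (real i * h))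
      = A n (real (2 ^ m) * h) - A n (real 0 * h)"
      by (rule sum_lessThan_telescope)
    also have "\<dots> = A n T" using A(2) by (simp add: h_def)
    finally show ?thesis .
  qed
  have "S u \<le> a"
  proof (rule ccontr)
    assume "\<not> S u \<le> a"
    then obtain c where c: "a < c" "c < S u" using dense by (auto simp: not_le)
    define d where "d = (a + c) / 2"
    have d: "a < d" "d < c" "0 < d" using c a(1) by (auto simp: d_def)
    have "(\<lambda>n. (h + \<delta> n) / h * d) \<longlonglongrightarrow> (h + 0) / h * d" by (intro tendsto_intros \<delta>) (use h in simp)
    then have "\<forall>\<^sub>F n in sequentially. (h + \<delta> n) / h * d < c" by (rule order_tendstoD(2)) (use h d in simp)
    moreover have "\<forall>\<^sub>F n in sequentially. c < S (U n)" using lim c(2) by (rule order_tendstoD(1))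
    ultimately have "\<forall>\<^sub>F n in sequentially. \<not> A n T \<le> d"
    proof eventually_elim
      case (elim n)
      show ?case
      proof
        assume "A n T \<le> d"
        then have "(h + \<delta> n) / h * A n T \<le> (h + \<delta> n) / h * d" using h \<delta>(2)[of n]
          by (intro mult_left_mono) auto
        then show False using elim SU[of n] by linarith
      qed
    qed
    then show False using a(2)[OF d(1)] by (simp add: frequently_def)
  qed
  then show "(\<Sum>i<2 ^ m. (norm (u (0 + real (Suc i) * ((T - 0) / 2 ^ m)) - u (0 + real i * ((T - 0) / 2 ^
    m))))\<^sup>2 / ((T - 0) / 2 ^ m)) \<le> a"
    unfolding S_def h_def by simp
qed

text \<open>\<open>U\<close> carries the velocity bound, \<open>w\<close> the energy and the
  subgradients, and \<delta> bounds their distance in terms of the energy. Since \<open>A\<close>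
  and \<open>B\<close> share the dissipated energy, their liminfs may be taken separately and both
  halves survive in the limit inequality.\<close>

lemma approximate_solutions_converge:
  fixes U w \<zeta> :: "nat \<Rightarrow> real \<Rightarrow> 'h::{real_inner,banach,second_countable_topology}"
  assumes p: "proper_functional \<phi>" and l: "lower_semicontinuous \<phi>" and comp: "comp_condition \<phi>"
    and chain: "chain_condition \<phi>"
    and K: "K1 \<ge> 0" "K2 \<ge> 0" "\<And>u. \<phi> u \<ge> ereal (- K1 * norm u - K2)"
    and \<delta>: "\<And>n. 0 \<le> \<delta> n" "\<delta> \<longlonglongrightarrow> 0" and \<kappa>: "\<kappa> \<longlonglongrightarrow> 1"
    and E: "E \<longlonglongrightarrow> energy \<phi> u0" and u0: "u0 \<in> effective_domain \<phi>" and U0: "(\<lambda>n. U n 0) \<longlonglongrightarrow> u0"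
    and A: "\<And>n s t. 0 \<le> s \<Longrightarrow> s \<le> t \<Longrightarrow> A n s \<le> A n t" "\<And>n. A n 0 = 0"
    and B: "\<And>n t. 0 \<le> t \<Longrightarrow> 0 \<le> B n t"
    and hold: "\<And>n s t. 0 \<le> s \<Longrightarrow> s \<le> t \<Longrightarrow> (norm (U n t - U n s))\<^sup>2 \<le> (t - s + \<delta> n) * (A n t - A n s)"
    and en: "\<And>n t. 0 \<le> t \<Longrightarrow> energy \<phi> (w n t) + A n t / 2 + B n t / 2 \<le> E n"
    and dom: "\<And>n t. 0 \<le> t \<Longrightarrow> w n t \<in> effective_domain \<phi>"
    and near: "\<And>n t. 0 \<le> t \<Longrightarrow> (norm (w n t - U n t))\<^sup>2 \<le> 2 * \<delta> n * (E n - energy \<phi> (w n t))"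
    and \<zeta>: "\<And>n. \<zeta> n \<in> borel_measurable lebesgue"
    and sub: "AE t in lebesgue. 0 < t \<longrightarrow> (\<forall>n. \<zeta> n t \<in> strong_limiting_subdiff \<phi> (w n t))"
    and Bz: "\<And>n t. 0 \<le> t \<Longrightarrow> ennreal (\<kappa> n) * (\<integral>\<^sup>+x\<in>{0<..<t - \<delta> n}.
      (ennreal (norm (\<zeta> n x)))\<^sup>2 \<partial>lebesgue) \<le> ennreal (B n t)"
  shows "\<exists>r u q. strict_mono r \<and> u 0 = u0 \<and> (\<forall>T>0. L2_primitive 0 T u q) \<and>
     (AE t in lebesgue. 0 < t \<longrightarrow> - q t \<in> strong_limiting_subdiff \<phi> (u t)) \<and>
     (\<forall>t\<ge>0. u t \<in> effective_domain \<phi> \<and> (\<lambda>k. U (r k) t) \<longlonglongrightarrow> u t \<and> (\<lambda>k. energy \<phi> (w (r k) t)) \<longlonglongrightarrow> energy \<phi> (u t))"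
proof -
  obtain Em where Em: "\<And>n. E n \<le> Em" "0 \<le> Em"
  proof -
    obtain K where "\<And>n. norm (E n) \<le> K" using convergent_imp_Bseq[of E] E unfolding convergent_def Bseq_def
      by auto
    then show ?thesis using that[of "\<bar>K\<bar>"] by (metis abs_ge_self abs_ge_zero order_trans real_norm_def)
  qed
  obtain D where D: "\<And>n. \<delta> n \<le> D" "0 \<le> D"
  proof -
    obtain K where "\<And>n. norm (\<delta> n) \<le> K" using convergent_imp_Bseq[of \<delta>] \<delta> unfolding convergent_def Bseq_def
      by auto
    then show ?thesis using that[of "\<bar>K\<bar>"] by (metis abs_ge_self abs_ge_zero order_trans real_norm_def)
  qed
  obtain R0 where R0: "\<And>n. norm (U n 0) \<le> R0" "0 \<le> R0"
  proof -
    obtain K where "K > 0" "\<And>n. norm (U n 0) \<le> K" using convergent_imp_Bseq[of "\<lambda>n. U n 0"] U0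
      unfolding convergent_def Bseq_def by auto
    then show ?thesis using that[of K] by auto
  qed
  have eq: "\<phi> (w n t) = ereal (energy \<phi> (w n t))" if "0 \<le> t" for n t
    using effective_domain_eq[OF p dom[OF that]] .
  have lower: "- K1 * norm (w n t) - K2 \<le> energy \<phi> (w n t)" if "0 \<le> t" for n t
    using K(3)[of "w n t"] eq[OF that, of n] by (metis ereal_less_eq(3))
  have A0: "0 \<le> A n t" if "0 \<le> t" for n t using A(1)[of 0 t n] A(2)[of n] that by simp
  have gap: "0 \<le> E n - energy \<phi> (w n t)" "A n t \<le> 2 * (E n - energy \<phi> (w n t))"
    "B n t \<le> 2 * (E n - energy \<phi> (w n t))" if "0 \<le> t" for n t
    using en[OF that, of n] A0[OF that, of n] B[OF that, of n] by argo+
  have "\<exists>R\<ge>0. \<forall>n t. 0 \<le> t \<longrightarrow> t \<le> T \<longrightarrow> norm (w n t) \<le> R \<and> 2 * (E n - energy \<phi> (w n t)) \<le> R" if T: "0 \<le> T" for T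
  proof -
    \<comment> \<open>In |w - U n 0|^2 \<le> 2 |w - U|^2 + 2 |U - U n 0|^2 the squares on the right
      are at most \<open>2 * \<delta> n * g\<close> and \<open>2 * (t + \<delta> n) * g\<close>,
      where \<open>g\<close> is the energy gap. This gives the factor
      \<open>4 * t + 8 * \<delta> n\<close>.\<close>
    define c where "c = 4 * T + 8 * D"
    define b where "b = Em + K1 * R0 + K2"
    define R1 where "R1 = c * K1 + c * b + 1 + R0"
    have cb: "0 \<le> c" "0 \<le> b" using T D Em R0 K by (auto simp: c_def b_def)
    have R1: "0 \<le> R1" using cb K R0 by (simp add: R1_def)
    have w: "norm (w n t) \<le> R1" if t: "0 \<le> t" "t \<le> T" for n t
    proof -
      define x where "x = norm (w n t - U n 0)"
      define g where "g = E n - energy \<phi> (w n t)"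
      have g0: "0 \<le> g" using gap[OF t(1)] by (simp add: g_def)
      have "norm (w n t) \<le> x + R0" using norm_triangle_sub[of "w n t" "U n 0"] R0(1)[of n]
        by (simp add: x_def)
      then have "K1 * norm (w n t) \<le> K1 * (x + R0)" using K(1) by (rule mult_left_mono)
      then have g: "g \<le> b + K1 * x" using lower[OF t(1), of n] Em(1)[of n] unfolding g_def b_def
        by (simp add: algebra_simps)
      have "(norm (U n t - U n 0))\<^sup>2 \<le> (t + \<delta> n) * A n t" using hold[of 0 t n] t A(2)[of n] by simp
      also have "\<dots> \<le> (t + \<delta> n) * (2 * g)" using gap(2)[OF t(1), of n] t \<delta>(1)[of n] unfolding g_def
        by (intro mult_left_mono) auto
      finally have 1: "(norm (U n t - U n 0))\<^sup>2 \<le> (t + \<delta> n) * (2 * g)" .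
      have 2: "(norm (w n t - U n t))\<^sup>2 \<le> 2 * \<delta> n * g" using near[OF t(1), of n] by (simp add: g_def)
      have "x\<^sup>2 \<le> 2 * (norm (w n t - U n t))\<^sup>2 + 2 * (norm (U n t - U n 0))\<^sup>2"
        using norm_add_sq_le[of "w n t - U n t" "U n t - U n 0"] by (simp add: x_def)
      also have "\<dots> \<le> (4 * t + 8 * \<delta> n) * g" using 1 2 by (simp add: algebra_simps)
      also have "\<dots> \<le> c * g" using g0 t D(1)[of n] by (intro mult_right_mono) (auto simp: c_def)
      also have "\<dots> \<le> c * (b + K1 * x)" using g cb by (intro mult_left_mono) auto
      finally have "x \<le> c * K1 + c * b + 1" by (rule quadratic_bound) (use cb K in auto)
      then show ?thesis using \<open>norm (w n t) \<le> x + R0\<close> by (simp add: R1_def)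
    qed
    have "2 * (E n - energy \<phi> (w n t)) \<le> 2 * (Em + K1 * R1 + K2)" if t: "0 \<le> t" "t \<le> T" for n t
    proof -
      have "K1 * norm (w n t) \<le> K1 * R1" using w[OF t] K(1) by (rule mult_left_mono)
      then show ?thesis using lower[OF t(1), of n] Em(1)[of n] by simp
    qed
    then show ?thesis using w R1
      by (intro exI[of _ "max R1 (2 * (Em + K1 * R1 + K2))"]) (auto simp: le_max_iff_disj)
  qed
  then have "\<forall>T. \<exists>R. 0 \<le> T \<longrightarrow> 0 \<le> R \<and> (\<forall>n t. 0 \<le> t \<longrightarrow> t \<le> T \<longrightarrow> norm (w n t) \<le> R \<and>
    2 * (E n - energy \<phi> (w n t)) \<le> R)" by blast
  from choice[OF this] obtain R where R': "\<And>T. 0 \<le> T \<longrightarrow> 0 \<le> R T \<and> (\<forall>n t. 0 \<le> t \<longrightarrow> t \<le> T \<longrightarrow> norm (w n t) \<le> R T \<and>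
    2 * (E n - energy \<phi> (w n t)) \<le> R T)" by blast
  have R: "0 \<le> T \<Longrightarrow> 0 \<le> R T" "0 \<le> t \<Longrightarrow> t \<le> T \<Longrightarrow> norm (w n t) \<le> R T"
    "0 \<le> t \<Longrightarrow> t \<le> T \<Longrightarrow> 2 * (E n - energy \<phi> (w n t)) \<le> R T" for T t n
    using R'[of T] by auto
  have AR: "A n t \<le> R T" and BR: "B n t \<le> R T" and near': "(norm (w n t - U n t))\<^sup>2 \<le> \<delta> n * R T"
    if t: "0 \<le> t" "t \<le> T" for n t T
  proof -
    show "A n t \<le> R T" "B n t \<le> R T" using gap[OF t(1), of n] R(3)[OF t, of n] by linarith+
    have "\<delta> n * (2 * (E n - energy \<phi> (w n t))) \<le> \<delta> n * R T" using R(3)[OF t] \<delta>(1)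
      by (intro mult_left_mono) auto
    then show "(norm (w n t - U n t))\<^sup>2 \<le> \<delta> n * R T" using near[OF t(1), of n] by (simp add: algebra_simps)
  qed
  have holdR: "(norm (U n t - U n s))\<^sup>2 \<le> (t - s + \<delta> n) * R T" if st: "0 \<le> s" "s \<le> t" "t \<le> T" for n s t T
  proof -
    have "A n t - A n s \<le> R T" using AR[of t T n] A0[of s n] st by simp
    then have "(t - s + \<delta> n) * (A n t - A n s) \<le> (t - s + \<delta> n) * R T" using st \<delta>(1)[of n]
      by (intro mult_left_mono) auto
    then show ?thesis using hold[OF st(1,2), of n] by linarith
  qed
  have wEm: "energy \<phi> (w n t) \<le> Em" if "0 \<le> t" for n t using gap(1)[OF that, of n] Em(1)[of n] by linarith
  \<comment> \<open>Compactness is used at countably many times only; the common modulus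
    \<open>holdR\<close> carries convergence to all other times.\<close>
  define S where "S = {t :: real. t \<in> \<rat> \<and> 0 \<le> t}"
  have S: "countable S" "S \<noteq> {}" unfolding S_def using countable_rat by (auto intro: countable_subset[of _ \<rat>])
  define \<tau> where "\<tau> = from_nat_into S"
  have r\<tau>: "range \<tau> = S" using S by (simp add: \<tau>_def range_from_nat_into)
  have \<tau>0: "0 \<le> \<tau> j" for j using r\<tau> unfolding S_def by blast
  have "\<exists>r. strict_mono r \<and> (\<forall>j. convergent (\<lambda>n. w (r n) (\<tau> j)))"
  proof (rule pointwise_convergent_subsequence[of "\<lambda>j. {v. \<phi> v \<le> ereal Em \<and> norm v \<le> R (\<tau> j)}"])
    show "compact {v. \<phi> v \<le> ereal Em \<and> norm v \<le> R (\<tau> j)}" for j by (rule bounded_sublevel_compact[OF l comp])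
    show "w n (\<tau> j) \<in> {v. \<phi> v \<le> ereal Em \<and> norm v \<le> R (\<tau> j)}" for n j
    proof -
      have "\<phi> (w n (\<tau> j)) \<le> ereal Em" using eq[OF \<tau>0] wEm[OF \<tau>0] by (metis ereal_less_eq(3))
      then show ?thesis using R(2)[OF \<tau>0 order_refl] by simp
    qed
  qed
  then obtain r where r: "strict_mono r" "\<And>j. convergent (\<lambda>n. w (r n) (\<tau> j))" by blast
  have \<delta>r: "(\<lambda>n. \<delta> (r n)) \<longlonglongrightarrow> 0" using LIMSEQ_subseq_LIMSEQ[OF \<delta>(2) r(1)] by (simp add: comp_def)
  have convU: "convergent (\<lambda>n. U (r n) t)" if t: "0 \<le> t" for t
  proof -
    have "Cauchy (\<lambda>n. U (r n) t)"
    proof (rule metric_CauchyI)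
      fix e :: real assume "e > 0"
      define T where "T = t + 1"
      \<comment> \<open>Chosen so that \<open>2 * \<eta> * R T < (e / 6)\<^sup>2\<close>: moving
        from \<open>t\<close> to a nearby rational time, and there from \<open>U\<close> to
        \<open>w\<close>, then costs less than \<open>e / 6\<close> each.\<close>
      define \<eta> where "\<eta> = min 1 ((e / 6)\<^sup>2 / (4 * (R T + 1)))"
      have RT: "0 \<le> R T" using R(1) t by (simp add: T_def)
      have \<eta>: "0 < \<eta>" "\<eta> \<le> 1" "2 * \<eta> * R T < (e / 6)\<^sup>2"
      proof -
        show "0 < \<eta>" "\<eta> \<le> 1" using \<open>e > 0\<close> RT by (auto simp: \<eta>_def)
        have "\<eta> \<le> (e / 6)\<^sup>2 / (4 * (R T + 1))" by (simp add: \<eta>_def)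
        then have "\<eta> * (4 * (R T + 1)) \<le> (e / 6)\<^sup>2" using RT by (simp add: pos_le_divide_eq)
        moreover have "2 * \<eta> * R T < \<eta> * (4 * (R T + 1))" using \<open>0 < \<eta>\<close> RT
          by (simp add: algebra_simps add_pos_nonneg)
        ultimately show "2 * \<eta> * R T < (e / 6)\<^sup>2" by linarith
      qed
      obtain x where x: "x \<in> \<rat>" "t < x" "x < t + \<eta>" using Rats_dense_in_real[of t "t + \<eta>"] \<eta>(1) by auto
      then have "x \<in> range \<tau>" using t unfolding r\<tau> S_def by auto
      then obtain j where j: "x = \<tau> j" by blast
      have xT: "0 \<le> x" "x \<le> T" using x t \<eta>(2) by (auto simp: T_def)
      have "\<forall>\<^sub>F n in sequentially. \<delta> (r n) < \<eta>" using \<delta>r \<eta>(1) by (rule order_tendstoD(2))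
      then obtain N1 where N1: "\<And>n. n \<ge> N1 \<Longrightarrow> \<delta> (r n) < \<eta>" by (auto simp: eventually_sequentially)
      obtain N2 where N2: "\<And>m n. m \<ge> N2 \<Longrightarrow> n \<ge> N2 \<Longrightarrow> dist (w (r m) x) (w (r n) x) < e / 3"
        using convergent_Cauchy[OF r(2)[of j]] \<open>e > 0\<close> unfolding j Cauchy_def
          by (meson divide_pos_pos zero_less_numeral)
      have near_x: "dist (U (r n) t) (w (r n) x) < e / 3" if "n \<ge> N1" for n
      proof -
        have "(norm (U (r n) x - U (r n) t))\<^sup>2 \<le> (x - t + \<delta> (r n)) * R T" by (rule holdR) (use x t xT in auto)
        also have "\<dots> \<le> (2 * \<eta>) * R T" using x N1[OF that] RT by (intro mult_right_mono) auto
        finally have "(norm (U (r n) x - U (r n) t))\<^sup>2 < (e / 6)\<^sup>2" using \<eta>(3) by linarith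
        then have 1: "norm (U (r n) x - U (r n) t) < e / 6" by (rule power_less_imp_less_base)
          (use \<open>e > 0\<close> in simp)
        have "(norm (w (r n) x - U (r n) x))\<^sup>2 \<le> \<delta> (r n) * R T" by (rule near'[OF xT])
        also have "\<dots> \<le> (2 * \<eta>) * R T" using N1[OF that] RT \<eta>(1) by (intro mult_right_mono) auto
        finally have "(norm (w (r n) x - U (r n) x))\<^sup>2 < (e / 6)\<^sup>2" using \<eta>(3) by linarith
        then have 2: "norm (w (r n) x - U (r n) x) < e / 6" by (rule power_less_imp_less_base)
          (use \<open>e > 0\<close> in simp)
        show ?thesis using 1 2 dist_triangle[of "U (r n) t" "w (r n) x" "U (r n) x"]
          by (simp add: dist_norm norm_minus_commute)
      qed
      show "\<exists>M. \<forall>m\<ge>M. \<forall>n\<ge>M. dist (U (r m) t) (U (r n) t) < e"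
      proof (intro exI[of _ "max N1 N2"] allI impI)
        fix m n assume mn: "max N1 N2 \<le> m" "max N1 N2 \<le> n"
        have "dist (U (r m) t) (w (r m) x) < e / 3" "dist (U (r n) t) (w (r n) x) < e / 3"
          "dist (w (r m) x) (w (r n) x) < e / 3"
          using near_x[of m] near_x[of n] N2[of m n] mn by auto
        then show "dist (U (r m) t) (U (r n) t) < e"
          using dist_triangle[of "U (r m) t" "U (r n) t" "w (r m) x"] dist_triangle[of "w (r m) x" "U (r n) t"
            "w (r n) x"]
          by (simp add: dist_commute)
      qed
    qed
    then show ?thesis by (rule Cauchy_convergent)
  qed
  define u where "u t = lim (\<lambda>n. U (r n) t)" for t
  have u: "(\<lambda>n. U (r n) t) \<longlonglongrightarrow> u t" if "0 \<le> t" for t using convU[OF that] unfolding u_def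
    by (simp add: convergent_LIMSEQ_iff)
  have uu0: "u 0 = u0" using LIMSEQ_unique[OF u[OF order_refl]] LIMSEQ_subseq_LIMSEQ[OF U0 r(1)]
    by (simp add: comp_def)
  have w: "(\<lambda>n. w (r n) t) \<longlonglongrightarrow> u t" if t: "0 \<le> t" for t
  proof -
    have "(\<lambda>n. (norm (w (r n) t - U (r n) t))\<^sup>2) \<longlonglongrightarrow> 0"
    proof (rule Lim_null_comparison[OF _ tendsto_mult_left_zero[OF \<delta>r]])
      have "norm ((norm (w (r n) t - U (r n) t))\<^sup>2) \<le> \<delta> (r n) * R t" for n
        using near'[OF t order_refl, of "r n"] by simp
      then show "\<forall>\<^sub>F n in sequentially. norm ((norm (w (r n) t - U (r n) t))\<^sup>2) \<le> \<delta> (r n) * R t"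
        by (rule always_eventually[OF allI])
    qed
    then have "(\<lambda>n. sqrt ((norm (w (r n) t - U (r n) t))\<^sup>2)) \<longlonglongrightarrow> sqrt 0" by (rule tendsto_real_sqrt)
    then have "(\<lambda>n. w (r n) t - U (r n) t) \<longlonglongrightarrow> 0" by (simp add: tendsto_norm_zero_iff)
    from tendsto_add[OF this u[OF t]] show ?thesis by simp
  qed
  have Er: "(\<lambda>n. E (r n)) \<longlonglongrightarrow> energy \<phi> u0" using LIMSEQ_subseq_LIMSEQ[OF E r(1)] by (simp add: comp_def)
  have \<kappa>r: "(\<lambda>n. \<kappa> (r n)) \<longlonglongrightarrow> 1" using LIMSEQ_subseq_LIMSEQ[OF \<kappa> r(1)] by (simp add: comp_def)
  have uhold: "(norm (u t - u s))\<^sup>2 \<le> (t - s) * R T" if st: "0 \<le> s" "s \<le> t" "t \<le> T" for s t T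
  proof (rule LIMSEQ_le)
    show "(\<lambda>n. (norm (U (r n) t - U (r n) s))\<^sup>2) \<longlonglongrightarrow> (norm (u t - u s))\<^sup>2"
      using st by (intro tendsto_intros u) auto
    have "(\<lambda>n. (t - s + \<delta> (r n)) * R T) \<longlonglongrightarrow> (t - s + 0) * R T"
      by (intro tendsto_mult tendsto_add tendsto_const \<delta>r)
    then show "(\<lambda>n. (t - s + \<delta> (r n)) * R T) \<longlonglongrightarrow> (t - s) * R T" by simp
    show "\<exists>N. \<forall>n\<ge>N. (norm (U (r n) t - U (r n) s))\<^sup>2 \<le> (t - s + \<delta> (r n)) * R T" using holdR[OF st] by blast
  qed
  have ucont: "continuous_on {0..T} u" for T
    by (rule holder_half_imp_continuous_on[where C="R T"]) (use uhold in auto)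
  have udom: "u t \<in> effective_domain \<phi>" if t: "0 \<le> t" for t
  proof -
    have "\<phi> (w (r n) t) \<le> ereal Em" for n using eq[OF t] wEm[OF t] by (metis ereal_less_eq(3))
    then have "\<phi> (u t) \<le> ereal Em" by (intro lower_semicontinuous_le[OF l w[OF t]]) auto
    then show ?thesis by (auto simp: effective_domain_def)
  qed
  have sub': "AE t in lebesgue. 0 < t \<longrightarrow> (\<forall>n. \<zeta> (r n) t \<in> strong_limiting_subdiff \<phi> (w (r n) t))"
    using sub by eventually_elim auto
  \<comment> \<open>The inclusion is conditional on convergence of the energies at earlier times,
    which the first half of this claim provides when applied at those times. The velocity
    \<open>q\<close> still depends on \<open>T\<close>.\<close>
  have step: "(\<lambda>n. energy \<phi> (w (r n) T)) \<longlonglongrightarrow> energy \<phi> (u T) \<and> (\<exists>q. L2_primitive 0 T u q \<and>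
     (AE t in lebesgue. 0 < t \<and> t < T \<longrightarrow> (\<lambda>n. energy \<phi> (w (r n) t)) \<longlonglongrightarrow> energy \<phi> (u t) \<longrightarrow> - q t \<in>
       strong_limiting_subdiff \<phi> (u t)))"
    if T: "0 < T" for T
  proof -
    have T0: "0 \<le> T" using T by simp
    obtain a where a: "0 \<le> a" "\<And>c. a < c \<Longrightarrow> \<exists>\<^sub>F n in sequentially. A (r n) T \<le> c"
      "\<And>c. c < a \<Longrightarrow> \<forall>\<^sub>F n in sequentially. c < A (r n) T"
      using real_liminf[of "\<lambda>n. A (r n) T" "R T"] A0[OF T0] AR[OF T0 order_refl] by blast
    obtain b where b: "0 \<le> b" "\<And>c. b < c \<Longrightarrow> \<exists>\<^sub>F n in sequentially. B (r n) T \<le> c"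
      "\<And>c. c < b \<Longrightarrow> \<forall>\<^sub>F n in sequentially. c < B (r n) T"
      using real_liminf[of "\<lambda>n. B (r n) T" "R T"] B[OF T0] BR[OF T0 order_refl] by blast
    obtain q where q: "L2_primitive 0 T u q" "(LINT x:{0<..<T}|lebesgue. (norm (q x))\<^sup>2) \<le> a"
      using limit_dyadic_bound[OF T ucont u \<delta>r \<delta>(1) A(1) A(2) hold a(1,2)] by blast
    have G: "(\<integral>\<^sup>+x\<in>{0<..<T}. (liminf (\<lambda>n. ennreal (norm (\<zeta> (r n) x))))\<^sup>2 \<partial>lebesgue) \<le> ennreal b"
      by (rule subgradient_liminf_bound[OF \<zeta> \<delta>r \<kappa>r b(1,2) Bz[OF T0]])
    have Ec: "\<forall>\<^sub>F n in sequentially. energy \<phi> (w (r n) T) \<le> c"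
      if c: "energy \<phi> (u 0) - (LINT x:{0<..<T}|lebesgue. (norm (q x))\<^sup>2) / 2 - b / 2 < c" for c
    proof -
      define Q where "Q = (LINT x:{0<..<T}|lebesgue. (norm (q x))\<^sup>2)"
      define e where "e = c - (energy \<phi> u0 - Q / 2 - b / 2)"
      have e: "0 < e" using c by (simp add: e_def Q_def uu0)
      have "\<forall>\<^sub>F n in sequentially. E (r n) < energy \<phi> u0 + e / 4" using Er by (rule order_tendstoD(2))
        (use e in simp)
      moreover have "\<forall>\<^sub>F n in sequentially. a - e / 2 < A (r n) T" by (rule a(3)) (use e in simp)
      moreover have "\<forall>\<^sub>F n in sequentially. b - e / 2 < B (r n) T" by (rule b(3)) (use e in simp)
      ultimately show ?thesis
      proof eventually_elim
        case (elim n)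
        have "c = e + energy \<phi> u0 - Q / 2 - b / 2" by (simp add: e_def)
        then show ?case using e elim en[OF T0, of "r n"] q(2) unfolding Q_def[symmetric] by argo
      qed
    qed
    have u0d: "u 0 \<in> effective_domain \<phi>" using uu0 u0 by simp
    note lim = limit_is_solution[OF p l chain q(1) T \<zeta> sub' w dom u0d wEm G b(1) Ec]
    show ?thesis using lim q(1) by blast
  qed
  have econv: "(\<lambda>n. energy \<phi> (w (r n) t)) \<longlonglongrightarrow> energy \<phi> (u t)" if t: "0 \<le> t" for t
  proof (cases "t = 0")
    case False
    then show ?thesis using step[of t] t by simp
  next
    case True
    show ?thesis unfolding True
    proof (rule order_tendstoI)
      fix a assume "a < energy \<phi> (u 0)"
      then have "ereal a < \<phi> (u 0)" using effective_domain_eq[OF p udom[OF order_refl]]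
        by (metis less_ereal.simps(1))
      also have "\<phi> (u 0) \<le> liminf (\<lambda>n. \<phi> (w (r n) 0))"
        by (rule lower_semicontinuous_sequentially[OF l w[OF order_refl]])
      finally have "\<forall>\<^sub>F n in sequentially. ereal a < \<phi> (w (r n) 0)" by (rule less_LiminfD)
      then show "\<forall>\<^sub>F n in sequentially. a < energy \<phi> (w (r n) 0)"
        by eventually_elim (metis eq[OF order_refl] less_ereal.simps(1))
    next
      fix a assume "energy \<phi> (u 0) < a"
      then have "\<forall>\<^sub>F n in sequentially. E (r n) < a" using Er uu0 by (intro order_tendstoD(2)) auto
      then show "\<forall>\<^sub>F n in sequentially. energy \<phi> (w (r n) 0) < a"
      proof eventually_elim
        case (elim n)
        then show ?case using gap(1)[OF order_refl, of "r n"] by linarith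
      qed
    qed
  qed
  have "\<exists>q. L2_primitive 0 (real (Suc n)) u q \<and> (AE t in lebesgue. 0 < t \<and> t < real (Suc n) \<longrightarrow>
    - q t \<in> strong_limiting_subdiff \<phi> (u t))" for n
  proof -
    obtain q where q: "L2_primitive 0 (real (Suc n)) u q"
      "AE t in lebesgue. 0 < t \<and> t < real (Suc n) \<longrightarrow> (\<lambda>k. energy \<phi> (w (r k) t)) \<longlonglongrightarrow> energy \<phi> (u t) \<longrightarrow>
        - q t \<in> strong_limiting_subdiff \<phi> (u t)"
      using step[of "real (Suc n)"] by (meson of_nat_0_less_iff zero_less_Suc)
    from q(2) have "AE t in lebesgue. 0 < t \<and> t < real (Suc n) \<longrightarrow> - q t \<in> strong_limiting_subdiff \<phi> (u t)"
      by eventually_elim (use econv in auto)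
    then show ?thesis using q(1) by blast
  qed
  from L2_primitive_extend[of u "\<lambda>t q. - q \<in> strong_limiting_subdiff \<phi> (u t)", OF this]
  obtain q where "\<forall>T>0. L2_primitive 0 T u q" "AE t in lebesgue. 0 < t \<longrightarrow>
    - q t \<in> strong_limiting_subdiff \<phi> (u t)" by blast
  then show ?thesis using r(1) uu0 udom u econv by blast
qed

section \<open>Minimizing movements\<close>

lemma frechet_subdiff_subset_strong:
  "\<xi> \<in> frechet_subdiff \<phi> v \<Longrightarrow> \<xi> \<in> strong_limiting_subdiff \<phi> v"
  unfolding strong_limiting_subdiff_def mem_Collect_eq
  by (intro conjI frechet_subdiff_domain, assumption, rule exI[of _ "\<lambda>_. v"], rule exI[of _ "\<lambda>_. \<xi>"]) simp

text \<open>The direct method: the quadratic term dominates the linear lower bound, so a minimising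
  sequence stays in a bounded sublevel, which is compact, and lower semicontinuity makes its limit a
  minimiser.\<close>

lemma resolvent_exists:
  fixes \<phi> :: "'h::{real_inner,banach,second_countable_topology} \<Rightarrow> ereal"
  assumes p: "proper_functional \<phi>" and l: "lower_semicontinuous \<phi>" and comp: "comp_condition \<phi>"
    and K: "K1 \<ge> 0" "K2 \<ge> 0" "\<And>u. \<phi> u \<ge> ereal (- K1 * norm u - K2)" and r: "r > 0"
  shows "\<exists>v\<in>effective_domain \<phi>. \<forall>w\<in>effective_domain \<phi>.
     energy \<phi> v + (norm (v - u))\<^sup>2 / (2 * r) \<le> energy \<phi> w + (norm (w - u))\<^sup>2 / (2 * r)"
proof -
  define F where "F v = energy \<phi> v + (norm (v - u))\<^sup>2 / (2 * r)" for v
  have eq: "\<phi> v = ereal (energy \<phi> v)" if "v \<in> effective_domain \<phi>" for v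
    by (rule effective_domain_eq[OF p that])
  have lower: "- K1 * norm v - K2 \<le> energy \<phi> v" if "v \<in> effective_domain \<phi>" for v
    using K(3)[of v] eq[OF that] by (metis ereal_less_eq(3))
  obtain w0 where w0: "w0 \<in> effective_domain \<phi>" using p by (auto simp: proper_functional_def)
  define b where "b = \<bar>F w0\<bar> + K1 * norm u + K2"
  define R where "R = 2 * r * K1 + 2 * r * b + 1 + norm u"
  have b0: "0 \<le> b" using K by (simp add: b_def)
  have EF: "energy \<phi> v \<le> F v" for v using r by (simp add: F_def)
  have bound: "norm v \<le> R" if v: "v \<in> effective_domain \<phi>" and le: "F v \<le> F w0" for v
  proof -
    define x where "x = norm (v - u)"
    have nv: "norm v \<le> x + norm u" using norm_triangle_sub[of v u] by (simp add: x_def add.commute)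
    then have "K1 * norm v \<le> K1 * (x + norm u)" using K(1) by (rule mult_left_mono)
    then have "x\<^sup>2 / (2 * r) \<le> b + K1 * x"
      using lower[OF v] le unfolding F_def[of v] x_def[symmetric] b_def by (simp add: algebra_simps)
    then have "x\<^sup>2 \<le> (2 * r) * (b + K1 * x)" using r by (simp add: pos_divide_le_eq mult.commute)
    then have "x \<le> 2 * r * K1 + 2 * r * b + 1" by (rule quadratic_bound) (use r b0 K in auto)
    then show ?thesis using nv by (simp add: R_def)
  qed
  define S where "S = {v \<in> effective_domain \<phi>. F v \<le> F w0}"
  have S0: "w0 \<in> S" using w0 by (simp add: S_def)
  have bddS: "bdd_below (F ` S)"
  proof (rule bdd_belowI2)
    fix v assume "v \<in> S"
    then have v: "v \<in> effective_domain \<phi>" "norm v \<le> R" using bound by (auto simp: S_def)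
    have "K1 * norm v \<le> K1 * R" using v(2) K(1) by (rule mult_left_mono)
    then show "- K1 * R - K2 \<le> F v" using lower[OF v(1)] EF[of v] by simp
  qed
  define m where "m = (INF v\<in>S. F v)"
  have m: "m \<le> F v" if "v \<in> S" for v unfolding m_def by (rule cINF_lower[OF bddS that])
  have "\<exists>v\<in>S. F v < m + 1 / real (Suc n)" for n
  proof -
    have "m < m + 1 / real (Suc n)" by simp
    then show ?thesis unfolding m_def using cINF_less_iff[OF _ bddS] S0 by blast
  qed
  then obtain x where x: "\<And>n. x n \<in> S" "\<And>n. F (x n) < m + 1 / real (Suc n)" by metis
  have "x n \<in> {v. \<phi> v \<le> ereal (F w0) \<and> norm v \<le> R}" for n
  proof -
    have xn: "x n \<in> effective_domain \<phi>" "F (x n) \<le> F w0" using x(1)[of n] by (auto simp: S_def)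
    then have "energy \<phi> (x n) \<le> F w0" using EF[of "x n"] by linarith
    then show ?thesis using bound[OF xn] eq[OF xn(1)]
      by (metis (mono_tags, lifting) ereal_less_eq(3) mem_Collect_eq)
  qed
  then obtain v s where vs: "strict_mono s" "(x \<circ> s) \<longlonglongrightarrow> v"
    using compact_imp_seq_compact[OF bounded_sublevel_compact[OF l comp, of "F w0" R]]
      unfolding seq_compact_def by blast
  have lim: "(\<lambda>n. x (s n)) \<longlonglongrightarrow> v" using vs(2) by (simp add: comp_def)
  have le: "\<phi> v \<le> ereal (m - (norm (v - u))\<^sup>2 / (2 * r))"
  proof (rule ereal_le_epsilon2)
    fix e :: real assume "0 < e"
    have "(\<lambda>n. (norm (x (s n) - u))\<^sup>2 / (2 * r)) \<longlonglongrightarrow> (norm (v - u))\<^sup>2 / (2 * r)"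
      using r by (intro tendsto_divide tendsto_power tendsto_norm tendsto_diff lim tendsto_const) simp
    then have "\<forall>\<^sub>F n in sequentially. (norm (v - u))\<^sup>2 / (2 * r) - e / 2 < (norm (x (s n) - u))\<^sup>2 / (2 * r)"
      by (rule order_tendstoD(1)) (use \<open>0 < e\<close> in simp)
    moreover have "\<forall>\<^sub>F n in sequentially. 1 / real (Suc n) < e / 2"
      using LIMSEQ_Suc[OF lim_1_over_n] by (rule order_tendstoD(2)) (use \<open>0 < e\<close> in simp)
    ultimately have "\<forall>\<^sub>F n in sequentially. \<phi> (x (s n)) \<le> ereal (m - (norm (v - u))\<^sup>2 / (2 * r) + e)"
    proof eventually_elim
      case (elim n)
      have "1 / real (Suc (s n)) \<le> 1 / real (Suc n)" using seq_suble[OF vs(1), of n] by (simp add: frac_le)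
      then have "F (x (s n)) < m + e / 2" using x(2)[of "s n"] elim(2) by linarith
      then have "energy \<phi> (x (s n)) \<le> m - (norm (v - u))\<^sup>2 / (2 * r) + e" using elim(1) unfolding F_def
        by linarith
      moreover have "x (s n) \<in> effective_domain \<phi>" using x(1) by (simp add: S_def)
      ultimately show ?case using eq by (metis ereal_less_eq(3))
    qed
    then have "\<phi> v \<le> ereal (m - (norm (v - u))\<^sup>2 / (2 * r) + e)"
      by (rule lower_semicontinuous_le[OF l lim, rotated]) simp
    then show "\<phi> v \<le> ereal (m - (norm (v - u))\<^sup>2 / (2 * r)) + ereal e" by simp
  qed
  then have v: "v \<in> effective_domain \<phi>" by (auto simp: effective_domain_def)
  then have Fv: "F v \<le> m" using le eq[OF v] unfolding F_def
    by (metis add.commute ereal_less_eq(3) le_diff_eq add_le_cancel_left diff_add_cancel)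
  have "F v \<le> F w" if w: "w \<in> effective_domain \<phi>" for w
    using m[of w] m[OF S0] Fv w by (cases "w \<in> S") (auto simp: S_def)
  then show ?thesis using v unfolding F_def by blast
qed

text \<open>De Giorgi's variational interpolation, discretised at the radii \<open>\<tau> N / (N + i)\<close>.\<close>

lemma De_Giorgi_estimate:
  fixes J :: "real \<Rightarrow> 'h::real_inner"
  assumes J: "\<And>r. r > 0 \<Longrightarrow> J r \<in> effective_domain \<phi>"
    and min: "\<And>r w. r > 0 \<Longrightarrow> w \<in> effective_domain \<phi> \<Longrightarrow>
      energy \<phi> (J r) + (norm (J r - u))\<^sup>2 / (2 * r) \<le> energy \<phi> w + (norm (w - u))\<^sup>2 / (2 * r)"
    and u: "u \<in> effective_domain \<phi>" and \<tau>: "\<tau> > 0" and N: "N > 0"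
  defines "\<rho> \<equiv> \<lambda>i::nat. \<tau> * real N / (real N + real i)"
  shows "(\<Sum>i<m. (norm ((J (\<rho> (Suc i)) - u) /\<^sub>R \<rho> (Suc i)))\<^sup>2 * (\<rho> i - \<rho> (Suc i)))
     \<le> (real N + 1) / real N * (2 * (energy \<phi> u - (energy \<phi> (J \<tau>) + (norm (J \<tau> - u))\<^sup>2 / (2 * \<tau>))))"
proof -
  define F where "F r = energy \<phi> (J r) + (norm (J r - u))\<^sup>2 / (2 * r)" for r
  have \<rho>: "\<rho> i > 0" for i using \<tau> N by (simp add: \<rho>_def add_pos_nonneg)
  have inv: "1 / \<rho> i = (real N + real i) / (\<tau> * real N)" for i by (simp add: \<rho>_def)
  have step: "(norm ((J (\<rho> (Suc i)) - u) /\<^sub>R \<rho> (Suc i)))\<^sup>2 * (\<rho> i - \<rho> (Suc i))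
    \<le> (real N + 1) / real N * (2 * (F (\<rho> (Suc i)) - F (\<rho> i)))" for i
  proof -
    define d where "d = norm (J (\<rho> (Suc i)) - u)"
    define a where "a = real N + real i"
    have a: "real N \<le> a" "0 < a" "real N + real (Suc i) = a + 1" using N by (auto simp: a_def)
    \<comment> \<open>The minimiser for the smaller radius competes in the problem for the larger
      one; the two functionals differ only in the factor of the squared distance.\<close>
    have "F (\<rho> i) \<le> energy \<phi> (J (\<rho> (Suc i))) + d\<^sup>2 / (2 * \<rho> i)"
      unfolding F_def d_def by (rule min[OF \<rho> J[OF \<rho>]])
    then have "d\<^sup>2 / 2 * (1 / \<rho> (Suc i) - 1 / \<rho> i) \<le> F (\<rho> (Suc i)) - F (\<rho> i)"
      unfolding F_def[of "\<rho> (Suc i)"] d_def[symmetric] by (simp add: algebra_simps)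
    \<comment> \<open>The radii are chosen so that their reciprocals form an arithmetic
      progression.\<close>
    also have "1 / \<rho> (Suc i) - 1 / \<rho> i = 1 / (\<tau> * real N)"
      unfolding inv by (simp add: diff_divide_distrib[symmetric])
    finally have F: "d\<^sup>2 / (\<tau> * real N) \<le> 2 * (F (\<rho> (Suc i)) - F (\<rho> i))" by simp
    have "(norm ((J (\<rho> (Suc i)) - u) /\<^sub>R \<rho> (Suc i)))\<^sup>2 * (\<rho> i - \<rho> (Suc i))
      = d\<^sup>2 / (\<rho> (Suc i))\<^sup>2 * (\<rho> i - \<rho> (Suc i))"
    proof -
      have "norm ((J (\<rho> (Suc i)) - u) /\<^sub>R \<rho> (Suc i)) = d / \<rho> (Suc i)" using \<rho>[of "Suc i"]
        by (simp add: d_def divide_inverse_commute)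
      then show ?thesis by (simp add: power_divide)
    qed
    \<comment> \<open>The factor is the ratio of consecutive radii, the price of evaluating the
      slope at the smaller radius only. It is largest for \<open>i = 0\<close>, where it equals (N +
      1) / N.\<close>
    also have "\<dots> = ((a + 1) / a) * (d\<^sup>2 / (\<tau> * real N))"
    proof -
      have r1: "\<rho> (Suc i) = \<tau> * real N / (a + 1)" "\<rho> i = \<tau> * real N / a" unfolding \<rho>_def using a(3)
        by (simp_all add: a_def)
      define M where "M = \<tau> * real N"
      define c where "c = a + 1"
      have pos: "0 < M" "0 < c" using \<tau> N a by (auto simp: M_def c_def)
      have "M / a - M / c = M * (c - a) / (a * c)" using a pos by (simp add: field_simps)
      then have "M / a - M / c = M / (a * c)" by (simp add: c_def)
      moreover have "d\<^sup>2 / (M / c)\<^sup>2 * (M / (a * c)) = c / a * (d\<^sup>2 / M)"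
        using a pos by (simp add: field_simps power2_eq_square)
      ultimately show ?thesis unfolding r1 M_def[symmetric] c_def[symmetric] by simp
    qed
    also have "\<dots> \<le> ((real N + 1) / real N) * (d\<^sup>2 / (\<tau> * real N))"
    proof (rule mult_right_mono)
      show "(a + 1) / a \<le> (real N + 1) / real N" using a N by (simp add: field_simps)
    qed (use \<tau> in simp)
    also have "\<dots> \<le> (real N + 1) / real N * (2 * (F (\<rho> (Suc i)) - F (\<rho> i)))"
      using F by (rule mult_left_mono) simp
    finally show ?thesis .
  qed
  have "(\<Sum>i<m. (norm ((J (\<rho> (Suc i)) - u) /\<^sub>R \<rho> (Suc i)))\<^sup>2 * (\<rho> i - \<rho> (Suc i))) \<le> (\<Sum>i<m.
    (real N + 1) / real N * (2 * (F (\<rho> (Suc i)) - F (\<rho> i))))"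
    by (intro sum_mono step)
  also have "\<dots> = (real N + 1) / real N * (2 * (F (\<rho> m) - F (\<rho> 0)))"
    by (simp only: sum_distrib_left[symmetric] sum_lessThan_telescope[of "\<lambda>i. F (\<rho> i)" m])
  also have "\<rho> 0 = \<tau>" using N by (simp add: \<rho>_def)
  also have "(real N + 1) / real N * (2 * (F (\<rho> m) - F \<tau>)) \<le> (real N + 1) / real N * (2 * (energy \<phi> u - F \<tau>))"
  proof (intro mult_left_mono diff_right_mono)
    show "F (\<rho> m) \<le> energy \<phi> u" using min[OF \<rho> u] by (simp add: F_def)
  qed auto
  finally show ?thesis by (simp add: F_def)
qed

text \<open>
  \<open>U\<close> is the discrete solution, \<open>w\<close> its variational interpolant with subgradients \<open>\<zeta>\<close>, and \<open>A\<close>, \<open>B\<close> are the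
  two halves of the dissipated energy: \<open>A\<close> controls the velocity of \<open>U\<close>, and \<open>B\<close> the subgradients.
\<close>

definition discrete_gradient_flow ::
  "('h::{real_inner,banach,second_countable_topology} \<Rightarrow> ereal) \<Rightarrow> 'h \<Rightarrow> real \<Rightarrow> real \<Rightarrow> (real \<Rightarrow> 'h) \<Rightarrow> (real \<Rightarrow> 'h)
    \<Rightarrow>
     (real \<Rightarrow> 'h) \<Rightarrow> (real \<Rightarrow> real) \<Rightarrow> (real \<Rightarrow> real) \<Rightarrow> bool" where
  "discrete_gradient_flow \<phi> u0 \<tau> \<kappa> U w \<zeta> A B \<longleftrightarrow>
     U 0 = u0 \<and> (\<forall>s t. 0 \<le> s \<longrightarrow> s \<le> t \<longrightarrow> A s \<le> A t) \<and> A 0 = 0 \<and> (\<forall>t\<ge>0. 0 \<le> B t) \<and>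
     (\<forall>s t. 0 \<le> s \<longrightarrow> s \<le> t \<longrightarrow> (norm (U t - U s))\<^sup>2 \<le> (t - s + \<tau>) * (A t - A s)) \<and>
     (\<forall>t\<ge>0. energy \<phi> (w t) + A t / 2 + B t / 2 \<le> energy \<phi> u0) \<and> (\<forall>t\<ge>0. w t \<in> effective_domain \<phi>) \<and>
     (\<forall>t\<ge>0. (norm (w t - U t))\<^sup>2 \<le> 2 * \<tau> * (energy \<phi> u0 - energy \<phi> (w t))) \<and>
     \<zeta> \<in> borel_measurable lebesgue \<and> (\<forall>t. \<zeta> t \<in> strong_limiting_subdiff \<phi> (w t)) \<and>
     (\<forall>t\<ge>0. ennreal \<kappa> * (\<integral>\<^sup>+x\<in>{0<..<t - \<tau>}. (ennreal (norm (\<zeta> x)))\<^sup>2 \<partial>lebesgue) \<le> ennreal (B t))"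

lemma discrete_gradient_flowD:
  assumes "discrete_gradient_flow \<phi> u0 \<tau> \<kappa> U w \<zeta> A B"
  shows "U 0 = u0" "\<And>s t. 0 \<le> s \<Longrightarrow> s \<le> t \<Longrightarrow> A s \<le> A t" "A 0 = 0" "\<And>t. 0 \<le> t \<Longrightarrow> 0 \<le> B t"
    and "\<And>s t. 0 \<le> s \<Longrightarrow> s \<le> t \<Longrightarrow> (norm (U t - U s))\<^sup>2 \<le> (t - s + \<tau>) * (A t - A s)"
    and "\<And>t. 0 \<le> t \<Longrightarrow> energy \<phi> (w t) + A t / 2 + B t / 2 \<le> energy \<phi> u0"
    and "\<And>t. 0 \<le> t \<Longrightarrow> w t \<in> effective_domain \<phi>"
    and "\<And>t. 0 \<le> t \<Longrightarrow> (norm (w t - U t))\<^sup>2 \<le> 2 * \<tau> * (energy \<phi> u0 - energy \<phi> (w t))"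
    and "\<zeta> \<in> borel_measurable lebesgue" "\<And>t. \<zeta> t \<in> strong_limiting_subdiff \<phi> (w t)"
    and "\<And>t. 0 \<le> t \<Longrightarrow> ennreal \<kappa> * (\<integral>\<^sup>+x\<in>{0<..<t - \<tau>}. (ennreal (norm (\<zeta> x)))\<^sup>2 \<partial>lebesgue) \<le> ennreal (B t)"
  using assms unfolding discrete_gradient_flow_def by (elim conjE; iprover)+

text \<open>Iterated minimisation gives \<open>V\<close>. In each step the energy drop splits
  exactly into the quadratic part \<open>a / 2\<close> and a remainder \<open>b / 2\<close>, and by
  \<open>De_Giorgi_estimate\<close> the remainder controls the slopes of the minimisers at the
  smaller radii. These are spread over the time cell: at elapsed time \<open>s\<close> inside the
  cell the largest radius \<open>\<rho> i\<close> not exceeding \<open>s\<close> is used.\<close>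

lemma discrete_gradient_flow_exists:
  fixes \<phi> :: "'h::{real_inner,banach,second_countable_topology} \<Rightarrow> ereal"
  assumes p: "proper_functional \<phi>" and l: "lower_semicontinuous \<phi>" and comp: "comp_condition \<phi>"
    and K: "K1 \<ge> 0" "K2 \<ge> 0" "\<And>u. \<phi> u \<ge> ereal (- K1 * norm u - K2)"
    and u0: "u0 \<in> effective_domain \<phi>" and \<tau>: "\<tau> > 0" and N: "N > (0::nat)"
  shows "\<exists>U w \<zeta> A B. discrete_gradient_flow \<phi> u0 \<tau> (real N / (real N + 1)) U w \<zeta> A B"
proof -
  have "\<forall>r u. \<exists>v. 0 < r \<longrightarrow> v \<in> effective_domain \<phi> \<and> (\<forall>w\<in>effective_domain \<phi>.
     energy \<phi> v + (norm (v - u))\<^sup>2 / (2 * r) \<le> energy \<phi> w + (norm (w - u))\<^sup>2 / (2 * r))"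
    using resolvent_exists[OF p l comp K] by blast
  then obtain J where J: "\<And>r u. 0 < r \<Longrightarrow> J r u \<in> effective_domain \<phi>"
    "\<And>r u w. 0 < r \<Longrightarrow> w \<in> effective_domain \<phi> \<Longrightarrow>
       energy \<phi> (J r u) + (norm (J r u - u))\<^sup>2 / (2 * r) \<le> energy \<phi> w + (norm (w - u))\<^sup>2 / (2 * r)" by metis
  define V where "V = rec_nat u0 (\<lambda>_. J \<tau>)"
  have V: "V 0 = u0" "V (Suc k) = J \<tau> (V k)" for k by (simp_all add: V_def)
  have Vdom: "V k \<in> effective_domain \<phi>" for k by (cases k) (use V u0 J \<tau> in auto)
  define a where "a k = (norm (V (Suc k) - V k))\<^sup>2 / \<tau>" for k
  define b where "b k = 2 * (energy \<phi> (V k) - (energy \<phi> (J \<tau> (V k)) + (norm (J \<tau> (V k) - V k))\<^sup>2 / (2 * \<tau>)))"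
    for k
  have a0: "0 \<le> a k" for k using \<tau> by (simp add: a_def)
  have b0: "0 \<le> b k" for k using J(2)[where r=\<tau> and u="V k" and w="V k", OF \<tau> Vdom] by (simp add: b_def)
  have e: "energy \<phi> (V (Suc k)) = energy \<phi> (V k) - a k / 2 - b k / 2" for k
    by (simp add: a_def b_def V add_divide_distrib diff_divide_distrib)
  have eV: "energy \<phi> (V k) + (\<Sum>i<k. a i) / 2 + (\<Sum>i<k. b i) / 2 = energy \<phi> u0" for k
    by (induction k) (simp_all add: V(1) e add_divide_distrib)
  define \<rho> where "\<rho> i = \<tau> * real N / (real N + real i)" for i :: nat
  have \<rho>0: "\<rho> i > 0" for i using \<tau> N by (simp add: \<rho>_def add_pos_nonneg)
  have \<rho>\<tau>: "\<rho> i \<le> \<tau>" for i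
  proof -
    have "real N / (real N + real i) \<le> 1" using N by simp
    then have "\<tau> * (real N / (real N + real i)) \<le> \<tau> * 1" using \<tau> by (intro mult_left_mono) auto
    then show ?thesis by (simp add: \<rho>_def)
  qed
  define kk where "kk t = nat \<lfloor>t / \<tau>\<rfloor>" for t
  \<comment> \<open>The least \<open>i\<close> with \<open>\<rho> i \<le> s\<close>, where
    \<open>s\<close> is the time elapsed in the cell, since this inequality amounts to
    \<open>real N * (\<tau> / s - 1) \<le> real i\<close>. At a node \<open>s\<close> is 0, the
    quotient has the default value 0, and the index is 0.\<close>
  define ii where "ii t = nat \<lceil>real N * (\<tau> / (t - real (kk t) * \<tau>) - 1)\<rceil>" for t
  define W where "W k i = J (\<rho> i) (V k)" for k i
  define Z where "Z k i = - ((W k i - V k) /\<^sub>R \<rho> i)" for k i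
  have kk: "real (kk t) * \<tau> \<le> t" "t < (real (kk t) + 1) * \<tau>" if "0 \<le> t" for t
  proof -
    have "real (kk t) = real_of_int \<lfloor>t / \<tau>\<rfloor>" using that \<tau> by (simp add: kk_def)
    then have "real (kk t) \<le> t / \<tau>" "t / \<tau> < real (kk t) + 1" by linarith+
    then show "real (kk t) * \<tau> \<le> t" "t < (real (kk t) + 1) * \<tau>" using \<tau> by (simp_all add: field_simps)
  qed
  have kk_mono: "kk s \<le> kk t" if "0 \<le> s" "s \<le> t" for s t
    unfolding kk_def using that \<tau> by (intro nat_mono floor_mono divide_right_mono) auto
  have mkk: "kk \<in> lebesgue \<rightarrow>\<^sub>M count_space UNIV" unfolding kk_def by (intro measurable_completion) measurable
  have mii: "ii \<in> lebesgue \<rightarrow>\<^sub>M count_space UNIV" unfolding ii_def kk_def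
    by (intro measurable_completion) measurable
  have mZ: "(\<lambda>t. Z (kk t) (ii t)) \<in> borel_measurable lebesgue"
  proof (rule measurable_compose_countable[OF _ mkk])
    show "(\<lambda>t. Z k (ii t)) \<in> borel_measurable lebesgue" for k by (rule measurable_compose[OF mii]) simp
  qed
  have Wle: "energy \<phi> (W k i) + (norm (W k i - V k))\<^sup>2 / (2 * \<rho> i) \<le> energy \<phi> (V k)" for k i
    using J(2)[where r="\<rho> i" and u="V k" and w="V k", OF \<rho>0 Vdom] by (simp add: W_def)
  have WleV: "energy \<phi> (W k i) \<le> energy \<phi> (V k)" for k i
  proof -
    have "0 \<le> (norm (W k i - V k))\<^sup>2 / (2 * \<rho> i)" using \<rho>0[of i] by simp
    then show ?thesis using Wle[of k i] by linarith
  qed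
  have Vle: "energy \<phi> (V k) \<le> energy \<phi> u0" for k
    using eV[of k] sum_nonneg[of "{..<k}" a] sum_nonneg[of "{..<k}" b] a0 b0 by simp
  have Zint: "(\<integral>\<^sup>+x\<in>{0<..<real k * \<tau>}. (ennreal (norm (Z (kk x) (ii x))))\<^sup>2 \<partial>lebesgue)
    \<le> ennreal ((real N + 1) / real N * (\<Sum>j<k. b j))" for k
  proof -
    define c where "c j i = (norm (Z j (Suc i)))\<^sup>2" for j i
    \<comment> \<open>The times in cell \<open>j\<close> at which the index is
      \<open>Suc i\<close>.\<close>
    define I where "I j i = {real j * \<tau> + \<rho> (Suc i)..<real j * \<tau> + \<rho> i}" for j i
    have "(\<integral>\<^sup>+x\<in>{0<..<real k * \<tau>}. (ennreal (norm (Z (kk x) (ii x))))\<^sup>2 \<partial>lebesgue)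
        \<le> (\<integral>\<^sup>+x. (\<Sum>j<k. \<Sum>i. ennreal (c j i) * indicator (I j i) x) \<partial>lebesgue)"
    proof (rule nn_integral_mono_AE)
      \<comment> \<open>The nodes form a null set. Away from them the elapsed time is positive and
        less than \<tau>, so the index is at least 1.\<close>
      have "AE x in lebesgue. \<forall>j::nat. x \<noteq> real j * \<tau>" using AE_lebesgue_neq by (simp add: AE_all_countable)
      then show "AE x in lebesgue. (ennreal (norm (Z (kk x) (ii x))))\<^sup>2 * indicator {0<..<real k * \<tau>} x
          \<le> (\<Sum>j<k. \<Sum>i. ennreal (c j i) * indicator (I j i) x)"
      proof eventually_elim
        case (elim x)
        show ?case
        proof (cases "x \<in> {0<..<real k * \<tau>}")
          case True
          define s where "s = x - real (kk x) * \<tau>"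
          have s: "0 < s" "s < \<tau>" using kk[of x] True elim[rule_format, of "kk x"]
            by (auto simp: s_def algebra_simps)
          have "kk x < k"
          proof -
            have "real (kk x) * \<tau> < real k * \<tau>" using kk(1)[of x] True by auto
            then show ?thesis using \<tau> by simp
          qed
          define y where "y = real N * (\<tau> / s - 1)"
          have "1 < \<tau> / s" using s by simp
          then have y0: "0 < y" using N by (simp add: y_def)
          have iiy: "ii x = nat \<lceil>y\<rceil>" by (simp add: ii_def y_def s_def)
          then have "ii x \<noteq> 0" using y0 by simp
          then obtain i where i: "ii x = Suc i" using not0_implies_Suc by blast
          have "real (ii x) = real_of_int \<lceil>y\<rceil>" using iiy y0 by simp
          then have yi: "real i < y" "y \<le> real (Suc i)" using i by linarith+
          have "\<rho> (Suc i) \<le> s"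
          proof -
            have "real N * (\<tau> / s) \<le> real N + real (Suc i)" using yi(2) by (simp add: y_def algebra_simps)
            then have "\<tau> * real N \<le> s * (real N + real (Suc i))" using s by (simp add: field_simps)
            then show ?thesis unfolding \<rho>_def using N by (simp add: pos_divide_le_eq add_pos_nonneg)
          qed
          moreover have "s < \<rho> i"
          proof -
            have "real N + real i < real N * (\<tau> / s)" using yi(1) by (simp add: y_def algebra_simps)
            then have "s * (real N + real i) < \<tau> * real N" using s by (simp add: field_simps)
            then show ?thesis unfolding \<rho>_def using N by (simp add: pos_less_divide_eq add_pos_nonneg)
          qed
          ultimately have xI: "x \<in> I (kk x) i" by (auto simp: I_def s_def)
          have "(ennreal (norm (Z (kk x) (ii x))))\<^sup>2 * indicator {0<..<real k * \<tau>} x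
            = ennreal (c (kk x) i) * indicator (I (kk x) i) x"
            using True xI i by (simp add: c_def ennreal_power)
          also have "\<dots> \<le> (\<Sum>i. ennreal (c (kk x) i) * indicator (I (kk x) i) x)"
          proof -
            define f where "f = (\<lambda>i. ennreal (c (kk x) i) * indicator (I (kk x) i) x)"
            have "sum f {i} \<le> suminf f" by (rule sum_le_suminf) auto
            then have "f i \<le> suminf f" by simp
            then show ?thesis unfolding f_def .
          qed
          also have "\<dots> \<le> (\<Sum>j<k. \<Sum>i. ennreal (c j i) * indicator (I j i) x)"
            using \<open>kk x < k\<close> by (intro member_le_sum) auto
          finally show ?thesis .
        qed simp
      qed
    qed
    also have "\<dots> = (\<Sum>j<k. \<Sum>i. \<integral>\<^sup>+x. ennreal (c j i) * indicator (I j i) x \<partial>lebesgue)"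
    proof -
      have m: "(\<lambda>x. ennreal (c j i) * indicator (I j i) x) \<in> borel_measurable lebesgue" for j i
        by (intro borel_measurable_times_ennreal borel_measurable_const borel_measurable_indicator) (simp
          add: I_def)
      have "(\<lambda>x. \<Sum>i. ennreal (c j i) * indicator (I j i) x) \<in> borel_measurable lebesgue" for j
        by (rule borel_measurable_suminf_order[OF m])
      then have "(\<integral>\<^sup>+x. (\<Sum>j<k. \<Sum>i. ennreal (c j i) * indicator (I j i) x) \<partial>lebesgue) = (\<Sum>j<k. \<integral>\<^sup>+x. (\<Sum>i.
        ennreal (c j i) * indicator (I j i) x) \<partial>lebesgue)"
        by (rule nn_integral_sum)
      also have "\<dots> = (\<Sum>j<k. \<Sum>i. \<integral>\<^sup>+x. ennreal (c j i) * indicator (I j i) x \<partial>lebesgue)"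
        by (intro sum.cong refl nn_integral_suminf m)
      finally show ?thesis .
    qed
    also have "\<dots> \<le> (\<Sum>j<k. ennreal ((real N + 1) / real N * b j))"
    proof (rule sum_mono)
      fix j
      show "(\<Sum>i. \<integral>\<^sup>+x. ennreal (c j i) * indicator (I j i) x \<partial>lebesgue)
        \<le> ennreal ((real N + 1) / real N * b j)"
      proof (rule suminf_le_const[OF summableI])
        fix m
        have len: "0 \<le> \<rho> i - \<rho> (Suc i)" for i
        proof -
          have "\<tau> * real N / (real N + real (Suc i)) \<le> \<tau> * real N / (real N + real i)"
            using N \<tau> by (intro divide_left_mono) (auto simp: add_pos_nonneg)
          then show ?thesis by (simp add: \<rho>_def)
        qed
        have "(\<integral>\<^sup>+x. ennreal (c j i) * indicator (I j i) x \<partial>lebesgue)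
          = ennreal ((norm ((J (\<rho> (Suc i)) (V j) - V j) /\<^sub>R \<rho> (Suc i)))\<^sup>2 * (\<rho> i - \<rho> (Suc i)))" for i
        proof -
          have "(\<integral>\<^sup>+x. ennreal (c j i) * indicator (I j i) x \<partial>lebesgue)
            = ennreal (c j i) * emeasure lebesgue (I j i)"
            by (rule nn_integral_cmult_indicator) (simp add: I_def)
          also have "emeasure lebesgue (I j i) = ennreal (\<rho> i - \<rho> (Suc i))" using len[of i]
            by (simp add: I_def)
          also have "ennreal (c j i) * ennreal (\<rho> i - \<rho> (Suc i)) = ennreal (c j i * (\<rho> i - \<rho> (Suc i)))"
            using len[of i] by (subst ennreal_mult) (auto simp: c_def)
          finally show ?thesis by (simp add: c_def Z_def W_def)
        qed
        then have "(\<Sum>i<m. \<integral>\<^sup>+x. ennreal (c j i) * indicator (I j i) x \<partial>lebesgue) =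
            ennreal (\<Sum>i<m. (norm ((J (\<rho> (Suc i)) (V j) - V j) /\<^sub>R \<rho> (Suc i)))\<^sup>2 * (\<rho> i - \<rho> (Suc i)))"
          using len by (simp add: sum_ennreal)
        also have "\<dots> \<le> ennreal ((real N + 1) / real N * b j)"
          unfolding b_def \<rho>_def
          by (intro ennreal_leI De_Giorgi_estimate[where J="\<lambda>r. J r (V j)"] J Vdom \<tau> N)
        finally show "(\<Sum>i<m. \<integral>\<^sup>+x. ennreal (c j i) * indicator (I j i) x \<partial>lebesgue)
          \<le> ennreal ((real N + 1) / real N * b j)" .
      qed
    qed
    also have "\<dots> = ennreal (\<Sum>j<k. (real N + 1) / real N * b j)" by (rule sum_ennreal) (use b0 N in simp)
    finally show ?thesis by (simp add: sum_distrib_left)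
  qed
  define U where "U t = V (kk t)" for t
  define A where "A t = (\<Sum>i<kk t. a i)" for t
  define B where "B t = (\<Sum>i<kk t. b i)" for t
  have kk0: "kk 0 = 0" by (simp add: kk_def)
  have Adiff: "A t - A s = (\<Sum>i\<in>{kk s..<kk t}. a i)" if "0 \<le> s" "s \<le> t" for s t
    unfolding A_def using sum.atLeastLessThan_concat[of 0 "kk s" "kk t" a] kk_mono[OF that]
      by (simp add: lessThan_atLeast0)
  show ?thesis
    unfolding discrete_gradient_flow_def
  proof (rule exI[of _ U], rule exI[of _ "\<lambda>t. W (kk t) (ii t)"], rule exI[of _
    "\<lambda>t. Z (kk t) (ii t)"], rule exI[of _ A], rule exI[of _ B], intro conjI allI impI)
    show "U 0 = u0" "A 0 = 0" by (simp_all add: U_def A_def kk0 V)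
    show "A s \<le> A t" if "0 \<le> s" "s \<le> t" for s t using Adiff[OF that] sum_nonneg[of "{kk s..<kk t}" a] a0
      by simp
    show "0 \<le> B t" for t unfolding B_def by (rule sum_nonneg) (use b0 in simp)
    show "(norm (U t - U s))\<^sup>2 \<le> (t - s + \<tau>) * (A t - A s)" if st: "0 \<le> s" "s \<le> t" for s t
    proof -
      have kst: "kk s \<le> kk t" by (rule kk_mono[OF st])
      have "U t - U s = (\<Sum>i\<in>{kk s..<kk t}. V (Suc i) - V i)" unfolding U_def using sum_Suc_diff'[OF kst, of V]
        by simp
      then have "norm (U t - U s) \<le> (\<Sum>i\<in>{kk s..<kk t}. norm (V (Suc i) - V i))" by (simp add: norm_sum)
      then have "(norm (U t - U s))\<^sup>2 \<le> (\<Sum>i\<in>{kk s..<kk t}. norm (V (Suc i) - V i))\<^sup>2"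
        by (rule power_mono) simp
      also have "\<dots> \<le> (\<Sum>i\<in>{kk s..<kk t}. (norm (V (Suc i) - V i))\<^sup>2) * real (card {kk s..<kk t})"
        by (rule sum_squared_le_sum_of_squares)
      also have "(\<Sum>i\<in>{kk s..<kk t}. (norm (V (Suc i) - V i))\<^sup>2) = \<tau> * (A t - A s)"
        unfolding Adiff[OF st] a_def sum_distrib_left using \<tau> by simp
      also have "\<tau> * (A t - A s) * real (card {kk s..<kk t})
        = ((real (kk t) - real (kk s)) * \<tau>) * (A t - A s)"
        using kst by (simp add: of_nat_diff)
      \<comment> \<open>The number of nodes passed between \<open>s\<close> and \<open>t\<close>,
        times \<tau>, exceeds \<open>t - s\<close> by at most \<tau>; this is the time error of the
        scheme.\<close>
      also have "\<dots> \<le> (t - s + \<tau>) * (A t - A s)"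
      proof (rule mult_right_mono)
        show "(real (kk t) - real (kk s)) * \<tau> \<le> t - s + \<tau>" using kk[of t] kk[of s] st
          by (simp add: algebra_simps)
        show "0 \<le> A t - A s" unfolding Adiff[OF st] by (rule sum_nonneg) (use a0 in simp)
      qed
      finally show ?thesis .
    qed
    show "energy \<phi> (W (kk t) (ii t)) + A t / 2 + B t / 2 \<le> energy \<phi> u0" for t
      using eV[of "kk t"] WleV[of "kk t" "ii t"] unfolding A_def B_def by linarith
    show "W (kk t) (ii t) \<in> effective_domain \<phi>" for t unfolding W_def by (rule J(1)[OF \<rho>0])
    show "(norm (W (kk t) (ii t) - U t))\<^sup>2 \<le> 2 * \<tau> * (energy \<phi> u0 - energy \<phi> (W (kk t) (ii t)))" for t
    proof -
      let ?k = "kk t" and ?i = "ii t"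
      have "(norm (W ?k ?i - V ?k))\<^sup>2 / (2 * \<rho> ?i) \<le> energy \<phi> u0 - energy \<phi> (W ?k ?i)"
        using Wle[of ?k ?i] Vle[of ?k] by linarith
      then have "(norm (W ?k ?i - V ?k))\<^sup>2 \<le> (2 * \<rho> ?i) * (energy \<phi> u0 - energy \<phi> (W ?k ?i))"
        using \<rho>0[of ?i] by (simp add: pos_divide_le_eq mult.commute)
      also have "\<dots> \<le> (2 * \<tau>) * (energy \<phi> u0 - energy \<phi> (W ?k ?i))"
        using \<rho>\<tau>[of ?i] WleV[of ?k ?i] Vle[of ?k] by (intro mult_right_mono) auto
      finally show ?thesis by (simp add: U_def)
    qed
    show "(\<lambda>t. Z (kk t) (ii t)) \<in> borel_measurable lebesgue" by (rule mZ)
    show "Z (kk t) (ii t) \<in> strong_limiting_subdiff \<phi> (W (kk t) (ii t))" for t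
      unfolding Z_def W_def
      by (intro frechet_subdiff_subset_strong minimizer_frechet_subdiff[OF p J(1)[OF \<rho>0] \<rho>0] J(2)[OF \<rho>0])
    show "ennreal (real N / (real N + 1)) * (\<integral>\<^sup>+x\<in>{0<..<t - \<tau>}.
      (ennreal (norm (Z (kk x) (ii x))))\<^sup>2 \<partial>lebesgue) \<le> ennreal (B t)" if t: "0 \<le> t" for t
    proof -
      \<comment> \<open>\<open>B\<close> counts completed cells only, and these contain all positive
        times up to \<open>t - \<tau>\<close>.\<close>
      have "t - \<tau> \<le> real (kk t) * \<tau>" using kk(2)[OF t] by (simp add: algebra_simps)
      then have "(\<integral>\<^sup>+x\<in>{0<..<t - \<tau>}. (ennreal (norm (Z (kk x) (ii x))))\<^sup>2 \<partial>lebesgue)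
        \<le> (\<integral>\<^sup>+x\<in>{0<..<real (kk t) * \<tau>}. (ennreal (norm (Z (kk x) (ii x))))\<^sup>2 \<partial>lebesgue)"
        by (intro nn_integral_mono) (auto simp: indicator_def)
      also have "\<dots> \<le> ennreal ((real N + 1) / real N * B t)" unfolding B_def by (rule Zint)
      finally have "ennreal (real N / (real N + 1)) * (\<integral>\<^sup>+x\<in>{0<..<t - \<tau>}.
        (ennreal (norm (Z (kk x) (ii x))))\<^sup>2 \<partial>lebesgue)
          \<le> ennreal (real N / (real N + 1)) * ennreal ((real N + 1) / real N * B
            t)" by (rule mult_left_mono) simp
      also have "\<dots> = ennreal (real N / (real N + 1) * ((real N + 1) / real N * B t))"
      proof (rule ennreal_mult[symmetric])
        have "0 \<le> B t" unfolding B_def by (rule sum_nonneg) (use b0 in simp)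
        then show "0 \<le> (real N + 1) / real N * B t" by simp
      qed simp
      also have "real N / (real N + 1) * ((real N + 1) / real N * B t) = B t" using N by simp
      finally show ?thesis .
    qed
  qed
qed

section \<open>The semiflow of solutions\<close>

lemma domain_valued_solutionsI:
  fixes u :: "real \<Rightarrow> 'h::{real_inner,banach,second_countable_topology}"
  assumes "\<And>T. 0 < T \<Longrightarrow> L2_primitive 0 T u q" "AE t in lebesgue. 0 < t \<longrightarrow>
    - q t \<in> strong_limiting_subdiff \<phi> (u t)"
    and dom: "\<And>t. 0 \<le> t \<Longrightarrow> u t \<in> effective_domain \<phi>"
  shows "restrict u {0..} \<in> domain_valued_solutions \<phi>"
proof -
  have "H1_fun 0 T (restrict u {0..}) q" if "0 < T" for T
  proof -
    have "L2_primitive 0 T (restrict u {0..}) q" by (rule L2_primitive_cong[OF assms(1)[OF that]]) auto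
    then show ?thesis using H1_fun_iff_L2_primitive[OF that] by blast
  qed
  moreover have "AE t in lebesgue_on {0<..}. - q t \<in> strong_limiting_subdiff \<phi> (restrict u {0..} t)"
    by (subst AE_restrict_space_iff, simp, use assms(2) in eventually_elim) simp
  ultimately have "restrict u {0..} \<in> gradient_flow_solutions \<phi>"
    unfolding gradient_flow_solutions_def using dom[of 0]
    by (intro CollectI conjI exI[of _ q] allI impI restrict_extensional) auto
  then show ?thesis using dom unfolding domain_valued_solutions_def by simp
qed

lemma domain_valued_solutionsE:
  fixes g :: "real \<Rightarrow> 'h::{real_inner,banach,second_countable_topology}"
  assumes "g \<in> domain_valued_solutions \<phi>"
  obtains q where "\<And>T. 0 < T \<Longrightarrow> L2_primitive 0 T g q"
    "AE t in lebesgue. 0 < t \<longrightarrow> - q t \<in> strong_limiting_subdiff \<phi> (g t)"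
    "\<And>t. 0 \<le> t \<Longrightarrow> g t \<in> effective_domain \<phi>" "g \<in> extensional {0..}"
proof -
  obtain q where q: "\<And>T. 0 < T \<Longrightarrow> H1_fun 0 T g q" "AE t in lebesgue_on {0<..}.
    - q t \<in> strong_limiting_subdiff \<phi> (g t)"
    using assms unfolding domain_valued_solutions_def gradient_flow_solutions_def by blast
  have "AE t in lebesgue. 0 < t \<longrightarrow> - q t \<in> strong_limiting_subdiff \<phi> (g t)"
    using q(2) by (subst (asm) AE_restrict_space_iff) auto
  moreover have "L2_primitive 0 T g q" if "0 < T" for T using q(1)[OF that] H1_fun_iff_L2_primitive[OF that]
    by blast
  ultimately show ?thesis using that assms unfolding domain_valued_solutions_def gradient_flow_solutions_def
    by blast
qed

text \<open>The step size is 1 / (n + 1) and the radius parameter is n + 1, so the time error tends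
  to 0 and the factor of the De Giorgi estimate to 1 simultaneously.\<close>

lemma solution_through_every_point:
  fixes \<phi> :: "'h::{real_inner,banach,second_countable_topology} \<Rightarrow> ereal"
  assumes p: "proper_functional \<phi>" and l: "lower_semicontinuous \<phi>" and comp: "comp_condition \<phi>"
    and chain: "chain_condition \<phi>"
    and K: "K1 \<ge> 0" "K2 \<ge> 0" "\<And>u. \<phi> u \<ge> ereal (- K1 * norm u - K2)"
    and u0: "u0 \<in> effective_domain \<phi>"
  shows "\<exists>g\<in>domain_valued_solutions \<phi>. g 0 = u0"
proof -
  have "\<forall>n. \<exists>U w \<zeta> A B. discrete_gradient_flow \<phi> u0 (1 / real (Suc n)) (real (Suc n) / (real (Suc n) + 1)) U w
    \<zeta> A B"
    by (intro allI discrete_gradient_flow_exists[OF p l comp K u0 _ zero_less_Suc]) simp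
  then obtain U w \<zeta> A B where "\<And>n. discrete_gradient_flow \<phi> u0 (1 / real (Suc n)) (real (Suc n) / (real (Suc
    n) + 1)) (U n) (w n) (\<zeta> n) (A n) (B n)"
    by metis
  note s = discrete_gradient_flowD[OF this]
  have "\<exists>r u q. strict_mono r \<and> u 0 = u0 \<and> (\<forall>T>0. L2_primitive 0 T u q) \<and>
     (AE t in lebesgue. 0 < t \<longrightarrow> - q t \<in> strong_limiting_subdiff \<phi> (u t)) \<and>
     (\<forall>t\<ge>0. u t \<in> effective_domain \<phi> \<and> (\<lambda>k. U (r k) t) \<longlonglongrightarrow> u t \<and> (\<lambda>k. energy \<phi> (w (r k) t)) \<longlonglongrightarrow> energy \<phi> (u t))"
  proof (rule approximate_solutions_converge[OF p l comp chain K,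
        where \<delta>="\<lambda>n. 1 / real (Suc n)" and \<kappa>="\<lambda>n. real (Suc n) / (real (Suc n) + 1)" and E="\<lambda>_. energy \<phi> u0"
          and A=A and B=B and \<zeta>=\<zeta>])
    show "(\<lambda>n. 1 / real (Suc n)) \<longlonglongrightarrow> 0" by (rule LIMSEQ_Suc[OF lim_1_over_n])
    show "(\<lambda>n. real (Suc n) / (real (Suc n) + 1)) \<longlonglongrightarrow> 1"
      using LIMSEQ_Suc[OF LIMSEQ_n_over_Suc_n[where 'a=real]] by (simp add: add.commute)
    show "AE t in lebesgue. 0 < t \<longrightarrow> (\<forall>n. \<zeta> n t \<in> strong_limiting_subdiff \<phi> (w n t))" using s(10) by simp
    show "(\<lambda>n. U n 0) \<longlonglongrightarrow> u0"
    proof -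
      have "U n 0 = u0" for n by (rule s(1))
      then show ?thesis by simp
    qed
    show "A n s' \<le> A n t" "(norm (U n t - U n s'))\<^sup>2 \<le> (t - s' + 1 / real (Suc n)) * (A n t - A n s')"
      if "0 \<le> s'" "s' \<le> t" for n s' t
      using s(2,5)[OF that] by blast+
    show "0 \<le> B n t" "energy \<phi> (w n t) + A n t / 2 + B n t / 2 \<le> energy \<phi> u0" "w n t \<in> effective_domain \<phi>"
      "(norm (w n t - U n t))\<^sup>2 \<le> 2 * (1 / real (Suc n)) * (energy \<phi> u0 - energy \<phi> (w n t))"
      "ennreal (real (Suc n) / (real (Suc n) + 1)) * (\<integral>\<^sup>+x\<in>{0<..<t - 1 / real (Suc n)}.
        (ennreal (norm (\<zeta> n x)))\<^sup>2 \<partial>lebesgue) \<le> ennreal (B n t)"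
      if "0 \<le> t" for n t using s(4,6-8,11)[OF that] by blast+
    show "A n 0 = 0" "\<zeta> n \<in> borel_measurable lebesgue" for n by (rule s(3) s(9))+
  qed (use u0 in auto)
  then obtain u q where u: "u 0 = u0" "\<And>T. T > 0 \<Longrightarrow> L2_primitive 0 T u q"
    "AE t in lebesgue. 0 < t \<longrightarrow> - q t \<in> strong_limiting_subdiff \<phi> (u t)"
    "\<And>t. 0 \<le> t \<Longrightarrow> u t \<in> effective_domain \<phi>" by blast
  from domain_valued_solutionsI[OF u(2,3,4)] u(1) show ?thesis by (intro bexI[of _ "restrict u {0..}"]) auto
qed

lemma solution_translate:
  fixes \<phi> :: "'h::{real_inner,banach,second_countable_topology} \<Rightarrow> ereal"
  assumes "g \<in> domain_valued_solutions \<phi>" "0 \<le> \<tau>"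
  shows "(\<lambda>t\<in>{0..}. g (t + \<tau>)) \<in> domain_valued_solutions \<phi>"
proof -
  obtain q where q: "\<And>T. 0 < T \<Longrightarrow> L2_primitive 0 T g q"
    "AE t in lebesgue. 0 < t \<longrightarrow> - q t \<in> strong_limiting_subdiff \<phi> (g t)"
    "\<And>t. 0 \<le> t \<Longrightarrow> g t \<in> effective_domain \<phi>" using domain_valued_solutionsE[OF assms(1)] by metis
  show ?thesis
  proof (rule domain_valued_solutionsI[where q="\<lambda>t. q (t + \<tau>)"])
    show "L2_primitive 0 T (\<lambda>t. g (t + \<tau>)) (\<lambda>t. q (t + \<tau>))" if "0 < T" for T
      using L2_primitive_shift[OF L2_primitive_subset[OF q(1)[of "T + \<tau>"], of \<tau> "T + \<tau>"], of \<tau>] that assms(2)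
        by simp
    have "AE t in lebesgue. 0 < \<tau> + 1 * t \<longrightarrow> - q (\<tau> + 1 * t) \<in> strong_limiting_subdiff \<phi> (g (\<tau> + 1 * t))"
      by (rule AE_lebesgue_isometry[OF _ q(2)]) simp
    then show "AE t in lebesgue. 0 < t \<longrightarrow> - q (t + \<tau>) \<in> strong_limiting_subdiff \<phi> (g (t + \<tau>))"
      by eventually_elim (use assms(2) in \<open>auto simp: add.commute\<close>)
  qed (use q(3) assms(2) in auto)
qed

lemma solution_concatenate:
  fixes \<phi> :: "'h::{real_inner,banach,second_countable_topology} \<Rightarrow> ereal"
  assumes "g \<in> domain_valued_solutions \<phi>" "h \<in> domain_valued_solutions \<phi>" and s: "0 \<le> s" and hg: "h 0 = g s"
  shows "(\<lambda>t\<in>{0..}. if t \<le> s then g t else h (t - s)) \<in> domain_valued_solutions \<phi>"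
proof -
  obtain q where q: "\<And>T. 0 < T \<Longrightarrow> L2_primitive 0 T g q"
    "AE t in lebesgue. 0 < t \<longrightarrow> - q t \<in> strong_limiting_subdiff \<phi> (g t)"
    "\<And>t. 0 \<le> t \<Longrightarrow> g t \<in> effective_domain \<phi>" using domain_valued_solutionsE[OF assms(1)] by metis
  obtain k where k: "\<And>T. 0 < T \<Longrightarrow> L2_primitive 0 T h k"
    "AE t in lebesgue. 0 < t \<longrightarrow> - k t \<in> strong_limiting_subdiff \<phi> (h t)"
    "\<And>t. 0 \<le> t \<Longrightarrow> h t \<in> effective_domain \<phi>" using domain_valued_solutionsE[OF assms(2)] by metis
  define z where "z t = (if t \<le> s then g t else h (t - s))" for t
  define y where "y t = (if t \<le> s then q t else k (t - s))" for t
  have "L2_primitive 0 T z y" if T: "0 < T" for T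
  proof -
    have 1: "L2_primitive 0 s z y"
      by (rule L2_primitive_cong[OF L2_primitive_subset[OF q(1)[of "s + 1"], of 0 s]])
        (use s in \<open>auto simp: z_def y_def\<close>)
    have "L2_primitive s (T + s) (\<lambda>t. h (t + - s)) (\<lambda>t. k (t + - s))"
      using L2_primitive_shift[OF k(1)[OF T], of "- s"] by simp
    then have 2: "L2_primitive s (T + s) z y"
      by (rule L2_primitive_cong) (use hg in \<open>auto simp: z_def y_def\<close>)
    have "L2_primitive 0 (T + s) z y" by (rule L2_primitive_concat[OF 1 2]) (use s T in auto)
    then show ?thesis by (rule L2_primitive_subset) (use s in auto)
  qed
  moreover have "AE t in lebesgue. 0 < t \<longrightarrow> - y t \<in> strong_limiting_subdiff \<phi> (z t)"
  proof -
    have "AE t in lebesgue. 0 < - s + 1 * t \<longrightarrow> - k (- s + 1 * t) \<in> strong_limiting_subdiff \<phi> (h (- s + 1 * t))"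
      by (rule AE_lebesgue_isometry[OF _ k(2)]) simp
    with q(2) show ?thesis by eventually_elim (auto simp: z_def y_def)
  qed
  moreover have "z t \<in> effective_domain \<phi>" if "0 \<le> t" for t using q(3) k(3) that by (simp add: z_def)
  ultimately have "restrict z {0..} \<in> domain_valued_solutions \<phi>" by (rule domain_valued_solutionsI)
  then show ?thesis by (simp add: z_def[abs_def])
qed

section \<open>Continuity of the energy and compactness of sequences of solutions\<close>

lemma continuous_on_set_integral:
  fixes f :: "real \<Rightarrow> 'b::{banach,second_countable_topology}"
  assumes "set_integrable lebesgue {a<..<b} f"
  shows "continuous_on {a..b} (\<lambda>t. LINT x:{a<..<t}|lebesgue. f x)"
  unfolding continuous_on_sequentially
proof (intro allI ballI impI, elim conjE)
  fix t s assume t: "t \<in> {a..b}" and s: "\<forall>n. s n \<in> {a..b}" "s \<longlonglongrightarrow> t"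
  have i: "integrable lebesgue (\<lambda>x. indicat_real {a<..<b} x *\<^sub>R f x)" using assms
    by (simp add: set_integrable_def)
  have m: "(\<lambda>x. indicat_real {a<..<c} x *\<^sub>R f x) \<in> borel_measurable lebesgue" if "c \<le> b" for c
  proof -
    have "set_integrable lebesgue {a<..<c} f" by (rule set_integrable_subset[OF assms]) (use that in auto)
    then show ?thesis unfolding set_integrable_def by (rule borel_measurable_integrable)
  qed
  have "(\<lambda>n. LINT x|lebesgue. indicat_real {a<..<s n} x *\<^sub>R f x) \<longlonglongrightarrow> (LINT x|lebesgue.
    indicat_real {a<..<t} x *\<^sub>R f x)"
  proof (rule integral_dominated_convergence[where w="\<lambda>x. norm (indicat_real {a<..<b} x *\<^sub>R f x)"])
    show "AE x in lebesgue. (\<lambda>n. indicat_real {a<..<s n} x *\<^sub>R f x) \<longlonglongrightarrow> indicat_real {a<..<t} x *\<^sub>R f x"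
      using AE_lebesgue_neq[of t]
    proof eventually_elim
      case (elim x)
      have "\<forall>\<^sub>F n in sequentially. indicat_real {a<..<s n} x = indicat_real {a<..<t} x"
      proof (cases "x < t")
        case True
        then have "\<forall>\<^sub>F n in sequentially. x < s n" using s(2) by (intro order_tendstoD(1))
        then show ?thesis by eventually_elim (use True in \<open>simp add: indicator_def\<close>)
      next
        case False
        then have "\<forall>\<^sub>F n in sequentially. s n < x" using s(2) elim by (intro order_tendstoD(2)) auto
        then show ?thesis by eventually_elim (use False in \<open>simp add: indicator_def\<close>)
      qed
      then have "\<forall>\<^sub>F n in sequentially. indicat_real {a<..<s n} x *\<^sub>R f x = indicat_real {a<..<t} x *\<^sub>R f x"
        by eventually_elim simp
      then show ?case by (rule tendsto_eventually)
    qed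
    show "AE x in lebesgue. norm (indicat_real {a<..<s n} x *\<^sub>R f x) \<le> norm (indicat_real {a<..<b} x *\<^sub>R f x)"
      for n
    proof (rule AE_I2)
      fix x
      have "s n \<le> b" using s(1) by auto
      then show "norm (indicat_real {a<..<s n} x *\<^sub>R f x) \<le> norm (indicat_real {a<..<b} x *\<^sub>R f x)"
        by (simp add: indicator_def)
    qed
    show "(\<lambda>x. indicat_real {a<..<s n} x *\<^sub>R f x) \<in> borel_measurable lebesgue" for n by (rule m)
      (use s(1) in auto)
    show "(\<lambda>x. indicat_real {a<..<t} x *\<^sub>R f x) \<in> borel_measurable lebesgue" by (rule m) (use t in auto)
    show "integrable lebesgue (\<lambda>x. norm (indicat_real {a<..<b} x *\<^sub>R f x))" by (rule integrable_norm[OF i])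
  qed
  then show "((\<lambda>t. LINT x:{a<..<t}|lebesgue. f x) \<circ> s) \<longlonglongrightarrow> (LINT x:{a<..<t}|lebesgue. f x)"
    by (simp add: comp_def set_lebesgue_integral_def)
qed

lemma solution_energy_continuous:
  fixes \<phi> :: "'h::{real_inner,banach,second_countable_topology} \<Rightarrow> ereal"
  assumes p: "proper_functional \<phi>" and l: "lower_semicontinuous \<phi>" and chain: "chain_condition \<phi>"
    and g: "g \<in> domain_valued_solutions \<phi>"
  shows "continuous_on {0..T} g" "continuous_on {0..T} (\<lambda>t. energy \<phi> (g t))"
    and "\<And>s t. 0 \<le> s \<Longrightarrow> s \<le> t \<Longrightarrow> energy \<phi> (g t) \<le> energy \<phi> (g s)"
proof -
  obtain q where q: "\<And>T. 0 < T \<Longrightarrow> L2_primitive 0 T g q"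
    "AE t in lebesgue. 0 < t \<longrightarrow> - q t \<in> strong_limiting_subdiff \<phi> (g t)"
    "\<And>t. 0 \<le> t \<Longrightarrow> g t \<in> effective_domain \<phi>" using domain_valued_solutionsE[OF g] by metis
  \<comment> \<open>The claims concern every real \<open>T\<close>, so a positive horizon beyond
    \<open>T\<close> is used.\<close>
  have T: "0 < \<bar>T\<bar> + 1" by simp
  note id = solution_energy_identity[OF p l chain q(1) q(2,3)]
  show "continuous_on {0..T} g" by (rule continuous_on_subset[OF L2_primitive_continuous[OF q(1)[OF T]]]) auto
  have i: "set_integrable lebesgue {0<..<\<bar>T\<bar> + 1} (\<lambda>x. (norm (q x))\<^sup>2)" using q(1)[OF T]
    by (simp add: L2_primitive_def L2_fun_iff_set)
  have "continuous_on {0..T} (\<lambda>t. energy \<phi> (g 0) - (LINT x:{0<..<t}|lebesgue. (norm (q x))\<^sup>2))"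
    by (intro continuous_on_diff continuous_on_const continuous_on_subset[OF continuous_on_set_integral[OF
      i]]) auto
  then show "continuous_on {0..T} (\<lambda>t. energy \<phi> (g t))"
  proof (rule continuous_on_eq)
    fix t assume "t \<in> {0..T}"
    then have "energy \<phi> (g t) = energy \<phi> (g 0) - (LINT x:{0<..<t}|lebesgue. (norm (q x))\<^sup>2)"
      by (intro id[OF T]) auto
    then show "energy \<phi> (g 0) - (LINT x:{0<..<t}|lebesgue. (norm (q x))\<^sup>2) = energy \<phi> (g t)" by (rule sym)
  qed
  show "energy \<phi> (g t) \<le> energy \<phi> (g s)" if "0 \<le> s" "s \<le> t" for s t
  proof -
    have "0 \<le> (LINT x:{s<..<t}|lebesgue. (norm (q x))\<^sup>2)" unfolding set_lebesgue_integral_def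
      by (rule integral_nonneg_AE) auto
    then show ?thesis using id[of "t + 1" s t] that by simp
  qed
qed

text \<open>The energy identity divides the dissipation of a solution into two equal halves, so the
  convergence lemma applies with \<open>A\<close> in both roles and without discretisation error.
  The common Hoelder constant bounds the dissipation up to \<open>T\<close>, which is an energy drop
  that converges along the subsequence.\<close>

lemma solution_sequence_converges:
  fixes \<phi> :: "'h::{real_inner,banach,second_countable_topology} \<Rightarrow> ereal"
  assumes p: "proper_functional \<phi>" and l: "lower_semicontinuous \<phi>" and comp: "comp_condition \<phi>"
    and chain: "chain_condition \<phi>"
    and K: "K1 \<ge> 0" "K2 \<ge> 0" "\<And>u. \<phi> u \<ge> ereal (- K1 * norm u - K2)"
    and g: "\<And>n::nat. g n \<in> domain_valued_solutions \<phi>" and g0: "g0 \<in> effective_domain \<phi>"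
    and lim: "(\<lambda>n. g n 0) \<longlonglongrightarrow> g0" "(\<lambda>n. energy \<phi> (g n 0)) \<longlonglongrightarrow> energy \<phi> g0"
  shows "\<exists>r u. strict_mono r \<and> u \<in> domain_valued_solutions \<phi> \<and> u 0 = g0 \<and>
     (\<forall>t\<ge>0. (\<lambda>k. g (r k) t) \<longlonglongrightarrow> u t \<and> (\<lambda>k. energy \<phi> (g (r k) t)) \<longlonglongrightarrow> energy \<phi> (u t)) \<and>
     (\<forall>T. \<exists>R\<ge>0. \<forall>k s t. 0 \<le> s \<longrightarrow> s \<le> t \<longrightarrow> t \<le> T \<longrightarrow> (norm (g (r k) t - g (r k) s))\<^sup>2 \<le> (t - s) * R)"
proof -
  have "\<forall>n. \<exists>q. (\<forall>T>0. L2_primitive 0 T (g n) q) \<and> (AE t in lebesgue. 0 < t \<longrightarrow>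
    - q t \<in> strong_limiting_subdiff \<phi> (g n t))"
    using domain_valued_solutionsE[OF g] by metis
  from choice[OF this] obtain q where q: "\<And>n T. 0 < T \<Longrightarrow> L2_primitive 0 T (g n) (q n)"
    "\<And>n. AE t in lebesgue. 0 < t \<longrightarrow> - q n t \<in> strong_limiting_subdiff \<phi> (g n t)" by blast
  have dom: "g n t \<in> effective_domain \<phi>" if "0 \<le> t" for n t using g that
    by (simp add: domain_valued_solutions_def)
  define A where "A n t = (LINT x:{0<..<t}|lebesgue. (norm (q n x))\<^sup>2)" for n t
  \<comment> \<open>Set to 0 at nonpositive times, where nothing is known about \<open>q n\<close>,
    so that it is measurable on the whole line as a limit of truncations.\<close>
  define \<zeta> where "\<zeta> n t = (if 0 < t then - q n t else 0)" for n t
  have i: "set_integrable lebesgue {0<..<t} (\<lambda>x. (norm (q n x))\<^sup>2)" for n t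
  proof (cases "0 < t")
    case True
    then show ?thesis using q(1)[OF True, of n] by (simp add: L2_primitive_def L2_fun_iff_set)
  next
    case False
    then have "{0<..<t} = {}" by auto
    then show ?thesis by (simp add: set_integrable_def)
  qed
  have Apos: "0 \<le> (LINT x:{s<..<t}|lebesgue. (norm (q n x))\<^sup>2)" for n s t
    unfolding set_lebesgue_integral_def by (rule integral_nonneg_AE) auto
  have Adiff: "A n t - A n s = (LINT x:{s<..<t}|lebesgue. (norm (q n x))\<^sup>2)" if "0 \<le> s" "s \<le> t" for n s t
    using set_integral_concat[OF i that] by (simp add: A_def)
  have hold: "(norm (g n t - g n s))\<^sup>2 \<le> (t - s) * (A n t - A n s)" if "0 \<le> s" "s \<le> t" for n s t
    using L2_primitive_holder(1)[OF q(1)[of "t + 1"], of s t n] that Adiff[OF that, of n] by simp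
  have id: "energy \<phi> (g n t) = energy \<phi> (g n 0) - A n t" if "0 \<le> t" for n t
    unfolding A_def by (rule solution_energy_identity[OF p l chain q(1)[of "t + 1"] q(2) dom])
      (use that in auto)
  have m\<zeta>: "\<zeta> n \<in> borel_measurable lebesgue" for n
  proof (rule borel_measurable_LIMSEQ_metric)
    have "L2_fun 0 (real (Suc k)) (q n)" for k using q(1)[of "real (Suc k)" n] by (simp add: L2_primitive_def)
    then have "L2_fun 0 (real (Suc k)) (\<lambda>t. - q n t)" for k by (rule L2_fun_minus)
    then show "(\<lambda>t. indicat_real {0<..<real (Suc k)} t *\<^sub>R (- q n t)) \<in> borel_measurable lebesgue" for k
      unfolding L2_fun_iff_set set_borel_measurable_def by blast
    fix t :: real
    obtain N where N: "t < real N" using reals_Archimedean2 by blast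
    have "\<forall>\<^sub>F k in sequentially. indicat_real {0<..<real (Suc k)} t *\<^sub>R (- q n t) = \<zeta> n t"
      using eventually_ge_at_top[of N] by eventually_elim (use N in \<open>auto simp: \<zeta>_def indicator_def\<close>)
    then show "(\<lambda>k. indicat_real {0<..<real (Suc k)} t *\<^sub>R (- q n t)) \<longlonglongrightarrow> \<zeta> n t" by (rule tendsto_eventually)
  qed
  have Bz: "(\<integral>\<^sup>+x\<in>{0<..<t}. (ennreal (norm (\<zeta> n x)))\<^sup>2 \<partial>lebesgue) \<le> ennreal (A n t)" for n t
  proof -
    have "(\<integral>\<^sup>+x\<in>{0<..<t}. (ennreal (norm (\<zeta> n x)))\<^sup>2 \<partial>lebesgue) = (\<integral>\<^sup>+x.
      ennreal (indicat_real {0<..<t} x *\<^sub>R (norm (q n x))\<^sup>2) \<partial>lebesgue)"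
      by (rule nn_integral_cong) (auto simp: indicator_def \<zeta>_def ennreal_power)
    also have "\<dots> = ennreal (A n t)"
      unfolding A_def set_lebesgue_integral_def using i[of t n]
        by (intro nn_integral_eq_integral) (auto simp: set_integrable_def)
    finally show ?thesis by simp
  qed
  have "\<exists>r u q. strict_mono r \<and> u 0 = g0 \<and> (\<forall>T>0. L2_primitive 0 T u q) \<and>
     (AE t in lebesgue. 0 < t \<longrightarrow> - q t \<in> strong_limiting_subdiff \<phi> (u t)) \<and>
     (\<forall>t\<ge>0. u t \<in> effective_domain \<phi> \<and> (\<lambda>k. g (r k) t) \<longlonglongrightarrow> u t \<and> (\<lambda>k. energy \<phi> (g (r k) t)) \<longlonglongrightarrow> energy \<phi> (u t))"
  proof (rule approximate_solutions_converge[OF p l comp chain K,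
        where \<delta>="\<lambda>_. 0" and \<kappa>="\<lambda>_. 1" and E="\<lambda>n. energy \<phi> (g n 0)" and A=A and B=A and \<zeta>=\<zeta>])
    have "AE t in lebesgue. \<forall>n. 0 < t \<longrightarrow> - q n t \<in> strong_limiting_subdiff \<phi> (g n t)" using q(2)
      unfolding AE_all_countable by blast
    then show "AE t in lebesgue. 0 < t \<longrightarrow> (\<forall>n. \<zeta> n t \<in> strong_limiting_subdiff \<phi> (g n t))"
      by eventually_elim (simp add: \<zeta>_def)
    show "A n s \<le> A n t" if "0 \<le> s" "s \<le> t" for n s t using Adiff[OF that, of n] Apos[of s t n] by simp
    show "A n 0 = 0" for n by (simp add: A_def set_lebesgue_integral_def)
    show "0 \<le> A n t" for n t unfolding A_def by (rule Apos)
    show "(norm (g n t - g n s))\<^sup>2 \<le> (t - s + 0) * (A n t - A n s)" if "0 \<le> s" "s \<le> t" for n s t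
      using hold[OF that] by simp
    show "energy \<phi> (g n t) + A n t / 2 + A n t / 2 \<le> energy \<phi> (g n 0)" if "0 \<le> t" for n t
      using id[OF that, of n] by simp
    show "ennreal 1 * (\<integral>\<^sup>+x\<in>{0<..<t - 0}. (ennreal (norm (\<zeta> n x)))\<^sup>2 \<partial>lebesgue) \<le> ennreal (A n t)" for n t
      using Bz[where n=n and t=t] by simp
  qed (use lim g0 dom m\<zeta> in auto)
  then obtain r u q' where u: "strict_mono r" "u 0 = g0" "\<And>T. 0 < T \<Longrightarrow> L2_primitive 0 T u q'"
    "AE t in lebesgue. 0 < t \<longrightarrow> - q' t \<in> strong_limiting_subdiff \<phi> (u t)"
      "\<And>t. 0 \<le> t \<Longrightarrow> u t \<in> effective_domain \<phi>"
    "\<And>t. 0 \<le> t \<Longrightarrow> (\<lambda>k. g (r k) t) \<longlonglongrightarrow> u t" "\<And>t. 0 \<le> t \<Longrightarrow> (\<lambda>k. energy \<phi> (g (r k) t)) \<longlonglongrightarrow> energy \<phi> (u t)" by blast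
  have "\<exists>R\<ge>0. \<forall>k s t. 0 \<le> s \<longrightarrow> s \<le> t \<longrightarrow> t \<le> T \<longrightarrow> (norm (g (r k) t - g (r k) s))\<^sup>2 \<le> (t - s) * R" for T
  proof (cases "0 \<le> T")
    case True
    have "(\<lambda>k. energy \<phi> (g (r k) 0) - energy \<phi> (g (r k) T)) \<longlonglongrightarrow> energy \<phi> (u 0) - energy \<phi> (u T)"
      using True by (intro tendsto_diff u) auto
    then have "Bseq (\<lambda>k. energy \<phi> (g (r k) 0) - energy \<phi> (g (r k) T))"
      by (intro convergent_imp_Bseq) (auto simp: convergent_def)
    then obtain R where R: "0 < R" "\<And>k. \<bar>energy \<phi> (g (r k) 0) - energy \<phi> (g (r k) T)\<bar> \<le> R" unfolding Bseq_def
      by auto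
    have "(norm (g (r k) t - g (r k) s))\<^sup>2 \<le> (t - s) * R" if st: "0 \<le> s" "s \<le> t" "t \<le> T" for k s t
    proof -
      have "A (r k) 0 = 0" by (simp add: A_def set_lebesgue_integral_def)
      moreover have "0 \<le> A (r k) s - A (r k) 0" unfolding Adiff[OF order_refl st(1)] by (rule Apos)
      moreover have "0 \<le> A (r k) T - A (r k) t" using Adiff[OF _ st(3)] Apos st by simp
      ultimately have "A (r k) t - A (r k) s \<le> A (r k) T" by linarith
      also have "\<dots> \<le> R" using id[OF True, of "r k"] R(2)[of k] by simp
      finally have "(t - s) * (A (r k) t - A (r k) s) \<le> (t - s) * R" using st by (intro mult_left_mono) auto
      then show ?thesis using hold[OF st(1,2), of "r k"] by linarith
    qed
    then show ?thesis using R(1) by (intro exI[of _ R]) auto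
  qed (auto intro: exI[of _ 0])
  moreover have "restrict u {0..} \<in> domain_valued_solutions \<phi>" using u(3,4,5)
    by (rule domain_valued_solutionsI)
  moreover have "restrict u {0..} 0 = g0" using u(2) by simp
  moreover have "\<forall>t\<ge>0. (\<lambda>k. g (r k) t) \<longlonglongrightarrow> restrict u {0..} t \<and> (\<lambda>k.
    energy \<phi> (g (r k) t)) \<longlonglongrightarrow> energy \<phi> (restrict u {0..} t)"
    using u(6,7) by simp
  ultimately show ?thesis
    by (intro exI[of _ r] exI[of _ "restrict u {0..}"] conjI allI) (use u(1) in blast)+
qed

section \<open>From pointwise to uniform convergence\<close>

text \<open>The common Hoelder constant gives equicontinuity, which reduces uniform closeness to a
  finite net of times.\<close>

lemma holder_pointwise_imp_uniform:
  fixes f :: "nat \<Rightarrow> real \<Rightarrow> 'b::real_normed_vector"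
  assumes R: "R \<ge> 0" "\<And>k s t. 0 \<le> s \<Longrightarrow> s \<le> t \<Longrightarrow> t \<le> T \<Longrightarrow> (norm (f k t - f k s))\<^sup>2 \<le> (t - s) * R"
    and c: "continuous_on {0..T} g" and lim: "\<And>t. t \<in> {0..T} \<Longrightarrow> (\<lambda>k. f k t) \<longlonglongrightarrow> g t" and e: "e > 0"
  shows "\<forall>\<^sub>F k in sequentially. \<forall>t\<in>{0..T}. norm (f k t - g t) < e"
proof -
  have "uniformly_continuous_on {0..T} g" using c by (simp add: compact_uniformly_continuous)
  moreover have "0 < e / 3" using e by simp
  ultimately obtain d1 where d1: "d1 > 0" "\<And>x y. x \<in> {0..T} \<Longrightarrow> y \<in> {0..T} \<Longrightarrow> dist y x < d1 \<Longrightarrow>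
    dist (g y) (g x) < e / 3"
    by (rule uniformly_continuous_onE) iprover
  define d where "d = min d1 ((e / 3)\<^sup>2 / (R + 1))"
  have d: "0 < d" "d \<le> d1" using d1 e R by (auto simp: d_def)
  have "d \<le> (e / 3)\<^sup>2 / (R + 1)" by (simp add: d_def)
  then have "d * (R + 1) \<le> (e / 3)\<^sup>2" using R(1) by (simp add: pos_le_divide_eq)
  then have dR: "d * R < (e / 3)\<^sup>2" using d by (simp add: algebra_simps)
  have hold: "norm (f k t - f k s) < e / 3" if st: "s \<in> {0..T}" "t \<in> {0..T}" "dist t s < d" for k s t
  proof (rule power_less_imp_less_base)
    have "(norm (f k t - f k s))\<^sup>2 \<le> dist t s * R"
      using R(2)[of s t k] R(2)[of t s k] st by (cases "s \<le> t") (auto simp: dist_real_def norm_minus_commute)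
    also have "\<dots> \<le> d * R" using st R(1) by (intro mult_right_mono) auto
    finally show "(norm (f k t - f k s))\<^sup>2 < (e / 3)\<^sup>2" using dR by linarith
  qed (use e in simp)
  have "{0..T} \<subseteq> (\<Union>t\<in>{0..T}. ball t d)" using d by auto
  then obtain I where I: "I \<subseteq> {0..T}" "finite I" "{0..T} \<subseteq> (\<Union>t\<in>I. ball t d)"
    using compactE_image[of "{0..T}" "{0..T}" "\<lambda>t. ball t d"] by auto
  have "\<forall>\<^sub>F k in sequentially. \<forall>s\<in>I. dist (f k s) (g s) < e / 3"
    using I e lim by (intro eventually_ball_finite ballI tendstoD) auto
  then show ?thesis
  proof eventually_elim
    case (elim k)
    show ?case
    proof
      fix t assume t: "t \<in> {0..T}"
      then obtain s where s: "s \<in> I" "dist s t < d" using I(3) by auto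
      then have sT: "s \<in> {0..T}" using I by auto
      have "norm (f k t - f k s) < e / 3" using hold[OF sT t] s by (simp add: dist_commute)
      moreover have "norm (f k s - g s) < e / 3" using elim s by (simp add: dist_norm)
      moreover have "norm (g s - g t) < e / 3" using d1(2)[OF t sT] s d by (simp add: dist_norm)
      moreover have "f k t - g t = (f k t - f k s) + (f k s - g s) + (g s - g t)" by simp
      ultimately show "norm (f k t - g t) < e" using norm_triangle_ineq[of "f k t - f k s"
        "f k s - g s"] norm_triangle_ineq[of "(f k t - f k s) + (f k s - g s)" "g s - g t"] by simp
    qed
  qed
qed

text \<open>A variant of Dini's theorem: monotonicity in time traps \<open>f k t\<close> between its
  values at two net points, at which continuity keeps \<open>g\<close> close to
  \<open>g t\<close>.\<close>

lemma antimono_pointwise_imp_uniform: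
  fixes f :: "nat \<Rightarrow> real \<Rightarrow> real"
  assumes mono: "\<And>k s t. 0 \<le> s \<Longrightarrow> s \<le> t \<Longrightarrow> f k t \<le> f k s"
    and c: "continuous_on {0..T} g" and lim: "\<And>t. t \<in> {0..T} \<Longrightarrow> (\<lambda>k. f k t) \<longlonglongrightarrow> g t" and e: "e > 0"
  shows "\<forall>\<^sub>F k in sequentially. \<forall>t\<in>{0..T}. \<bar>f k t - g t\<bar> < e"
proof -
  have "uniformly_continuous_on {0..T} g" using c by (simp add: compact_uniformly_continuous)
  moreover have "0 < e / 2" using e by simp
  ultimately obtain d where d: "d > 0" "\<And>x y. x \<in> {0..T} \<Longrightarrow> y \<in> {0..T} \<Longrightarrow> dist y x < d \<Longrightarrow>
    dist (g y) (g x) < e / 2"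
    by (rule uniformly_continuous_onE) iprover
  have "{0..T} \<subseteq> (\<Union>t\<in>{0..T}. ball t (d / 3))" using d by auto
  then obtain I where I: "I \<subseteq> {0..T}" "finite I" "{0..T} \<subseteq> (\<Union>t\<in>I. ball t (d / 3))"
    using compactE_image[of "{0..T}" "{0..T}" "\<lambda>t. ball t (d / 3)"] by auto
  \<comment> \<open>Shifting a net point by \<open>d / 3\<close> in both directions encloses the
    times that it serves; clipping keeps the shifted points in \<open>{0..T}\<close>, and they stay
    within \<open>d\<close> of these times.\<close>
  define L where "L c = max 0 (c - d / 3)" for c
  define H where "H c = min T (c + d / 3)" for c
  have LH: "L c \<in> {0..T}" "H c \<in> {0..T}" if "c \<in> I" for c using that I d by (auto simp: L_def H_def)
  have "\<forall>\<^sub>F k in sequentially. \<forall>c\<in>I. dist (f k (L c)) (g (L c)) < e / 2 \<and> dist (f k (H c)) (g (H c)) < e / 2"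
    using I e lim LH by (intro eventually_ball_finite ballI eventually_conj tendstoD) auto
  then show ?thesis
  proof eventually_elim
    case (elim k)
    show ?case
    proof
      fix t assume t: "t \<in> {0..T}"
      then obtain c where c: "c \<in> I" "dist c t < d / 3" using I(3) by auto
      have cT: "c \<in> {0..T}" using c I by auto
      have ct: "c - t < d / 3" "t - c < d / 3" using c(2) unfolding dist_real_def by linarith+
      have ord: "0 \<le> L c" "L c \<le> t" "t \<le> H c" using t ct by (auto simp: L_def H_def)
      have "t - L c < d" "H c - t < d" using t cT ct d(1) unfolding L_def H_def max_def min_def
        by (auto split: if_splits)
      then have "dist (L c) t < d" "dist (H c) t < d" using ord by (auto simp: dist_real_def)
      then have "dist (g (L c)) (g t) < e / 2" "dist (g (H c)) (g t) < e / 2" using d(2)[OF t] LH[OF c(1)]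
        by auto
      moreover have "dist (f k (L c)) (g (L c)) < e / 2" "dist (f k (H c)) (g (H c)) < e / 2" using elim c(1)
        by auto
      moreover have "f k t \<le> f k (L c)" "f k (H c) \<le> f k t" using mono[of "L c" t k] mono[of t "H c" k] ord
        by auto
      ultimately show "\<bar>f k t - g t\<bar> < e" unfolding dist_real_def by linarith
    qed
  qed
qed

section \<open>The energy metric\<close>

text \<open>The norm part alone separates points, and \<open>energy\<close> is real-valued
  everywhere, so the axioms hold on any carrier.\<close>

lemma energy_dist_metric:
  fixes \<phi> :: "'h::real_inner \<Rightarrow> ereal"
  shows "Metric_space X (energy_dist \<phi>)"
proof
  fix x y z :: 'h
  show "0 \<le> energy_dist \<phi> x y" by (simp add: energy_dist_def)
  show "energy_dist \<phi> x y = energy_dist \<phi> y x" by (simp add: energy_dist_def norm_minus_commute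
    abs_minus_commute)
  show "(energy_dist \<phi> x y = 0) = (x = y)"
  proof
    assume a: "energy_dist \<phi> x y = 0"
    have "norm (x - y) \<le> 0" using a abs_ge_zero[of "energy \<phi> x - energy \<phi> y"] unfolding energy_dist_def
      by linarith
    then show "x = y" by simp
  qed (simp add: energy_dist_def)
  show "energy_dist \<phi> x z \<le> energy_dist \<phi> x y + energy_dist \<phi> y z"
    using norm_triangle_ineq[of "x - y" "y - z"] abs_triangle_ineq[of "energy \<phi> x - energy \<phi> y"
      "energy \<phi> y - energy \<phi> z"]
    unfolding energy_dist_def by simp
qed

lemma energy_dist_tendsto:
  fixes \<phi> :: "'h::real_inner \<Rightarrow> ereal"
  shows "((\<lambda>k. energy_dist \<phi> (x k) y) \<longlongrightarrow> 0) F \<longleftrightarrow> (x \<longlongrightarrow> y) F \<and> ((\<lambda>k. energy \<phi> (x k)) \<longlongrightarrow> energy \<phi> y) F"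
proof
  assume a: "((\<lambda>k. energy_dist \<phi> (x k) y) \<longlongrightarrow> 0) F"
  have "((\<lambda>k. x k - y) \<longlongrightarrow> 0) F" "((\<lambda>k. energy \<phi> (x k) - energy \<phi> y) \<longlongrightarrow> 0) F"
    by (rule Lim_null_comparison[OF _ a], rule always_eventually, simp add: energy_dist_def)+
  then show "(x \<longlongrightarrow> y) F \<and> ((\<lambda>k. energy \<phi> (x k)) \<longlongrightarrow> energy \<phi> y) F" by (simp add: LIM_zero_iff)
next
  assume a: "(x \<longlongrightarrow> y) F \<and> ((\<lambda>k. energy \<phi> (x k)) \<longlongrightarrow> energy \<phi> y) F"
  then have "((\<lambda>k. norm (x k - y) + \<bar>energy \<phi> (x k) - energy \<phi> y\<bar>) \<longlongrightarrow> norm (y - y) + \<bar>energy \<phi> y - energy \<phi> y\<bar>)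
    F"
    by (intro tendsto_add tendsto_norm tendsto_rabs tendsto_diff tendsto_const; blast)
  then show "((\<lambda>k. energy_dist \<phi> (x k) y) \<longlongrightarrow> 0) F" by (simp add: energy_dist_def)
qed

text \<open>The Hoelder bound treats the norm part of the metric, and monotonicity of the energies
  together with continuity of the limit energy treats the other part.\<close>

lemma solution_sequence_converges_uniformly:
  fixes \<phi> :: "'h::{real_inner,banach,second_countable_topology} \<Rightarrow> ereal"
  assumes p: "proper_functional \<phi>" and l: "lower_semicontinuous \<phi>" and comp: "comp_condition \<phi>"
    and chain: "chain_condition \<phi>"
    and K: "K1 \<ge> 0" "K2 \<ge> 0" "\<And>u. \<phi> u \<ge> ereal (- K1 * norm u - K2)"
    and g: "\<And>n::nat. g n \<in> domain_valued_solutions \<phi>" and g0: "g0 \<in> effective_domain \<phi>"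
    and lim: "(\<lambda>n. g n 0) \<longlonglongrightarrow> g0" "(\<lambda>n. energy \<phi> (g n 0)) \<longlonglongrightarrow> energy \<phi> g0"
  shows "\<exists>r u. strict_mono r \<and> u \<in> domain_valued_solutions \<phi> \<and> u 0 = g0 \<and>
     (\<forall>T. \<forall>\<epsilon>>0. \<forall>\<^sub>F k in sequentially. \<forall>t\<in>{0..T}. energy_dist \<phi> (g (r k) t) (u t) < \<epsilon>)"
proof -
  from solution_sequence_converges[OF p l comp chain K g g0 lim]
  obtain r u where ru: "strict_mono r" "u \<in> domain_valued_solutions \<phi>" "u 0 = g0"
    and ptw: "\<forall>t\<ge>0. (\<lambda>k. g (r k) t) \<longlonglongrightarrow> u t \<and> (\<lambda>k. energy \<phi> (g (r k) t)) \<longlonglongrightarrow> energy \<phi> (u t)"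
    and hold: "\<forall>T. \<exists>R\<ge>0. \<forall>k s t. 0 \<le> s \<longrightarrow> s \<le> t \<longrightarrow> t \<le> T \<longrightarrow> (norm (g (r k) t - g (r k) s))\<^sup>2 \<le> (t - s) * R"
    by (elim exE conjE)
  have "\<forall>\<^sub>F k in sequentially. \<forall>t\<in>{0..T}. energy_dist \<phi> (g (r k) t) (u t) < \<epsilon>" if e: "\<epsilon> > 0" for T \<epsilon> :: real
  proof -
    obtain R where R: "R \<ge> 0" "\<And>k s t. 0 \<le> s \<Longrightarrow> s \<le> t \<Longrightarrow> t \<le> T \<Longrightarrow> (norm (g (r k) t - g (r k) s))\<^sup>2 \<le> (t - s) * R"
      using hold[rule_format, of T] by iprover
    have "\<forall>\<^sub>F k in sequentially. \<forall>t\<in>{0..T}. norm (g (r k) t - u t) < \<epsilon> / 2"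
      by (rule holder_pointwise_imp_uniform[where f="\<lambda>k.
        g (r k)", OF R solution_energy_continuous(1)[OF p l chain ru(2)]]) (use ptw e in auto)
    moreover have "\<forall>\<^sub>F k in sequentially. \<forall>t\<in>{0..T}. \<bar>energy \<phi> (g (r k) t) - energy \<phi> (u t)\<bar> < \<epsilon> / 2"
      by (rule antimono_pointwise_imp_uniform[where f="\<lambda>k t. energy \<phi> (g (r k) t)",
            OF solution_energy_continuous(3)[OF p l chain g] solution_energy_continuous(2)[OF p l chain
              ru(2)]]) (use ptw e in auto)
    ultimately show ?thesis
    proof eventually_elim
      case (elim k)
      show ?case
      proof
        fix t assume t: "t \<in> {0..T}"
        show "energy_dist \<phi> (g (r k) t) (u t) < \<epsilon>" using bspec[OF elim(1) t] bspec[OF elim(2) t]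
          unfolding energy_dist_def by linarith
      qed
    qed
  qed
  with ru show ?thesis by (intro exI[of _ r] exI[of _ u] conjI allI impI)
qed

text \<open>One compactness statement yields both limit properties: uniform convergence on
  \<open>{0..t}\<close> contains convergence at time \<open>t\<close>, and a compact set of times
  lies in some \<open>{0..T}\<close>.\<close>

theorem theorem6:
  fixes \<phi> :: "'h::{real_inner,banach,second_countable_topology} \<Rightarrow> ereal"
  assumes "proper_functional \<phi>"
    and "lower_semicontinuous \<phi>"
    and "comp_condition \<phi>"
    and "chain_condition \<phi>"
    and "\<exists>K\<^sub>1 K\<^sub>2. K\<^sub>1 \<ge> 0 \<and> K\<^sub>2 \<ge> 0 \<and> (\<forall>u. \<phi> u \<ge> ereal (- K\<^sub>1 * norm u - K\<^sub>2))"
  shows "generalized_semiflow (effective_domain \<phi>) (energy_dist \<phi>) (domain_valued_solutions \<phi>) \<and>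
         (\<forall>u \<in> domain_valued_solutions \<phi>.
            continuous_map (top_of_set {0..})
              (Metric_space.mtopology (effective_domain \<phi>) (energy_dist \<phi>)) u) \<and>
         locally_uniform_limit_property (effective_domain \<phi>) (energy_dist \<phi>)
           (domain_valued_solutions \<phi>)"
proof -
  obtain K1 K2 where K: "K1 \<ge> 0" "K2 \<ge> 0" "\<And>u. \<phi> u \<ge> ereal (- K1 * norm u - K2)" using assms(5) by blast
  interpret Metric_space "effective_domain \<phi>" "energy_dist \<phi>" by (rule energy_dist_metric)
  have dom: "g t \<in> effective_domain \<phi>" if "g \<in> domain_valued_solutions \<phi>" "0 \<le> t" for g t
    using that by (simp add: domain_valued_solutions_def)
  have limit: "\<exists>r u. strict_mono r \<and> u \<in> domain_valued_solutions \<phi> \<and> u 0 = g0 \<and>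
     (\<forall>T. \<forall>\<epsilon>>0. \<forall>\<^sub>F k in sequentially. \<forall>t\<in>{0..T}. energy_dist \<phi> (g (r k) t) (u t) < \<epsilon>)"
    if g: "\<And>n::nat. g n \<in> domain_valued_solutions \<phi>" and "limitin mtopology (\<lambda>n. g n 0) g0 sequentially"
      for g g0
  proof (rule solution_sequence_converges_uniformly[OF assms(1-4) K g])
    show "g0 \<in> effective_domain \<phi>" "(\<lambda>n. g n 0) \<longlonglongrightarrow> g0" "(\<lambda>n. energy \<phi> (g n 0)) \<longlonglongrightarrow> energy \<phi> g0"
      using that(2) unfolding limitin_metric_dist_null energy_dist_tendsto by blast+
  qed
  have "generalized_semiflow (effective_domain \<phi>) (energy_dist \<phi>) (domain_valued_solutions \<phi>)"
  proof
    show "domain_valued_solutions \<phi> \<subseteq> {0..} \<rightarrow>\<^sub>E effective_domain \<phi>"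
      by (auto simp: domain_valued_solutions_def gradient_flow_solutions_def PiE_def)
    show "\<exists>r u. strict_mono r \<and> u \<in> domain_valued_solutions \<phi> \<and> u 0 = g0 \<and>
        (\<forall>t\<ge>0. limitin mtopology (\<lambda>k. g (r k) t) (u t) sequentially)"
      if g: "\<And>n::nat. g n \<in> domain_valued_solutions \<phi>" and g0: "limitin mtopology (\<lambda>n. g n 0) g0 sequentially"
        for g g0
    proof -
      obtain r u where ru: "strict_mono r" "u \<in> domain_valued_solutions \<phi>" "u 0 = g0"
        and unif: "\<forall>T. \<forall>\<epsilon>>0. \<forall>\<^sub>F k in sequentially. \<forall>t\<in>{0..T}. energy_dist \<phi> (g (r k) t) (u t) < \<epsilon>"
        using limit[OF g g0] by (elim exE conjE)
      have "limitin mtopology (\<lambda>k. g (r k) t) (u t) sequentially" if t: "0 \<le> t" for t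
        unfolding limitin_metric
      proof (intro conjI allI impI)
        fix \<epsilon> :: real assume "\<epsilon> > 0"
        with unif have "\<forall>\<^sub>F k in sequentially. \<forall>s\<in>{0..t}. energy_dist \<phi> (g (r k) s) (u s) < \<epsilon>" by iprover
        then show "\<forall>\<^sub>F k in sequentially. g (r k) t \<in> effective_domain \<phi> \<and>
          energy_dist \<phi> (g (r k) t) (u t) < \<epsilon>"
          by eventually_elim (use t dom[OF g t] in auto)
      qed (rule dom[OF ru(2) t])
      with ru show ?thesis by (intro exI[of _ r] exI[of _ u] conjI allI impI)
    qed
  qed (use solution_through_every_point[OF assms(1-4) K] solution_translate solution_concatenate in auto)
  moreover have "continuous_map (top_of_set {0..}) mtopology u" if u: "u \<in> domain_valued_solutions \<phi>" for u
    unfolding continuous_map_atin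
  proof
    fix t :: real assume "t \<in> topspace (top_of_set {0..})"
    then have t: "0 \<le> t" by simp
    note c = solution_energy_continuous(1,2)[OF assms(1,2,4) u, of "t + 1"]
    \<comment> \<open>The filter at \<open>t\<close> sees only a neighbourhood, so continuity on
      \<open>{0..t + 1}\<close> suffices.\<close>
    have "at t within {0..t + 1} = at t within {0..}"
      by (rule at_within_nhd[where S="{..<t + 1}"]) auto
    then have "(u \<longlongrightarrow> u t) (at t within {0..}) \<and> ((\<lambda>s. energy \<phi> (u s)) \<longlongrightarrow> energy \<phi> (u t)) (at t within {0..})"
      using c t unfolding continuous_on_def by (metis add_increasing2 atLeastAtMost_iff le_add_same_cancel1
        zero_le_one)
    then have "((\<lambda>s. energy_dist \<phi> (u s) (u t)) \<longlongrightarrow> 0) (at t within {0..})" unfolding energy_dist_tendsto .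
    moreover have "\<forall>\<^sub>F s in at t within {0..}. u s \<in> effective_domain \<phi>"
      unfolding eventually_at_filter by (rule always_eventually) (use dom[OF u] in auto)
    ultimately have "limitin mtopology u (u t) (at t within {0..})"
      using dom[OF u t] by (simp add: limitin_metric_dist_null)
    moreover have "atin_within euclidean t {0..} = at t within {0..}"
      by (rule filter_eqI) (auto simp: eventually_atin_within eventually_at_topological)
    ultimately show "limitin mtopology u (u t) (atin (top_of_set {0..}) t)" using t
      by (simp add: atin_subtopology_within)
  qed
  moreover have "locally_uniform_limit_property (effective_domain \<phi>) (energy_dist \<phi>) (domain_valued_solutions
    \<phi>)"
    unfolding locally_uniform_limit_property_def
  proof (intro allI impI)
    fix g g0
    assume g: "\<forall>n::nat. g n \<in> domain_valued_solutions \<phi>"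
      and g0: "limitin mtopology (\<lambda>n. g n 0) g0 sequentially"
    obtain r u where ru: "strict_mono r" "u \<in> domain_valued_solutions \<phi>" "u 0 = g0"
      and unif: "\<forall>T. \<forall>\<epsilon>>0. \<forall>\<^sub>F k in sequentially. \<forall>t\<in>{0..T}. energy_dist \<phi> (g (r k) t) (u t) < \<epsilon>"
      using limit[OF spec[OF g] g0] by (elim exE conjE)
    have "\<forall>\<^sub>F k in sequentially. \<forall>t\<in>I. energy_dist \<phi> (g (r k) t) (u t) < \<epsilon>"
      if I: "compact I" "I \<subseteq> {0..}" and e: "\<epsilon> > 0" for I \<epsilon>
    proof -
      obtain T where T: "\<And>t. t \<in> I \<Longrightarrow> norm t \<le> T" using compact_imp_bounded[OF I(1)] unfolding bounded_iff
        by blast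
      have IT: "I \<subseteq> {0..T}"
      proof
        fix t assume "t \<in> I"
        then show "t \<in> {0..T}" using T[of t] I(2) by auto
      qed
      from unif e have "\<forall>\<^sub>F k in sequentially. \<forall>t\<in>{0..T}. energy_dist \<phi> (g (r k) t) (u t) < \<epsilon>" by iprover
      then show ?thesis by eventually_elim (use IT in blast)
    qed
    then show "\<exists>r g'. strict_mono r \<and> g' \<in> domain_valued_solutions \<phi> \<and> g' 0 = g0 \<and>
           (\<forall>I. compact I \<and> I \<subseteq> {0..} \<longrightarrow>
              (\<forall>\<epsilon>>0. \<forall>\<^sub>F k in sequentially. \<forall>t\<in>I. energy_dist \<phi> (g (r k) t) (g' t) < \<epsilon>))"
      using ru by (intro exI[of _ r] exI[of _ u]) simp
  qed
  ultimately show ?thesis by blast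
qed

end
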